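(* Let $X=\{X(t),t\in\mathbb{R}^N\}$ be an $(N,d)$-Gaussian random field whose coordinates are independent copies of a real-valued centered Gaussian random field $X_0$ with continuous covariance function, where $X_0$ satisfies Conditions (C1) and (C3) with index $H=(H_1,\ldots,H_N)\in(0,1)^N$. Let $I,J\subseteq[0,1]^N$ be partially separated compact intervals of the form $I=\prod_{j=1}^N[a_j,a_j+h]$ and $J=\prod_{j=1}^N[b_j,b_j+h]$ with $h>0$, where $b_j>a_j+h$ for $j\in S$ and $a_j=b_j$ for $j\in S^c$, with $S\subseteq\{1,\ldots,N\}$ and $S^c=\{1,\ldots,N\}\setminus S$ both nonempty. Let $L_S(X,I\times J)$ be the self-intersection local time of $X$ on $I$ and $J$. Then: (i) $L_S(X,I\times J)\in L^2(\Omega,\mathbb{P})$ if $2\sum_{j\in S}\frac1{H_j}+\sum_{j\in S^c}\frac1{H_j}>d$. (ii) $L_S(X,I\times J)\notin L^2(\Omega,\mathbb{P})$ if $2\sum_{j=1}^N\frac1{H_j}\le d$. (iii) $L_S(X,I\times J)\in D_1$ if $2\sum_{j\in S}\frac1{H_j}+\sum_{j\in S^c}\frac1{H_j}>d+2$. (iv) $L_S(X,I\times J)\notin D_1$ if $2\sum_{j=1}^N\frac1{H_j}\le d+2$.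
   Context: $N,d\ge1$ are integers. An $(N,d)$-Gaussian random field is $X(t)=(X_1(t),\ldots,X_d(t))\in\mathbb{R}^d$, where $X_1,\ldots,X_d$ are independent copies of $X_0$. Sample paths are taken to be continuous on $[0,1]^N$. The set $S$ is the set of all coordinates $j$ such that $\inf_{s\in I,\,t\in J}|s_j-t_j|>0$; $I$ and $J$ are partially separated when $S$ and $S^c$ are both nonempty. (The subscript $S$ in $L_S$ is only part of the name of the self-intersection local time.) Condition (C1): there is a constant $0<c_1<\infty$ such that $\mathbb{E}[(X_0(s)-X_0(t))^2]\le c_1\sum_{j=1}^N|s_j-t_j|^{2H_j}$ for all $s,t\in[0,1]^N$. Condition (C3): there is a constant $c>0$ such that for all $u,t^1,t^2,t^3\in[0,1]^N$, $\mathrm{Var}(X_0(u)\mid X_0(t^1),X_0(t^2),X_0(t^3))\ge c\sum_{j=1}^N\min_{0\le k\le3}|u_j-t_j^k|^{2H_j}$, where $t_j^0=0$ for $j=1,\ldots,N$ (the left side is the conditional variance). The self-intersection local time is formally $L_S(X,I\times J)=\int_{I\times J}\delta(X(s)-X(t))\,ds\,dt$; that is, it is the local time at $0$ on $I\times J$ of the field $V(s,t)=X(s)-X(t)$, defined as the limit in $L^2(\Omega,\mathbb{P})$ as $\varepsilon\to0$ of $\int_{I\times J}p_\varepsilon(X(s)-X(t))\,ds\,dt$, where $p_\varepsilon(x)=(2\pi\varepsilon)^{-d/2}\exp(-\|x\|^2/(2\varepsilon))$, $x\in\mathbb{R}^d$. The assertion $L_S(X,I\times J)\in L^2(\Omega,\mathbb{P})$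 means that this $L^2$ limit exists, and $L_S(X,I\times J)\in D_1$ means that it exists and belongs to $D_1$; $\notin$ denotes the negation. Chaos expansion and $D_1$: let $\mathcal{P}_n$ be the closure in $L^2(\Omega,\mathbb{P})$ of the set of all polynomials of degree at most $n$ in finitely many of the underlying Gaussian variables $X_i(t)$, and let $\mathcal{C}_n$ be the orthogonal complement of $\mathcal{P}_{n-1}$ in $\mathcal{P}_n$ (with $\mathcal{C}_0$ the constants). Every square-integrable functional $F$ of $X$ has a unique chaos expansion $F=\sum_{n\ge0}F_n$, $F_n\in\mathcal{C}_n$, and $D_1=\{F\in L^2(\Omega,\mathbb{P}):\ \sum_{n\ge0}n\,\mathbb{E}(|F_n|^2)<\infty\}$. *)

theory Defs
  imports "HOL-Probability.Probability" "HOL-Library.Multiset"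
begin

text \<open>Normal random variables, with the point masses \<open>N(\<mu>, 0)\<close> included.\<close>

definition gaussian_rv :: "'w measure \<Rightarrow> ('w \<Rightarrow> real) \<Rightarrow> bool" where
  "gaussian_rv M Y \<longleftrightarrow> Y \<in> borel_measurable M \<and>
     (\<exists>\<mu> \<sigma>. 0 \<le> \<sigma> \<and>
        (if \<sigma> = 0 then AE \<omega> in M. Y \<omega> = \<mu>
         else distributed M lborel Y (normal_density \<mu> \<sigma>)))"

definition gaussian_field :: "'w measure \<Rightarrow> ('t \<Rightarrow> 'w \<Rightarrow> real) \<Rightarrow> bool" where
  "gaussian_field M Y \<longleftrightarrow>
     (\<forall>T c. finite T \<longrightarrow> gaussian_rv M (\<lambda>\<omega>. \<Sum>t\<in>T. c t * Y t \<omega>))"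

definition centered_field :: "'w measure \<Rightarrow> ('t \<Rightarrow> 'w \<Rightarrow> real) \<Rightarrow> bool" where
  "centered_field M Y \<longleftrightarrow> (\<forall>t. (\<integral>\<omega>. Y t \<omega> \<partial>M) = 0)"

definition continuous_covariance ::
    "'w measure \<Rightarrow> ('t::topological_space \<Rightarrow> 'w \<Rightarrow> real) \<Rightarrow> bool" where
  "continuous_covariance M Y \<longleftrightarrow>
     continuous_on UNIV (\<lambda>(s, t).
       \<integral>\<omega>. (Y s \<omega> - (\<integral>\<omega>'. Y s \<omega>' \<partial>M)) * (Y t \<omega> - (\<integral>\<omega>'. Y t \<omega>' \<partial>M)) \<partial>M)"

text \<open>
  A field is regarded as a random element of the product space \<open>\<real>\<^sup>T\<close>; equality of laws there is
  equality of finite-dimensional distributions.  The field \<open>Y\<close> may live on a probability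
  space \<open>M0\<close> of its own.
\<close>

definition independent_copies ::
    "'v measure \<Rightarrow> ('t \<Rightarrow> 'v \<Rightarrow> real) \<Rightarrow> 'w measure \<Rightarrow> ('t \<Rightarrow> 'w \<Rightarrow> real ^ 'd::finite) \<Rightarrow> bool"
  where
  "independent_copies M0 Y M X \<longleftrightarrow>
     prob_space.indep_vars M (\<lambda>_. PiM UNIV (\<lambda>_. borel)) (\<lambda>i \<omega> t. X t \<omega> $ i) UNIV \<and>
     (\<forall>i. distr M (PiM UNIV (\<lambda>_. borel)) (\<lambda>\<omega> t. X t \<omega> $ i) =
          distr M0 (PiM UNIV (\<lambda>_. borel)) (\<lambda>\<omega> t. Y t \<omega>))"

definition condition_C1 ::
    "'v measure \<Rightarrow> (real ^ 'n \<Rightarrow> 'v \<Rightarrow> real) \<Rightarrow> real ^ 'n::finite \<Rightarrow> bool" where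
  "condition_C1 M Y H \<longleftrightarrow>
     (\<exists>c>0. \<forall>s\<in>cbox 0 1. \<forall>t\<in>cbox 0 1.
        (\<integral>\<omega>. (Y s \<omega> - Y t \<omega>)\<^sup>2 \<partial>M) \<le> c * (\<Sum>j\<in>UNIV. \<bar>s $ j - t $ j\<bar> powr (2 * H $ j)))"

definition cond_variance :: "'v measure \<Rightarrow> 'v measure \<Rightarrow> ('v \<Rightarrow> real) \<Rightarrow> 'v \<Rightarrow> real" where
  "cond_variance M F Y =
     real_cond_exp M F (\<lambda>\<omega>. (Y \<omega> - real_cond_exp M F Y \<omega>)\<^sup>2)"

definition generated_algebra :: "'v measure \<Rightarrow> ('k \<Rightarrow> 'v \<Rightarrow> real) \<Rightarrow> 'k set \<Rightarrow> 'v measure" where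
  "generated_algebra M Y K =
     vimage_algebra (space M) (\<lambda>\<omega>. \<lambda>k\<in>K. Y k \<omega>) (PiM K (\<lambda>_. borel))"

text \<open>
  The update \<open>t(0 := 0)\<close> encodes the convention \<open>t\<^sup>0 = 0\<close>: the origin enters the lower bound
  but not the conditioning.
\<close>

definition condition_C3 ::
    "'v measure \<Rightarrow> (real ^ 'n \<Rightarrow> 'v \<Rightarrow> real) \<Rightarrow> real ^ 'n::finite \<Rightarrow> bool" where
  "condition_C3 M Y H \<longleftrightarrow>
     (\<exists>c>0. \<forall>u\<in>cbox 0 1. \<forall>t :: nat \<Rightarrow> real ^ 'n. (\<forall>k\<in>{1..3}. t k \<in> cbox 0 1) \<longrightarrow>
        (AE \<omega> in M.
           c * (\<Sum>j\<in>UNIV. MIN k\<in>{0..3}. \<bar>u $ j - (t(0 := 0)) k $ j\<bar> powr (2 * H $ j))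
           \<le> cond_variance M (generated_algebra M (\<lambda>k. Y (t k)) {1..3}) (Y u) \<omega>))"

definition separated_coords :: "(real ^ 'n) set \<Rightarrow> (real ^ 'n) set \<Rightarrow> 'n::finite set" where
  "separated_coords I J = {j. (INF p\<in>I \<times> J. \<bar>fst p $ j - snd p $ j\<bar>) > 0}"

definition partially_separated :: "(real ^ 'n::finite) set \<Rightarrow> (real ^ 'n) set \<Rightarrow> bool" where
  "partially_separated I J \<longleftrightarrow> separated_coords I J \<noteq> {} \<and> - separated_coords I J \<noteq> {}"

definition square_integrable :: "'w measure \<Rightarrow> ('w \<Rightarrow> real) \<Rightarrow> bool" where
  "square_integrable M f \<longleftrightarrow> f \<in> borel_measurable M \<and> integrable M (\<lambda>\<omega>. (f \<omega>)\<^sup>2)"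

definition L2_tendsto ::
    "'w measure \<Rightarrow> ('e \<Rightarrow> 'w \<Rightarrow> real) \<Rightarrow> ('w \<Rightarrow> real) \<Rightarrow> 'e filter \<Rightarrow> bool" where
  "L2_tendsto M f l F \<longleftrightarrow>
     (\<forall>\<^sub>F e in F. square_integrable M (f e)) \<and> square_integrable M l \<and>
     ((\<lambda>e. \<integral>\<omega>. (f e \<omega> - l \<omega>)\<^sup>2 \<partial>M) \<longlongrightarrow> 0) F"

definition heat_kernel :: "real \<Rightarrow> real ^ 'd::finite \<Rightarrow> real" where
  "heat_kernel \<epsilon> x =
     (2 * pi * \<epsilon>) powr (- real CARD('d) / 2) * exp (- (norm x)\<^sup>2 / (2 * \<epsilon>))"

definition approx_self_intersection_local_time ::
    "(real ^ 'n::finite \<Rightarrow> 'w \<Rightarrow> real ^ 'd::finite) \<Rightarrow> (real ^ 'n) set \<Rightarrow> (real ^ 'n) set \<Rightarrow>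
     real \<Rightarrow> 'w \<Rightarrow> real" where
  "approx_self_intersection_local_time X I J \<epsilon> \<omega> =
     (LINT p:I \<times> J|lborel. heat_kernel \<epsilon> (X (fst p) \<omega> - X (snd p) \<omega>))"

text \<open>
  \<open>L\<close> is a version of the local time; versions agree almost surely.
\<close>

definition self_intersection_local_time ::
    "'w measure \<Rightarrow> (real ^ 'n::finite \<Rightarrow> 'w \<Rightarrow> real ^ 'd::finite) \<Rightarrow> (real ^ 'n) set \<Rightarrow>
     (real ^ 'n) set \<Rightarrow> ('w \<Rightarrow> real) \<Rightarrow> bool" where
  "self_intersection_local_time M X I J L \<longleftrightarrow>
     L2_tendsto M (approx_self_intersection_local_time X I J) L (at_right 0)"

text \<open>
  A monomial in the variables \<open>X\<^sub>i(t)\<close> is a finite multiset of pairs \<open>(i, t)\<close>, its degree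
  being the size of the multiset.
\<close>

definition polynomials_of :: "('t \<Rightarrow> 'w \<Rightarrow> real ^ 'd::finite) \<Rightarrow> nat \<Rightarrow> ('w \<Rightarrow> real) set" where
  "polynomials_of X n =
     {\<lambda>\<omega>. \<Sum>m\<in>A. c m * (\<Prod>(i, t)\<in>#m. X t \<omega> $ i) |
        (A :: ('d \<times> 't) multiset set) c. finite A \<and> (\<forall>m\<in>A. size m \<le> n)}"

definition polynomial_closure ::
    "'w measure \<Rightarrow> ('t \<Rightarrow> 'w \<Rightarrow> real ^ 'd::finite) \<Rightarrow> nat \<Rightarrow> ('w \<Rightarrow> real) set" where
  "polynomial_closure M X n =
     {F. \<exists>G :: nat \<Rightarrow> 'w \<Rightarrow> real.
           (\<forall>k. G k \<in> polynomials_of X n) \<and> L2_tendsto M G F sequentially}"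

text \<open>
  Elements of \<open>L\<^sup>2\<close> are functions rather than equivalence classes, so that the chaos of order \<open>0\<close>
  consists of the functions that are almost surely constant.
\<close>

definition chaos ::
    "'w measure \<Rightarrow> ('t \<Rightarrow> 'w \<Rightarrow> real ^ 'd::finite) \<Rightarrow> nat \<Rightarrow> ('w \<Rightarrow> real) set" where
  "chaos M X n =
     {F \<in> polynomial_closure M X n.
        n > 0 \<longrightarrow> (\<forall>G\<in>polynomial_closure M X (n - 1). (\<integral>\<omega>. F \<omega> * G \<omega> \<partial>M) = 0)}"

definition chaos_expansion ::
    "'w measure \<Rightarrow> ('t \<Rightarrow> 'w \<Rightarrow> real ^ 'd::finite) \<Rightarrow> ('w \<Rightarrow> real) \<Rightarrow>
     (nat \<Rightarrow> 'w \<Rightarrow> real) \<Rightarrow> bool" where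
  "chaos_expansion M X F Fn \<longleftrightarrow>
     (\<forall>n. Fn n \<in> chaos M X n) \<and>
     L2_tendsto M (\<lambda>k \<omega>. \<Sum>n<k. Fn n \<omega>) F sequentially"

definition D1 ::
    "'w measure \<Rightarrow> ('t \<Rightarrow> 'w \<Rightarrow> real ^ 'd::finite) \<Rightarrow> ('w \<Rightarrow> real) set" where
  "D1 M X =
     {F. square_integrable M F \<and>
         (\<exists>Fn. chaos_expansion M X F Fn \<and> summable (\<lambda>n. real n * (\<integral>\<omega>. \<bar>Fn n \<omega>\<bar>\<^sup>2 \<partial>M)))}"

end

theory Submission
  imports Defs
begin

text \<open>
  The self-intersection local time is the local time at \<open>0\<close> of the Gaussian field
  \<open>V(p) = X(s) - X(t)\<close>, \<open>p = (s, t)\<close>.  Let \<open>R(p, q)\<close> be the covariance of one coordinate of \<open>V\<close> and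
  \<open>\<Delta>(p, q) = R(p, p) R(q, q) - R(p, q)\<^sup>2\<close>.

  Chaos side.  The heat kernel is a Fourier integral, so the approximations of the local time are
  mixtures of the variables \<open>cos (\<xi> \<bullet> V p)\<close> over \<open>(p, \<xi>)\<close> with weight \<open>exp (- \<epsilon> \<bar>\<xi>\<bar>\<^sup>2 / 2)\<close>.  A centred
  Gaussian variable \<open>Y\<close> of variance \<open>v\<close> satisfies \<open>exp (i Y) = exp (- v / 2) \<Sum>n. i^n h\<^sub>n(Y)\<close>, where
  \<open>h\<^sub>n\<close> is the Hermite polynomial of variance \<open>v\<close> divided by \<open>n!\<close>; hence the candidate for the \<open>n\<close>-th
  chaos component is a mixture of the variables \<open>h\<^sub>n(\<xi> \<bullet> V p)\<close> (\<open>n\<close> even) with the weight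
  \<open>exp (- R(p, p) \<bar>\<xi>\<bar>\<^sup>2 / 2)\<close>.  As \<open>E (h\<^sub>n(Y) h\<^sub>n(Z)) = (E (Y Z))^n / n!\<close>, all second moments become
  "energies": integrals over \<open>p, q\<close> of
  \<open>\<integral>\<integral> exp (- A \<bar>\<xi>\<bar>\<^sup>2 / 2 - B \<bar>\<eta>\<bar>\<^sup>2 / 2) f (R(p, q) \<xi> \<bullet> \<eta>) d\<xi> d\<eta>\<close> with \<open>f x = x^n / n!\<close> for the
  \<open>n\<close>-th component and \<open>f = cosh\<close> for the approximations themselves.  Summing over even \<open>n\<close> by monotone
  convergence gives two criteria for a general Gaussian field: the \<open>L\<^sup>2\<close> limit exists iff the energy of
  \<open>cosh\<close> is finite (\<open>approx_converges_imp_energy_finite\<close>, \<open>energy_finite_imp_approx_converges\<close>), and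
  then the components form its chaos expansion (\<open>approx_limit_chaos_expansion\<close>), so that the limit lies
  in \<open>D1\<close> iff the energy of \<open>\<Sum>n. n x^n / n! = x sinh x\<close> is finite (\<open>approx_limit_in_D1_iff\<close>).

  Analytic side.  The inner Gaussian integral is \<open>(2\<pi>)^d \<Delta> powr (- d / 2)\<close> for \<open>cosh\<close> and comparable to
  \<open>\<Delta> powr (- (d + 2) / 2)\<close> for \<open>x sinh x\<close> where \<open>R(p, q)\<close> stays away from \<open>0\<close>.  The third condition
  bounds the best linear prediction error of \<open>V q\<close> from \<open>V p\<close> from below, twice: through the prediction of
  \<open>X\<close> at \<open>s'\<close> and through that at \<open>t'\<close>, where \<open>q = (s', t')\<close>.  Thus \<open>\<Delta>\<close> is at least a constant times a
  sum of powers of distances in which every coordinate occurs for \<open>s'\<close> and the separated ones occur again,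
  independently, for \<open>t'\<close>; such a sum dominates a weighted geometric mean, and the integral is bounded by
  a product of one-dimensional integrals of \<open>\<bar>x\<bar> powr - g\<close>, where \<open>g < 1\<close> is exactly the hypothesis on
  the indices (\<open>sing_gap_le_prod\<close>, \<open>sing_gap_integral_finite\<close>).  Conversely the first condition bounds
  \<open>\<Delta>\<close> above by the anisotropic distance of \<open>p\<close> and \<open>q\<close>, and every dyadic shell around the diagonal
  contributes at least a fixed amount to the integral (\<open>holder_integral_infinite\<close>).
\<close>

section \<open>Square-integrable functions\<close>

lemma square_integrableD:
  assumes "square_integrable M f"
  shows square_integrable_measurable[measurable_dest]: "f \<in> borel_measurable M"
    and square_integrable_integrable_power2: "integrable M (\<lambda>x. (f x)\<^sup>2)"
  using assms by (auto simp: square_integrable_def)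

lemma square_integrable_mult:
  assumes f: "square_integrable M f" and g: "square_integrable M g"
  shows "integrable M (\<lambda>x. f x * g x)"
proof (rule Bochner_Integration.integrable_bound)
  show "integrable M (\<lambda>x. (f x)\<^sup>2 + (g x)\<^sup>2)"
    using assms by (auto simp: square_integrable_def)
  show "(\<lambda>x. f x * g x) \<in> borel_measurable M"
    using square_integrable_measurable[OF f] square_integrable_measurable[OF g] by simp
  have "\<bar>a * b\<bar> \<le> a\<^sup>2 + b\<^sup>2" for a b :: real
  proof -
    have "2 * (\<bar>a\<bar> * \<bar>b\<bar>) \<le> a\<^sup>2 + b\<^sup>2"
      using zero_le_power2[of "\<bar>a\<bar> - \<bar>b\<bar>"] by (simp add: power2_diff)
    moreover have "0 \<le> \<bar>a\<bar> * \<bar>b\<bar>" by simp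
    ultimately show ?thesis unfolding abs_mult by linarith
  qed
  then show "AE x in M. norm (f x * g x) \<le> norm ((f x)\<^sup>2 + (g x)\<^sup>2)"
    by (intro AE_I2) (simp add: order_trans[OF _ abs_ge_self])
qed

lemma square_integrable_scale:
  "square_integrable M f \<Longrightarrow> square_integrable M (\<lambda>x. c * f x)"
  by (auto simp: square_integrable_def power_mult_distrib)

lemma square_integrable_add:
  assumes f: "square_integrable M f" and g: "square_integrable M g"
  shows "square_integrable M (\<lambda>x. f x + g x)"
proof -
  have "integrable M (\<lambda>x. (f x)\<^sup>2 + (g x)\<^sup>2 + 2 * (f x * g x))"
    using square_integrable_mult[OF f g] f g by (auto simp: square_integrable_def)
  then show ?thesis
    using f g by (auto simp: square_integrable_def power2_sum mult.assoc)
qed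

lemma square_integrable_diff:
  assumes f: "square_integrable M f" and g: "square_integrable M g"
  shows "square_integrable M (\<lambda>x. f x - g x)"
  using square_integrable_add[OF f square_integrable_scale[OF g, of "-1"]] by simp

lemma square_integrable_sum:
  assumes "\<And>i. i \<in> A \<Longrightarrow> square_integrable M (f i)"
  shows "square_integrable M (\<lambda>x. \<Sum>i\<in>A. f i x)"
proof (cases "finite A")
  case True
  then show ?thesis using assms
  proof (induction A rule: finite_induct)
    case empty then show ?case by (simp add: square_integrable_def)
  next
    case (insert a A)
    then show ?case using square_integrable_add[of M "f a" "\<lambda>x. \<Sum>i\<in>A. f i x"] by simp
  qed
qed (simp add: square_integrable_def)

lemma square_integrable_const: "finite_measure M \<Longrightarrow> square_integrable M (\<lambda>_. c)"
  by (simp add: square_integrable_def finite_measure.integrable_const)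

lemma square_integrable_zero [simp]: "square_integrable M (\<lambda>_. 0)"
  by (simp add: square_integrable_def)

lemma square_integrable_integrable:
  assumes "finite_measure M" "square_integrable M f"
  shows "integrable M f"
  using square_integrable_mult[OF assms(2) square_integrable_const[OF assms(1), of 1]] by simp

lemma square_integrable_bounded:
  assumes "finite_measure M" "f \<in> borel_measurable M" "\<And>x. \<bar>f x\<bar> \<le> B"
  shows "square_integrable M f"
  unfolding square_integrable_def
proof
  show "integrable M (\<lambda>x. (f x)\<^sup>2)"
  proof (rule finite_measure.integrable_const_bound[OF assms(1), of _ "B\<^sup>2"])
    show "AE x in M. norm ((f x)\<^sup>2) \<le> B\<^sup>2"
    proof (rule AE_I2)
      fix x
      have "\<bar>f x\<bar> ^ 2 \<le> B ^ 2" using assms(3)[of x] by (intro power_mono) auto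
      then show "norm ((f x)\<^sup>2) \<le> B\<^sup>2" by simp
    qed
    show "(\<lambda>x. (f x)\<^sup>2) \<in> borel_measurable M" using assms(2) by simp
  qed
qed (rule assms(2))

lemma integral_power2_diff:
  assumes f: "square_integrable M f" and g: "square_integrable M g"
  shows "(\<integral>x. (f x - g x)\<^sup>2 \<partial>M) = (\<integral>x. (f x)\<^sup>2 \<partial>M) - 2 * (\<integral>x. f x * g x \<partial>M) + (\<integral>x. (g x)\<^sup>2 \<partial>M)"
proof -
  have "(\<integral>x. (f x - g x)\<^sup>2 \<partial>M) = (\<integral>x. ((f x)\<^sup>2 - 2 * (f x * g x)) + (g x)\<^sup>2 \<partial>M)"
    by (simp add: power2_diff algebra_simps)
  also have "\<dots> = (\<integral>x. (f x)\<^sup>2 \<partial>M) - 2 * (\<integral>x. f x * g x \<partial>M) + (\<integral>x. (g x)\<^sup>2 \<partial>M)"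
    using square_integrable_mult[OF f g] f g by (simp add: square_integrable_def)
  finally show ?thesis .
qed

lemma integral_power2_sum:
  assumes f: "square_integrable M f" and g: "square_integrable M g"
  shows "(\<integral>x. (f x + g x)\<^sup>2 \<partial>M) = (\<integral>x. (f x)\<^sup>2 \<partial>M) + 2 * (\<integral>x. f x * g x \<partial>M) + (\<integral>x. (g x)\<^sup>2 \<partial>M)"
proof -
  have "(\<integral>x. (f x + g x)\<^sup>2 \<partial>M) = (\<integral>x. ((f x)\<^sup>2 + 2 * (f x * g x)) + (g x)\<^sup>2 \<partial>M)"
    by (simp add: power2_sum algebra_simps)
  also have "\<dots> = (\<integral>x. (f x)\<^sup>2 \<partial>M) + 2 * (\<integral>x. f x * g x \<partial>M) + (\<integral>x. (g x)\<^sup>2 \<partial>M)"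
    using square_integrable_mult[OF f g] f g by (simp add: square_integrable_def)
  finally show ?thesis .
qed

lemma Cauchy_Schwarz_L2:
  assumes f: "square_integrable M f" and g: "square_integrable M g"
  shows "(\<integral>x. f x * g x \<partial>M)\<^sup>2 \<le> (\<integral>x. (f x)\<^sup>2 \<partial>M) * (\<integral>x. (g x)\<^sup>2 \<partial>M)"
proof -
  let ?a = "\<integral>x. (f x)\<^sup>2 \<partial>M" and ?b = "\<integral>x. f x * g x \<partial>M" and ?c = "\<integral>x. (g x)\<^sup>2 \<partial>M"
  have q: "0 \<le> ?a - 2 * (l * ?b) + l\<^sup>2 * ?c" for l
  proof -
    have "0 \<le> (\<integral>x. (f x - l * g x)\<^sup>2 \<partial>M)" by simp
    also have "\<dots> = ?a - 2 * (\<integral>x. f x * (l * g x) \<partial>M) + (\<integral>x. (l * g x)\<^sup>2 \<partial>M)"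
      by (rule integral_power2_diff[OF f square_integrable_scale[OF g]])
    also have "(\<integral>x. f x * (l * g x) \<partial>M) = l * ?b"
      by (simp add: mult.left_commute)
    also have "(\<integral>x. (l * g x)\<^sup>2 \<partial>M) = l\<^sup>2 * ?c"
      by (simp add: power_mult_distrib)
    finally show ?thesis .
  qed
  have c0: "0 \<le> ?c" by simp
  show ?thesis
  proof (cases "?c = 0")
    case True
    have "?b = 0"
    proof (rule ccontr)
      assume b: "?b \<noteq> 0"
      have "0 \<le> ?a - 2 * ((?a + 1) / (2 * ?b) * ?b)" using q[of "(?a + 1) / (2 * ?b)"] True by simp
      also have "\<dots> = -1" using b by (simp add: field_simps)
      finally show False by simp
    qed
    then show ?thesis by simp
  next
    case False
    then have c: "?c > 0" using c0 by linarith
    have "0 \<le> ?a - 2 * (?b / ?c * ?b) + (?b / ?c)\<^sup>2 * ?c" by (rule q)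
    also have "\<dots> = ?a - ?b\<^sup>2 / ?c" using c by (simp add: power2_eq_square field_simps)
    finally show ?thesis using c by (simp add: field_simps)
  qed
qed

lemma integral_abs_le_sqrt:
  assumes "prob_space M" "square_integrable M f"
  shows "(\<integral>x. \<bar>f x\<bar> \<partial>M) \<le> sqrt (\<integral>x. (f x)\<^sup>2 \<partial>M)"
proof -
  interpret prob_space M by fact
  have "square_integrable M (\<lambda>x. \<bar>f x\<bar>)" using assms(2) by (auto simp: square_integrable_def)
  from Cauchy_Schwarz_L2[OF this square_integrable_const[of M 1]]
  have "(\<integral>x. \<bar>f x\<bar> \<partial>M)\<^sup>2 \<le> (\<integral>x. (f x)\<^sup>2 \<partial>M)" by (simp add: finite_measure_axioms prob_space)
  then show ?thesis by (simp add: real_le_rsqrt)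
qed

lemma L2_tendsto_inner:
  assumes "L2_tendsto M f l F" "square_integrable M g"
  shows "((\<lambda>e. \<integral>x. f e x * g x \<partial>M) \<longlongrightarrow> (\<integral>x. l x * g x \<partial>M)) F"
proof -
  have ev: "\<forall>\<^sub>F e in F. square_integrable M (f e)" and l: "square_integrable M l"
    and lim: "((\<lambda>e. \<integral>\<omega>. (f e \<omega> - l \<omega>)\<^sup>2 \<partial>M) \<longlongrightarrow> 0) F"
    using assms(1) by (auto simp: L2_tendsto_def)
  have "((\<lambda>e. (\<integral>x. f e x * g x \<partial>M) - (\<integral>x. l x * g x \<partial>M)) \<longlongrightarrow> 0) F"
  proof (rule Lim_null_comparison)
    show "\<forall>\<^sub>F e in F. norm ((\<integral>x. f e x * g x \<partial>M) - (\<integral>x. l x * g x \<partial>M))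
        \<le> sqrt ((\<integral>\<omega>. (f e \<omega> - l \<omega>)\<^sup>2 \<partial>M) * (\<integral>\<omega>. (g \<omega>)\<^sup>2 \<partial>M))"
      using ev
    proof eventually_elim
      case (elim e)
      have "(\<integral>x. f e x * g x \<partial>M) - (\<integral>x. l x * g x \<partial>M) = (\<integral>x. (f e x - l x) * g x \<partial>M)"
        using square_integrable_mult[OF elim assms(2)] square_integrable_mult[OF l assms(2)]
        by (simp add: left_diff_distrib)
      then show ?case
        using Cauchy_Schwarz_L2[OF square_integrable_diff[OF elim l] assms(2)]
        by (simp add: real_le_rsqrt)
    qed
    show "((\<lambda>e. sqrt ((\<integral>\<omega>. (f e \<omega> - l \<omega>)\<^sup>2 \<partial>M) * (\<integral>\<omega>. (g \<omega>)\<^sup>2 \<partial>M))) \<longlongrightarrow> 0) F"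
      using tendsto_real_sqrt[OF tendsto_mult_right[OF lim, of "\<integral>\<omega>. (g \<omega>)\<^sup>2 \<partial>M"]] by simp
  qed
  then show ?thesis by (simp add: LIM_zero_iff)
qed

lemma L2_tendsto_power2:
  assumes "L2_tendsto M f l F"
  shows "((\<lambda>e. \<integral>x. (f e x)\<^sup>2 \<partial>M) \<longlongrightarrow> (\<integral>x. (l x)\<^sup>2 \<partial>M)) F"
proof -
  have ev: "\<forall>\<^sub>F e in F. square_integrable M (f e)" and l: "square_integrable M l"
    and lim: "((\<lambda>e. \<integral>\<omega>. (f e \<omega> - l \<omega>)\<^sup>2 \<partial>M) \<longlongrightarrow> 0) F"
    using assms(1) by (auto simp: L2_tendsto_def)
  have "((\<lambda>e. (\<integral>\<omega>. (f e \<omega> - l \<omega>)\<^sup>2 \<partial>M) + 2 * (\<integral>x. f e x * l x \<partial>M) - (\<integral>x. (l x)\<^sup>2 \<partial>M))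
      \<longlongrightarrow> 0 + 2 * (\<integral>x. l x * l x \<partial>M) - (\<integral>x. (l x)\<^sup>2 \<partial>M)) F"
    by (intro tendsto_intros lim L2_tendsto_inner[OF assms l])
  then have "((\<lambda>e. (\<integral>\<omega>. (f e \<omega> - l \<omega>)\<^sup>2 \<partial>M) + 2 * (\<integral>x. f e x * l x \<partial>M) - (\<integral>x. (l x)\<^sup>2 \<partial>M))
      \<longlongrightarrow> (\<integral>x. (l x)\<^sup>2 \<partial>M)) F" by (simp add: power2_eq_square)
  moreover have "\<forall>\<^sub>F e in F. (\<integral>\<omega>. (f e \<omega> - l \<omega>)\<^sup>2 \<partial>M) + 2 * (\<integral>x. f e x * l x \<partial>M)
      - (\<integral>x. (l x)\<^sup>2 \<partial>M) = (\<integral>x. (f e x)\<^sup>2 \<partial>M)"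
    using ev by eventually_elim (simp add: integral_power2_diff[OF _ l])
  ultimately show ?thesis by (rule Lim_transform_eventually)
qed

text \<open>
  The completeness of \<open>L\<^sup>2\<close>, from that of \<open>L\<^sup>1\<close>: on a probability space an \<open>L\<^sup>2\<close>-Cauchy sequence is
  \<open>L\<^sup>1\<close>-Cauchy, hence converges almost surely along a subsequence, and Fatou's lemma bounds the
  \<open>L\<^sup>2\<close> distance to the limit.
\<close>

lemma L2_complete:
  assumes "prob_space M" and sq: "\<And>k. square_integrable M (f k)"
    and cau: "\<And>e. e > 0 \<Longrightarrow> \<exists>K. \<forall>m\<ge>K. \<forall>n\<ge>K. (\<integral>x. (f m x - f n x)\<^sup>2 \<partial>M) < e"
  shows "\<exists>l. L2_tendsto M f l sequentially"
proof -
  interpret prob_space M by fact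
  have meas[measurable]: "f k \<in> borel_measurable M" for k using sq square_integrable_measurable by blast
  have int: "integrable M (f k)" for k
    by (rule square_integrable_integrable[OF finite_measure_axioms sq])
  have "\<exists>K. \<forall>m\<ge>K. \<forall>n\<ge>K. (\<integral>x. norm (f m x - f n x) \<partial>M) < e" if e: "e > 0" for e
  proof -
    obtain K where K: "\<forall>m\<ge>K. \<forall>n\<ge>K. (\<integral>x. (f m x - f n x)\<^sup>2 \<partial>M) < e\<^sup>2"
      using cau[OF zero_less_power[OF e, of 2]] by blast
    have "(\<integral>x. norm (f m x - f n x) \<partial>M) < e" if "m \<ge> K" "n \<ge> K" for m n
    proof -
      have "(\<integral>x. norm (f m x - f n x) \<partial>M) \<le> sqrt (\<integral>x. (f m x - f n x)\<^sup>2 \<partial>M)"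
        using integral_abs_le_sqrt[OF assms(1) square_integrable_diff[OF sq sq]] by simp
      also have "\<dots> < sqrt (e\<^sup>2)" by (rule real_sqrt_less_mono) (use K that in blast)
      finally show ?thesis using \<open>e > 0\<close> by simp
    qed
    then show ?thesis by blast
  qed
  then obtain r where r: "strict_mono r" and AEc: "AE x in M. Cauchy (\<lambda>i. f (r i) x)"
    using cauchy_L1_AE_cauchy_subseq[of M f] int by blast
  define l where "l x = lim (\<lambda>i. f (r i) x)" for x
  have l[measurable]: "l \<in> borel_measurable M" unfolding l_def by measurable
  have lim: "AE x in M. (\<lambda>i. f (r i) x) \<longlonglongrightarrow> l x"
    using AEc by eventually_elim (auto simp: l_def Cauchy_convergent_iff convergent_LIMSEQ_iff)
  have bound: "integrable M (\<lambda>x. (f m x - l x)\<^sup>2) \<and> (\<integral>x. (f m x - l x)\<^sup>2 \<partial>M) \<le> e"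
    if e: "0 \<le> e" and K: "\<forall>n\<ge>K. (\<integral>x. (f m x - f n x)\<^sup>2 \<partial>M) \<le> e" for m K e
  proof -
    have "(\<integral>\<^sup>+x. ennreal ((f m x - l x)\<^sup>2) \<partial>M)
        = (\<integral>\<^sup>+x. liminf (\<lambda>i. ennreal ((f m x - f (r i) x)\<^sup>2)) \<partial>M)"
    proof (rule nn_integral_cong_AE, use lim in eventually_elim)
      case (elim x)
      have "(\<lambda>i. ennreal ((f m x - f (r i) x)\<^sup>2)) \<longlonglongrightarrow> ennreal ((f m x - l x)\<^sup>2)"
        by (intro tendsto_intros elim tendsto_ennrealI)
      then show ?case by (rule lim_imp_Liminf[OF sequentially_bot, symmetric])
    qed
    also have "\<dots> \<le> liminf (\<lambda>i. \<integral>\<^sup>+x. ennreal ((f m x - f (r i) x)\<^sup>2) \<partial>M)"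
      by (rule nn_integral_liminf) simp
    also have "\<dots> \<le> ennreal e"
    proof (rule Liminf_le)
      have "(\<integral>\<^sup>+x. ennreal ((f m x - f (r i) x)\<^sup>2) \<partial>M) \<le> ennreal e" if "i \<ge> K" for i
      proof -
        have "r i \<ge> K" using that seq_suble[OF r, of i] by linarith
        then show ?thesis using K square_integrable_diff[OF sq sq, of m "r i"]
          by (subst nn_integral_eq_integral) (auto simp: square_integrable_def intro!: ennreal_leI)
      qed
      then show "\<forall>\<^sub>F i in sequentially. (\<integral>\<^sup>+x. ennreal ((f m x - f (r i) x)\<^sup>2) \<partial>M) \<le> ennreal e"
        by (auto simp: eventually_sequentially)
    qed simp
    finally have nn: "(\<integral>\<^sup>+x. ennreal ((f m x - l x)\<^sup>2) \<partial>M) \<le> ennreal e" .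
    then have i: "integrable M (\<lambda>x. (f m x - l x)\<^sup>2)"
      by (intro integrableI_bounded) (auto intro: le_less_trans)
    then show ?thesis using nn e by (subst (asm) nn_integral_eq_integral) (auto simp: ennreal_le_iff)
  qed
  have sql: "square_integrable M l"
  proof -
    obtain K where K: "\<forall>m\<ge>K. \<forall>n\<ge>K. (\<integral>x. (f m x - f n x)\<^sup>2 \<partial>M) < 1" using cau[of 1] by auto
    have "integrable M (\<lambda>x. (f K x - l x)\<^sup>2)"
      using bound[of 1 K K] K by (auto intro: less_imp_le)
    then have "square_integrable M (\<lambda>x. f K x - l x)" by (simp add: square_integrable_def)
    from square_integrable_diff[OF sq[of K] this] show ?thesis by simp
  qed
  have "(\<lambda>m. \<integral>x. (f m x - l x)\<^sup>2 \<partial>M) \<longlonglongrightarrow> 0"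
  proof (rule LIMSEQ_I)
    fix e :: real assume e: "0 < e"
    obtain K where K: "\<forall>m\<ge>K. \<forall>n\<ge>K. (\<integral>x. (f m x - f n x)\<^sup>2 \<partial>M) < e / 2" using cau[of "e/2"] e by auto
    have "norm ((\<integral>x. (f m x - l x)\<^sup>2 \<partial>M) - 0) < e" if "m \<ge> K" for m
    proof -
      have "\<forall>n\<ge>K. (\<integral>x. (f m x - f n x)\<^sup>2 \<partial>M) \<le> e / 2" using K that less_imp_le by blast
      then have "(\<integral>x. (f m x - l x)\<^sup>2 \<partial>M) \<le> e / 2" using bound[of "e/2" K m] e by auto
      moreover have "0 \<le> (\<integral>x. (f m x - l x)\<^sup>2 \<partial>M)" by simp
      ultimately show ?thesis using e by simp
    qed
    then show "\<exists>no. \<forall>n\<ge>no. norm ((\<integral>x. (f n x - l x)\<^sup>2 \<partial>M) - 0) < e" by blast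
  qed
  then show ?thesis using sq sql by (auto simp: L2_tendsto_def)
qed

section \<open>Mixtures of square-integrable functions\<close>

text \<open>
  A mixture is an integral of random variables over a parameter.  For a finite mixing measure, square
  integrability on the product space is all that Fubini's theorem needs for inner products with
  mixtures, since \<open>\<bar>f g\<bar> \<le> f\<^sup>2 + g\<^sup>2\<close>.
\<close>

lemma L2_mixture:
  fixes f :: "'a \<Rightarrow> 'b \<Rightarrow> real"
  assumes "finite_measure M" "finite_measure N"
    and f: "square_integrable (M \<Otimes>\<^sub>M N) (\<lambda>(x, z). f x z)"
  defines "F \<equiv> \<lambda>x. \<integral>z. f x z \<partial>N"
  shows square_integrable_mixture: "square_integrable M F"
    and integrable_mixture_inner:
      "square_integrable M g \<Longrightarrow> integrable N (\<lambda>z. \<integral>x. f x z * g x \<partial>M)"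
    and mixture_inner:
      "square_integrable M g \<Longrightarrow> (\<integral>x. F x * g x \<partial>M) = (\<integral>z. (\<integral>x. f x z * g x \<partial>M) \<partial>N)"
proof -
  interpret M: finite_measure M by fact
  interpret N: finite_measure N by fact
  interpret P: pair_sigma_finite M N ..
  interpret PF: finite_measure "M \<Otimes>\<^sub>M N" by (rule finite_measure_pair_measure; fact)
  have fm[measurable]: "(\<lambda>(x, z). f x z) \<in> borel_measurable (M \<Otimes>\<^sub>M N)"
    using f by (simp add: square_integrable_def)
  have Fm[measurable]: "F \<in> borel_measurable M" unfolding F_def by measurable
  have f2: "integrable (M \<Otimes>\<^sub>M N) (\<lambda>(x, z). (f x z)\<^sup>2)"
    using f by (simp add: square_integrable_def case_prod_unfold)
  have i2: "integrable M (\<lambda>x. \<integral>z. (f x z)\<^sup>2 \<partial>N)"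
    by (rule P.integrable_fst[OF f2])
  have AEi: "AE x in M. integrable N (\<lambda>z. (f x z)\<^sup>2)"
    by (rule P.AE_integrable_fst'[where f = "\<lambda>(x, z). (f x z)\<^sup>2", simplified, OF f2])
  show sqF: "square_integrable M F"
    unfolding square_integrable_def
  proof
    show "integrable M (\<lambda>x. (F x)\<^sup>2)"
    proof (rule Bochner_Integration.integrable_bound[OF integrable_mult_right[OF i2, of "measure N (space N)"]])
      show "AE x in M. norm ((F x)\<^sup>2) \<le> norm (measure N (space N) * (\<integral>z. (f x z)\<^sup>2 \<partial>N))"
        using AEi AE_space
      proof eventually_elim
        case (elim x)
        have "square_integrable N (f x)" using elim by (simp add: square_integrable_def)
        from Cauchy_Schwarz_L2[OF this square_integrable_const[of N 1]]
        show ?case by (simp add: F_def N.finite_measure_axioms mult.commute)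
      qed
    qed simp
  qed fact
  assume g: "square_integrable M g"
  have gm[measurable]: "g \<in> borel_measurable M" using g by (simp add: square_integrable_def)
  have "square_integrable (M \<Otimes>\<^sub>M N) (\<lambda>(x, z). g x)"
    unfolding square_integrable_def
  proof
    have "integrable (M \<Otimes>\<^sub>M N) (\<lambda>(x, z). (g x)\<^sup>2)"
    proof (rule P.Fubini_integrable)
      show "AE x in M. integrable N (\<lambda>z. case (x, z) of (x, z) \<Rightarrow> (g x)\<^sup>2)"
        by simp
      show "integrable M (\<lambda>x. LINT z|N. norm (case (x, z) of (x, z) \<Rightarrow> (g x)\<^sup>2))"
        using g by (simp add: square_integrable_def)
    qed simp
    then show "integrable (M \<Otimes>\<^sub>M N) (\<lambda>x. (case x of (x, z) \<Rightarrow> g x)\<^sup>2)"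
      by (simp add: case_prod_unfold)
  qed simp
  from square_integrable_mult[OF f this]
  have fg: "integrable (M \<Otimes>\<^sub>M N) (\<lambda>(x, z). f x z * g x)"
    by (simp add: case_prod_unfold)
  show "integrable N (\<lambda>z. \<integral>x. f x z * g x \<partial>M)"
    by (rule P.integrable_snd[OF fg])
  have "(\<integral>x. F x * g x \<partial>M) = (\<integral>x. (\<integral>z. f x z * g x \<partial>N) \<partial>M)"
    by (simp add: F_def)
  also have "\<dots> = (\<integral>z. (\<integral>x. f x z * g x \<partial>M) \<partial>N)"
    by (rule P.Fubini_integral[OF fg, symmetric])
  finally show "(\<integral>x. F x * g x \<partial>M) = (\<integral>z. (\<integral>x. f x z * g x \<partial>M) \<partial>N)" .
qed

lemma square_integrable_pairI:
  fixes f :: "'a \<Rightarrow> 'b \<Rightarrow> real"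
  assumes "finite_measure M" "finite_measure N"
    and [measurable]: "(\<lambda>(x, z). f x z) \<in> borel_measurable (M \<Otimes>\<^sub>M N)"
    and sq: "\<And>z. square_integrable M (\<lambda>x. f x z)"
    and int: "integrable N (\<lambda>z. \<integral>x. (f x z)\<^sup>2 \<partial>M)"
  shows "square_integrable (M \<Otimes>\<^sub>M N) (\<lambda>(x, z). f x z)"
proof -
  interpret M: finite_measure M by fact
  interpret N: finite_measure N by fact
  interpret P: pair_sigma_finite M N ..
  interpret Q: pair_sigma_finite N M ..
  have m[measurable]: "(\<lambda>(z, x). f x z) \<in> borel_measurable (N \<Otimes>\<^sub>M M)"
    using measurable_pair_swap[OF assms(3)] by (simp add: case_prod_unfold)
  have "integrable (N \<Otimes>\<^sub>M M) (\<lambda>(z, x). (f x z)\<^sup>2)"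
    by (rule Q.Fubini_integrable) (use sq int in \<open>auto simp: square_integrable_def\<close>)
  from Q.integrable_product_swap[OF this]
  show ?thesis using assms(3) by (simp add: square_integrable_def case_prod_unfold)
qed

text \<open>
  A mixture of elements of a linear space lies in its \<open>L\<^sup>2\<close> closure.  The argument is a derandomised
  law of large numbers, so no regularity in the parameter is involved.  With \<open>m\<close> the mean of the
  family, the average of \<open>\<parallel>S + f z - m\<parallel>\<^sup>2\<close> over \<open>z\<close> is \<open>\<parallel>S\<parallel>\<^sup>2\<close> plus a constant, because the cross term
  averages to \<open>0\<close>; so the sample points can be chosen one by one such that the squared norm of the sum of
  \<open>k\<close> deviations grows at most linearly in \<open>k\<close>.  After division by \<open>k\<close> it tends to \<open>0\<close>.
\<close>

lemma L2_mixture_sampling: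
  fixes f :: "'a \<Rightarrow> 'b \<Rightarrow> real"
  assumes "finite_measure M" "finite_measure N"
    and f: "square_integrable (M \<Otimes>\<^sub>M N) (\<lambda>(x, z). f x z)"
    and sq: "\<And>z. square_integrable M (\<lambda>x. f x z)"
    and PP: "\<And>z. (\<lambda>x. f x z) \<in> PP" "(\<lambda>x. 0) \<in> PP"
      "\<And>g h. g \<in> PP \<Longrightarrow> h \<in> PP \<Longrightarrow> (\<lambda>x. g x + h x) \<in> PP"
      "\<And>c g. g \<in> PP \<Longrightarrow> (\<lambda>x. c * g x) \<in> PP"
  shows "\<exists>G. (\<forall>k. G k \<in> PP) \<and> L2_tendsto M G (\<lambda>x. \<integral>z. f x z \<partial>N) sequentially"
proof (cases "measure N (space N) = 0")
  case True
  interpret N: finite_measure N by fact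
  have "emeasure N (space N) = 0" using True by (simp add: N.emeasure_eq_measure)
  then have "N = null_measure N"
    by (intro measure_eqI) (auto dest: sets.sets_into_space intro!: emeasure_eq_0[of "space N"])
  then have "(\<lambda>x. \<integral>z. f x z \<partial>N) = (\<lambda>x. 0)"
    by (metis integral_null_measure)
  then show ?thesis using PP(2) by (intro exI[of _ "\<lambda>_ _. 0"]) (simp add: L2_tendsto_def)
next
  case False
  interpret M: finite_measure M by fact
  interpret N: finite_measure N by fact
  interpret P: pair_sigma_finite M N ..
  interpret Q: pair_sigma_finite N M ..
  define c where "c = measure N (space N)"
  have c: "c > 0" using False by (simp add: c_def zero_less_measure_iff)
  define F where "F x = (\<integral>z. f x z \<partial>N)" for x
  have sqF: "square_integrable M F"
    unfolding F_def by (rule square_integrable_mixture[OF assms(1-3)])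
  define m where "m x = F x / c" for x
  have sqm: "square_integrable M m"
    unfolding m_def using square_integrable_scale[OF sqF, of "1/c"] by simp
  define C where "C = (\<integral>z. (\<integral>x. (f x z - m x)\<^sup>2 \<partial>M) \<partial>N)"
  have intm: "integrable M (\<lambda>x. (m x)\<^sup>2)" using sqm by (simp add: square_integrable_def)
  have "integrable (M \<Otimes>\<^sub>M N) (\<lambda>(x, z). (f x z)\<^sup>2)"
    using f by (simp add: square_integrable_def case_prod_unfold)
  then have intf2: "integrable N (\<lambda>z. \<integral>x. (f x z)\<^sup>2 \<partial>M)"
    by (rule P.integrable_snd)
  have fm2: "(\<integral>x. (f x z - m x)\<^sup>2 \<partial>M)
      = (\<integral>x. (f x z)\<^sup>2 \<partial>M) - 2 * (\<integral>x. f x z * m x \<partial>M) + (\<integral>x. (m x)\<^sup>2 \<partial>M)" for z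
    by (rule integral_power2_diff[OF sq sqm])
  have intC: "integrable N (\<lambda>z. \<integral>x. (f x z - m x)\<^sup>2 \<partial>M)"
    unfolding fm2
    by (intro Bochner_Integration.integrable_add Bochner_Integration.integrable_diff intf2
        integrable_mult_right integrable_mixture_inner[OF assms(1-3) sqm]) auto
  \<comment> \<open>some sample point does not do worse than the average over all of them\<close>
  have step: "\<exists>z. (\<integral>x. (S x + (f x z - m x))\<^sup>2 \<partial>M) \<le> (\<integral>x. (S x)\<^sup>2 \<partial>M) + C / c"
    if S: "square_integrable M S" for S
  proof (rule ccontr)
    assume "\<not> ?thesis"
    then have less: "(\<integral>x. (S x)\<^sup>2 \<partial>M) + C / c < (\<integral>x. (S x + (f x z - m x))\<^sup>2 \<partial>M)" for z
      by (auto simp: not_le)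
    have eq: "(\<integral>x. (S x + (f x z - m x))\<^sup>2 \<partial>M)
        = (\<integral>x. (S x)\<^sup>2 \<partial>M) + 2 * ((\<integral>x. f x z * S x \<partial>M) - (\<integral>x. m x * S x \<partial>M)) + (\<integral>x. (f x z - m x)\<^sup>2 \<partial>M)" for z
    proof -
      have "(\<integral>x. S x * (f x z - m x) \<partial>M) = (\<integral>x. f x z * S x - m x * S x \<partial>M)"
        by (simp add: algebra_simps)
      also have "\<dots> = (\<integral>x. f x z * S x \<partial>M) - (\<integral>x. m x * S x \<partial>M)"
        using square_integrable_mult[OF sq S] square_integrable_mult[OF sqm S] by simp
      finally show ?thesis
        using integral_power2_sum[OF S square_integrable_diff[OF sq sqm]] by simp
    qed
    have int: "integrable N (\<lambda>z. \<integral>x. (S x + (f x z - m x))\<^sup>2 \<partial>M)"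
      unfolding eq
      by (intro Bochner_Integration.integrable_add Bochner_Integration.integrable_diff intC
        integrable_mult_right integrable_mixture_inner[OF assms(1-3) S]) auto
    have mS: "(\<integral>x. m x * S x \<partial>M) = (\<integral>x. F x * S x \<partial>M) / c" by (simp add: m_def)
    have "(\<integral>z. (\<integral>x. (S x + (f x z - m x))\<^sup>2 \<partial>M) \<partial>N)
        = c * (\<integral>x. (S x)\<^sup>2 \<partial>M) + 2 * ((\<integral>z. (\<integral>x. f x z * S x \<partial>M) \<partial>N) - c * (\<integral>x. m x * S x \<partial>M)) + C"
      unfolding eq C_def c_def
      using intC integrable_mixture_inner[OF assms(1-3) S]
      by (simp add: algebra_simps)
    also have "\<dots> = c * (\<integral>x. (S x)\<^sup>2 \<partial>M) + C"
      using c mixture_inner[OF assms(1-3) S] by (simp add: mS F_def)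
    finally have val: "(\<integral>z. (\<integral>x. (S x + (f x z - m x))\<^sup>2 \<partial>M) \<partial>N) = c * (\<integral>x. (S x)\<^sup>2 \<partial>M) + C" .
    define D where "D z = (\<integral>x. (S x + (f x z - m x))\<^sup>2 \<partial>M) - ((\<integral>x. (S x)\<^sup>2 \<partial>M) + C / c)" for z
    have Dpos: "D z > 0" for z using less[of z] by (simp add: D_def)
    have iD: "integrable N D" unfolding D_def using int by auto
    have "(\<integral>z. D z \<partial>N) = 0"
      unfolding D_def using int c val by (simp add: c_def[symmetric] field_simps)
    then have "AE z in N. D z = 0"
      using integral_nonneg_eq_0_iff_AE[OF iD] Dpos by (simp add: less_imp_le)
    then have "AE z in N. False" by eventually_elim (use Dpos in \<open>auto simp: less_le\<close>)
    then have "emeasure N (space N) = 0"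
      by (simp add: AE_iff_measurable[of "space N"] )
    then show False using c by (simp add: c_def measure_def)
  qed
  have ex: "\<exists>S. \<forall>k. ((\<lambda>x. S k x + real k * m x) \<in> PP \<and> square_integrable M (S k)
       \<and> (\<integral>x. (S k x)\<^sup>2 \<partial>M) \<le> real k * (C / c)) \<and> True"
  proof (rule dependent_nat_choice)
    show "\<exists>S. (\<lambda>x. S x + real 0 * m x) \<in> PP \<and> square_integrable M S
       \<and> (\<integral>x. (S x)\<^sup>2 \<partial>M) \<le> real 0 * (C / c)"
      using PP(2) by (intro exI[of _ "\<lambda>_. 0"]) simp
  next
    fix S k
    assume *: "(\<lambda>x. S x + real k * m x) \<in> PP \<and> square_integrable M S
       \<and> (\<integral>x. (S x)\<^sup>2 \<partial>M) \<le> real k * (C / c)"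
    then obtain z where z: "(\<integral>x. (S x + (f x z - m x))\<^sup>2 \<partial>M) \<le> (\<integral>x. (S x)\<^sup>2 \<partial>M) + C / c"
      using step by blast
    let ?S = "\<lambda>x. S x + (f x z - m x)"
    have "(\<lambda>x. ?S x + real (Suc k) * m x) = (\<lambda>x. (S x + real k * m x) + f x z)"
      by (simp add: algebra_simps fun_eq_iff)
    then have "(\<lambda>x. ?S x + real (Suc k) * m x) \<in> PP" using PP(1,3) * by simp
    moreover have "square_integrable M ?S"
      using * by (intro square_integrable_add square_integrable_diff sq sqm) auto
    moreover have "(\<integral>x. (?S x)\<^sup>2 \<partial>M) \<le> real (Suc k) * (C / c)"
      using z * by (simp add: algebra_simps)
    ultimately show "\<exists>S'. ((\<lambda>x. S' x + real (Suc k) * m x) \<in> PP \<and> square_integrable M S'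
       \<and> (\<integral>x. (S' x)\<^sup>2 \<partial>M) \<le> real (Suc k) * (C / c)) \<and> True"
      by (intro exI[of _ ?S]) blast
  qed
  then obtain S where S: "\<And>k. (\<lambda>x. S k x + real k * m x) \<in> PP" "\<And>k. square_integrable M (S k)"
     "\<And>k. (\<integral>x. (S k x)\<^sup>2 \<partial>M) \<le> real k * (C / c)" by blast
  define G where "G k x = (c / real (Suc k)) * (S (Suc k) x + real (Suc k) * m x)" for k x
  have GF: "G k x - F x = (c / real (Suc k)) * S (Suc k) x" for k x
    using c by (simp add: G_def m_def field_simps del: of_nat_Suc)
  have "L2_tendsto M G F sequentially"
    unfolding L2_tendsto_def
  proof (intro conjI sqF always_eventually allI)
    show "square_integrable M (G k)" for k
      unfolding G_def by (intro square_integrable_scale square_integrable_add S sqm)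
    show "(\<lambda>k. \<integral>x. (G k x - F x)\<^sup>2 \<partial>M) \<longlonglongrightarrow> 0"
    proof (rule Lim_null_comparison)
      show "\<forall>\<^sub>F k in sequentially. norm (\<integral>x. (G k x - F x)\<^sup>2 \<partial>M) \<le> c * C * inverse (real (Suc k))"
      proof (intro always_eventually allI)
        fix k
        have "norm (\<integral>x. (G k x - F x)\<^sup>2 \<partial>M) = (c / real (Suc k))\<^sup>2 * (\<integral>x. (S (Suc k) x)\<^sup>2 \<partial>M)"
          unfolding GF power_mult_distrib by simp
        also have "\<dots> \<le> (c / real (Suc k))\<^sup>2 * (real (Suc k) * (C / c))"
          by (intro mult_left_mono S) simp
        also have "\<dots> = c * C * inverse (real (Suc k))"
          using c by (simp add: power2_eq_square field_simps del: of_nat_Suc)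
        finally show "norm (\<integral>x. (G k x - F x)\<^sup>2 \<partial>M) \<le> c * C * inverse (real (Suc k))" .
      qed
      show "(\<lambda>k. c * C * inverse (real (Suc k))) \<longlonglongrightarrow> 0"
        using tendsto_mult_left[OF LIMSEQ_inverse_real_of_nat, of "c * C"] by simp
    qed
  qed
  moreover have "G k \<in> PP" for k
    unfolding G_def by (rule PP(4)[OF S(1)])
  ultimately show ?thesis unfolding F_def by blast
qed

section \<open>Hermite polynomials\<close>

text \<open>
  The coefficients of \<open>exp (- w \<theta>\<^sup>2 / 2)\<close> as a power series in \<open>\<theta>\<close>.
\<close>

definition quad_exp_coeff :: "real \<Rightarrow> nat \<Rightarrow> real" where
  "quad_exp_coeff w m = (if even m then (- w / 2) ^ (m div 2) / fact (m div 2) else 0)"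

text \<open>
  The coefficients of \<open>exp (\<theta> z - w \<theta>\<^sup>2 / 2)\<close> as a power series in \<open>\<theta>\<close>, that is, the Hermite polynomial
  of degree \<open>n\<close> for variance \<open>w\<close>, divided by \<open>n!\<close>.  This normalisation keeps factorials out of the
  generating function.
\<close>

definition hermite :: "real \<Rightarrow> nat \<Rightarrow> real \<Rightarrow> real" where
  "hermite w n z = (\<Sum>j\<le>n. z ^ j / fact j * quad_exp_coeff w (n - j))"

lemma quad_exp_coeff_sums:
  fixes \<theta> :: "'a::{real_normed_field, banach}"
  shows "(\<lambda>m. of_real (quad_exp_coeff w m) * \<theta> ^ m) sums exp (- \<theta>\<^sup>2 * of_real w / 2)"
proof -
  let ?f = "\<lambda>m. of_real (quad_exp_coeff w m) * \<theta> ^ m"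
  have "(\<lambda>k. ?f (2 * k)) sums exp (- \<theta>\<^sup>2 * of_real w / 2)"
  proof -
    have "?f (2 * k) = (- \<theta>\<^sup>2 * of_real w / 2) ^ k /\<^sub>R fact k" for k
    proof -
      have "?f (2 * k) = of_real ((- w / 2) ^ k / fact k) * (\<theta>\<^sup>2) ^ k"
        by (simp add: quad_exp_coeff_def power_mult)
      also have "\<dots> = (of_real (- w / 2) * \<theta>\<^sup>2) ^ k * of_real (inverse (fact k))"
        unfolding power_mult_distrib of_real_mult of_real_power divide_inverse by (simp only: ac_simps)
      also have "of_real (- w / 2) * \<theta>\<^sup>2 = - \<theta>\<^sup>2 * of_real w / 2" by simp
      finally show ?thesis by (simp add: scaleR_conv_of_real mult.commute)
    qed
    then show ?thesis using exp_converges[of "- \<theta>\<^sup>2 * of_real w / 2"] by simp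
  qed
  moreover have "strict_mono (\<lambda>k::nat. 2 * k)" by (auto simp: strict_mono_def)
  moreover have "?f n = 0" if "n \<notin> range (\<lambda>k::nat. 2 * k)" for n
    using that by (auto simp: quad_exp_coeff_def elim!: evenE)
  ultimately show ?thesis using sums_mono_reindex[of "\<lambda>k. 2 * k" ?f] by blast
qed

lemma abs_quad_exp_coeff: "\<bar>quad_exp_coeff w m\<bar> = quad_exp_coeff (- \<bar>w\<bar>) m"
  by (simp add: quad_exp_coeff_def power_abs)

lemma hermite_sums:
  fixes \<theta> :: "'a::{real_normed_field, banach}"
  shows "(\<lambda>n. of_real (hermite w n z) * \<theta> ^ n) sums exp (\<theta> * of_real z - \<theta>\<^sup>2 * of_real w / 2)"
proof -
  let ?a = "\<lambda>j. (\<theta> * of_real z) ^ j /\<^sub>R fact j"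
  let ?b = "\<lambda>m. of_real (quad_exp_coeff w m) * \<theta> ^ m"
  have a: "summable (\<lambda>k. norm (?a k))" by (rule summable_norm_exp)
  have "norm (?b m) = of_real (quad_exp_coeff (- \<bar>w\<bar>) m) * norm \<theta> ^ m" for m
    by (simp add: norm_mult norm_power abs_quad_exp_coeff)
  then have b: "summable (\<lambda>k. norm (?b k))"
    using sums_summable[OF quad_exp_coeff_sums[of "- \<bar>w\<bar>" "norm \<theta>"]] by simp
  have "(\<lambda>k. \<Sum>i\<le>k. ?a i * ?b (k - i)) sums ((\<Sum>k. ?a k) * (\<Sum>k. ?b k))"
    by (rule Cauchy_product_sums[OF a b])
  moreover have "(\<Sum>i\<le>k. ?a i * ?b (k - i)) = of_real (hermite w k z) * \<theta> ^ k" for k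
  proof -
    have "(\<Sum>i\<le>k. ?a i * ?b (k - i))
      = (\<Sum>i\<le>k. of_real (z ^ i / fact i * quad_exp_coeff w (k - i)) * \<theta> ^ k)"
    proof (rule sum.cong[OF refl])
      fix i assume "i \<in> {..k}"
      then have "\<theta> ^ k = \<theta> ^ i * \<theta> ^ (k - i)" by (simp flip: power_add)
      then show "?a i * ?b (k - i) = of_real (z ^ i / fact i * quad_exp_coeff w (k - i)) * \<theta> ^ k"
        by (simp add: power_mult_distrib scaleR_conv_of_real divide_inverse ac_simps)
    qed
    then show ?thesis by (simp add: hermite_def sum_distrib_right)
  qed
  moreover have "(\<Sum>k. ?a k) = exp (\<theta> * of_real z)" by (simp add: exp_def)
  moreover have "(\<Sum>k. ?b k) = exp (- \<theta>\<^sup>2 * of_real w / 2)"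
    using quad_exp_coeff_sums by (rule sums_unique[symmetric])
  ultimately show ?thesis by (simp flip: exp_add)
qed

text \<open>
  A negative variance makes all coefficients nonnegative, so that \<open>hermite (- \<bar>w\<bar>)\<close> at \<open>\<bar>z\<bar>\<close> majorises
  the polynomial and serves as the summable bound for the generating series.
\<close>

lemma abs_hermite_le: "\<bar>hermite w n z\<bar> \<le> hermite (- \<bar>w\<bar>) n \<bar>z\<bar>"
  unfolding hermite_def
  by (rule order_trans[OF sum_abs]) (simp add: abs_mult abs_quad_exp_coeff power_abs)

lemma hermite_nonneg: "0 \<le> hermite (- \<bar>w\<bar>) n \<bar>z\<bar>"
  using abs_hermite_le[of w n z] by linarith

lemma hermite_abs_sums:
  "(\<lambda>n. hermite (- \<bar>w\<bar>) n \<bar>z\<bar> * \<bar>t\<bar> ^ n) sums exp (\<bar>t\<bar> * \<bar>z\<bar> + t\<^sup>2 * \<bar>w\<bar> / 2)"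
  using hermite_sums[of "- \<bar>w\<bar>" "\<bar>z\<bar>" "\<bar>t\<bar>"] by simp

lemma abs_hermite_le_exp: "\<bar>hermite w n z\<bar> \<le> exp (\<bar>w\<bar> / 2) * exp \<bar>z\<bar>"
proof -
  have "hermite (- \<bar>w\<bar>) n \<bar>z\<bar> \<le> exp (\<bar>z\<bar> + \<bar>w\<bar> / 2)"
  proof -
    have s: "(\<lambda>n. hermite (- \<bar>w\<bar>) n \<bar>z\<bar>) sums exp (\<bar>z\<bar> + \<bar>w\<bar> / 2)"
      using hermite_abs_sums[of w z 1] by simp
    have "sum (\<lambda>n. hermite (- \<bar>w\<bar>) n \<bar>z\<bar>) {n} \<le> exp (\<bar>z\<bar> + \<bar>w\<bar> / 2)"
      unfolding sums_unique[OF s]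
      by (rule sum_le_suminf[OF sums_summable[OF s]]) (auto simp: hermite_nonneg)
    then show ?thesis by simp
  qed
  with abs_hermite_le[of w n z] show ?thesis by (simp add: exp_add mult.commute)
qed

lemma hermite_0_eq: "hermite 0 n z = z ^ n / fact n"
proof -
  have "quad_exp_coeff 0 k = (if k = 0 then 1 else 0)" for k
    by (auto simp: quad_exp_coeff_def power_0_left elim!: evenE)
  then have "hermite 0 n z = (\<Sum>j\<le>n. if j = n then z ^ j / fact j else 0)"
    unfolding hermite_def by (intro sum.cong) auto
  then show ?thesis by simp
qed

lemma hermite_measurable [measurable]:
  "w \<in> borel_measurable M \<Longrightarrow> f \<in> borel_measurable M \<Longrightarrow> (\<lambda>x. hermite (w x) n (f x)) \<in> borel_measurable M"
proof -
  assume [measurable]: "w \<in> borel_measurable M" "f \<in> borel_measurable M"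
  have [measurable]: "(\<lambda>x. quad_exp_coeff (w x) k) \<in> borel_measurable M" for k
    by (cases "even k") (simp_all add: quad_exp_coeff_def)
  show ?thesis unfolding hermite_def divide_inverse by measurable
qed

lemma powser_coeff_unique_real:
  fixes a b :: "nat \<Rightarrow> real"
  assumes a: "\<And>t. (\<lambda>n. a n * t ^ n) sums f t" and b: "\<And>t. (\<lambda>n. b n * t ^ n) sums f t"
  shows "a n = b n"
proof -
  define c where "c n = a n - b n" for n
  have c: "(\<lambda>n. c n * t ^ n) sums 0" for t
    using sums_diff[OF a[of t] b[of t]] by (simp add: c_def left_diff_distrib)
  have "c n = 0" for n
  proof (induction n rule: less_induct)
    case (less n)
    have "(\<lambda>m. c (m + n) * t ^ m) sums 0" if "t \<noteq> 0" for t
    proof -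
      have "(\<lambda>m. c (m + n) * t ^ (m + n)) sums 0"
        using c[of t] less by (subst sums_zero_iff_shift) auto
      then have "(\<lambda>m. c (m + n) * t ^ (m + n) * inverse (t ^ n)) sums (0 * inverse (t ^ n))"
        by (rule sums_mult2)
      then show ?thesis using that by (simp add: power_add mult.assoc)
    qed
    then have "((\<lambda>_. 0) \<longlongrightarrow> c (0 + n)) (at (0::real))"
      by (intro powser_limit_0_strong[of 1 "\<lambda>m. c (m + n)"]) auto
    then show ?case using tendsto_unique[OF at_neq_bot _ tendsto_const] by fastforce
  qed
  then show ?thesis by (simp add: c_def)
qed

lemma powser_coeff_unique:
  fixes a b :: "nat \<Rightarrow> complex"
  assumes a: "\<And>t::real. (\<lambda>n. a n * of_real t ^ n) sums f t"
    and b: "\<And>t::real. (\<lambda>n. b n * of_real t ^ n) sums f t"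
  shows "a n = b n"
proof (rule complex_eqI)
  have R: "Re (c * of_real t ^ n) = Re c * t ^ n" and I: "Im (c * of_real t ^ n) = Im c * t ^ n" for c t n
    by (simp_all flip: of_real_power)
  show "Re (a n) = Re (b n)"
    using sums_Re[OF a] sums_Re[OF b] by (intro powser_coeff_unique_real) (simp_all add: R)
  show "Im (a n) = Im (b n)"
    using sums_Im[OF a] sums_Im[OF b] by (intro powser_coeff_unique_real) (simp_all add: I)
qed

section \<open>Gaussian spaces\<close>

text \<open>
  A linear space of centred Gaussian variables.  Writing the laws as images of the standard normal law
  under scaling includes the degenerate ones.  Every joint law is determined by covariances, because the
  characteristic function of each linear combination is.
\<close>

locale gaussian_space = prob_space M for M :: "'w measure" +
  fixes G :: "('w \<Rightarrow> real) set"
  assumes add: "Y \<in> G \<Longrightarrow> Z \<in> G \<Longrightarrow> (\<lambda>\<omega>. Y \<omega> + Z \<omega>) \<in> G"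
    and scale: "Y \<in> G \<Longrightarrow> (\<lambda>\<omega>. c * Y \<omega>) \<in> G"
    and G_measurable: "Y \<in> G \<Longrightarrow> Y \<in> borel_measurable M"
    and G_normal: "Y \<in> G \<Longrightarrow>
      \<exists>\<sigma>. distr M borel Y = distr std_normal_distribution borel (\<lambda>x. \<sigma> * x)"
begin

lemma G_integral:
  fixes f :: "real \<Rightarrow> 'b::{banach, second_countable_topology}"
  assumes "Y \<in> G" "f \<in> borel_measurable borel"
    and "distr M borel Y = distr std_normal_distribution borel (\<lambda>x. \<sigma> * x)"
  shows "(\<integral>\<omega>. f (Y \<omega>) \<partial>M) = (\<integral>x. f (\<sigma> * x) \<partial>std_normal_distribution)"
    and "integrable M (\<lambda>\<omega>. f (Y \<omega>)) \<longleftrightarrow> integrable std_normal_distribution (\<lambda>x. f (\<sigma> * x))"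
proof -
  note [measurable] = assms(2) G_measurable[OF assms(1)]
  have m: "(\<lambda>x. \<sigma> * x) \<in> borel_measurable std_normal_distribution" by simp
  have "(\<integral>\<omega>. f (Y \<omega>) \<partial>M) = integral\<^sup>L (distr M borel Y) f"
    by (subst integral_distr) auto
  also have "\<dots> = (\<integral>x. f (\<sigma> * x) \<partial>std_normal_distribution)"
    unfolding assms(3) by (subst integral_distr[OF m]) auto
  finally show "(\<integral>\<omega>. f (Y \<omega>) \<partial>M) = (\<integral>x. f (\<sigma> * x) \<partial>std_normal_distribution)" .
  have "integrable M (\<lambda>\<omega>. f (Y \<omega>)) \<longleftrightarrow> integrable (distr M borel Y) f"
    by (subst integrable_distr_eq) auto
  also have "\<dots> \<longleftrightarrow> integrable std_normal_distribution (\<lambda>x. f (\<sigma> * x))"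
    unfolding assms(3) by (subst integrable_distr_eq[OF m]) auto
  finally show "integrable M (\<lambda>\<omega>. f (Y \<omega>)) \<longleftrightarrow> integrable std_normal_distribution (\<lambda>x. f (\<sigma> * x))" .
qed

lemma integrable_exp_std_normal: "integrable std_normal_distribution (\<lambda>x. exp (c * x))"
proof -
  have "integrable lborel (\<lambda>x. exp (c\<^sup>2 / 2) * normal_density c 1 x)" by simp
  also have "(\<lambda>x. exp (c\<^sup>2 / 2) * normal_density c 1 x) = (\<lambda>x. std_normal_density x * exp (c * x))"
  proof
    fix x
    have "c\<^sup>2 / 2 + - (x - c)\<^sup>2 / 2 = - x\<^sup>2 / 2 + c * x" by (simp add: power2_eq_square algebra_simps add_divide_distrib diff_divide_distrib)
    then have "exp (c\<^sup>2 / 2) * exp (- (x - c)\<^sup>2 / 2) = exp (- x\<^sup>2 / 2) * exp (c * x)"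
      by (simp only: exp_add[symmetric])
    then show "exp (c\<^sup>2 / 2) * normal_density c 1 x = std_normal_density x * exp (c * x)"
      by (simp add: normal_density_def)
  qed
  finally show ?thesis by (subst integrable_density) auto
qed

lemma integrable_exp_abs:
  assumes "Y \<in> G" shows "integrable M (\<lambda>\<omega>. exp (c * \<bar>Y \<omega>\<bar>))"
proof -
  obtain \<sigma> where \<sigma>: "distr M borel Y = distr std_normal_distribution borel (\<lambda>x. \<sigma> * x)"
    using G_normal[OF assms] by blast
  have "integrable std_normal_distribution (\<lambda>x. exp (c * \<bar>\<sigma> * x\<bar>))"
  proof (rule Bochner_Integration.integrable_bound)
    show "integrable std_normal_distribution (\<lambda>x. exp ((c * \<sigma>) * x) + exp (- (c * \<sigma>) * x))"
      by (intro Bochner_Integration.integrable_add integrable_exp_std_normal)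
    show "AE x in std_normal_distribution. norm (exp (c * \<bar>\<sigma> * x\<bar>)) \<le> norm (exp ((c * \<sigma>) * x) + exp (- (c * \<sigma>) * x))"
    proof (intro AE_I2)
      fix x
      have "exp (c * \<bar>\<sigma> * x\<bar>) \<le> exp ((c * \<sigma>) * x) + exp (- (c * \<sigma>) * x)"
        by (cases "0 \<le> \<sigma> * x") (simp_all add: mult.assoc)
      then show "norm (exp (c * \<bar>\<sigma> * x\<bar>)) \<le> norm (exp ((c * \<sigma>) * x) + exp (- (c * \<sigma>) * x))"
        by (simp only: real_norm_def abs_exp_cancel)
    qed
  qed simp
  then show ?thesis using G_integral(2)[OF assms _ \<sigma>, of "\<lambda>x. exp (c * \<bar>x\<bar>)"] by simp
qed

text \<open>
  A class of random variables that contains the Gaussian ones, their polynomials and all bounded variables,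
  is closed under products, and consists of integrable variables: it removes integrability questions
  from the computations below.
\<close>

definition subexp :: "('w \<Rightarrow> 'b::{banach, second_countable_topology}) \<Rightarrow> bool" where
  "subexp f \<longleftrightarrow> f \<in> borel_measurable M \<and>
    (\<exists>C Ys. set Ys \<subseteq> G \<and> (\<forall>\<omega>\<in>space M. norm (f \<omega>) \<le> C * exp (\<Sum>Y\<leftarrow>Ys. \<bar>Y \<omega>\<bar>)))"

lemma subexpI:
  assumes "f \<in> borel_measurable M" "set Ys \<subseteq> G"
    "\<And>\<omega>. \<omega> \<in> space M \<Longrightarrow> norm (f \<omega>) \<le> C * exp (\<Sum>Y\<leftarrow>Ys. \<bar>Y \<omega>\<bar>)"
  shows "subexp f"
  using assms unfolding subexp_def by blast

lemma subexp_measurable: "subexp f \<Longrightarrow> f \<in> borel_measurable M"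
  by (simp add: subexp_def)

lemma subexp_const: "subexp (\<lambda>_. c)"
  by (rule subexpI[of _ "[]" "norm c"]) auto

lemma subexp_bounded:
  assumes "f \<in> borel_measurable M" "\<And>\<omega>. norm (f \<omega>) \<le> C" shows "subexp f"
  by (rule subexpI[of _ "[]" C]) (use assms in auto)

lemma subexp_exp: assumes "Y \<in> G" shows "subexp (\<lambda>\<omega>. exp (c * \<bar>Y \<omega>\<bar>))"
proof (rule subexpI[of _ "[\<lambda>\<omega>. c * Y \<omega>]" 1])
  show "(\<lambda>\<omega>. exp (c * \<bar>Y \<omega>\<bar>)) \<in> borel_measurable M" using G_measurable[OF assms] by simp
qed (use scale[OF assms] in \<open>auto simp: abs_mult mult_right_mono\<close>)

lemma subexp_mono:
  assumes "subexp g" "f \<in> borel_measurable M" "\<And>\<omega>. \<omega> \<in> space M \<Longrightarrow> norm (f \<omega>) \<le> norm (g \<omega>)"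
  shows "subexp f"
  using assms unfolding subexp_def by (meson order_trans)

lemma subexp_mult:
  fixes f g :: "'w \<Rightarrow> 'b::{banach, second_countable_topology, real_normed_algebra}"
  assumes "subexp f" "subexp g" shows "subexp (\<lambda>\<omega>. f \<omega> * g \<omega>)"
proof -
  obtain C Ys where f: "set Ys \<subseteq> G" "\<And>\<omega>. \<omega> \<in> space M \<Longrightarrow> norm (f \<omega>) \<le> C * exp (\<Sum>Y\<leftarrow>Ys. \<bar>Y \<omega>\<bar>)"
    using assms(1) unfolding subexp_def by blast
  obtain D Zs where g: "set Zs \<subseteq> G" "\<And>\<omega>. \<omega> \<in> space M \<Longrightarrow> norm (g \<omega>) \<le> D * exp (\<Sum>Y\<leftarrow>Zs. \<bar>Y \<omega>\<bar>)"
    using assms(2) unfolding subexp_def by blast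
  show ?thesis
  proof (rule subexpI[of _ "Ys @ Zs" "C * D"])
    fix \<omega> assume w: "\<omega> \<in> space M"
    have "norm (f \<omega> * g \<omega>) \<le> norm (f \<omega>) * norm (g \<omega>)" by (rule norm_mult_ineq)
    also have "\<dots> \<le> (C * exp (\<Sum>Y\<leftarrow>Ys. \<bar>Y \<omega>\<bar>)) * (D * exp (\<Sum>Y\<leftarrow>Zs. \<bar>Y \<omega>\<bar>))"
      by (intro mult_mono f(2) g(2) w order_trans[OF norm_ge_zero f(2)[OF w]]) simp
    finally show "norm (f \<omega> * g \<omega>) \<le> C * D * exp (\<Sum>Y\<leftarrow>Ys @ Zs. \<bar>Y \<omega>\<bar>)"
      by (simp add: exp_add ac_simps)
  qed (use assms f g in \<open>auto simp: subexp_def\<close>)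
qed

lemma subexp_add:
  assumes "subexp f" "subexp g" shows "subexp (\<lambda>\<omega>. f \<omega> + g \<omega>)"
proof -
  obtain C Ys where f: "set Ys \<subseteq> G" "\<And>\<omega>. \<omega> \<in> space M \<Longrightarrow> norm (f \<omega>) \<le> C * exp (\<Sum>Y\<leftarrow>Ys. \<bar>Y \<omega>\<bar>)"
    using assms(1) unfolding subexp_def by blast
  obtain D Zs where g: "set Zs \<subseteq> G" "\<And>\<omega>. \<omega> \<in> space M \<Longrightarrow> norm (g \<omega>) \<le> D * exp (\<Sum>Y\<leftarrow>Zs. \<bar>Y \<omega>\<bar>)"
    using assms(2) unfolding subexp_def by blast
  have nn: "0 \<le> (\<Sum>Y\<leftarrow>Ws. \<bar>Y \<omega>\<bar>)" for Ws :: "('w \<Rightarrow> real) list" and \<omega>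
    by (rule sum_list_nonneg) auto
  show ?thesis
  proof (rule subexpI[of _ "Ys @ Zs" "\<bar>C\<bar> + \<bar>D\<bar>"])
    fix \<omega> assume w: "\<omega> \<in> space M"
    have "norm (f \<omega> + g \<omega>) \<le> norm (f \<omega>) + norm (g \<omega>)" by (rule norm_triangle_ineq)
    also have "\<dots> \<le> \<bar>C\<bar> * exp (\<Sum>Y\<leftarrow>Ys. \<bar>Y \<omega>\<bar>) + \<bar>D\<bar> * exp (\<Sum>Y\<leftarrow>Zs. \<bar>Y \<omega>\<bar>)"
      by (intro add_mono order_trans[OF f(2)[OF w]] order_trans[OF g(2)[OF w]] mult_right_mono) auto
    also have "\<dots> \<le> \<bar>C\<bar> * exp (\<Sum>Y\<leftarrow>Ys @ Zs. \<bar>Y \<omega>\<bar>) + \<bar>D\<bar> * exp (\<Sum>Y\<leftarrow>Ys @ Zs. \<bar>Y \<omega>\<bar>)"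
      by (intro add_mono mult_left_mono) (auto simp: nn)
    finally show "norm (f \<omega> + g \<omega>) \<le> (\<bar>C\<bar> + \<bar>D\<bar>) * exp (\<Sum>Y\<leftarrow>Ys @ Zs. \<bar>Y \<omega>\<bar>)"
      by (simp add: distrib_right)
  qed (use assms f g in \<open>auto simp: subexp_def\<close>)
qed

lemma subexp_G: assumes "Y \<in> G" shows "subexp Y"
proof (rule subexpI[of _ "[Y]" 1])
  fix \<omega> show "norm (Y \<omega>) \<le> 1 * exp (\<Sum>Y\<leftarrow>[Y]. \<bar>Y \<omega>\<bar>)"
    by (simp add: order_trans[OF _ exp_ge_add_one_self])
qed (use assms G_measurable in auto)

lemma subexp_hermite: assumes "Y \<in> G" shows "subexp (\<lambda>\<omega>. hermite w n (Y \<omega>))"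
  by (rule subexpI[of _ "[Y]" "exp (\<bar>w\<bar> / 2)"])
    (use assms G_measurable abs_hermite_le_exp in auto)

lemma subexp_power: "subexp f \<Longrightarrow> subexp (\<lambda>\<omega>. (f \<omega> :: real) ^ n)"
  by (induction n) (auto intro: subexp_const subexp_mult)

lemma subexp_prod_list: "set Ys \<subseteq> G \<Longrightarrow> subexp (\<lambda>\<omega>. \<Prod>Y\<leftarrow>Ys. Y \<omega>)"
  by (induction Ys) (auto intro: subexp_const subexp_mult subexp_G)

lemma integrable_exp_sum_list:
  "set Ys \<subseteq> G \<Longrightarrow> integrable M (\<lambda>\<omega>. exp (c * (\<Sum>Y\<leftarrow>Ys. \<bar>Y \<omega>\<bar>)))"
proof (induction Ys arbitrary: c)
  case (Cons Y Ys)
  have Ym[measurable]: "Y \<in> borel_measurable M" using Cons.prems G_measurable by simp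
  have Zm[measurable]: "(\<lambda>\<omega>. \<Sum>Z\<leftarrow>Ys. \<bar>Z \<omega>\<bar>) \<in> borel_measurable M"
    using Cons.prems G_measurable by (induction Ys) auto
  show ?case
  proof (rule Bochner_Integration.integrable_bound)
    show "integrable M (\<lambda>\<omega>. exp (2 * c * \<bar>Y \<omega>\<bar>) + exp (2 * c * (\<Sum>Z\<leftarrow>Ys. \<bar>Z \<omega>\<bar>)))"
      using Cons integrable_exp_abs by (intro Bochner_Integration.integrable_add) auto
    have "exp (c * (a + b)) \<le> exp (2 * c * a) + exp (2 * c * b)" for a b :: real
    proof -
      have *: "c * (a + b) \<le> max (2 * c * a) (2 * c * b)" by (simp add: max_def algebra_simps)
      have "exp (c * (a + b)) \<le> exp (max (2 * c * a) (2 * c * b))" using * by simp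
      also have "\<dots> \<le> exp (2 * c * a) + exp (2 * c * b)" by (simp add: max_def)
      finally show ?thesis .
    qed
    then show "AE \<omega> in M. norm (exp (c * (\<Sum>Z\<leftarrow>Y # Ys. \<bar>Z \<omega>\<bar>)))
        \<le> norm (exp (2 * c * \<bar>Y \<omega>\<bar>) + exp (2 * c * (\<Sum>Z\<leftarrow>Ys. \<bar>Z \<omega>\<bar>)))"
      by (intro AE_I2) (simp add: order_trans[OF _ abs_ge_self])
  qed simp
qed simp

lemma subexp_integrable: assumes "subexp f" shows "integrable M f"
proof -
  obtain C Ys where f: "set Ys \<subseteq> G" "\<And>\<omega>. \<omega> \<in> space M \<Longrightarrow> norm (f \<omega>) \<le> C * exp (\<Sum>Y\<leftarrow>Ys. \<bar>Y \<omega>\<bar>)"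
    using assms unfolding subexp_def by blast
  show ?thesis
  proof (rule Bochner_Integration.integrable_bound)
    show "integrable M (\<lambda>\<omega>. C * exp (1 * (\<Sum>Y\<leftarrow>Ys. \<bar>Y \<omega>\<bar>)))"
      using integrable_exp_sum_list[OF f(1), of 1] by simp
    show "AE \<omega> in M. norm (f \<omega>) \<le> norm (C * exp (1 * (\<Sum>Y\<leftarrow>Ys. \<bar>Y \<omega>\<bar>)))"
      using f(2) by (intro AE_I2) (simp add: order_trans[OF _ abs_ge_self])
  qed (rule subexp_measurable[OF assms])
qed

lemma subexp_square_integrable: "subexp f \<Longrightarrow> square_integrable M f"
  using subexp_integrable[OF subexp_mult[of f f]]
  by (simp add: square_integrable_def subexp_measurable power2_eq_square)

lemma G_square_integrable: "Y \<in> G \<Longrightarrow> square_integrable M Y"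
  by (intro subexp_square_integrable subexp_G)

lemma charfun_G:
  assumes "Y \<in> G"
  shows "(\<integral>\<omega>. exp (\<i> * of_real (Y \<omega>)) \<partial>M) = of_real (exp (- (\<integral>\<omega>. (Y \<omega>)\<^sup>2 \<partial>M) / 2))"
proof -
  obtain \<sigma> where \<sigma>: "distr M borel Y = distr std_normal_distribution borel (\<lambda>x. \<sigma> * x)"
    using G_normal[OF assms] by blast
  have "(\<integral>\<omega>. (Y \<omega>)\<^sup>2 \<partial>M) = (\<integral>x. (\<sigma> * x)\<^sup>2 \<partial>std_normal_distribution)"
    by (rule G_integral(1)[OF assms _ \<sigma>]) simp
  also have "\<dots> = \<sigma>\<^sup>2"
    using std_normal_distribution_even_moments[of 1] by (simp add: power_mult_distrib)
  finally have v: "(\<integral>\<omega>. (Y \<omega>)\<^sup>2 \<partial>M) = \<sigma>\<^sup>2" .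
  have "(\<integral>\<omega>. exp (\<i> * of_real (Y \<omega>)) \<partial>M) = (\<integral>x. exp (\<i> * of_real (\<sigma> * x)) \<partial>std_normal_distribution)"
    by (rule G_integral(1)[OF assms _ \<sigma>]) simp
  also have "\<dots> = char std_normal_distribution \<sigma>"
    by (simp add: char_def)
  also have "\<dots> = of_real (exp (- \<sigma>\<^sup>2 / 2))" by (simp add: char_std_normal_distribution)
  finally show ?thesis by (simp add: v)
qed

text \<open>
  Testing against a Hermite polynomial is taking a power series coefficient: expectations of
  \<open>g exp (i t Z + t\<^sup>2 w / 2)\<close> may be expanded in \<open>t\<close> term by term.
\<close>

lemma hermite_series_integral:
  fixes g :: "'w \<Rightarrow> complex"
  assumes g: "subexp g" and Z: "Z \<in> G"
  shows "(\<lambda>n. (\<i> ^ n * (\<integral>\<omega>. g \<omega> * of_real (hermite w n (Z \<omega>)) \<partial>M)) * of_real t ^ n) sums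
    (\<integral>\<omega>. g \<omega> * exp (\<i> * of_real (t * Z \<omega>) + of_real (t\<^sup>2 * w / 2)) \<partial>M)"
proof -
  note [measurable] = subexp_measurable[OF g] G_measurable[OF Z]
  define f where "f n \<omega> = g \<omega> * (of_real (hermite w n (Z \<omega>)) * (\<i> * of_real t) ^ n)" for n \<omega>
  define D where "D \<omega> = norm (g \<omega>) * exp (\<bar>t\<bar> * \<bar>Z \<omega>\<bar> + t\<^sup>2 * \<bar>w\<bar> / 2)" for \<omega>
  have nf: "norm (f n \<omega>) \<le> norm (g \<omega>) * (hermite (- \<bar>w\<bar>) n \<bar>Z \<omega>\<bar> * \<bar>t\<bar> ^ n)" for n \<omega>
    unfolding f_def norm_mult norm_power
    by (intro mult_left_mono) (auto simp: abs_hermite_le intro!: mult_right_mono)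
  have s: "(\<lambda>n. norm (g \<omega>) * (hermite (- \<bar>w\<bar>) n \<bar>Z \<omega>\<bar> * \<bar>t\<bar> ^ n)) sums D \<omega>" for \<omega>
    unfolding D_def by (intro sums_mult hermite_abs_sums)
  have sg: "subexp (\<lambda>\<omega>. norm (g \<omega>))" by (rule subexp_mono[OF g]) auto
  have iD: "integrable M D"
    unfolding D_def exp_add
    by (intro subexp_integrable subexp_mult sg subexp_exp Z subexp_const)
  have summ: "summable (\<lambda>n. norm (f n \<omega>))" for \<omega>
    by (rule summable_comparison_test'[OF sums_summable[OF s[of \<omega>]], of 0]) (use nf in auto)
  have le: "(\<Sum>i<n. norm (f i \<omega>)) \<le> D \<omega>" for n \<omega>
  proof -
    have "(\<Sum>i<n. norm (f i \<omega>)) \<le> (\<Sum>i<n. norm (g \<omega>) * (hermite (- \<bar>w\<bar>) i \<bar>Z \<omega>\<bar> * \<bar>t\<bar> ^ i))"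
      by (intro sum_mono nf)
    also have "\<dots> \<le> D \<omega>"
      unfolding sums_unique[OF s] by (rule sum_le_suminf[OF sums_summable[OF s]]) (auto simp: hermite_nonneg)
    finally show ?thesis .
  qed
  have f_int: "integrable M (f n)" for n
  proof (rule Bochner_Integration.integrable_bound[OF iD])
    show "f n \<in> borel_measurable M" unfolding f_def by measurable
    have "norm (f n \<omega>) \<le> D \<omega>" for \<omega>
      using le[of \<omega> "Suc n"] sum_nonneg[of "{..<n}" "\<lambda>i. norm (f i \<omega>)"] by simp
    then show "AE x in M. norm (f n x) \<le> norm (D x)"
      by (intro AE_I2) (simp add: order_trans[OF _ abs_ge_self])
  qed
  have summ_int: "summable (\<lambda>n. \<integral>\<omega>. norm (f n \<omega>) \<partial>M)"
  proof (rule summableI_nonneg_bounded)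
    fix n
    have "(\<Sum>i<n. \<integral>\<omega>. norm (f i \<omega>) \<partial>M) = (\<integral>\<omega>. (\<Sum>i<n. norm (f i \<omega>)) \<partial>M)"
      using f_int by (subst Bochner_Integration.integral_sum) auto
    also have "\<dots> \<le> (\<integral>\<omega>. D \<omega> \<partial>M)"
      using f_int by (intro integral_mono iD le) auto
    finally show "(\<Sum>i<n. \<integral>\<omega>. norm (f i \<omega>) \<partial>M) \<le> (\<integral>\<omega>. D \<omega> \<partial>M)" .
  qed simp
  have "(\<lambda>n. \<integral>\<omega>. f n \<omega> \<partial>M) sums (\<integral>\<omega>. (\<Sum>n. f n \<omega>) \<partial>M)"
    using f_int summ summ_int by (intro sums_integral) auto
  moreover have "(\<Sum>n. f n \<omega>) = g \<omega> * exp (\<i> * of_real (t * Z \<omega>) + of_real (t\<^sup>2 * w / 2))" for \<omega>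
  proof -
    have "(\<lambda>n. f n \<omega>) sums (g \<omega> * exp ((\<i> * of_real t) * of_real (Z \<omega>) - (\<i> * of_real t)\<^sup>2 * of_real w / 2))"
      unfolding f_def by (intro sums_mult hermite_sums)
    from sums_unique[OF this] show ?thesis by (simp add: power_mult_distrib mult.assoc)
  qed
  moreover have "(\<integral>\<omega>. f n \<omega> \<partial>M) = (\<i> ^ n * (\<integral>\<omega>. g \<omega> * of_real (hermite w n (Z \<omega>)) \<partial>M)) * of_real t ^ n" for n
  proof -
    have "(\<integral>\<omega>. f n \<omega> \<partial>M) = (\<integral>\<omega>. (\<i> ^ n * of_real t ^ n) * (g \<omega> * of_real (hermite w n (Z \<omega>))) \<partial>M)"
      by (simp add: f_def power_mult_distrib ac_simps)
    also have "\<dots> = (\<i> ^ n * of_real t ^ n) * (\<integral>\<omega>. g \<omega> * of_real (hermite w n (Z \<omega>)) \<partial>M)"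
      by (rule integral_mult_right_zero)
    finally show ?thesis by (simp add: ac_simps)
  qed
  ultimately show ?thesis by simp
qed

text \<open>
  Both sides are coefficients of the same power series in \<open>t\<close>: the expectation of
  \<open>exp (i Y + i t Z + t\<^sup>2 w / 2)\<close> is an explicit exponential, as \<open>Y + t Z\<close> is Gaussian.
\<close>

lemma expectation_iexp_hermite:
  assumes Y: "Y \<in> G" and Z: "Z \<in> G"
  shows "(\<integral>\<omega>. exp (\<i> * of_real (Y \<omega>)) * of_real (hermite (\<integral>\<omega>. (Z \<omega>)\<^sup>2 \<partial>M) n (Z \<omega>)) \<partial>M)
    = of_real (exp (- (\<integral>\<omega>. (Y \<omega>)\<^sup>2 \<partial>M) / 2)) * (\<i> * of_real (\<integral>\<omega>. Y \<omega> * Z \<omega> \<partial>M)) ^ n / fact n"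
    (is "?E n = of_real (exp (- ?v / 2)) * (\<i> * of_real ?c) ^ n / fact n")
proof -
  let ?w = "\<integral>\<omega>. (Z \<omega>)\<^sup>2 \<partial>M"
  note [measurable] = G_measurable[OF Y] G_measurable[OF Z]
  have g: "subexp (\<lambda>\<omega>. exp (\<i> * of_real (Y \<omega>)) :: complex)"
    by (rule subexp_bounded[of _ 1]) auto
  have val: "(\<integral>\<omega>. exp (\<i> * of_real (Y \<omega>)) * exp (\<i> * of_real (t * Z \<omega>) + of_real (t\<^sup>2 * ?w / 2)) \<partial>M)
      = of_real (exp (- ?v / 2)) * exp (of_real (- t * ?c))" for t
  proof -
    have YZ: "(\<lambda>\<omega>. Y \<omega> + t * Z \<omega>) \<in> G" by (intro add scale Y Z)
    have var: "(\<integral>\<omega>. (Y \<omega> + t * Z \<omega>)\<^sup>2 \<partial>M) = ?v + 2 * t * ?c + t\<^sup>2 * ?w"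
      by (subst integral_power2_sum)
        (auto simp: G_square_integrable Y Z scale power_mult_distrib mult.left_commute[of _ t])
    have "(\<integral>\<omega>. exp (\<i> * of_real (Y \<omega>)) * exp (\<i> * of_real (t * Z \<omega>) + of_real (t\<^sup>2 * ?w / 2)) \<partial>M)
        = (\<integral>\<omega>. exp (of_real (t\<^sup>2 * ?w / 2)) * exp (\<i> * of_real (Y \<omega> + t * Z \<omega>)) \<partial>M)"
      by (simp add: exp_add[symmetric] algebra_simps)
    also have "\<dots> = exp (of_real (t\<^sup>2 * ?w / 2)) * of_real (exp (- (\<integral>\<omega>. (Y \<omega> + t * Z \<omega>)\<^sup>2 \<partial>M) / 2))"
      using charfun_G[OF YZ] by simp
    also have "\<dots> = of_real (exp (t\<^sup>2 * ?w / 2) * exp (- (\<integral>\<omega>. (Y \<omega> + t * Z \<omega>)\<^sup>2 \<partial>M) / 2))"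
      by (simp only: exp_of_real of_real_mult)
    also have "exp (t\<^sup>2 * ?w / 2) * exp (- (\<integral>\<omega>. (Y \<omega> + t * Z \<omega>)\<^sup>2 \<partial>M) / 2) = exp (- ?v / 2) * exp (- t * ?c)"
      unfolding var exp_add[symmetric] by (simp add: algebra_simps add_divide_distrib diff_divide_distrib)
    finally show ?thesis by (simp only: exp_of_real) (simp only: of_real_mult)
  qed
  have s1: "(\<lambda>n. (\<i> ^ n * ?E n) * of_real t ^ n) sums
      (of_real (exp (- ?v / 2)) * exp (of_real (- t * ?c)))" for t
    using hermite_series_integral[OF g Z, of ?w t] unfolding val .
  have s2: "(\<lambda>n. (of_real (exp (- ?v / 2)) * ((- of_real ?c) ^ n / fact n)) * of_real t ^ n) sums
      (complex_of_real (exp (- ?v / 2)) * exp (of_real (- t * ?c)))" for t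
  proof -
    have "(\<lambda>n. of_real (exp (- ?v / 2)) * (of_real (- t * ?c) ^ n /\<^sub>R fact n)) sums
      (of_real (exp (- ?v / 2)) * exp (complex_of_real (- t * ?c)))"
      by (intro sums_mult exp_converges)
    moreover have "of_real (- t * ?c) ^ n /\<^sub>R fact n = (- complex_of_real ?c) ^ n / fact n * of_real t ^ n" for n
    proof -
      have *: "complex_of_real (- t * ?c) = (- complex_of_real ?c) * of_real t" by simp
      show ?thesis unfolding * power_mult_distrib scaleR_conv_of_real divide_inverse by simp
    qed
    ultimately show ?thesis by (simp only: mult.assoc)
  qed
  have "\<i> ^ n * ?E n = of_real (exp (- ?v / 2)) * ((- of_real ?c) ^ n / fact n)"
    by (rule powser_coeff_unique[OF s1 s2])
  then have "(- \<i>) ^ n * (\<i> ^ n * ?E n) = (- \<i>) ^ n * (of_real (exp (- ?v / 2)) * ((- of_real ?c) ^ n / fact n))"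
    by simp
  moreover have "(- \<i>) ^ n * (\<i> ^ n * ?E n) = ?E n"
    by (simp add: mult.assoc[symmetric] power_mult_distrib[symmetric])
  moreover have "(- \<i>) ^ n * (of_real (exp (- ?v / 2)) * ((- of_real ?c) ^ n / fact n))
      = of_real (exp (- ?v / 2)) * (\<i> * of_real ?c) ^ n / fact n"
    by (simp add: power_mult_distrib[symmetric])
  ultimately show ?thesis by simp
qed

lemma expectation_cos_hermite:
  assumes Y: "Y \<in> G" and Z: "Z \<in> G"
  shows "(\<integral>\<omega>. cos (Y \<omega>) * hermite (\<integral>\<omega>. (Z \<omega>)\<^sup>2 \<partial>M) n (Z \<omega>) \<partial>M)
    = Re (\<i> ^ n) * (exp (- (\<integral>\<omega>. (Y \<omega>)\<^sup>2 \<partial>M) / 2) * (\<integral>\<omega>. Y \<omega> * Z \<omega> \<partial>M) ^ n / fact n)"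
proof -
  let ?w = "\<integral>\<omega>. (Z \<omega>)\<^sup>2 \<partial>M" and ?v = "\<integral>\<omega>. (Y \<omega>)\<^sup>2 \<partial>M" and ?c = "\<integral>\<omega>. Y \<omega> * Z \<omega> \<partial>M"
  let ?g = "\<lambda>\<omega>. exp (\<i> * of_real (Y \<omega>)) * of_real (hermite ?w n (Z \<omega>)) :: complex"
  note [measurable] = G_measurable[OF Y] G_measurable[OF Z]
  have "subexp (\<lambda>\<omega>. of_real (hermite ?w n (Z \<omega>)) :: complex)"
    by (rule subexp_mono[OF subexp_hermite[OF Z, of ?w n]]) auto
  moreover have "subexp (\<lambda>\<omega>. exp (\<i> * of_real (Y \<omega>)) :: complex)"
    by (rule subexp_bounded[of _ 1]) auto
  ultimately have "subexp ?g" by (rule subexp_mult[rotated])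
  then have "integrable M ?g" by (rule subexp_integrable)
  then have "(\<integral>\<omega>. Re (?g \<omega>) \<partial>M) = Re (\<integral>\<omega>. ?g \<omega> \<partial>M)" by (rule integral_Re)
  moreover have "Re (?g \<omega>) = cos (Y \<omega>) * hermite ?w n (Z \<omega>)" for \<omega>
    by (simp add: Re_exp)
  moreover have "Re (\<integral>\<omega>. ?g \<omega> \<partial>M) = Re (\<i> ^ n) * (exp (- ?v / 2) * ?c ^ n / fact n)"
  proof -
    have "of_real (exp (- ?v / 2)) * (\<i> * of_real ?c) ^ n / fact n
        = \<i> ^ n * of_real (exp (- ?v / 2) * ?c ^ n / fact n)"
      by (simp add: power_mult_distrib)
    then show ?thesis
      unfolding expectation_iexp_hermite[OF Y Z]
      by (simp only: times_complex.sel Re_complex_of_real Im_complex_of_real mult_zero_right diff_zero)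
  qed
  ultimately show ?thesis by (simp only:)
qed

text \<open>
  Again by comparison of coefficients: replacing \<open>Y\<close> by \<open>t U\<close> in the previous lemma gives \<open>t^n\<close> times a
  power series in \<open>t\<close>, whereas expanding \<open>exp (i t U)\<close> produces the moments \<open>E (h\<^sub>n(Z) U^m)\<close>.  Up to factorials,
  powers of \<open>U\<close> are Hermite polynomials of variance \<open>0\<close>, so \<open>hermite_series_integral\<close> covers this expansion.
\<close>

lemma expectation_hermite_power:
  assumes U: "U \<in> G" and Z: "Z \<in> G" and mn: "m \<le> n"
  shows "(\<integral>\<omega>. hermite (\<integral>\<omega>. (Z \<omega>)\<^sup>2 \<partial>M) n (Z \<omega>) * U \<omega> ^ m \<partial>M)
    = (if m = n then (\<integral>\<omega>. U \<omega> * Z \<omega> \<partial>M) ^ n else 0)"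
proof -
  let ?w = "\<integral>\<omega>. (Z \<omega>)\<^sup>2 \<partial>M" and ?u = "\<integral>\<omega>. (U \<omega>)\<^sup>2 \<partial>M" and ?c = "\<integral>\<omega>. U \<omega> * Z \<omega> \<partial>M"
  let ?h = "\<lambda>\<omega>. hermite ?w n (Z \<omega>)"
  let ?K = "(\<i> * of_real ?c) ^ n / fact n :: complex"
  note [measurable] = G_measurable[OF U] G_measurable[OF Z]
  have g: "subexp (\<lambda>\<omega>. of_real (?h \<omega>) :: complex)"
    by (rule subexp_mono[OF subexp_hermite[OF Z, of ?w n]]) auto
  have val: "(\<integral>\<omega>. of_real (?h \<omega>) * exp (\<i> * of_real (t * U \<omega>) + of_real (t\<^sup>2 * 0 / 2)) \<partial>M)
      = of_real (exp (- t\<^sup>2 * ?u / 2)) * (?K * of_real t ^ n)" for t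
  proof -
    have "(\<integral>\<omega>. of_real (?h \<omega>) * exp (\<i> * of_real (t * U \<omega>) + of_real (t\<^sup>2 * 0 / 2)) \<partial>M)
        = (\<integral>\<omega>. exp (\<i> * of_real (t * U \<omega>)) * of_real (?h \<omega>) \<partial>M)"
      by (simp add: mult.commute)
    also have "\<dots> = of_real (exp (- (\<integral>\<omega>. (t * U \<omega>)\<^sup>2 \<partial>M) / 2)) * (\<i> * of_real (\<integral>\<omega>. t * U \<omega> * Z \<omega> \<partial>M)) ^ n / fact n"
      by (rule expectation_iexp_hermite[OF scale[OF U] Z])
    also have "(\<integral>\<omega>. (t * U \<omega>)\<^sup>2 \<partial>M) = t\<^sup>2 * ?u" by (simp add: power_mult_distrib)
    also have "(\<integral>\<omega>. t * U \<omega> * Z \<omega> \<partial>M) = t * ?c" by (simp add: mult.assoc)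
    finally show ?thesis by (simp add: power_mult_distrib)
  qed
  define a where "a m = \<i> ^ m * (\<integral>\<omega>. of_real (?h \<omega>) * of_real (hermite 0 m (U \<omega>)) \<partial>M)" for m :: nat
  define b where "b m = (if m < n then 0 else of_real (quad_exp_coeff ?u (m - n)) * ?K)" for m
  have s1: "(\<lambda>m. a m * of_real t ^ m) sums (of_real (exp (- t\<^sup>2 * ?u / 2)) * (?K * of_real t ^ n))" for t
    using hermite_series_integral[OF g U, of 0 t] unfolding val a_def .
  have s2: "(\<lambda>m. b m * of_real t ^ m) sums (of_real (exp (- t\<^sup>2 * ?u / 2)) * (?K * of_real t ^ n))" for t :: real
  proof -
    have "(\<lambda>m. of_real (quad_exp_coeff ?u m) * of_real t ^ m) sums
        exp (- (complex_of_real t)\<^sup>2 * of_real ?u / 2)"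
      by (rule quad_exp_coeff_sums)
    moreover have "exp (- (complex_of_real t)\<^sup>2 * of_real ?u / 2) = of_real (exp (- t\<^sup>2 * ?u / 2))"
      unfolding exp_of_real[symmetric] by simp
    ultimately have "(\<lambda>m. of_real (quad_exp_coeff ?u m) * of_real t ^ m * (?K * of_real t ^ n)) sums
        (of_real (exp (- t\<^sup>2 * ?u / 2)) * (?K * of_real t ^ n))"
      by (intro sums_mult2) simp
    moreover have "of_real (quad_exp_coeff ?u m) * of_real t ^ m * (?K * of_real t ^ n)
        = b (m + n) * of_real t ^ (m + n)" for m
      by (simp add: b_def power_add)
    ultimately have "(\<lambda>m. b (m + n) * of_real t ^ (m + n)) sums
        (of_real (exp (- t\<^sup>2 * ?u / 2)) * (?K * of_real t ^ n))" by simp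
    then show ?thesis
      by (subst (asm) sums_zero_iff_shift[of n "\<lambda>m. b m * of_real t ^ m"]) (auto simp: b_def)
  qed
  have ab: "a m = b m" by (rule powser_coeff_unique[OF s1 s2])
  have "(\<integral>\<omega>. of_real (?h \<omega>) * of_real (hermite 0 m (U \<omega>)) \<partial>M)
      = complex_of_real (\<integral>\<omega>. ?h \<omega> * (U \<omega> ^ m / fact m) \<partial>M)"
    by (simp only: hermite_0_eq of_real_mult[symmetric] integral_complex_of_real)
  then have am: "a m = \<i> ^ m * of_real ((\<integral>\<omega>. ?h \<omega> * U \<omega> ^ m \<partial>M) / fact m)"
    by (simp only: a_def times_divide_eq_right integral_divide_zero)
  have cancel: "x = y" if "\<i> ^ m * of_real x = \<i> ^ m * of_real y" for x y :: real
  proof -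
    have "complex_of_real x = of_real y"
      using that by (simp only: mult_cancel_left power_eq_0_iff complex_i_not_zero) simp
    then show ?thesis by (simp only: of_real_eq_iff)
  qed
  show ?thesis
  proof (cases "m = n")
    case True
    have "quad_exp_coeff ?u 0 = 1" by (simp add: quad_exp_coeff_def)
    then have "b m = ?K" using True by (simp add: b_def)
    also have "?K = \<i> ^ m * of_real (?c ^ n / fact n)"
      using True by (simp add: power_mult_distrib)
    finally have "(\<integral>\<omega>. ?h \<omega> * U \<omega> ^ m \<partial>M) / fact m = ?c ^ n / fact n"
      using ab am by (intro cancel) (simp only:)
    then show ?thesis using True by simp
  next
    case False
    then have "b m = \<i> ^ m * of_real 0" using mn by (simp add: b_def)
    then have "(\<integral>\<omega>. ?h \<omega> * U \<omega> ^ m \<partial>M) / fact m = 0"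
      using ab am by (intro cancel) (simp only:)
    then show ?thesis using False by simp
  qed
qed

text \<open>
  Polarisation: products of different Gaussian variables are reached from powers.  In the induction step
  a power of \<open>\<theta> Y + U\<close> replaces a power of \<open>U\<close>; the expectation vanishes for every \<open>\<theta>\<close>, hence so
  does the coefficient of \<open>\<theta>\<close>.
\<close>

lemma expectation_hermite_product:
  assumes Z: "Z \<in> G"
  shows "set Ys \<subseteq> G \<Longrightarrow> U \<in> G \<Longrightarrow> length Ys + k < n \<Longrightarrow>
    (\<integral>\<omega>. hermite (\<integral>\<omega>. (Z \<omega>)\<^sup>2 \<partial>M) n (Z \<omega>) * ((\<Prod>Y\<leftarrow>Ys. Y \<omega>) * U \<omega> ^ k) \<partial>M) = 0"
proof (induction Ys arbitrary: U k)
  case Nil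
  then show ?case using expectation_hermite_power[OF Nil(2) Z, of k n] by simp
next
  case (Cons Y Ys)
  let ?h = "\<lambda>\<omega>. hermite (\<integral>\<omega>. (Z \<omega>)\<^sup>2 \<partial>M) n (Z \<omega>)"
  have Y: "Y \<in> G" and Ys: "set Ys \<subseteq> G" and U: "U \<in> G" using Cons.prems by auto
  define c where "c j = of_nat (Suc k choose j) *
    (\<integral>\<omega>. ?h \<omega> * ((\<Prod>Y\<leftarrow>Ys. Y \<omega>) * (Y \<omega> ^ j * U \<omega> ^ (Suc k - j))) \<partial>M)" for j
  have "(\<Sum>j\<le>Suc k. c j * \<theta> ^ j) = 0" for \<theta>
  proof -
    have V: "(\<lambda>\<omega>. \<theta> * Y \<omega> + U \<omega>) \<in> G" by (intro add scale Y U)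
    have "0 = (\<integral>\<omega>. ?h \<omega> * ((\<Prod>Y\<leftarrow>Ys. Y \<omega>) * (\<theta> * Y \<omega> + U \<omega>) ^ Suc k) \<partial>M)"
      using Cons.prems by (intro Cons.IH[OF Ys V, symmetric]) auto
    also have "\<dots> = (\<integral>\<omega>. (\<Sum>j\<le>Suc k. (of_nat (Suc k choose j) * \<theta> ^ j) *
        (?h \<omega> * ((\<Prod>Y\<leftarrow>Ys. Y \<omega>) * (Y \<omega> ^ j * U \<omega> ^ (Suc k - j))))) \<partial>M)"
      unfolding binomial_ring sum_distrib_left
      by (intro Bochner_Integration.integral_cong refl sum.cong) (simp add: power_mult_distrib ac_simps)
    also have "\<dots> = (\<Sum>j\<le>Suc k. (\<integral>\<omega>. (of_nat (Suc k choose j) * \<theta> ^ j) *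
        (?h \<omega> * ((\<Prod>Y\<leftarrow>Ys. Y \<omega>) * (Y \<omega> ^ j * U \<omega> ^ (Suc k - j)))) \<partial>M))"
      by (intro Bochner_Integration.integral_sum integrable_mult_right subexp_integrable subexp_mult
          subexp_hermite Z subexp_prod_list Ys subexp_power subexp_G Y U)
    also have "\<dots> = (\<Sum>j\<le>Suc k. c j * \<theta> ^ j)"
      unfolding c_def integral_mult_right_zero by (simp only: ac_simps)
    finally show ?thesis by simp
  qed
  \<comment> \<open>the coefficient of the first power of \<open>\<theta>\<close> contains one factor \<open>Y\<close>\<close>
  then have "c 1 = 0" using polyfun_eq_0[of c "Suc k"] by auto
  then have "(\<integral>\<omega>. ?h \<omega> * ((\<Prod>Y\<leftarrow>Ys. Y \<omega>) * (Y \<omega> * U \<omega> ^ k)) \<partial>M) = 0"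
    by (simp add: c_def del: of_nat_Suc)
  then show ?case by (simp add: ac_simps)
qed

lemma expectation_hermite_hermite:
  assumes Y: "Y \<in> G" and Z: "Z \<in> G"
  shows "(\<integral>\<omega>. hermite (\<integral>\<omega>. (Y \<omega>)\<^sup>2 \<partial>M) n (Y \<omega>) * hermite (\<integral>\<omega>. (Z \<omega>)\<^sup>2 \<partial>M) n (Z \<omega>) \<partial>M)
    = (\<integral>\<omega>. Y \<omega> * Z \<omega> \<partial>M) ^ n / fact n"
proof -
  let ?v = "\<integral>\<omega>. (Y \<omega>)\<^sup>2 \<partial>M" and ?w = "\<integral>\<omega>. (Z \<omega>)\<^sup>2 \<partial>M"
  have "(\<integral>\<omega>. hermite ?v n (Y \<omega>) * hermite ?w n (Z \<omega>) \<partial>M)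
    = (\<integral>\<omega>. (\<Sum>j\<le>n. (quad_exp_coeff ?v (n - j) / fact j) * (hermite ?w n (Z \<omega>) * Y \<omega> ^ j)) \<partial>M)"
    by (intro Bochner_Integration.integral_cong refl)
      (simp add: hermite_def[of ?v] sum_distrib_left sum_distrib_right ac_simps)
  also have "\<dots> = (\<Sum>j\<le>n. (\<integral>\<omega>. (quad_exp_coeff ?v (n - j) / fact j) * (hermite ?w n (Z \<omega>) * Y \<omega> ^ j) \<partial>M))"
    by (intro Bochner_Integration.integral_sum integrable_mult_right subexp_integrable subexp_mult
        subexp_hermite Z subexp_power subexp_G Y)
  also have "\<dots> = (\<Sum>j\<le>n. if j = n then (\<integral>\<omega>. Y \<omega> * Z \<omega> \<partial>M) ^ n / fact n else 0)"
    by (intro sum.cong refl)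
      (auto simp: expectation_hermite_power[OF Y Z] quad_exp_coeff_def)
  finally show ?thesis by simp
qed

lemma expectation_cos_cos:
  assumes Y: "Y \<in> G" and Z: "Z \<in> G"
  shows "(\<integral>\<omega>. cos (Y \<omega>) * cos (Z \<omega>) \<partial>M)
    = exp (- (\<integral>\<omega>. (Y \<omega>)\<^sup>2 \<partial>M) / 2) * exp (- (\<integral>\<omega>. (Z \<omega>)\<^sup>2 \<partial>M) / 2) * cosh (\<integral>\<omega>. Y \<omega> * Z \<omega> \<partial>M)"
proof -
  let ?w = "\<integral>\<omega>. (Z \<omega>)\<^sup>2 \<partial>M" and ?v = "\<integral>\<omega>. (Y \<omega>)\<^sup>2 \<partial>M" and ?c = "\<integral>\<omega>. Y \<omega> * Z \<omega> \<partial>M"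
  note [measurable] = G_measurable[OF Y] G_measurable[OF Z]
  have cosE: "(\<integral>\<omega>. cos (U \<omega>) \<partial>M) = exp (- (\<integral>\<omega>. (U \<omega>)\<^sup>2 \<partial>M) / 2)" if U: "U \<in> G" for U
    using expectation_cos_hermite[OF U U, of 0] by (simp add: hermite_def quad_exp_coeff_def)
  have var: "(\<integral>\<omega>. (Y \<omega> + s * Z \<omega>)\<^sup>2 \<partial>M) = ?v + 2 * s * ?c + s\<^sup>2 * ?w" for s
    by (subst integral_power2_sum)
      (auto simp: G_square_integrable Y Z scale power_mult_distrib mult.left_commute[of _ s])
  have i: "integrable M (\<lambda>\<omega>. cos (Y \<omega> + s * Z \<omega>))" for s
    by (rule subexp_integrable[OF subexp_bounded[of _ 1]]) auto
  have "(\<integral>\<omega>. cos (Y \<omega>) * cos (Z \<omega>) \<partial>M)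
      = (\<integral>\<omega>. (cos (Y \<omega> + (-1) * Z \<omega>) + cos (Y \<omega> + 1 * Z \<omega>)) / 2 \<partial>M)"
    by (simp add: cos_times_cos)
  also have "\<dots> = ((\<integral>\<omega>. cos (Y \<omega> + (-1) * Z \<omega>) \<partial>M) + (\<integral>\<omega>. cos (Y \<omega> + 1 * Z \<omega>) \<partial>M)) / 2"
    using i[of "-1"] i[of 1] by simp
  also have "\<dots> = (exp (- (?v + 2 * (-1) * ?c + (-1)\<^sup>2 * ?w) / 2) + exp (- (?v + 2 * 1 * ?c + 1\<^sup>2 * ?w) / 2)) / 2"
    by (simp only: cosE[OF add[OF Y scale[OF Z]]] var)
  also have "\<dots> = exp (- ?v / 2) * exp (- ?w / 2) * cosh ?c"
    by (simp add: cosh_def exp_add[symmetric] algebra_simps add_divide_distrib diff_divide_distrib)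
  finally show ?thesis .
qed

end

section \<open>Polynomials in a Gaussian field and its chaoses\<close>

definition linear_span :: "('t \<Rightarrow> 'w \<Rightarrow> real ^ 'd::finite) \<Rightarrow> ('w \<Rightarrow> real) set" where
  "linear_span X = {Y. \<exists>T c. finite T \<and> Y = (\<lambda>\<omega>. \<Sum>i\<in>UNIV. \<Sum>t\<in>T. c i t * X t \<omega> $ i)}"

lemma linear_spanI:
  assumes "finite T" "Y = (\<lambda>\<omega>. \<Sum>i\<in>UNIV. \<Sum>t\<in>T. c i t * X t \<omega> $ i)"
  shows "Y \<in> linear_span X"
proof -
  have "\<exists>T c. finite T \<and> Y = (\<lambda>\<omega>. \<Sum>i\<in>UNIV. \<Sum>t\<in>T. c i t * X t \<omega> $ i)"
    by (rule exI[of _ T], rule exI[of _ c], rule conjI[OF assms])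
  then show ?thesis by (simp add: linear_span_def)
qed

lemma linear_spanE:
  assumes "Y \<in> linear_span X"
  obtains T c where "finite T" "Y = (\<lambda>\<omega>. \<Sum>i\<in>UNIV. \<Sum>t\<in>T. c i t * X t \<omega> $ i)"
  using assms unfolding linear_span_def mem_Collect_eq by (elim exE conjE)

lemma linear_span_scale: "Y \<in> linear_span X \<Longrightarrow> (\<lambda>\<omega>. k * Y \<omega>) \<in> linear_span X"
proof -
  assume "Y \<in> linear_span X"
  then obtain T c where T: "finite T" "Y = (\<lambda>\<omega>. \<Sum>i\<in>UNIV. \<Sum>t\<in>T. c i t * X t \<omega> $ i)"
    by (rule linear_spanE)
  have "(\<lambda>\<omega>. k * Y \<omega>) = (\<lambda>\<omega>. \<Sum>i\<in>UNIV. \<Sum>t\<in>T. (k * c i t) * X t \<omega> $ i)"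
    unfolding T(2) sum_distrib_left mult.assoc ..
  then show ?thesis by (rule linear_spanI[OF T(1)])
qed

lemma sum_union_extend:
  fixes c d :: "'a \<Rightarrow> real"
  assumes "finite A" "finite B"
  shows "(\<Sum>m\<in>A. c m * f m) + (\<Sum>m\<in>B. d m * f m)
    = (\<Sum>m\<in>A \<union> B. ((if m \<in> A then c m else 0) + (if m \<in> B then d m else 0)) * f m)"
proof -
  have "(\<Sum>m\<in>A. c m * f m) = (\<Sum>m\<in>A \<union> B. (if m \<in> A then c m else 0) * f m)"
    using assms by (intro sum.mono_neutral_cong_left) auto
  moreover have "(\<Sum>m\<in>B. d m * f m) = (\<Sum>m\<in>A \<union> B. (if m \<in> B then d m else 0) * f m)"
    using assms by (intro sum.mono_neutral_cong_left) auto
  ultimately show ?thesis by (simp only: distrib_right sum.distrib)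
qed

lemma linear_span_add:
  assumes "Y \<in> linear_span X" "Z \<in> linear_span X"
  shows "(\<lambda>\<omega>. Y \<omega> + Z \<omega>) \<in> linear_span X"
proof -
  obtain T c where T: "finite T" "Y = (\<lambda>\<omega>. \<Sum>i\<in>UNIV. \<Sum>t\<in>T. c i t * X t \<omega> $ i)"
    using assms(1) by (rule linear_spanE)
  obtain U d where U: "finite U" "Z = (\<lambda>\<omega>. \<Sum>i\<in>UNIV. \<Sum>t\<in>U. d i t * X t \<omega> $ i)"
    using assms(2) by (rule linear_spanE)
  have "(\<lambda>\<omega>. Y \<omega> + Z \<omega>) = (\<lambda>\<omega>. \<Sum>i\<in>UNIV. \<Sum>t\<in>T \<union> U.
      ((if t \<in> T then c i t else 0) + (if t \<in> U then d i t else 0)) * X t \<omega> $ i)"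
    unfolding T U sum.distrib[symmetric] sum_union_extend[OF T(1) U(1)] ..
  then show ?thesis by (rule linear_spanI[rotated]) (use T(1) U(1) in simp)
qed

lemma linear_span_coordinate: "(\<lambda>\<omega>. X t \<omega> $ i) \<in> linear_span X"
  by (rule linear_spanI[of "{t}" _ "\<lambda>j s. if j = i then 1 else 0"]) (simp_all add: mult_delta_left)

lemma polynomials_ofE:
  assumes "q \<in> polynomials_of X n"
  obtains A c where "finite A" "\<forall>m\<in>A. size m \<le> n"
    "q = (\<lambda>\<omega>. \<Sum>m\<in>A. c m * (\<Prod>(i, t)\<in>#m. X t \<omega> $ i))"
  using assms unfolding polynomials_of_def mem_Collect_eq by (elim exE conjE)

lemma polynomials_ofI:
  assumes "finite A" "\<forall>m\<in>A. size m \<le> n"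
    "q = (\<lambda>\<omega>. \<Sum>m\<in>A. c m * (\<Prod>(i, t)\<in>#m. X t \<omega> $ i))"
  shows "q \<in> polynomials_of X n"
  unfolding polynomials_of_def mem_Collect_eq
  by (intro exI[of _ A] exI[of _ c] conjI assms)

lemma polynomials_of_const: "(\<lambda>_. c) \<in> polynomials_of X n"
  by (rule polynomials_ofI[of "{{#}}" _ _ "\<lambda>_. c"]) auto

lemma polynomials_of_mono: "m \<le> n \<Longrightarrow> polynomials_of X m \<subseteq> polynomials_of X n"
  by (intro subsetI, erule polynomials_ofE, rule polynomials_ofI) (auto intro: order_trans)

lemma polynomials_of_add:
  assumes "p \<in> polynomials_of X n" "q \<in> polynomials_of X n"
  shows "(\<lambda>\<omega>. p \<omega> + q \<omega>) \<in> polynomials_of X n"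
proof -
  obtain A c where A: "finite A" "\<forall>m\<in>A. size m \<le> n"
    "p = (\<lambda>\<omega>. \<Sum>m\<in>A. c m * (\<Prod>(i, t)\<in>#m. X t \<omega> $ i))"
    using assms(1) by (rule polynomials_ofE)
  obtain B d where B: "finite B" "\<forall>m\<in>B. size m \<le> n"
    "q = (\<lambda>\<omega>. \<Sum>m\<in>B. d m * (\<Prod>(i, t)\<in>#m. X t \<omega> $ i))"
    using assms(2) by (rule polynomials_ofE)
  show ?thesis
  proof (rule polynomials_ofI[of "A \<union> B"])
    show "(\<lambda>\<omega>. p \<omega> + q \<omega>) = (\<lambda>\<omega>. \<Sum>m\<in>A \<union> B.
        ((if m \<in> A then c m else 0) + (if m \<in> B then d m else 0)) * (\<Prod>(i, t)\<in>#m. X t \<omega> $ i))"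
      unfolding A(3) B(3) sum_union_extend[OF A(1) B(1)] ..
  qed (use A B in auto)
qed

lemma polynomials_of_scale:
  assumes "p \<in> polynomials_of X n" shows "(\<lambda>\<omega>. k * p \<omega>) \<in> polynomials_of X n"
proof -
  obtain A c where A: "finite A" "\<forall>m\<in>A. size m \<le> n"
    "p = (\<lambda>\<omega>. \<Sum>m\<in>A. c m * (\<Prod>(i, t)\<in>#m. X t \<omega> $ i))"
    using assms by (rule polynomials_ofE)
  show ?thesis
    by (rule polynomials_ofI[of A _ _ "\<lambda>m. k * c m"]) (use A in \<open>auto simp: sum_distrib_left mult.assoc\<close>)
qed

lemma polynomials_of_sum:
  "(\<And>j. j \<in> J \<Longrightarrow> p j \<in> polynomials_of X n) \<Longrightarrow> (\<lambda>\<omega>. \<Sum>j\<in>J. p j \<omega>) \<in> polynomials_of X n"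
  by (induction J rule: infinite_finite_induct)
    (auto intro: polynomials_of_add polynomials_of_const)

lemma polynomials_of_mult_coordinate:
  assumes "p \<in> polynomials_of X n"
  shows "(\<lambda>\<omega>. X t \<omega> $ i * p \<omega>) \<in> polynomials_of X (Suc n)"
proof -
  obtain A c where A: "finite A" "\<forall>m\<in>A. size m \<le> n"
    "p = (\<lambda>\<omega>. \<Sum>m\<in>A. c m * (\<Prod>(i, t)\<in>#m. X t \<omega> $ i))"
    using assms by (rule polynomials_ofE)
  have "(\<lambda>\<omega>. X t \<omega> $ i * p \<omega>)
    = (\<lambda>\<omega>. \<Sum>m\<in>add_mset (i, t) ` A. c (m - {#(i, t)#}) * (\<Prod>(i, t)\<in>#m. X t \<omega> $ i))"
    by (subst sum.reindex) (auto simp: A(3) sum_distrib_left ac_simps inj_on_def)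
  then show ?thesis
    by (rule polynomials_ofI[rotated 2]) (use A in auto)
qed

lemma polynomials_of_mult_span:
  assumes "Y \<in> linear_span X" "p \<in> polynomials_of X n"
  shows "(\<lambda>\<omega>. Y \<omega> * p \<omega>) \<in> polynomials_of X (Suc n)"
proof -
  obtain T c where T: "finite T" "Y = (\<lambda>\<omega>. \<Sum>i\<in>UNIV. \<Sum>t\<in>T. c i t * X t \<omega> $ i)"
    using assms(1) by (rule linear_spanE)
  have "(\<lambda>\<omega>. Y \<omega> * p \<omega>) = (\<lambda>\<omega>. \<Sum>i\<in>UNIV. \<Sum>t\<in>T. c i t * (X t \<omega> $ i * p \<omega>))"
    by (simp add: T(2) sum_distrib_right mult.assoc)
  then show ?thesis
    by (simp only:) (intro polynomials_of_sum polynomials_of_scale polynomials_of_mult_coordinate assms(2))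
qed

lemma polynomials_of_power:
  assumes "Y \<in> linear_span X" shows "(\<lambda>\<omega>. Y \<omega> ^ k) \<in> polynomials_of X k"
proof (induction k)
  case (Suc k)
  from polynomials_of_mult_span[OF assms this] show ?case by simp
qed (simp add: polynomials_of_const)

lemma polynomials_of_hermite:
  assumes "Y \<in> linear_span X" shows "(\<lambda>\<omega>. hermite w n (Y \<omega>)) \<in> polynomials_of X n"
proof -
  have "(\<lambda>\<omega>. hermite w n (Y \<omega>)) = (\<lambda>\<omega>. \<Sum>j\<le>n. (quad_exp_coeff w (n - j) / fact j) * Y \<omega> ^ j)"
    by (simp add: hermite_def mult.commute)
  then show ?thesis
    using polynomials_of_power[OF assms] polynomials_of_mono[of _ n X]
    by (simp only:) (intro polynomials_of_sum polynomials_of_scale, blast)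
qed

lemma polynomial_closure_mono: "m \<le> n \<Longrightarrow> polynomial_closure M X m \<subseteq> polynomial_closure M X n"
  unfolding polynomial_closure_def using polynomials_of_mono[of m n X] by blast

lemma polynomial_closure_square_integrable: "F \<in> polynomial_closure M X n \<Longrightarrow> square_integrable M F"
  by (auto simp: polynomial_closure_def L2_tendsto_def)

lemma chaos_square_integrable: "F \<in> chaos M X n \<Longrightarrow> square_integrable M F"
  by (auto simp: chaos_def polynomial_closure_square_integrable)

lemma chaos_orthogonal:
  assumes "F \<in> chaos M X m" "G \<in> chaos M X n" "m \<noteq> n"
  shows "(\<integral>\<omega>. F \<omega> * G \<omega> \<partial>M) = 0"
proof -
  have *: "(\<integral>\<omega>. F \<omega> * G \<omega> \<partial>M) = 0"
    if "F \<in> chaos M X m" "G \<in> chaos M X n" "n < m" for F G m n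
    proof -
    have "G \<in> polynomial_closure M X (m - 1)"
      using that polynomial_closure_mono[of n "m - 1" M X] by (simp add: chaos_def) fastforce
    then show ?thesis using that by (auto simp: chaos_def)
  qed
  show ?thesis
    using *[of F m G n] *[of G n F m] assms by (cases "n < m") (auto simp: mult.commute)
qed

lemma chaos_expansion_inner:
  assumes "chaos_expansion M X L F" "G \<in> chaos M X n"
  shows "(\<integral>\<omega>. L \<omega> * G \<omega> \<partial>M) = (\<integral>\<omega>. F n \<omega> * G \<omega> \<partial>M)"
proof -
  have F: "F k \<in> chaos M X k" for k using assms(1) by (simp add: chaos_expansion_def)
  have G: "square_integrable M G" by (rule chaos_square_integrable[OF assms(2)])
  have "(\<lambda>k. \<integral>\<omega>. (\<Sum>j<k. F j \<omega>) * G \<omega> \<partial>M) \<longlonglongrightarrow> (\<integral>\<omega>. L \<omega> * G \<omega> \<partial>M)"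
    using assms(1) G by (intro L2_tendsto_inner) (auto simp: chaos_expansion_def)
  moreover have "(\<lambda>k. \<integral>\<omega>. (\<Sum>j<k. F j \<omega>) * G \<omega> \<partial>M) \<longlonglongrightarrow> (\<integral>\<omega>. F n \<omega> * G \<omega> \<partial>M)"
  proof (rule tendsto_eventually)
    have "(\<integral>\<omega>. (\<Sum>j<k. F j \<omega>) * G \<omega> \<partial>M) = (\<integral>\<omega>. F n \<omega> * G \<omega> \<partial>M)" if "n < k" for k
    proof -
      have "(\<integral>\<omega>. (\<Sum>j<k. F j \<omega>) * G \<omega> \<partial>M) = (\<Sum>j<k. \<integral>\<omega>. F j \<omega> * G \<omega> \<partial>M)"
        unfolding sum_distrib_right
        by (intro Bochner_Integration.integral_sum square_integrable_mult G chaos_square_integrable[OF F])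
      also have "\<dots> = (\<Sum>j<k. if j = n then (\<integral>\<omega>. F n \<omega> * G \<omega> \<partial>M) else 0)"
        by (intro sum.cong refl) (auto intro: chaos_orthogonal[OF F assms(2)])
      finally show ?thesis using that by simp
    qed
    then show "\<forall>\<^sub>F k in sequentially. (\<integral>\<omega>. (\<Sum>j<k. F j \<omega>) * G \<omega> \<partial>M) = (\<integral>\<omega>. F n \<omega> * G \<omega> \<partial>M)"
      by (auto intro: eventually_mono[OF eventually_gt_at_top[of n]])
  qed
  ultimately show ?thesis by (rule LIMSEQ_unique)
qed

text \<open>
  The norms in a chaos expansion are determined by the functional, so that membership in \<open>D1\<close> can be
  tested on any one expansion: with \<open>F\<close> and \<open>F'\<close> two expansions of \<open>L\<close>, both squared norms equal the
  inner product of \<open>F n\<close> and \<open>F' n\<close>, since each of these is also an inner product with \<open>L\<close>.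
\<close>

lemma chaos_expansion_unique_norm:
  assumes F: "chaos_expansion M X L F" and F': "chaos_expansion M X L F'"
  shows "(\<integral>\<omega>. (F n \<omega>)\<^sup>2 \<partial>M) = (\<integral>\<omega>. (F' n \<omega>)\<^sup>2 \<partial>M)"
proof -
  have "F n \<in> chaos M X n" "F' n \<in> chaos M X n" using assms by (auto simp: chaos_expansion_def)
  note i = chaos_expansion_inner[OF F this(1)] chaos_expansion_inner[OF F this(2)]
    chaos_expansion_inner[OF F' this(1)] chaos_expansion_inner[OF F' this(2)]
  show ?thesis using i by (simp add: power2_eq_square mult.commute)
qed

text \<open>
  Parseval: an orthogonal family with the inner products of projections of \<open>L\<close> converges to \<open>L\<close> as soon as
  no mass is lost.
\<close>

lemma chaos_expansionI:
  assumes F: "\<And>n. F n \<in> chaos M X n" and L: "square_integrable M L"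
    and inner: "\<And>n. (\<integral>\<omega>. L \<omega> * F n \<omega> \<partial>M) = (\<integral>\<omega>. (F n \<omega>)\<^sup>2 \<partial>M)"
    and sums: "(\<lambda>n. \<integral>\<omega>. (F n \<omega>)\<^sup>2 \<partial>M) sums (\<integral>\<omega>. (L \<omega>)\<^sup>2 \<partial>M)"
  shows "chaos_expansion M X L F"
  unfolding chaos_expansion_def L2_tendsto_def
proof (intro conjI allI F L always_eventually)
  have sqF: "square_integrable M (F n)" for n by (rule chaos_square_integrable[OF F])
  show sqS: "square_integrable M (\<lambda>\<omega>. \<Sum>n<k. F n \<omega>)" for k
    by (intro square_integrable_sum sqF)
  have eq: "(\<integral>\<omega>. ((\<Sum>n<k. F n \<omega>) - L \<omega>)\<^sup>2 \<partial>M) = (\<integral>\<omega>. (L \<omega>)\<^sup>2 \<partial>M) - (\<Sum>n<k. \<integral>\<omega>. (F n \<omega>)\<^sup>2 \<partial>M)" for k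
  proof -
    have SL: "(\<integral>\<omega>. (\<Sum>n<k. F n \<omega>) * L \<omega> \<partial>M) = (\<Sum>n<k. \<integral>\<omega>. (F n \<omega>)\<^sup>2 \<partial>M)"
    proof -
      have "(\<integral>\<omega>. (\<Sum>n<k. F n \<omega>) * L \<omega> \<partial>M) = (\<Sum>n<k. \<integral>\<omega>. F n \<omega> * L \<omega> \<partial>M)"
        unfolding sum_distrib_right
        by (intro Bochner_Integration.integral_sum square_integrable_mult L sqF)
      then show ?thesis by (simp add: inner mult.commute[of "F _ _"])
    qed
    have SS: "(\<integral>\<omega>. (\<Sum>n<k. F n \<omega>)\<^sup>2 \<partial>M) = (\<Sum>n<k. \<integral>\<omega>. (F n \<omega>)\<^sup>2 \<partial>M)"
    proof -
      have "(\<integral>\<omega>. (\<Sum>n<k. F n \<omega>)\<^sup>2 \<partial>M) = (\<integral>\<omega>. (\<Sum>n<k. \<Sum>m<k. F n \<omega> * F m \<omega>) \<partial>M)"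
        by (simp add: power2_eq_square sum_product)
      also have "\<dots> = (\<Sum>n<k. \<Sum>m<k. \<integral>\<omega>. F n \<omega> * F m \<omega> \<partial>M)"
        by (simp add: square_integrable_mult[OF sqF sqF])
      also have "\<dots> = (\<Sum>n<k. \<Sum>m<k. if m = n then (\<integral>\<omega>. (F n \<omega>)\<^sup>2 \<partial>M) else 0)"
        by (intro sum.cong refl) (auto simp: power2_eq_square intro: chaos_orthogonal[OF F F])
      finally show ?thesis by simp
    qed
    show ?thesis using integral_power2_diff[OF sqS L, of k] by (simp add: SL SS)
  qed
  have "(\<lambda>k. (\<integral>\<omega>. (L \<omega>)\<^sup>2 \<partial>M) - (\<Sum>n<k. \<integral>\<omega>. (F n \<omega>)\<^sup>2 \<partial>M))
      \<longlonglongrightarrow> (\<integral>\<omega>. (L \<omega>)\<^sup>2 \<partial>M) - (\<integral>\<omega>. (L \<omega>)\<^sup>2 \<partial>M)"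
    using sums unfolding sums_def by (intro tendsto_intros)
  then show "(\<lambda>k. \<integral>\<omega>. ((\<Sum>n<k. F n \<omega>) - L \<omega>)\<^sup>2 \<partial>M) \<longlonglongrightarrow> 0"
    by (simp add: eq)
qed

locale gaussian_coordinates = gaussian_space M "linear_span X"
  for M :: "'w measure" and X :: "'t \<Rightarrow> 'w \<Rightarrow> real ^ 'd::finite"
begin

lemma monomial_as_prod_list:
  obtains Ys where "set Ys \<subseteq> linear_span X" "length Ys = size m"
    "(\<lambda>\<omega>. \<Prod>(i, t)\<in>#m. X t \<omega> $ i) = (\<lambda>\<omega>. \<Prod>Y\<leftarrow>Ys. Y \<omega>)"
proof -
  obtain xs where xs: "mset xs = m" using ex_mset by blast
  have "(\<Prod>(i, t)\<in>#m. X t \<omega> $ i) = (\<Prod>Y\<leftarrow>map (\<lambda>(i, t) \<omega>. X t \<omega> $ i) xs. Y \<omega>)" for \<omega>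
    unfolding xs[symmetric] mset_map[symmetric] prod_mset_prod_list
    by (simp add: comp_def case_prod_unfold)
  then show ?thesis
    using that[of "map (\<lambda>(i, t) \<omega>. X t \<omega> $ i) xs"] xs linear_span_coordinate by fastforce
qed

lemma polynomial_subexp:
  assumes "p \<in> polynomials_of X n" shows "subexp p"
proof -
  obtain A c where A: "finite A" "\<forall>m\<in>A. size m \<le> n"
    "p = (\<lambda>\<omega>. \<Sum>m\<in>A. c m * (\<Prod>(i, t)\<in>#m. X t \<omega> $ i))"
    using assms by (rule polynomials_ofE)
  have mon: "subexp (\<lambda>\<omega>. \<Prod>(i, t)\<in>#m. X t \<omega> $ i)" for m
    by (rule monomial_as_prod_list[of m]) (simp add: subexp_prod_list)
  have "subexp (\<lambda>\<omega>. \<Sum>m\<in>A. c m * (\<Prod>(i, t)\<in>#m. X t \<omega> $ i))"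
    using A(1) by (induction A) (auto intro!: subexp_const subexp_add subexp_mult mon)
  then show ?thesis using A(3) by simp
qed

lemma hermite_orthogonal_polynomial:
  assumes p: "p \<in> polynomials_of X k" and kn: "k < n" and Z: "Z \<in> linear_span X"
  shows "(\<integral>\<omega>. hermite (\<integral>\<omega>. (Z \<omega>)\<^sup>2 \<partial>M) n (Z \<omega>) * p \<omega> \<partial>M) = 0"
proof -
  obtain A c where A: "finite A" "\<forall>m\<in>A. size m \<le> k"
    "p = (\<lambda>\<omega>. \<Sum>m\<in>A. c m * (\<Prod>(i, t)\<in>#m. X t \<omega> $ i))"
    using p by (rule polynomials_ofE)
  let ?h = "\<lambda>\<omega>. hermite (\<integral>\<omega>. (Z \<omega>)\<^sup>2 \<partial>M) n (Z \<omega>)"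
  let ?mon = "\<lambda>m \<omega>. \<Prod>(i, t)\<in>#m. X t \<omega> $ i"
  have mon: "subexp (?mon m)" for m
    by (rule monomial_as_prod_list[of m]) (simp add: subexp_prod_list)
  have "(\<integral>\<omega>. ?h \<omega> * p \<omega> \<partial>M) = (\<integral>\<omega>. (\<Sum>m\<in>A. c m * (?h \<omega> * ?mon m \<omega>)) \<partial>M)"
    by (simp add: A(3) sum_distrib_left mult.left_commute)
  also have "\<dots> = (\<Sum>m\<in>A. \<integral>\<omega>. c m * (?h \<omega> * ?mon m \<omega>) \<partial>M)"
    by (intro Bochner_Integration.integral_sum integrable_mult_right subexp_integrable subexp_mult
        subexp_hermite Z mon)
  also have "\<dots> = (\<Sum>m\<in>A. 0)"
  proof (intro sum.cong refl)
    fix m assume m: "m \<in> A"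
    obtain Ys where Ys: "set Ys \<subseteq> linear_span X" "length Ys = size m"
      "?mon m = (\<lambda>\<omega>. \<Prod>Y\<leftarrow>Ys. Y \<omega>)" by (rule monomial_as_prod_list)
    have "(\<integral>\<omega>. ?h \<omega> * ((\<Prod>Y\<leftarrow>Ys. Y \<omega>) * Z \<omega> ^ 0) \<partial>M) = 0"
      using bspec[OF A(2) m] kn Ys(2) by (intro expectation_hermite_product[OF Z Ys(1) Z]) auto
    then have "(\<integral>\<omega>. ?h \<omega> * ?mon m \<omega> \<partial>M) = 0" using fun_cong[OF Ys(3)] by simp
    then show "(\<integral>\<omega>. c m * (?h \<omega> * ?mon m \<omega>) \<partial>M) = 0" by simp
  qed
  finally show ?thesis by simp
qed

text \<open>
  The chaos components of the local time are mixtures of this kind.  They lie in the closure of the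
  polynomials by \<open>L2_mixture_sampling\<close>, and orthogonality to lower degrees passes through the mixing
  integral.
\<close>

lemma hermite_mixture_in_chaos:
  fixes Y :: "'z \<Rightarrow> 'w \<Rightarrow> real"
  assumes N: "finite_measure N" and Y: "\<And>z. Y z \<in> linear_span X"
    and sq: "square_integrable (M \<Otimes>\<^sub>M N) (\<lambda>(\<omega>, z). hermite (\<integral>\<omega>. (Y z \<omega>)\<^sup>2 \<partial>M) n (Y z \<omega>))"
  shows "(\<lambda>\<omega>. k * (\<integral>z. hermite (\<integral>\<omega>. (Y z \<omega>)\<^sup>2 \<partial>M) n (Y z \<omega>) \<partial>N)) \<in> chaos M X n"
proof -
  let ?f = "\<lambda>\<omega> z. k * hermite (\<integral>\<omega>. (Y z \<omega>)\<^sup>2 \<partial>M) n (Y z \<omega>)"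
  have M: "finite_measure M" by unfold_locales
  have sqf: "square_integrable (M \<Otimes>\<^sub>M N) (\<lambda>(\<omega>, z). ?f \<omega> z)"
    using square_integrable_scale[OF sq, of k] by (simp add: case_prod_unfold)
  have sqz: "square_integrable M (\<lambda>\<omega>. ?f \<omega> z)" for z
    by (intro square_integrable_scale subexp_square_integrable subexp_hermite Y)
  have fP: "(\<lambda>\<omega>. ?f \<omega> z) \<in> polynomials_of X n" for z
    by (intro polynomials_of_scale polynomials_of_hermite Y)
  have "(\<lambda>\<omega>. \<integral>z. ?f \<omega> z \<partial>N) \<in> chaos M X n"
    unfolding chaos_def
  proof (intro CollectI conjI impI ballI)
    show "(\<lambda>\<omega>. \<integral>z. ?f \<omega> z \<partial>N) \<in> polynomial_closure M X n"
      unfolding polynomial_closure_def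
      by (intro CollectI L2_mixture_sampling[OF M N sqf sqz fP] polynomials_of_const
          polynomials_of_add polynomials_of_scale)
  next
    fix G assume n: "0 < n" and "G \<in> polynomial_closure M X (n - 1)"
    then obtain g where g: "\<And>k. g k \<in> polynomials_of X (n - 1)" "L2_tendsto M g G sequentially"
      unfolding polynomial_closure_def by blast
    have sqF: "square_integrable M (\<lambda>\<omega>. \<integral>z. ?f \<omega> z \<partial>N)"
      by (rule square_integrable_mixture[OF M N sqf])
    have "(\<integral>\<omega>. (\<integral>z. ?f \<omega> z \<partial>N) * g j \<omega> \<partial>M) = 0" for j
    proof -
      have "(\<integral>\<omega>. (\<integral>z. ?f \<omega> z \<partial>N) * g j \<omega> \<partial>M) = (\<integral>z. (\<integral>\<omega>. ?f \<omega> z * g j \<omega> \<partial>M) \<partial>N)"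
        by (intro mixture_inner[OF M N sqf] subexp_square_integrable polynomial_subexp[OF g(1)])
      also have "\<dots> = (\<integral>z. 0 \<partial>N)"
        using hermite_orthogonal_polynomial[OF g(1)[of j] _ Y] n by (simp add: mult.assoc)
      finally show ?thesis by simp
    qed
    then have "(\<lambda>j. \<integral>\<omega>. g j \<omega> * (\<integral>z. ?f \<omega> z \<partial>N) \<partial>M) \<longlonglongrightarrow> 0" by (simp add: mult.commute)
    moreover have "(\<lambda>j. \<integral>\<omega>. g j \<omega> * (\<integral>z. ?f \<omega> z \<partial>N) \<partial>M) \<longlonglongrightarrow> (\<integral>\<omega>. G \<omega> * (\<integral>z. ?f \<omega> z \<partial>N) \<partial>M)"
      by (rule L2_tendsto_inner[OF g(2) sqF])
    ultimately show "(\<integral>\<omega>. (\<integral>z. ?f \<omega> z \<partial>N) * G \<omega> \<partial>M) = 0"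
      using LIMSEQ_unique by (fastforce simp: mult.commute)
  qed
  then show ?thesis by simp
qed

end

section \<open>Gaussian integrals over Euclidean space\<close>

lemma Basis_vec_eq_range: "(Basis :: (real ^ 'd::finite) set) = range (\<lambda>i. axis i 1)"
  by (auto simp: Basis_vec_def)

lemma inj_axis_one: "inj (\<lambda>i::'d::finite. axis i (1::real))"
  by (auto simp: inj_on_def axis_eq_axis)

lemma nn_integral_vec_prod:
  fixes f :: "'d::finite \<Rightarrow> real \<Rightarrow> ennreal"
  assumes [measurable]: "\<And>j. f j \<in> borel_measurable borel"
  shows "(\<integral>\<^sup>+(x::real^'d). (\<Prod>j\<in>UNIV. f j (x $ j)) \<partial>lborel) = (\<Prod>j\<in>UNIV. \<integral>\<^sup>+x. f j x \<partial>lborel)"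
proof -
  have "(\<integral>\<^sup>+(x::real^'d). (\<Prod>b\<in>Basis. f (axis_index b) (x \<bullet> b)) \<partial>lborel)
      = (\<Prod>b\<in>(Basis::(real^'d) set). \<integral>\<^sup>+x. f (axis_index b) x \<partial>lborel)"
    by (rule nn_integral_lborel_prod) auto
  then show ?thesis
    by (simp add: Basis_vec_eq_range prod.reindex[OF inj_axis_one] inner_axis)
qed

lemma lborel_integral_vec_prod:
  fixes f :: "'d::finite \<Rightarrow> real \<Rightarrow> complex"
  assumes int: "\<And>j. integrable lborel (f j)"
  shows "(\<integral>(x::real^'d). (\<Prod>j\<in>UNIV. f j (x $ j)) \<partial>lborel) = (\<Prod>j\<in>UNIV. \<integral>x. f j x \<partial>lborel)"
proof -
  interpret product_sigma_finite "\<lambda>_::real^'d. lborel :: real measure" ..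
  have [measurable]: "f j \<in> borel_measurable borel" for j
    using borel_measurable_integrable[OF int] by simp
  have "(\<integral>(x::real^'d). (\<Prod>j\<in>UNIV. f j (x $ j)) \<partial>lborel)
      = (\<integral>(x::real^'d). (\<Prod>b\<in>Basis. f (axis_index b) (x \<bullet> b)) \<partial>lborel)"
    by (simp add: Basis_vec_eq_range prod.reindex[OF inj_axis_one] inner_axis)
  also have "\<dots> = (\<integral>g. (\<Prod>b\<in>Basis. f (axis_index b) ((\<Sum>b'\<in>Basis. g b' *\<^sub>R b') \<bullet> b)) \<partial>(\<Pi>\<^sub>M b\<in>(Basis::(real^'d) set). lborel))"
    by (subst lborel_eq, subst integral_distr) auto
  also have "\<dots> = (\<integral>g. (\<Prod>b\<in>Basis. f (axis_index b) (g b)) \<partial>(\<Pi>\<^sub>M b\<in>(Basis::(real^'d) set). lborel))"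
    by (intro Bochner_Integration.integral_cong refl prod.cong) simp
  also have "\<dots> = (\<Prod>b\<in>(Basis::(real^'d) set). \<integral>x. f (axis_index b) x \<partial>lborel)"
    by (rule product_integral_prod) (auto intro: int)
  also have "\<dots> = (\<Prod>j\<in>UNIV. \<integral>x. f j x \<partial>lborel)"
    by (simp add: Basis_vec_eq_range prod.reindex[OF inj_axis_one])
  finally show ?thesis .
qed

lemma norm_power2_vec: "(norm (x::real^'d::finite))\<^sup>2 = (\<Sum>j\<in>UNIV. (x $ j)\<^sup>2)"
  by (simp add: norm_vec_def L2_set_def sum_nonneg)

lemma gaussian_density_shift:
  assumes "A > 0"
  shows "exp (- A * x\<^sup>2 / 2 + c * x) = sqrt (2 * pi / A) * exp (c\<^sup>2 / (2 * A)) * normal_density (c / A) (1 / sqrt A) x"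
proof -
  have "c\<^sup>2 / (2 * A) + - (x - c / A)\<^sup>2 / (2 * (1 / sqrt A)\<^sup>2) = - A * x\<^sup>2 / 2 + c * x"
    using assms by (simp add: power2_eq_square field_simps)
  then have "exp (- A * x\<^sup>2 / 2 + c * x) = exp (c\<^sup>2 / (2 * A)) * exp (- (x - c / A)\<^sup>2 / (2 * (1 / sqrt A)\<^sup>2))"
    by (simp only: exp_add[symmetric])
  moreover have "sqrt (2 * pi / A) * (1 / sqrt (2 * pi * (1 / sqrt A)\<^sup>2)) = 1"
    using assms by (simp add: power_divide real_sqrt_mult real_sqrt_divide)
  ultimately show ?thesis unfolding normal_density_def by (simp add: mult.left_commute mult.commute)
qed

lemma nn_integral_gaussian_1:
  assumes "A > 0"
  shows "(\<integral>\<^sup>+x. ennreal (exp (- A * x\<^sup>2 / 2 + c * x)) \<partial>lborel) = ennreal (sqrt (2 * pi / A) * exp (c\<^sup>2 / (2 * A)))"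
proof -
  have "(\<integral>\<^sup>+x. ennreal (normal_density (c / A) (1 / sqrt A) x) \<partial>lborel) = 1"
  proof -
    have "prob_space (density lborel (normal_density (c / A) (1 / sqrt A)))"
      using assms by (intro prob_space_normal_density) simp
    from prob_space.emeasure_space_1[OF this] show ?thesis by (simp add: emeasure_density)
  qed
  then show ?thesis
    unfolding gaussian_density_shift[OF assms]
    using assms by (simp add: ennreal_mult nn_integral_cmult)
qed

lemma nn_integral_gaussian:
  fixes c :: "real ^ 'd::finite"
  assumes "A > 0"
  shows "(\<integral>\<^sup>+(x::real^'d). ennreal (exp (- A * (norm x)\<^sup>2 / 2 + c \<bullet> x)) \<partial>lborel)
    = ennreal ((2 * pi / A) powr (real CARD('d) / 2) * exp ((norm c)\<^sup>2 / (2 * A)))"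
proof -
  have "ennreal (exp (- A * (norm x)\<^sup>2 / 2 + c \<bullet> x)) = (\<Prod>j\<in>UNIV. ennreal (exp (- A * (x $ j)\<^sup>2 / 2 + c $ j * x $ j)))"
    for x :: "real ^ 'd"
  proof -
    have "- A * (norm x)\<^sup>2 / 2 + c \<bullet> x = (\<Sum>j\<in>UNIV. - A * (x $ j)\<^sup>2 / 2 + c $ j * x $ j)"
      by (simp add: norm_power2_vec inner_vec_def sum.distrib sum_distrib_left sum_divide_distrib sum_negf sum_subtractf)
    then show ?thesis by (simp add: prod_ennreal exp_sum)
  qed
  then have "(\<integral>\<^sup>+(x::real^'d). ennreal (exp (- A * (norm x)\<^sup>2 / 2 + c \<bullet> x)) \<partial>lborel)
    = (\<Prod>j\<in>UNIV. \<integral>\<^sup>+x. ennreal (exp (- A * x\<^sup>2 / 2 + c $ j * x)) \<partial>lborel)"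
    by (simp only:) (rule nn_integral_vec_prod, measurable)
  also have "\<dots> = (\<Prod>j\<in>(UNIV::'d set). ennreal (sqrt (2 * pi / A) * exp ((c $ j)\<^sup>2 / (2 * A))))"
    by (simp only: nn_integral_gaussian_1[OF assms])
  also have "\<dots> = ennreal (\<Prod>j\<in>(UNIV::'d set). sqrt (2 * pi / A) * exp ((c $ j)\<^sup>2 / (2 * A)))"
    using assms by (intro prod_ennreal) auto
  also have "(\<Prod>j\<in>(UNIV::'d set). sqrt (2 * pi / A) * exp ((c $ j)\<^sup>2 / (2 * A)))
      = sqrt (2 * pi / A) ^ CARD('d) * exp (\<Sum>j\<in>UNIV. (c $ j)\<^sup>2 / (2 * A))"
    by (simp add: prod.distrib exp_sum)
  also have "(\<Sum>j\<in>UNIV. (c $ j)\<^sup>2 / (2 * A)) = (norm c)\<^sup>2 / (2 * A)"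
    by (simp add: norm_power2_vec sum_divide_distrib)
  also have "sqrt (2 * pi / A) ^ CARD('d) = (2 * pi / A) powr (real CARD('d) / 2)"
    using assms by (simp add: powr_half_sqrt[symmetric] powr_realpow[symmetric] powr_powr)
  finally show ?thesis .
qed

lemma integrable_gaussian_weight:
  assumes "A > 0"
  shows "integrable lborel (\<lambda>x::real^'d::finite. exp (- A * (norm x)\<^sup>2 / 2))"
proof (rule integrableI_nonneg)
  show "(\<integral>\<^sup>+(x::real^'d). ennreal (exp (- A * (norm x)\<^sup>2 / 2)) \<partial>lborel) < \<infinity>"
    using nn_integral_gaussian[OF assms, of "0::real^'d"] by simp
qed auto

lemma fourier_gaussian_1:
  assumes "A > 0"
  shows "(\<integral>x. exp (\<i> * of_real (c * x)) * of_real (exp (- A * x\<^sup>2 / 2)) \<partial>lborel)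
      = complex_of_real (sqrt (2 * pi / A) * exp (- c\<^sup>2 / (2 * A)))"
proof -
  let ?s = "1 / sqrt A"
  have s: "?s > 0" using assms by simp
  have "(\<integral>x. exp (\<i> * of_real (c * x)) * complex_of_real (exp (- A * x\<^sup>2 / 2)) \<partial>lborel)
      = \<bar>?s\<bar> *\<^sub>R (\<integral>x. exp (\<i> * of_real (c * (0 + ?s * x))) * of_real (exp (- A * (0 + ?s * x)\<^sup>2 / 2)) \<partial>lborel)"
    using s by (intro lborel_integral_real_affine) simp
  also have "(\<integral>x. exp (\<i> * of_real (c * (0 + ?s * x))) * complex_of_real (exp (- A * (0 + ?s * x)\<^sup>2 / 2)) \<partial>lborel)
      = (\<integral>x. of_real (sqrt (2 * pi)) * (std_normal_density x *\<^sub>R exp (\<i> * of_real ((c * ?s) * x))) \<partial>lborel)"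
  proof (intro Bochner_Integration.integral_cong refl)
    fix x
    have "- A * (0 + ?s * x)\<^sup>2 / 2 = - x\<^sup>2 / 2" using assms by (simp add: power_mult_distrib power_divide)
    then have "exp (- A * (0 + ?s * x)\<^sup>2 / 2) = sqrt (2 * pi) * std_normal_density x"
      by (simp only:) (simp add: normal_density_def)
    then show "exp (\<i> * of_real (c * (0 + ?s * x))) * complex_of_real (exp (- A * (0 + ?s * x)\<^sup>2 / 2))
      = of_real (sqrt (2 * pi)) * (std_normal_density x *\<^sub>R exp (\<i> * of_real ((c * ?s) * x)))"
      by (simp only:) (simp add: scaleR_conv_of_real mult_ac)
  qed
  also have "\<dots> = of_real (sqrt (2 * pi)) * char std_normal_distribution (c * ?s)"
    unfolding integral_mult_right_zero char_def by (subst integral_density) auto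
  also have "char std_normal_distribution (c * ?s) = of_real (exp (- (c * ?s)\<^sup>2 / 2))"
    by (simp only: char_std_normal_distribution)
  also have "- (c * ?s)\<^sup>2 / 2 = - c\<^sup>2 / (2 * A)" using assms by (simp add: power_mult_distrib power_divide)
  finally show ?thesis
    using assms by (simp add: scaleR_conv_of_real real_sqrt_divide real_sqrt_mult)
qed

lemma fourier_gaussian:
  fixes c :: "real ^ 'd::finite"
  assumes "A > 0"
  shows "(\<integral>(x::real^'d). cos (x \<bullet> c) * exp (- A * (norm x)\<^sup>2 / 2) \<partial>lborel)
      = (2 * pi / A) powr (real CARD('d) / 2) * exp (- (norm c)\<^sup>2 / (2 * A))"
proof -
  let ?f = "\<lambda>j x. exp (\<i> * of_real (c $ j * x)) * of_real (exp (- A * x\<^sup>2 / 2))"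
  let ?F = "\<lambda>x::real^'d. exp (\<i> * of_real (x \<bullet> c)) * complex_of_real (exp (- A * (norm x)\<^sup>2 / 2))"
  have "integrable lborel (\<lambda>x. exp (- A * x\<^sup>2 / 2))"
    using nn_integral_gaussian_1[OF assms, of 0] by (intro integrableI_nonneg) auto
  then have i: "complex_integrable lborel (?f j)" for j
    by (rule Bochner_Integration.integrable_bound) (auto simp: norm_mult)
  have F: "?F x = (\<Prod>j\<in>UNIV. ?f j (x $ j))" for x
  proof -
    have "(\<Prod>j\<in>UNIV. ?f j (x $ j)) = exp (\<Sum>j\<in>UNIV. \<i> * of_real (c $ j * x $ j)) * of_real (exp (\<Sum>j\<in>UNIV. - A * (x $ j)\<^sup>2 / 2))"
      by (simp only: prod.distrib exp_sum finite of_real_prod)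
    also have "(\<Sum>j\<in>UNIV. \<i> * complex_of_real (c $ j * x $ j)) = \<i> * of_real (x \<bullet> c)"
      by (simp add: inner_vec_def sum_distrib_left mult.commute)
    also have "(\<Sum>j\<in>UNIV. - A * (x $ j)\<^sup>2 / 2) = - A * (norm x)\<^sup>2 / 2"
      by (simp add: norm_power2_vec sum_distrib_left sum_divide_distrib sum_negf)
    finally show ?thesis ..
  qed
  have "(\<integral>x. ?F x \<partial>lborel) = (\<Prod>j\<in>UNIV. \<integral>x. ?f j x \<partial>lborel)"
    unfolding F by (rule lborel_integral_vec_prod[OF i])
  also have "\<dots> = of_real (\<Prod>j\<in>(UNIV::'d set). sqrt (2 * pi / A) * exp (- (c $ j)\<^sup>2 / (2 * A)))"
    by (simp only: fourier_gaussian_1[OF assms] of_real_prod)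
  also have "(\<Prod>j\<in>(UNIV::'d set). sqrt (2 * pi / A) * exp (- (c $ j)\<^sup>2 / (2 * A)))
      = sqrt (2 * pi / A) ^ CARD('d) * exp (\<Sum>j\<in>UNIV. - (c $ j)\<^sup>2 / (2 * A))"
    by (simp add: prod.distrib exp_sum)
  also have "(\<Sum>j\<in>UNIV. - (c $ j)\<^sup>2 / (2 * A)) = - (norm c)\<^sup>2 / (2 * A)"
    by (simp add: norm_power2_vec sum_divide_distrib sum_negf)
  also have "sqrt (2 * pi / A) ^ CARD('d) = (2 * pi / A) powr (real CARD('d) / 2)"
    using assms by (simp add: powr_half_sqrt[symmetric] powr_realpow[symmetric] powr_powr)
  finally have val: "(\<integral>x. ?F x \<partial>lborel) = of_real ((2 * pi / A) powr (real CARD('d) / 2) * exp (- (norm c)\<^sup>2 / (2 * A)))" .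
  have "complex_integrable lborel ?F"
    by (rule Bochner_Integration.integrable_bound[OF integrable_gaussian_weight[OF assms]]) (auto simp: norm_mult)
  then have "(\<integral>x. Re (?F x) \<partial>lborel) = Re (\<integral>x. ?F x \<partial>lborel)" by (rule integral_Re)
  moreover have "Re (?F x) = cos (x \<bullet> c) * exp (- A * (norm x)\<^sup>2 / 2)" for x
    by (simp only: times_complex.sel Re_complex_of_real Im_complex_of_real mult_zero_right diff_zero) (simp add: Re_exp)
  ultimately show ?thesis by (simp only: val Re_complex_of_real)
qed

lemma powr_divide_eq_mult: "0 \<le> x \<Longrightarrow> 0 \<le> y \<Longrightarrow> (x / y) powr a = x powr a * y powr - (a::real)"
  unfolding powr_minus by (subst powr_divide) (auto simp: divide_inverse)

lemma heat_kernel_fourier: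
  fixes x :: "real ^ 'd::finite"
  assumes "\<epsilon> > 0"
  shows "heat_kernel \<epsilon> x = (2 * pi) powr - real CARD('d) * (\<integral>(\<xi>::real^'d). cos (\<xi> \<bullet> x) * exp (- \<epsilon> * (norm \<xi>)\<^sup>2 / 2) \<partial>lborel)"
proof -
  have "(2 * pi) powr - real CARD('d) * (2 * pi / \<epsilon>) powr (real CARD('d) / 2) = (2 * pi * \<epsilon>) powr (- real CARD('d) / 2)"
  proof -
    let ?d = "real CARD('d)"
    have 1: "(2 * pi / \<epsilon>) powr (?d / 2) = (2 * pi) powr (?d / 2) * \<epsilon> powr (- ?d / 2)"
      using powr_divide_eq_mult[of "2 * pi" \<epsilon> "?d / 2"] assms by (simp only: minus_divide_left) simp
    have 2: "(2 * pi * \<epsilon>) powr (- ?d / 2) = (2 * pi) powr (- ?d / 2) * \<epsilon> powr (- ?d / 2)"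
      using assms by (subst powr_mult) auto
    have "- ?d + ?d / 2 = - ?d / 2" by simp
    then have 3: "(2 * pi) powr - ?d * (2 * pi) powr (?d / 2) = (2 * pi) powr (- ?d / 2)"
      by (simp only: powr_add[symmetric])
    show ?thesis unfolding 1 2 3[symmetric] by (simp only: mult.assoc)
  qed
  then show ?thesis
    unfolding fourier_gaussian[OF assms] heat_kernel_def by simp
qed

lemma borel_measurable_cosh_real [measurable]: "(cosh :: real \<Rightarrow> real) \<in> borel_measurable borel"
  by (intro borel_measurable_continuous_onI continuous_intros)

lemma borel_measurable_sinh_real [measurable]: "(sinh :: real \<Rightarrow> real) \<in> borel_measurable borel"
  by (intro borel_measurable_continuous_onI continuous_intros)

text \<open>
  The type argument fixes the dimension, which the other arguments do not determine.
\<close>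

definition gauss2 :: "'d::finite itself \<Rightarrow> (real \<Rightarrow> real) \<Rightarrow> real \<Rightarrow> real \<Rightarrow> real \<Rightarrow> ennreal" where
  "gauss2 TYPE('d) f A B s = (\<integral>\<^sup>+(\<xi>::real^'d). \<integral>\<^sup>+(\<eta>::real^'d).
     ennreal (exp (- A * (norm \<xi>)\<^sup>2 / 2) * exp (- B * (norm \<eta>)\<^sup>2 / 2) * f (s * (\<xi> \<bullet> \<eta>))) \<partial>lborel \<partial>lborel)"

text \<open>
  Completing the square in \<open>\<eta>\<close> turns the outer integral into a Gaussian one with parameter \<open>A - s\<^sup>2 / B\<close>.
\<close>

lemma gauss2_exp:
  assumes "B > 0" "A * B > s\<^sup>2"
  shows "gauss2 TYPE('d::finite) exp A B s = ennreal ((2 * pi) powr real CARD('d) * (A * B - s\<^sup>2) powr (- real CARD('d) / 2))"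
proof -
  let ?d = "real CARD('d)"
  have A': "A - s\<^sup>2 / B > 0" using assms by (simp add: field_simps)
  have "gauss2 TYPE('d) exp A B s = (\<integral>\<^sup>+(\<xi>::real^'d). ennreal (exp (- A * (norm \<xi>)\<^sup>2 / 2)) *
      (\<integral>\<^sup>+\<eta>. ennreal (exp (- B * (norm \<eta>)\<^sup>2 / 2 + (s *\<^sub>R \<xi>) \<bullet> \<eta>)) \<partial>lborel) \<partial>lborel)"
    unfolding gauss2_def
  proof (intro nn_integral_cong)
    fix \<xi> :: "real ^ 'd"
    have "exp (- A * (norm \<xi>)\<^sup>2 / 2) * exp (- B * (norm \<eta>)\<^sup>2 / 2) * exp (s * (\<xi> \<bullet> \<eta>))
        = exp (- A * (norm \<xi>)\<^sup>2 / 2) * exp (- B * (norm \<eta>)\<^sup>2 / 2 + (s *\<^sub>R \<xi>) \<bullet> \<eta>)" for \<eta>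
      by (simp only: exp_add inner_scaleR_left mult.assoc)
    then show "(\<integral>\<^sup>+\<eta>. ennreal (exp (- A * (norm \<xi>)\<^sup>2 / 2) * exp (- B * (norm \<eta>)\<^sup>2 / 2) * exp (s * (\<xi> \<bullet> \<eta>))) \<partial>lborel)
      = ennreal (exp (- A * (norm \<xi>)\<^sup>2 / 2)) *
        (\<integral>\<^sup>+\<eta>. ennreal (exp (- B * (norm \<eta>)\<^sup>2 / 2 + (s *\<^sub>R \<xi>) \<bullet> \<eta>)) \<partial>lborel)"
      by (simp only: ennreal_mult exp_ge_zero) (rule nn_integral_cmult, measurable)
  qed
  also have "\<dots> = (\<integral>\<^sup>+(\<xi>::real^'d). ennreal ((2 * pi / B) powr (?d / 2)) *
      ennreal (exp (- (A - s\<^sup>2 / B) * (norm \<xi>)\<^sup>2 / 2 + 0 \<bullet> \<xi>)) \<partial>lborel)"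
  proof (intro nn_integral_cong)
    fix \<xi> :: "real ^ 'd"
    have "- A * (norm \<xi>)\<^sup>2 / 2 + (norm (s *\<^sub>R \<xi>))\<^sup>2 / (2 * B) = - (A - s\<^sup>2 / B) * (norm \<xi>)\<^sup>2 / 2 + 0 \<bullet> \<xi>"
      by (simp add: power_mult_distrib algebra_simps diff_divide_distrib)
    then have "exp (- A * (norm \<xi>)\<^sup>2 / 2) * exp ((norm (s *\<^sub>R \<xi>))\<^sup>2 / (2 * B))
        = exp (- (A - s\<^sup>2 / B) * (norm \<xi>)\<^sup>2 / 2 + 0 \<bullet> \<xi>)"
      by (simp only: exp_add[symmetric])
    note X = this
    show "ennreal (exp (- A * (norm \<xi>)\<^sup>2 / 2)) *
      (\<integral>\<^sup>+\<eta>. ennreal (exp (- B * (norm \<eta>)\<^sup>2 / 2 + (s *\<^sub>R \<xi>) \<bullet> \<eta>)) \<partial>lborel)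
      = ennreal ((2 * pi / B) powr (?d / 2)) * ennreal (exp (- (A - s\<^sup>2 / B) * (norm \<xi>)\<^sup>2 / 2 + 0 \<bullet> \<xi>))"
      unfolding nn_integral_gaussian[OF assms(1)] X[symmetric]
      by (simp only: ennreal_mult powr_ge_zero exp_ge_zero mult_nonneg_nonneg mult_ac)
  qed
  also have "\<dots> = ennreal ((2 * pi / B) powr (?d / 2)) * ennreal ((2 * pi / (A - s\<^sup>2 / B)) powr (?d / 2) * exp ((norm (0::real^'d))\<^sup>2 / (2 * (A - s\<^sup>2 / B))))"
    by (subst nn_integral_cmult) (simp_all only: nn_integral_gaussian[OF A'], measurable)
  also have "\<dots> = ennreal ((2 * pi / B) powr (?d / 2) * (2 * pi / (A - s\<^sup>2 / B)) powr (?d / 2))"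
    by (simp add: ennreal_mult[symmetric])
  also have "(2 * pi / B) powr (?d / 2) * (2 * pi / (A - s\<^sup>2 / B)) powr (?d / 2)
      = ((2 * pi)\<^sup>2 / (A * B - s\<^sup>2)) powr (?d / 2)"
    using assms A' by (subst powr_mult[symmetric]) (auto simp: field_simps power2_eq_square)
  also have "\<dots> = (2 * pi) powr ?d * (A * B - s\<^sup>2) powr (- ?d / 2)"
  proof -
    have "((2 * pi)\<^sup>2) powr (?d / 2) = ((2 * pi) powr 2) powr (?d / 2)"
      by (subst powr_numeral) auto
    also have "\<dots> = (2 * pi) powr ?d" by (simp only: powr_powr) simp
    finally have "((2 * pi)\<^sup>2) powr (?d / 2) = (2 * pi) powr ?d" .
    then show ?thesis
      using powr_divide_eq_mult[of "(2 * pi)\<^sup>2" "A * B - s\<^sup>2" "?d / 2"] assms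
      by (simp only: minus_divide_left) simp
  qed
  finally show ?thesis .
qed

lemma gauss2_add:
  assumes [measurable]: "f \<in> borel_measurable borel" "g \<in> borel_measurable borel"
    and "\<And>x. 0 \<le> f x" "\<And>x. 0 \<le> g x"
  shows "gauss2 TYPE('d::finite) (\<lambda>x. f x + g x) A B s = gauss2 TYPE('d) f A B s + gauss2 TYPE('d) g A B s"
  unfolding gauss2_def
  by (simp add: distrib_left ennreal_plus assms nn_integral_add)

lemma gauss2_scale:
  assumes [measurable]: "f \<in> borel_measurable borel" and "0 \<le> c" "\<And>x. 0 \<le> f x"
  shows "gauss2 TYPE('d::finite) (\<lambda>x. c * f x) A B s = ennreal c * gauss2 TYPE('d) f A B s"
  unfolding gauss2_def
  by (simp add: nn_integral_cmult[symmetric] ennreal_mult[symmetric] assms mult.left_commute)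

lemma gauss2_mono:
  assumes "\<And>x. f x \<le> g x"
  shows "gauss2 TYPE('d::finite) f A B s \<le> gauss2 TYPE('d) g A B s"
  unfolding gauss2_def by (intro nn_integral_mono ennreal_leI mult_left_mono assms) auto

lemma gauss2_antimono:
  assumes "A \<le> A'" "\<And>x. 0 \<le> f x"
  shows "gauss2 TYPE('d::finite) f A' B s \<le> gauss2 TYPE('d) f A B s"
  unfolding gauss2_def using assms by (intro nn_integral_mono ennreal_leI mult_right_mono) (auto intro: mult_right_mono)

lemma gauss2_dilate: "gauss2 TYPE('d::finite) (\<lambda>x. f (k * x)) A B s = gauss2 TYPE('d) f A B (k * s)"
  unfolding gauss2_def by (simp add: mult.assoc)

lemma gauss2_cosh:
  assumes "B > 0" "A * B > s\<^sup>2"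
  shows "gauss2 TYPE('d::finite) cosh A B s = ennreal ((2 * pi) powr real CARD('d) * (A * B - s\<^sup>2) powr (- real CARD('d) / 2))"
proof -
  let ?v = "(2 * pi) powr real CARD('d) * (A * B - s\<^sup>2) powr (- real CARD('d) / 2)"
  have "gauss2 TYPE('d) cosh A B s = gauss2 TYPE('d) (\<lambda>x. 1 / 2 * exp (1 * x) + 1 / 2 * exp ((-1) * x)) A B s"
    by (intro arg_cong[of _ _ "\<lambda>f. gauss2 TYPE('d) f A B s"]) (auto simp: cosh_def)
  also have "\<dots> = ennreal (1/2) * gauss2 TYPE('d) exp A B (1 * s) + ennreal (1/2) * gauss2 TYPE('d) exp A B ((-1) * s)"
    by (subst gauss2_add, simp, simp, simp, simp) (simp only: gauss2_dilate[symmetric], subst gauss2_scale, simp, simp, simp, subst gauss2_scale, simp, simp, simp, rule refl)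
  also have "\<dots> = ennreal (1/2) * ennreal ?v + ennreal (1/2) * ennreal ?v"
  proof -
    have "gauss2 TYPE('d) exp A B (1 * s) = ennreal ?v" "gauss2 TYPE('d) exp A B ((-1) * s) = ennreal ?v"
      using gauss2_exp[of B "1 * s" A, where 'd='d] gauss2_exp[of B "(-1) * s" A, where 'd='d] assms by simp_all
    then show ?thesis by (simp only:)
  qed
  also have "\<dots> = ennreal (1/2 * ?v) + ennreal (1/2 * ?v)"
    by (simp only: ennreal_mult[symmetric] powr_ge_zero mult_nonneg_nonneg divide_nonneg_pos zero_le_one zero_less_numeral)
  also have "\<dots> = ennreal (1/2 * ?v + 1/2 * ?v)"
    by (rule ennreal_plus[symmetric]) auto
  finally show ?thesis by simp
qed

text \<open>
  The bound allows \<open>A * B \<le> s\<^sup>2\<close>, where the integral is infinite: increasing \<open>A\<close> until the determinant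
  equals \<open>D\<close> only decreases the integral.
\<close>

lemma gauss2_cosh_ge:
  assumes "A > 0" "B > 0" "A * B - s\<^sup>2 \<le> D" "D > 0"
  shows "ennreal ((2 * pi) powr real CARD('d) * D powr (- real CARD('d) / 2)) \<le> gauss2 TYPE('d::finite) cosh A B s"
proof -
  define A' where "A' = (s\<^sup>2 + D) / B"
  have A': "A \<le> A'" "A' * B - s\<^sup>2 = D" using assms by (auto simp: A'_def field_simps)
  have "gauss2 TYPE('d) cosh A' B s \<le> gauss2 TYPE('d) cosh A B s"
    by (rule gauss2_antimono[OF A'(1)]) simp
  then show ?thesis
    using gauss2_cosh[of B s A', where 'd='d] assms A' by simp
qed

lemma gauss2_cosh_le:
  assumes "B > 0" "A * B - s\<^sup>2 \<ge> D" "D > 0"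
  shows "gauss2 TYPE('d::finite) cosh A B s \<le> ennreal ((2 * pi) powr real CARD('d) * D powr (- real CARD('d) / 2))"
  using assms by (subst gauss2_cosh) (auto intro!: ennreal_leI mult_left_mono powr_mono2')

lemma sinh_mult_nonneg: "0 \<le> x * sinh (x::real)"
  by (cases "x \<ge> 0") (auto intro: mult_nonpos_nonpos)

text \<open>
  Convexity of \<open>cosh\<close>.  With \<open>y = (1 + \<delta>) x\<close> or \<open>y = (1 - \<delta>) x\<close> it compares \<open>\<delta> x sinh x\<close> with difference
  quotients of \<open>cosh\<close> under dilation, which replaces the differentiation of \<open>gauss2_cosh\<close> in \<open>s\<close>.
\<close>

lemma cosh_tangent: "cosh x + (y - x) * sinh x \<le> cosh (y::real)"
proof -
  have *: "exp x * (1 + (y - x)) \<le> exp y" for x y :: real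
  proof -
    have "exp x * (1 + (y - x)) \<le> exp x * exp (y - x)" by (intro mult_left_mono exp_ge_add_one_self) simp
    then show ?thesis by (simp flip: exp_add)
  qed
  show ?thesis
    using *[of x y] *[of "-x" "-y"] by (simp add: cosh_def sinh_def field_simps)
qed

lemma gauss2_sinh_le:
  assumes "A > 0" "B > 0" "A * B \<le> M" "A * B - s\<^sup>2 \<ge> D" "D > 0"
  shows "gauss2 TYPE('d::finite) (\<lambda>x. x * sinh x) A B s
     \<le> ennreal (6 * M * 2 powr (real CARD('d) / 2) * (2 * pi) powr real CARD('d) * D powr (- (real CARD('d) + 2) / 2))"
proof -
  let ?d = "real CARD('d)"
  \<comment> \<open>small enough for \<open>((1 + \<delta>) s)\<^sup>2\<close> to use up at most half of the determinant\<close>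
  define \<delta> where "\<delta> = D / (6 * M)"
  have DM: "D \<le> M" using assms by (smt (verit) zero_le_power2)
  have M: "M > 0" using DM assms by linarith
  have \<delta>: "0 < \<delta>" "\<delta> \<le> 1" using DM M assms by (auto simp: \<delta>_def field_simps)
  have s2: "s\<^sup>2 \<le> M" using assms by linarith
  have "\<delta> * (x * sinh x) \<le> cosh ((1 + \<delta>) * x)" for x
  proof -
    have "cosh x + \<delta> * (x * sinh x) \<le> cosh ((1 + \<delta>) * x)"
      using cosh_tangent[of x "(1 + \<delta>) * x"] by (simp add: algebra_simps)
    then show ?thesis using cosh_real_nonneg[of x] by linarith
  qed
  then have "gauss2 TYPE('d) (\<lambda>x. \<delta> * (x * sinh x)) A B s \<le> gauss2 TYPE('d) (\<lambda>x. cosh ((1 + \<delta>) * x)) A B s"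
    by (rule gauss2_mono)
  also have "\<dots> = gauss2 TYPE('d) cosh A B ((1 + \<delta>) * s)" by (rule gauss2_dilate)
  also have "\<dots> \<le> ennreal ((2 * pi) powr ?d * (D / 2) powr (- ?d / 2))"
  proof (rule gauss2_cosh_le[OF assms(2)])
    have "((1 + \<delta>) * s)\<^sup>2 = s\<^sup>2 + (2 * \<delta> + \<delta>\<^sup>2) * s\<^sup>2" by (simp add: power2_eq_square algebra_simps)
    also have "(2 * \<delta> + \<delta>\<^sup>2) * s\<^sup>2 \<le> (3 * \<delta>) * M"
      using \<delta> s2 M by (intro mult_mono) (auto simp: power2_eq_square)
    also have "\<dots> = D / 2" using M by (simp add: \<delta>_def)
    finally show "D / 2 \<le> A * B - ((1 + \<delta>) * s)\<^sup>2" using assms by simp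
  qed (use assms in simp)
  finally have le: "ennreal \<delta> * gauss2 TYPE('d) (\<lambda>x. x * sinh x) A B s \<le> ennreal ((2 * pi) powr ?d * (D / 2) powr (- ?d / 2))"
    using \<delta> by (subst (asm) gauss2_scale) (auto simp: sinh_mult_nonneg)
  have "gauss2 TYPE('d) (\<lambda>x. x * sinh x) A B s = ennreal (1 / \<delta>) * (ennreal \<delta> * gauss2 TYPE('d) (\<lambda>x. x * sinh x) A B s)"
    using \<delta> by (simp add: mult.assoc[symmetric] ennreal_mult[symmetric])
  also have "\<dots> \<le> ennreal (1 / \<delta>) * ennreal ((2 * pi) powr ?d * (D / 2) powr (- ?d / 2))"
    by (rule mult_left_mono[OF le]) simp
  also have "\<dots> = ennreal ((1 / \<delta>) * ((2 * pi) powr ?d * (D / 2) powr (- ?d / 2)))"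
    using \<delta> by (subst ennreal_mult) auto
  also have "(1 / \<delta>) * ((2 * pi) powr ?d * (D / 2) powr (- ?d / 2))
     = 6 * M * 2 powr (?d / 2) * (2 * pi) powr ?d * D powr (- (?d + 2) / 2)"
  proof -
    have "- (?d + 2) / 2 = - ?d / 2 + - 1" by simp
    then have "D powr (- (?d + 2) / 2) = D powr (- ?d / 2) * D powr (- 1)"
      by (simp only: powr_add)
    note 1 = this
    have 2: "(D / 2) powr (- ?d / 2) = D powr (- ?d / 2) * 2 powr (?d / 2)"
      using powr_divide_eq_mult[of D 2 "- ?d / 2"] assms by simp
    have 3: "D powr - 1 = 1 / D" using assms by (simp add: powr_minus divide_inverse)
    have 4: "1 / \<delta> = 6 * M * (1 / D)" by (simp add: \<delta>_def)
    show ?thesis unfolding 1 2 3 4 by (simp only: mult_ac)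
  qed
  finally show ?thesis .
qed

lemma gauss2_sinh_ge:
  assumes "A > 0" "B > 0" "A * B - s\<^sup>2 \<le> D" "D > 0" "D \<le> s\<^sup>2"
  shows "ennreal (s\<^sup>2 * (1 - 2 powr (- real CARD('d) / 2)) * (2 * pi) powr real CARD('d) * D powr (- (real CARD('d) + 2) / 2))
     \<le> gauss2 TYPE('d::finite) (\<lambda>x. x * sinh x) A B s"
proof -
  let ?d = "real CARD('d)" and ?T = "gauss2 TYPE('d) (\<lambda>x. x * sinh x)"
  define A' where "A' = (s\<^sup>2 + D) / B"
  have A': "A \<le> A'" "A' * B - s\<^sup>2 = D" using assms by (auto simp: A'_def field_simps)
  have s: "s\<^sup>2 > 0" using assms by linarith
  \<comment> \<open>large enough for the dilation by \<open>1 - \<delta>\<close> to double the determinant\<close>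
  define \<delta> where "\<delta> = D / s\<^sup>2"
  have \<delta>: "0 < \<delta>" "\<delta> \<le> 1" using assms s by (auto simp: \<delta>_def)
  have "cosh x \<le> \<delta> * (x * sinh x) + cosh ((1 - \<delta>) * x)" for x
    using cosh_tangent[of x "(1 - \<delta>) * x"] by (simp add: algebra_simps)
  then have "gauss2 TYPE('d) cosh A' B s \<le> gauss2 TYPE('d) (\<lambda>x. \<delta> * (x * sinh x) + cosh ((1 - \<delta>) * x)) A' B s"
    by (rule gauss2_mono)
  also have "\<dots> = ennreal \<delta> * ?T A' B s + gauss2 TYPE('d) cosh A' B ((1 - \<delta>) * s)"
    using \<delta> by (subst gauss2_add) (auto simp: sinh_mult_nonneg gauss2_dilate gauss2_scale)
  also have "gauss2 TYPE('d) cosh A' B ((1 - \<delta>) * s) \<le> ennreal ((2 * pi) powr ?d * (2 * D) powr (- ?d / 2))"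
  proof (rule gauss2_cosh_le[OF assms(2)])
    have dD: "\<delta> * s\<^sup>2 = D" using s by (simp add: \<delta>_def)
    have "A' * B - ((1 - \<delta>) * s)\<^sup>2 = D + (2 * \<delta> - \<delta>\<^sup>2) * s\<^sup>2"
      using A' by (simp add: power2_eq_square algebra_simps)
    also have "\<dots> = D + 2 * (\<delta> * s\<^sup>2) - \<delta> * (\<delta> * s\<^sup>2)"
      by (simp only: power2_eq_square left_diff_distrib mult.assoc add_diff_eq)
    also have "\<dots> = D + 2 * D - \<delta> * D" unfolding dD ..
    also have "\<dots> \<ge> 2 * D" using \<delta> assms by simp
    finally show "2 * D \<le> A' * B - ((1 - \<delta>) * s)\<^sup>2" .
  qed (use assms in simp)
  finally have "ennreal ((2 * pi) powr ?d * D powr (- ?d / 2))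
      \<le> ennreal \<delta> * ?T A' B s + ennreal ((2 * pi) powr ?d * (2 * D) powr (- ?d / 2))"
    using gauss2_cosh[of B s A', where 'd='d] assms A' by (simp add: add_left_mono)
  then have "ennreal ((2 * pi) powr ?d * D powr (- ?d / 2)) - ennreal ((2 * pi) powr ?d * (2 * D) powr (- ?d / 2))
      \<le> ennreal \<delta> * ?T A' B s"
    by (simp add: ennreal_minus_le_iff add.commute)
  then have le: "ennreal ((2 * pi) powr ?d * D powr (- ?d / 2) - (2 * pi) powr ?d * (2 * D) powr (- ?d / 2))
      \<le> ennreal \<delta> * ?T A' B s"
    by (simp add: ennreal_minus)
  have "s\<^sup>2 * (1 - 2 powr (- ?d / 2)) * (2 * pi) powr ?d * D powr (- (?d + 2) / 2)
      = (1 / \<delta>) * ((2 * pi) powr ?d * D powr (- ?d / 2) - (2 * pi) powr ?d * (2 * D) powr (- ?d / 2))"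
  proof -
    have "- (?d + 2) / 2 = - ?d / 2 + - 1" by simp
    then have "D powr (- (?d + 2) / 2) = D powr (- ?d / 2) * D powr (- 1)"
      by (simp only: powr_add)
    note 1 = this
    have 2: "(2 * D) powr (- ?d / 2) = 2 powr (- ?d / 2) * D powr (- ?d / 2)"
      using assms by (subst powr_mult) auto
    have 3: "D powr - 1 = 1 / D" using assms by (simp add: powr_minus divide_inverse)
    have 4: "1 / \<delta> = s\<^sup>2 * (1 / D)" by (simp add: \<delta>_def)
    show ?thesis unfolding 1 2 3 4 by (simp add: algebra_simps)
  qed
  also have "ennreal \<dots> = ennreal (1 / \<delta>) * ennreal ((2 * pi) powr ?d * D powr (- ?d / 2) - (2 * pi) powr ?d * (2 * D) powr (- ?d / 2))"
    using \<delta> by (intro ennreal_mult') auto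
  also have "\<dots> \<le> ennreal (1 / \<delta>) * (ennreal \<delta> * ?T A' B s)"
    by (rule mult_left_mono[OF le]) simp
  also have "\<dots> = ?T A' B s"
    using \<delta> by (simp add: mult.assoc[symmetric] ennreal_mult[symmetric])
  also have "\<dots> \<le> ?T A B s" by (rule gauss2_antimono[OF A'(1) sinh_mult_nonneg])
  finally show ?thesis .
qed

section \<open>Second moments of mixtures and exponential series\<close>

lemma mixture_inner_nn:
  fixes f :: "'a \<Rightarrow> 'b \<Rightarrow> real" and g :: "'a \<Rightarrow> 'c \<Rightarrow> real"
  assumes M: "finite_measure M" and N: "finite_measure N" and N': "finite_measure N'"
    and f: "square_integrable (M \<Otimes>\<^sub>M N) (\<lambda>(x, z). f x z)"
    and g: "square_integrable (M \<Otimes>\<^sub>M N') (\<lambda>(x, z). g x z)"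
    and fz: "\<And>z. square_integrable M (\<lambda>x. f x z)"
    and e: "\<And>z z'. (\<integral>x. f x z * g x z' \<partial>M) = e z z'" and e0: "\<And>z z'. 0 \<le> e z z'"
  shows "ennreal (\<integral>x. (\<integral>z. f x z \<partial>N) * (\<integral>z'. g x z' \<partial>N') \<partial>M) = (\<integral>\<^sup>+z. \<integral>\<^sup>+z'. ennreal (e z z') \<partial>N' \<partial>N)"
    and "0 \<le> (\<integral>x. (\<integral>z. f x z \<partial>N) * (\<integral>z'. g x z' \<partial>N') \<partial>M)"
proof -
  let ?G = "\<lambda>x. \<integral>z'. g x z' \<partial>N'"
  have sqG: "square_integrable M ?G" by (rule square_integrable_mixture[OF M N' g])
  have inner: "(\<integral>x. f x z * ?G x \<partial>M) = (\<integral>z'. e z z' \<partial>N')" for z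
    using mixture_inner[OF M N' g fz[of z]] by (simp add: mult.commute e[symmetric])
  have i1: "integrable N' (\<lambda>z'. e z z')" for z
    using integrable_mixture_inner[OF M N' g fz[of z]] by (simp add: mult.commute e[symmetric])
  have i2: "integrable N (\<lambda>z. \<integral>z'. e z z' \<partial>N')"
    using integrable_mixture_inner[OF M N f sqG] by (simp add: inner)
  have eq: "(\<integral>x. (\<integral>z. f x z \<partial>N) * ?G x \<partial>M) = (\<integral>z. (\<integral>z'. e z z' \<partial>N') \<partial>N)"
    using mixture_inner[OF M N f sqG] by (simp add: inner)
  show "0 \<le> (\<integral>x. (\<integral>z. f x z \<partial>N) * ?G x \<partial>M)"
    unfolding eq by (intro Bochner_Integration.integral_nonneg e0)
  show "ennreal (\<integral>x. (\<integral>z. f x z \<partial>N) * ?G x \<partial>M) = (\<integral>\<^sup>+z. \<integral>\<^sup>+z'. ennreal (e z z') \<partial>N' \<partial>N)"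
    unfolding eq using i1 i2 e0
    by (simp add: nn_integral_eq_integral integral_nonneg_AE)
qed

definition even_exp_term :: "nat \<Rightarrow> real \<Rightarrow> real" where
  "even_exp_term n x = (if even n then x ^ n / fact n else 0)"

lemma even_exp_term_nonneg: "0 \<le> even_exp_term n x"
  by (simp add: even_exp_term_def zero_le_even_power)

lemma even_exp_term_measurable [measurable]: "even_exp_term n \<in> borel_measurable borel"
  unfolding even_exp_term_def[abs_def] by measurable

lemma Re_ii_power_square: "(Re (\<i> ^ n))\<^sup>2 = (if even n then 1 else 0)"
proof (cases "even n")
  case True
  then obtain k where "n = 2 * k" by (elim evenE)
  then have "\<i> ^ n = of_real ((-1) ^ k)" by (simp add: power_mult)
  then show ?thesis using True by (simp only: Re_complex_of_real) (simp add: power_mult[symmetric])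
next
  case False
  then obtain k where "n = 2 * k + 1" by (elim oddE)
  then have "\<i> ^ n = of_real ((-1) ^ k) * \<i>" by (simp add: power_mult)
  then show ?thesis using False by (simp only: times_complex.sel Re_complex_of_real Im_complex_of_real) simp
qed

lemma exp_sums_real: "(\<lambda>n. x ^ n / fact n) sums exp (x::real)"
  using exp_converges[of x] by (simp add: field_class.field_divide_inverse mult.commute)

lemma even_exp_term_sums_cosh: "(\<lambda>n. even_exp_term n x) sums cosh x"
proof -
  have "(\<lambda>n. (x ^ n / fact n + (- x) ^ n / fact n) / 2) sums cosh x"
    unfolding cosh_field_def by (intro sums_divide sums_add exp_sums_real)
  moreover have "(x ^ n / fact n + (- x) ^ n / fact n) / 2 = even_exp_term n x" for n
    by (cases "even n") (simp_all add: even_exp_term_def)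
  ultimately show ?thesis by simp
qed

lemma even_exp_term_sums_sinh: "(\<lambda>n. real n * even_exp_term n x) sums (x * sinh x)"
proof -
  have "(\<lambda>n. x * ((x ^ n / fact n - (- x) ^ n / fact n) / 2)) sums (x * sinh x)"
    unfolding sinh_field_def by (intro sums_mult sums_divide sums_diff exp_sums_real)
  moreover have "x * ((x ^ n / fact n - (- x) ^ n / fact n) / 2) = real (Suc n) * even_exp_term (Suc n) x" for n
  proof (cases "even n")
    case False
    have "real (Suc n) * (x ^ Suc n / fact (Suc n)) = x * (x ^ n / fact n)"
      unfolding fact_Suc by (simp del: of_nat_Suc)
    then show ?thesis using False by (simp add: even_exp_term_def del: fact_Suc of_nat_Suc)
  qed (simp add: even_exp_term_def)
  ultimately have "(\<lambda>n. real (Suc n) * even_exp_term (Suc n) x) sums (x * sinh x)" by (simp only:)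
  then show ?thesis by (subst (asm) sums_Suc_iff) simp
qed

lemma power_div_fact_le_exp: assumes "0 \<le> (y::real)" shows "y ^ n / fact n \<le> exp y"
proof -
  note s = exp_sums_real[of y]
  have "sum (\<lambda>n. y ^ n / fact n) {n} \<le> exp y"
    unfolding sums_unique[OF s] using assms by (intro sum_le_suminf sums_summable[OF s]) auto
  then show ?thesis by simp
qed

lemma gauss2_suminf:
  assumes [measurable]: "\<And>n. f n \<in> borel_measurable borel"
    and f0: "\<And>n x. 0 \<le> f n x" and s: "\<And>x. (\<lambda>n. f n x) sums g x"
  shows "gauss2 TYPE('d::finite) g A B s = (\<Sum>n. gauss2 TYPE('d) (f n) A B s)"
proof -
  have "gauss2 TYPE('d) g A B s = (\<integral>\<^sup>+(\<xi>::real^'d). \<integral>\<^sup>+(\<eta>::real^'d). (\<Sum>n.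
     ennreal (exp (- A * (norm \<xi>)\<^sup>2 / 2) * exp (- B * (norm \<eta>)\<^sup>2 / 2) * f n (s * (\<xi> \<bullet> \<eta>)))) \<partial>lborel \<partial>lborel)"
    unfolding gauss2_def
  proof (intro nn_integral_cong)
    fix \<xi> \<eta> :: "real^'d"
    let ?w = "exp (- A * (norm \<xi>)\<^sup>2 / 2) * exp (- B * (norm \<eta>)\<^sup>2 / 2)"
    have "(\<lambda>n. ?w * f n (s * (\<xi> \<bullet> \<eta>))) sums (?w * g (s * (\<xi> \<bullet> \<eta>)))"
      by (intro sums_mult s)
    then have "(\<Sum>n. ennreal (?w * f n (s * (\<xi> \<bullet> \<eta>)))) = ennreal (?w * g (s * (\<xi> \<bullet> \<eta>)))"
      by (subst suminf_ennreal2) (auto simp: f0 sums_iff)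
    then show "ennreal (?w * g (s * (\<xi> \<bullet> \<eta>))) = (\<Sum>n. ennreal (?w * f n (s * (\<xi> \<bullet> \<eta>))))" ..
  qed
  also have "\<dots> = (\<Sum>n. gauss2 TYPE('d) (f n) A B s)"
    unfolding gauss2_def by (simp add: nn_integral_suminf)
  finally show ?thesis .
qed

lemma gauss2_tendsto:
  assumes [measurable]: "f \<in> borel_measurable borel" and f0: "\<And>x. 0 \<le> f x"
    and a: "decseq a" "a \<longlonglongrightarrow> A" and b: "decseq b" "b \<longlonglongrightarrow> B"
  shows "(\<lambda>k. gauss2 TYPE('d::finite) f (a k) (b k) s) \<longlonglongrightarrow> gauss2 TYPE('d) f A B s"
    and "incseq (\<lambda>k. gauss2 TYPE('d::finite) f (a k) (b k) s)"
proof -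
  have le: "exp (- a i * (norm \<xi>)\<^sup>2 / 2) * exp (- b i * (norm \<eta>)\<^sup>2 / 2) * f (s * (\<xi> \<bullet> \<eta>))
      \<le> exp (- a j * (norm \<xi>)\<^sup>2 / 2) * exp (- b j * (norm \<eta>)\<^sup>2 / 2) * f (s * (\<xi> \<bullet> \<eta>))"
    if "i \<le> j" for i j and \<xi> \<eta> :: "real^'d"
    using decseqD[OF a(1) that] decseqD[OF b(1) that] f0
    by (intro mult_right_mono mult_mono) (auto intro: mult_right_mono)
  have inner: "(\<lambda>k. \<integral>\<^sup>+(\<eta>::real^'d). ennreal (exp (- a k * (norm \<xi>)\<^sup>2 / 2) * exp (- b k * (norm \<eta>)\<^sup>2 / 2) * f (s * (\<xi> \<bullet> \<eta>))) \<partial>lborel)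
    \<longlonglongrightarrow> (\<integral>\<^sup>+(\<eta>::real^'d). ennreal (exp (- A * (norm \<xi>)\<^sup>2 / 2) * exp (- B * (norm \<eta>)\<^sup>2 / 2) * f (s * (\<xi> \<bullet> \<eta>))) \<partial>lborel)"
    for \<xi> :: "real^'d"
  proof (rule nn_integral_LIMSEQ)
    show "incseq (\<lambda>k (\<eta>::real^'d). ennreal (exp (- a k * (norm \<xi>)\<^sup>2 / 2) * exp (- b k * (norm \<eta>)\<^sup>2 / 2) * f (s * (\<xi> \<bullet> \<eta>))))"
      by (intro incseq_SucI le_funI ennreal_leI le) simp
    show "(\<lambda>k. ennreal (exp (- a k * (norm \<xi>)\<^sup>2 / 2) * exp (- b k * (norm \<eta>)\<^sup>2 / 2) * f (s * (\<xi> \<bullet> \<eta>))))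
      \<longlonglongrightarrow> ennreal (exp (- A * (norm \<xi>)\<^sup>2 / 2) * exp (- B * (norm \<eta>)\<^sup>2 / 2) * f (s * (\<xi> \<bullet> \<eta>)))" for \<eta> :: "real^'d"
      by (intro tendsto_ennrealI tendsto_intros a b) auto
  qed measurable
  show "(\<lambda>k. gauss2 TYPE('d::finite) f (a k) (b k) s) \<longlonglongrightarrow> gauss2 TYPE('d) f A B s"
    unfolding gauss2_def
  proof (rule nn_integral_LIMSEQ)
    show "incseq (\<lambda>k (\<xi>::real^'d). \<integral>\<^sup>+(\<eta>::real^'d). ennreal (exp (- a k * (norm \<xi>)\<^sup>2 / 2) * exp (- b k * (norm \<eta>)\<^sup>2 / 2) * f (s * (\<xi> \<bullet> \<eta>))) \<partial>lborel)"
      by (intro incseq_SucI le_funI nn_integral_mono ennreal_leI le) simp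
  qed (use inner in measurable)
  show "incseq (\<lambda>k. gauss2 TYPE('d::finite) f (a k) (b k) s)"
    unfolding gauss2_def
    by (intro incseq_SucI nn_integral_mono ennreal_leI le) simp
qed

lemma gauss2_antimono2:
  assumes "A \<le> A'" "B \<le> B'" "\<And>x. 0 \<le> f x"
  shows "gauss2 TYPE('d::finite) f A' B' s \<le> gauss2 TYPE('d) f A B s"
  unfolding gauss2_def
  by (intro nn_integral_mono ennreal_leI mult_right_mono mult_mono) (auto intro: mult_right_mono assms)

lemma zero_in_chaos: "(\<lambda>_. 0) \<in> chaos M X n"
  unfolding chaos_def polynomial_closure_def
  by (auto simp: L2_tendsto_def polynomials_of_const intro!: exI[of _ "\<lambda>_ _. 0"])

section \<open>The local time at zero of a Gaussian field\<close>

text \<open>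
  The coordinates of \<open>V\<close> are independent copies of a field with covariance \<open>R\<close>, expressed through linear functionals:
  those of \<open>V\<close> lie in a Gaussian space and have the corresponding covariances.
\<close>

locale gaussian_local_time = gaussian_coordinates M X
  for M :: "'w measure" and X :: "'t \<Rightarrow> 'w \<Rightarrow> real ^ 'd::finite" +
  fixes V :: "'p::euclidean_space \<Rightarrow> 'w \<Rightarrow> real ^ 'd" and E :: "'p set"
    and R :: "'p \<Rightarrow> 'p \<Rightarrow> real" and \<sigma>0 :: real
  assumes V_measurable: "(\<lambda>(\<omega>, p). V p \<omega>) \<in> borel_measurable (M \<Otimes>\<^sub>M borel)"
    and V_span: "\<And>\<xi> p. (\<lambda>\<omega>. \<xi> \<bullet> V p \<omega>) \<in> linear_span X"
    and V_cov: "\<And>\<xi> \<eta> p q. (\<integral>\<omega>. (\<xi> \<bullet> V p \<omega>) * (\<eta> \<bullet> V q \<omega>) \<partial>M) = (\<xi> \<bullet> \<eta>) * R p q"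
    and R_measurable: "(\<lambda>(p, q). R p q) \<in> borel_measurable (borel \<Otimes>\<^sub>M borel)"
    and E_sets: "E \<in> sets borel" and E_finite: "emeasure lborel E < \<infinity>"
    and R_pos: "\<And>p. p \<in> E \<Longrightarrow> \<sigma>0 \<le> R p p" and \<sigma>0: "0 < \<sigma>0"
begin

lemmas [measurable] = E_sets

lemma R_measurable' [measurable]:
  "f \<in> borel_measurable N \<Longrightarrow> g \<in> borel_measurable N \<Longrightarrow> (\<lambda>x. R (f x) (g x)) \<in> borel_measurable N"
  using measurable_compose[OF measurable_Pair R_measurable, of f N g] by simp

lemma V_measurable' [measurable]:
  "f \<in> N \<rightarrow>\<^sub>M M \<Longrightarrow> g \<in> borel_measurable N \<Longrightarrow> (\<lambda>x. V (g x) (f x)) \<in> borel_measurable N"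
  using measurable_compose[OF measurable_Pair V_measurable, of f N g] by simp

text \<open>
  The mixing measures on pairs \<open>(p, \<xi>)\<close>.  The constant function \<open>\<epsilon>\<close> belongs to the approximation at level
  \<open>\<epsilon>\<close>, the variance \<open>R p p\<close> to the chaos components.
\<close>

definition weight :: "('p \<Rightarrow> real) \<Rightarrow> ('p \<times> (real ^ 'd)) measure" where
  "weight \<tau> = density (lborel \<Otimes>\<^sub>M lborel)
     (\<lambda>(p, \<xi>). indicator E p * ennreal (exp (- \<tau> p * (norm \<xi>)\<^sup>2 / 2)))"

lemma sets_weight [measurable_cong]: "sets (weight \<tau>) = sets (borel \<Otimes>\<^sub>M borel)"
  by (simp add: weight_def cong: sets_pair_measure_cong)

lemma nn_integral_weight:
  assumes [measurable]: "\<tau> \<in> borel_measurable borel" "g \<in> borel_measurable (borel \<Otimes>\<^sub>M borel)"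
  shows "(\<integral>\<^sup>+z. g z \<partial>weight \<tau>) =
    (\<integral>\<^sup>+p. indicator E p * (\<integral>\<^sup>+\<xi>. ennreal (exp (- \<tau> p * (norm \<xi>)\<^sup>2 / 2)) * g (p, \<xi>) \<partial>lborel) \<partial>lborel)"
proof -
  have "(\<integral>\<^sup>+z. g z \<partial>weight \<tau>) = (\<integral>\<^sup>+z. (\<lambda>(p, \<xi>). indicator E p * ennreal (exp (- \<tau> p * (norm \<xi>)\<^sup>2 / 2))) z * g z \<partial>(lborel \<Otimes>\<^sub>M lborel))"
    unfolding weight_def by (rule nn_integral_density) measurable
  also have "\<dots> = (\<integral>\<^sup>+p. \<integral>\<^sup>+\<xi>. indicator E p * (ennreal (exp (- \<tau> p * (norm \<xi>)\<^sup>2 / 2)) * g (p, \<xi>)) \<partial>lborel \<partial>lborel)"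
    by (subst lborel.nn_integral_fst[symmetric]) (auto simp: mult.assoc)
  also have "\<dots> = (\<integral>\<^sup>+p. indicator E p * (\<integral>\<^sup>+\<xi>. ennreal (exp (- \<tau> p * (norm \<xi>)\<^sup>2 / 2)) * g (p, \<xi>) \<partial>lborel) \<partial>lborel)"
    by (intro nn_integral_cong nn_integral_cmult) measurable
  finally show ?thesis .
qed

lemma nn_integral_weight_finite:
  assumes [measurable]: "\<tau> \<in> borel_measurable borel" "g \<in> borel_measurable (borel \<Otimes>\<^sub>M borel)"
    and c: "c > 0" and le: "\<And>p \<xi>. p \<in> E \<Longrightarrow> ennreal (exp (- \<tau> p * (norm \<xi>)\<^sup>2 / 2)) * g (p, \<xi>) \<le> ennreal (K * exp (- c * (norm \<xi>)\<^sup>2 / 2))"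
    and K: "0 \<le> K"
  shows "(\<integral>\<^sup>+z. g z \<partial>weight \<tau>) < \<infinity>"
proof -
  let ?C = "(\<integral>\<^sup>+\<xi>. ennreal (K * exp (- c * (norm \<xi>)\<^sup>2 / 2)) \<partial>(lborel :: (real^'d) measure))"
  have "integrable lborel (\<lambda>\<xi>::real^'d. K * exp (- c * (norm \<xi>)\<^sup>2 / 2))"
    by (intro integrable_mult_right integrable_gaussian_weight c)
  then have C: "?C < \<infinity>" using K by (subst nn_integral_eq_integral) auto
  have "(\<integral>\<^sup>+z. g z \<partial>weight \<tau>) \<le> (\<integral>\<^sup>+p. ?C * indicator E p \<partial>lborel)"
    unfolding nn_integral_weight[OF assms(1,2)]
  proof (intro nn_integral_mono)
    fix p
    show "indicator E p * (\<integral>\<^sup>+\<xi>. ennreal (exp (- \<tau> p * (norm \<xi>)\<^sup>2 / 2)) * g (p, \<xi>) \<partial>lborel) \<le> ?C * indicator E p"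
    proof (cases "p \<in> E")
      case True
      have "(\<integral>\<^sup>+\<xi>. ennreal (exp (- \<tau> p * (norm \<xi>)\<^sup>2 / 2)) * g (p, \<xi>) \<partial>lborel) \<le> ?C"
        by (intro nn_integral_mono le True)
      then show ?thesis using True by (simp only: indicator_simps mult_1_left mult_1_right)
    qed simp
  qed
  also have "\<dots> = ?C * emeasure lborel E" by (rule nn_integral_cmult_indicator) simp
  also have "\<dots> < \<infinity>" using C E_finite by (simp add: ennreal_mult_less_top)
  finally show ?thesis .
qed

lemma finite_measure_weight:
  assumes [measurable]: "\<tau> \<in> borel_measurable borel" and "c > 0" "\<And>p. p \<in> E \<Longrightarrow> c \<le> \<tau> p"
  shows "finite_measure (weight \<tau>)"
proof
  have "(\<integral>\<^sup>+z. 1 \<partial>weight \<tau>) < \<infinity>"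
    by (rule nn_integral_weight_finite[OF assms(1) _ assms(2), of _ 1])
      (auto intro!: ennreal_leI mult_right_mono assms)
  then show "emeasure (weight \<tau>) (space (weight \<tau>)) \<noteq> \<infinity>" by simp
qed

text \<open>
  All second moments of approximations and chaos components are energies, by \<open>nn_integral_weight_weight\<close>.
\<close>

definition energy :: "(real \<Rightarrow> real) \<Rightarrow> ('p \<Rightarrow> real) \<Rightarrow> ('p \<Rightarrow> real) \<Rightarrow> ennreal" where
  "energy f \<tau> \<tau>' = (\<integral>\<^sup>+p. indicator E p * (\<integral>\<^sup>+q. indicator E q * gauss2 TYPE('d) f (\<tau> p) (\<tau>' q) (R p q) \<partial>lborel) \<partial>lborel)"

lemma gauss2_measurable [measurable]:
  assumes [measurable]: "f \<in> borel_measurable borel" "a \<in> borel_measurable N" "b \<in> borel_measurable N" "s \<in> borel_measurable N"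
  shows "(\<lambda>x. gauss2 TYPE('d) f (a x) (b x) (s x)) \<in> borel_measurable N"
  unfolding gauss2_def by measurable

lemma nn_integral_weight_weight:
  assumes [measurable]: "f \<in> borel_measurable borel" "\<tau> \<in> borel_measurable borel" "\<tau>' \<in> borel_measurable borel"
     "a \<in> borel_measurable borel" "a' \<in> borel_measurable borel"
    and f0: "\<And>x. 0 \<le> f x"
  shows "(\<integral>\<^sup>+z. \<integral>\<^sup>+z'. ennreal (exp (- a (fst z) * (norm (snd z))\<^sup>2 / 2) * exp (- a' (fst z') * (norm (snd z'))\<^sup>2 / 2)
      * f (R (fst z) (fst z') * (snd z \<bullet> snd z'))) \<partial>weight \<tau>' \<partial>weight \<tau>)
    = energy f (\<lambda>p. \<tau> p + a p) (\<lambda>p. \<tau>' p + a' p)"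
proof -
  let ?g = "\<lambda>p (\<xi>::real^'d) q (\<eta>::real^'d). exp (- (\<tau> p + a p) * (norm \<xi>)\<^sup>2 / 2) * exp (- (\<tau>' q + a' q) * (norm \<eta>)\<^sup>2 / 2) * f (R p q * (\<xi> \<bullet> \<eta>))"
  have w: "exp (- \<tau> p * (norm \<xi>)\<^sup>2 / 2) * (exp (- \<tau>' q * (norm \<eta>)\<^sup>2 / 2) * (exp (- a p * (norm \<xi>)\<^sup>2 / 2) * exp (- a' q * (norm \<eta>)\<^sup>2 / 2) * f (R p q * (\<xi> \<bullet> \<eta>))))
      = ?g p \<xi> q \<eta>" for p q and \<xi> \<eta> :: "real^'d"
  proof -
    have "exp (- (\<tau> p + a p) * (norm \<xi>)\<^sup>2 / 2) = exp (- \<tau> p * (norm \<xi>)\<^sup>2 / 2) * exp (- a p * (norm \<xi>)\<^sup>2 / 2)"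
      "exp (- (\<tau>' q + a' q) * (norm \<eta>)\<^sup>2 / 2) = exp (- \<tau>' q * (norm \<eta>)\<^sup>2 / 2) * exp (- a' q * (norm \<eta>)\<^sup>2 / 2)"
      unfolding exp_add[symmetric] by (simp_all add: algebra_simps add_divide_distrib diff_divide_distrib)
    then show ?thesis by (simp only: mult_ac)
  qed
  let ?h = "\<lambda>(z::'p \<times> (real^'d)) (z'::'p \<times> (real^'d)). ennreal (exp (- a (fst z) * (norm (snd z))\<^sup>2 / 2) * exp (- a' (fst z') * (norm (snd z'))\<^sup>2 / 2)
      * f (R (fst z) (fst z') * (snd z \<bullet> snd z')))"
  let ?I = "\<lambda>z::'p \<times> (real^'d). \<integral>\<^sup>+q. indicator E q * (\<integral>\<^sup>+\<eta>. ennreal (exp (- \<tau>' q * (norm \<eta>)\<^sup>2 / 2)) * ?h z (q, \<eta>) \<partial>lborel) \<partial>lborel"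
  have [measurable]: "?I \<in> borel_measurable (borel \<Otimes>\<^sub>M borel)" by measurable
  have "(\<integral>\<^sup>+z'. ?h z z' \<partial>weight \<tau>') = ?I z" for z
    by (rule nn_integral_weight) measurable
  then have "(\<integral>\<^sup>+z. \<integral>\<^sup>+z'. ?h z z' \<partial>weight \<tau>' \<partial>weight \<tau>) = (\<integral>\<^sup>+z. ?I z \<partial>weight \<tau>)"
    by (simp only:)
  also have "\<dots> = (\<integral>\<^sup>+p. indicator E p * (\<integral>\<^sup>+\<xi>. ennreal (exp (- \<tau> p * (norm \<xi>)\<^sup>2 / 2)) * ?I (p, \<xi>) \<partial>lborel) \<partial>lborel)"
    by (rule nn_integral_weight) measurable
  also have "\<dots> = (\<integral>\<^sup>+p. indicator E p * (\<integral>\<^sup>+\<xi>. (\<integral>\<^sup>+q. indicator E q * (\<integral>\<^sup>+\<eta>. ennreal (?g p \<xi> q \<eta>) \<partial>lborel) \<partial>lborel) \<partial>lborel) \<partial>lborel)"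
  proof (intro nn_integral_cong arg_cong2[of _ _ _ _ "(*)"] refl)
    fix p :: 'p and \<xi> :: "real^'d"
    let ?c = "ennreal (exp (- \<tau> p * (norm \<xi>)\<^sup>2 / 2))"
    have "?c * ?I (p, \<xi>) = (\<integral>\<^sup>+q. ?c * (indicator E q * (\<integral>\<^sup>+\<eta>. ennreal (exp (- \<tau>' q * (norm \<eta>)\<^sup>2 / 2)) * ?h (p, \<xi>) (q, \<eta>) \<partial>lborel)) \<partial>lborel)"
      by (rule nn_integral_cmult[symmetric]) measurable
    also have "\<dots> = (\<integral>\<^sup>+q. indicator E q * (\<integral>\<^sup>+\<eta>. ?c * (ennreal (exp (- \<tau>' q * (norm \<eta>)\<^sup>2 / 2)) * ?h (p, \<xi>) (q, \<eta>)) \<partial>lborel) \<partial>lborel)"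
    proof (intro nn_integral_cong)
      fix q
      have "?c * (\<integral>\<^sup>+\<eta>. ennreal (exp (- \<tau>' q * (norm \<eta>)\<^sup>2 / 2)) * ?h (p, \<xi>) (q, \<eta>) \<partial>lborel)
          = (\<integral>\<^sup>+\<eta>. ?c * (ennreal (exp (- \<tau>' q * (norm \<eta>)\<^sup>2 / 2)) * ?h (p, \<xi>) (q, \<eta>)) \<partial>lborel)"
        by (rule nn_integral_cmult[symmetric]) (simp only: fst_conv snd_conv, measurable)
      then show "?c * (indicator E q * (\<integral>\<^sup>+\<eta>. ennreal (exp (- \<tau>' q * (norm \<eta>)\<^sup>2 / 2)) * ?h (p, \<xi>) (q, \<eta>) \<partial>lborel))
          = indicator E q * (\<integral>\<^sup>+\<eta>. ?c * (ennreal (exp (- \<tau>' q * (norm \<eta>)\<^sup>2 / 2)) * ?h (p, \<xi>) (q, \<eta>)) \<partial>lborel)"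
        by (subst mult.left_commute) (simp only:)
    qed
    also have "\<dots> = (\<integral>\<^sup>+q. indicator E q * (\<integral>\<^sup>+\<eta>. ennreal (?g p \<xi> q \<eta>) \<partial>lborel) \<partial>lborel)"
      by (simp only: fst_conv snd_conv ennreal_mult[symmetric] exp_ge_zero mult_nonneg_nonneg f0 w)
    finally show "?c * ?I (p, \<xi>) = (\<integral>\<^sup>+q. indicator E q * (\<integral>\<^sup>+\<eta>. ennreal (?g p \<xi> q \<eta>) \<partial>lborel) \<partial>lborel)" .
  qed
  also have "\<dots> = (\<integral>\<^sup>+p. indicator E p * (\<integral>\<^sup>+q. (\<integral>\<^sup>+\<xi>. indicator E q * (\<integral>\<^sup>+\<eta>. ennreal (?g p \<xi> q \<eta>) \<partial>lborel) \<partial>lborel) \<partial>lborel) \<partial>lborel)"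
    by (intro nn_integral_cong arg_cong2[of _ _ _ _ "(*)"] refl lborel_pair.Fubini') measurable
  also have "\<dots> = (\<integral>\<^sup>+p. indicator E p * (\<integral>\<^sup>+q. indicator E q * (\<integral>\<^sup>+\<xi>. \<integral>\<^sup>+\<eta>. ennreal (?g p \<xi> q \<eta>) \<partial>lborel \<partial>lborel) \<partial>lborel) \<partial>lborel)"
    by (intro nn_integral_cong arg_cong2[of _ _ _ _ "(*)"] refl nn_integral_cmult) measurable
  finally show ?thesis unfolding energy_def gauss2_def .
qed

lemma energy_suminf:
  assumes [measurable]: "\<And>n. f n \<in> borel_measurable borel" "\<tau> \<in> borel_measurable borel" "\<tau>' \<in> borel_measurable borel"
    and f0: "\<And>n x. 0 \<le> f n x" and s: "\<And>x. (\<lambda>n. f n x) sums g x"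
  shows "energy g \<tau> \<tau>' = (\<Sum>n. energy (f n) \<tau> \<tau>')"
proof -
  let ?G = "\<lambda>n p q. gauss2 TYPE('d) (f n) (\<tau> p) (\<tau>' q) (R p q)"
  have "energy g \<tau> \<tau>' = (\<integral>\<^sup>+p. indicator E p * (\<integral>\<^sup>+q. (\<Sum>n. indicator E q * ?G n p q) \<partial>lborel) \<partial>lborel)"
    unfolding energy_def gauss2_suminf[OF assms(1) f0 s] ennreal_suminf_cmult ..
  also have "\<dots> = (\<integral>\<^sup>+p. indicator E p * (\<Sum>n. \<integral>\<^sup>+q. indicator E q * ?G n p q \<partial>lborel) \<partial>lborel)"
    by (intro nn_integral_cong arg_cong2[of _ _ _ _ "(*)"] refl nn_integral_suminf) measurable
  also have "\<dots> = (\<integral>\<^sup>+p. (\<Sum>n. indicator E p * (\<integral>\<^sup>+q. indicator E q * ?G n p q \<partial>lborel)) \<partial>lborel)"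
    unfolding ennreal_suminf_cmult ..
  also have "\<dots> = (\<Sum>n. energy (f n) \<tau> \<tau>')"
    unfolding energy_def by (rule nn_integral_suminf) measurable
  finally show ?thesis .
qed

lemma energy_antimono:
  assumes "\<And>p. p \<in> E \<Longrightarrow> \<tau>1 p \<le> \<tau> p" "\<And>p. p \<in> E \<Longrightarrow> \<tau>1' p \<le> \<tau>' p" "\<And>x. 0 \<le> f x"
  shows "energy f \<tau> \<tau>' \<le> energy f \<tau>1 \<tau>1'"
  unfolding energy_def
  by (intro nn_integral_mono)
    (auto split: split_indicator intro!: nn_integral_mono gauss2_antimono2 assms)

lemma energy_tendsto:
  assumes [measurable]: "f \<in> borel_measurable borel" "\<tau> \<in> borel_measurable borel" "\<tau>' \<in> borel_measurable borel"
    and f0: "\<And>x. 0 \<le> f x" and "0 \<le> c" "0 \<le> c'"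
  shows "(\<lambda>k. energy f (\<lambda>p. \<tau> p + c * inverse (real (Suc k))) (\<lambda>p. \<tau>' p + c' * inverse (real (Suc k)))) \<longlonglongrightarrow> energy f \<tau> \<tau>'"
proof -
  have dec: "decseq (\<lambda>k. x + c * inverse (real (Suc k)))" if "0 \<le> c" for x c :: real
    using that by (intro decseq_SucI add_left_mono mult_left_mono le_imp_inverse_le) auto
  have lim: "(\<lambda>k. x + c * inverse (real (Suc k))) \<longlonglongrightarrow> x" for x c :: real
    using tendsto_add[OF tendsto_const[of x] tendsto_mult_left[OF LIMSEQ_inverse_real_of_nat, of c]] by simp
  note g = gauss2_tendsto[OF assms(1) f0 dec[OF assms(5)] lim dec[OF assms(6)] lim, where 'd='d]
  let ?G = "\<lambda>k p q. gauss2 TYPE('d) f (\<tau> p + c * inverse (real (Suc k))) (\<tau>' q + c' * inverse (real (Suc k))) (R p q)"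
  have le: "?G i p q \<le> ?G j p q" if "i \<le> j" for i j p q
    using incseqD[OF g(2) that] .
  have inner: "(\<lambda>k. \<integral>\<^sup>+q. indicator E q * ?G k p q \<partial>lborel) \<longlonglongrightarrow> (\<integral>\<^sup>+q. indicator E q * gauss2 TYPE('d) f (\<tau> p) (\<tau>' q) (R p q) \<partial>lborel)" for p
  proof (rule nn_integral_LIMSEQ)
    show "incseq (\<lambda>k q. indicator E q * ?G k p q)"
      by (intro incseq_SucI le_funI mult_left_mono le) auto
    show "(\<lambda>k. indicator E q * ?G k p q) \<longlonglongrightarrow> indicator E q * gauss2 TYPE('d) f (\<tau> p) (\<tau>' q) (R p q)" for q
      using g(1) by (auto split: split_indicator)
  qed measurable
  show ?thesis
    unfolding energy_def
  proof (rule nn_integral_LIMSEQ)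
    show "incseq (\<lambda>k p. indicator E p * (\<integral>\<^sup>+q. indicator E q * ?G k p q \<partial>lborel))"
      by (intro incseq_SucI le_funI mult_left_mono nn_integral_mono le) auto
    show "(\<lambda>k. indicator E p * (\<integral>\<^sup>+q. indicator E q * ?G k p q \<partial>lborel)) \<longlonglongrightarrow>
       indicator E p * (\<integral>\<^sup>+q. indicator E q * gauss2 TYPE('d) f (\<tau> p) (\<tau>' q) (R p q) \<partial>lborel)" for p
      using inner[of p] by (auto split: split_indicator)
  qed measurable
qed

abbreviation variance_of :: "'p \<Rightarrow> real" where "variance_of p \<equiv> R p p"

lemma inner_V_power2: "(\<integral>\<omega>. (\<xi> \<bullet> V p \<omega>)\<^sup>2 \<partial>M) = (norm \<xi>)\<^sup>2 * R p p"
  using V_cov[of \<xi> p \<xi> p] by (simp add: power2_eq_square dot_square_norm)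

lemma measurable_weight_eq:
  "borel_measurable (M \<Otimes>\<^sub>M weight \<tau>) = borel_measurable (M \<Otimes>\<^sub>M (borel \<Otimes>\<^sub>M borel))"
  by (intro measurable_cong_sets sets_pair_measure_cong) (auto simp: sets_weight)

definition cos_kernel :: "'w \<Rightarrow> 'p \<times> (real ^ 'd) \<Rightarrow> real" where
  "cos_kernel \<omega> z = cos (snd z \<bullet> V (fst z) \<omega>)"

text \<open>
  The factor \<open>Re (i^n)\<close> is \<open>0\<close> for odd \<open>n\<close> and the sign of the expansion of the cosine for even \<open>n\<close>.
\<close>

definition chaos_kernel :: "nat \<Rightarrow> 'w \<Rightarrow> 'p \<times> (real ^ 'd) \<Rightarrow> real" where
  "chaos_kernel n \<omega> z = Re (\<i> ^ n) * hermite (\<integral>\<omega>. (snd z \<bullet> V (fst z) \<omega>)\<^sup>2 \<partial>M) n (snd z \<bullet> V (fst z) \<omega>)"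

lemma cos_kernel_measurable: "(\<lambda>(\<omega>, z). cos_kernel \<omega> z) \<in> borel_measurable (M \<Otimes>\<^sub>M weight \<tau>)"
  unfolding cos_kernel_def measurable_weight_eq by measurable

lemma chaos_kernel_measurable: "(\<lambda>(\<omega>, z). chaos_kernel n \<omega> z) \<in> borel_measurable (M \<Otimes>\<^sub>M weight \<tau>)"
  unfolding chaos_kernel_def inner_V_power2 measurable_weight_eq by measurable

lemma finite_measure_weight_const: "\<epsilon> > 0 \<Longrightarrow> finite_measure (weight (\<lambda>_. \<epsilon>))"
  by (rule finite_measure_weight[of _ \<epsilon>]) auto

lemma finite_measure_weight_variance: "finite_measure (weight variance_of)"
  by (rule finite_measure_weight[of _ \<sigma>0]) (auto simp: R_pos \<sigma>0)

lemma finite_M: "finite_measure M" by unfold_locales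

lemma cos_kernel_square_integrable:
  assumes "\<epsilon> > 0"
  shows "square_integrable (M \<Otimes>\<^sub>M weight (\<lambda>_. \<epsilon>)) (\<lambda>(\<omega>, z). cos_kernel \<omega> z)"
proof (rule square_integrable_bounded[of _ _ 1])
  show "finite_measure (M \<Otimes>\<^sub>M weight (\<lambda>_. \<epsilon>))"
    by (intro finite_measure_pair_measure finite_M finite_measure_weight_const assms)
qed (auto simp: cos_kernel_measurable cos_kernel_def)

lemma cos_kernel_square_integrable_section: "square_integrable M (\<lambda>\<omega>. cos_kernel \<omega> z)"
proof (rule square_integrable_bounded[OF finite_M, of _ 1])
  show "(\<lambda>\<omega>. cos_kernel \<omega> z) \<in> borel_measurable M"
    unfolding cos_kernel_def by measurable
qed (simp add: cos_kernel_def)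

lemma chaos_kernel_square_integrable_section: "square_integrable M (\<lambda>\<omega>. chaos_kernel n \<omega> z)"
  unfolding chaos_kernel_def
  by (intro square_integrable_scale subexp_square_integrable subexp_hermite V_span)

lemma chaos_kernel_inner:
  "(\<integral>\<omega>. chaos_kernel n \<omega> z * chaos_kernel n \<omega> z' \<partial>M)
    = even_exp_term n (R (fst z) (fst z') * (snd z \<bullet> snd z'))"
proof -
  have "(\<integral>\<omega>. chaos_kernel n \<omega> z * chaos_kernel n \<omega> z' \<partial>M)
    = (\<integral>\<omega>. (Re (\<i> ^ n))\<^sup>2 * (hermite (\<integral>\<omega>. (snd z \<bullet> V (fst z) \<omega>)\<^sup>2 \<partial>M) n (snd z \<bullet> V (fst z) \<omega>) *
      hermite (\<integral>\<omega>. (snd z' \<bullet> V (fst z') \<omega>)\<^sup>2 \<partial>M) n (snd z' \<bullet> V (fst z') \<omega>)) \<partial>M)"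
    unfolding chaos_kernel_def by (simp only: power2_eq_square mult_ac)
  also have "\<dots> = (Re (\<i> ^ n))\<^sup>2 * ((\<integral>\<omega>. (snd z \<bullet> V (fst z) \<omega>) * (snd z' \<bullet> V (fst z') \<omega>) \<partial>M) ^ n / fact n)"
    unfolding integral_mult_right_zero expectation_hermite_hermite[OF V_span V_span] ..
  finally show ?thesis
    unfolding V_cov Re_ii_power_square by (simp add: even_exp_term_def mult.commute)
qed

lemma cos_kernel_chaos_kernel_inner:
  "(\<integral>\<omega>. cos_kernel \<omega> z * chaos_kernel n \<omega> z' \<partial>M)
    = exp (- variance_of (fst z) * (norm (snd z))\<^sup>2 / 2) * even_exp_term n (R (fst z) (fst z') * (snd z \<bullet> snd z'))"
proof -
  have "(\<integral>\<omega>. cos_kernel \<omega> z * chaos_kernel n \<omega> z' \<partial>M)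
    = Re (\<i> ^ n) * (\<integral>\<omega>. cos (snd z \<bullet> V (fst z) \<omega>) *
      hermite (\<integral>\<omega>. (snd z' \<bullet> V (fst z') \<omega>)\<^sup>2 \<partial>M) n (snd z' \<bullet> V (fst z') \<omega>) \<partial>M)"
    unfolding integral_mult_right_zero[symmetric] chaos_kernel_def cos_kernel_def by (simp only: mult_ac)
  also have "\<dots> = (Re (\<i> ^ n))\<^sup>2 * (exp (- variance_of (fst z) * (norm (snd z))\<^sup>2 / 2) *
      (R (fst z) (fst z') * (snd z \<bullet> snd z')) ^ n / fact n)"
    unfolding expectation_cos_hermite[OF V_span V_span] V_cov
    unfolding inner_V_power2 by (simp add: power2_eq_square mult_ac)
  finally show ?thesis
    unfolding Re_ii_power_square by (simp add: even_exp_term_def)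
qed

lemma cos_kernel_inner:
  "(\<integral>\<omega>. cos_kernel \<omega> z * cos_kernel \<omega> z' \<partial>M)
    = exp (- variance_of (fst z) * (norm (snd z))\<^sup>2 / 2) * exp (- variance_of (fst z') * (norm (snd z'))\<^sup>2 / 2)
      * cosh (R (fst z) (fst z') * (snd z \<bullet> snd z'))"
  unfolding cos_kernel_def expectation_cos_cos[OF V_span V_span] V_cov inner_V_power2
  by (simp add: mult_ac)

text \<open>
  The second moment of the kernel at \<open>(p, \<xi>)\<close> is \<open>y^n / n!\<close> with \<open>y = R p p \<bar>\<xi>\<bar>\<^sup>2\<close>, while the weight is
  \<open>exp (- y / 2)\<close>; the bound \<open>y^n / n! \<le> 4^n exp (y / 4)\<close> leaves half of the exponent.
\<close>

lemma chaos_kernel_square_integrable: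
  "square_integrable (M \<Otimes>\<^sub>M weight variance_of) (\<lambda>(\<omega>, z). chaos_kernel n \<omega> z)"
proof (rule square_integrable_pairI[OF finite_M finite_measure_weight_variance chaos_kernel_measurable
      chaos_kernel_square_integrable_section])
  have eq: "(\<integral>\<omega>. (chaos_kernel n \<omega> z)\<^sup>2 \<partial>M) = even_exp_term n (variance_of (fst z) * (norm (snd z))\<^sup>2)" for z
    using chaos_kernel_inner[of n z z] by (simp add: power2_eq_square dot_square_norm)
  show "integrable (weight variance_of) (\<lambda>z. \<integral>\<omega>. (chaos_kernel n \<omega> z)\<^sup>2 \<partial>M)"
    unfolding eq
  proof (rule integrableI_nonneg)
    show "(\<integral>\<^sup>+z. ennreal (even_exp_term n (variance_of (fst z) * (norm (snd z))\<^sup>2)) \<partial>weight variance_of) < \<infinity>"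
    proof (rule nn_integral_weight_finite[of _ _ "\<sigma>0 / 2" "4 ^ n"])
      fix p and \<xi> :: "real ^ 'd" assume p: "p \<in> E"
      let ?y = "variance_of p * (norm \<xi>)\<^sup>2"
      have v: "\<sigma>0 \<le> variance_of p" using R_pos[OF p] .
      have y: "0 \<le> ?y" using v \<sigma>0 by simp
      have "even_exp_term n ?y \<le> ?y ^ n / fact n"
        using y by (simp add: even_exp_term_def)
      also have "\<dots> = 4 ^ n * ((?y / 4) ^ n / fact n)" by (simp add: power_divide)
      also have "\<dots> \<le> 4 ^ n * exp (?y / 4)"
        using y by (intro mult_left_mono power_div_fact_le_exp) auto
      finally have "exp (- variance_of p * (norm \<xi>)\<^sup>2 / 2) * even_exp_term n ?y
          \<le> exp (- variance_of p * (norm \<xi>)\<^sup>2 / 2) * (4 ^ n * exp (?y / 4))"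
        by (intro mult_left_mono) auto
      also have "\<dots> = 4 ^ n * exp (- ?y / 4)"
      proof -
        have "- variance_of p * (norm \<xi>)\<^sup>2 / 2 + ?y / 4 = - ?y / 4" by simp
        then have "exp (- variance_of p * (norm \<xi>)\<^sup>2 / 2) * exp (?y / 4) = exp (- ?y / 4)"
          by (simp only: exp_add[symmetric])
        then show ?thesis by (simp only: mult.left_commute)
      qed
      also have "\<dots> \<le> 4 ^ n * exp (- (\<sigma>0 / 2) * (norm \<xi>)\<^sup>2 / 2)"
        using mult_right_mono[OF v, of "(norm \<xi>)\<^sup>2"] by (intro mult_left_mono) auto
      finally show "ennreal (exp (- variance_of p * (norm \<xi>)\<^sup>2 / 2)) *
          ennreal (even_exp_term n (variance_of (fst (p, \<xi>)) * (norm (snd (p, \<xi>)))\<^sup>2))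
          \<le> ennreal (4 ^ n * exp (- (\<sigma>0 / 2) * (norm \<xi>)\<^sup>2 / 2))"
        by (simp only: fst_conv snd_conv ennreal_mult[symmetric] exp_ge_zero even_exp_term_nonneg ennreal_leI)
    qed (use \<sigma>0 in auto)
  qed (auto simp: even_exp_term_nonneg cong: measurable_cong_sets)
qed

definition fourier_const :: real where "fourier_const = (2 * pi) powr - real CARD('d)"

definition approx :: "real \<Rightarrow> 'w \<Rightarrow> real" where
  "approx \<epsilon> \<omega> = fourier_const * (\<integral>z. cos_kernel \<omega> z \<partial>weight (\<lambda>_. \<epsilon>))"

definition chaos_component :: "nat \<Rightarrow> 'w \<Rightarrow> real" where
  "chaos_component n \<omega> = fourier_const * (\<integral>z. chaos_kernel n \<omega> z \<partial>weight variance_of)"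

lemma fourier_const_pos: "0 < fourier_const"
  by (simp add: fourier_const_def)

lemma approx_eq_heat_kernel:
  assumes \<epsilon>: "\<epsilon> > 0" and \<omega>: "\<omega> \<in> space M"
  shows "(LINT p:E|lborel. heat_kernel \<epsilon> (V p \<omega>)) = approx \<epsilon> \<omega>"
proof -
  let ?w = "\<lambda>(p, \<xi>::real^'d). indicator E p * exp (- \<epsilon> * (norm \<xi>)\<^sup>2 / 2) :: real"
  have weight: "weight (\<lambda>_. \<epsilon>) = density (lborel \<Otimes>\<^sub>M lborel) ?w"
    unfolding weight_def
    by (intro arg_cong2[of _ _ _ _ density] refl ext) (auto simp: ennreal_mult'' ennreal_indicator)
  have [measurable]: "(\<lambda>p. V p \<omega>) \<in> borel_measurable borel"
    using \<omega> by measurable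
  have cm[measurable]: "cos_kernel \<omega> \<in> borel_measurable (lborel \<Otimes>\<^sub>M lborel)"
    unfolding cos_kernel_def[abs_def] by measurable
  have [measurable]: "?w \<in> borel_measurable (lborel \<Otimes>\<^sub>M lborel)" by measurable
  interpret W: finite_measure "weight (\<lambda>_. \<epsilon>)" by (rule finite_measure_weight_const[OF \<epsilon>])
  have "integrable (weight (\<lambda>_. \<epsilon>)) (cos_kernel \<omega>)"
  proof (rule W.integrable_const_bound[of _ 1])
    show "cos_kernel \<omega> \<in> borel_measurable (weight (\<lambda>_. \<epsilon>))"
      using cm by (simp add: weight)
  qed (simp add: cos_kernel_def)
  then have int: "integrable (lborel \<Otimes>\<^sub>M lborel) (\<lambda>z. ?w z *\<^sub>R cos_kernel \<omega> z)"
    unfolding weight by (subst (asm) integrable_density) auto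
  have "(\<integral>z. cos_kernel \<omega> z \<partial>weight (\<lambda>_. \<epsilon>)) = (\<integral>z. ?w z *\<^sub>R cos_kernel \<omega> z \<partial>(lborel \<Otimes>\<^sub>M lborel))"
    unfolding weight by (rule integral_density) auto
  also have "\<dots> = (\<integral>p. \<integral>\<xi>. ?w (p, \<xi>) *\<^sub>R cos_kernel \<omega> (p, \<xi>) \<partial>lborel \<partial>lborel)"
    by (rule lborel_pair.integral_fst'[symmetric, OF int])
  also have "\<dots> = (\<integral>p. indicator E p * (\<integral>\<xi>. cos (\<xi> \<bullet> V p \<omega>) * exp (- \<epsilon> * (norm \<xi>)\<^sup>2 / 2) \<partial>lborel) \<partial>lborel)"
    unfolding cos_kernel_def integral_mult_right_zero[symmetric]
    by (intro Bochner_Integration.integral_cong refl) (simp add: mult_ac)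
  finally have *: "(\<integral>z. cos_kernel \<omega> z \<partial>weight (\<lambda>_. \<epsilon>))
      = (\<integral>p. indicator E p * (\<integral>\<xi>. cos (\<xi> \<bullet> V p \<omega>) * exp (- \<epsilon> * (norm \<xi>)\<^sup>2 / 2) \<partial>lborel) \<partial>lborel)" .
  have "(LINT p:E|lborel. heat_kernel \<epsilon> (V p \<omega>))
      = (\<integral>p. fourier_const * (indicator E p * (\<integral>\<xi>. cos (\<xi> \<bullet> V p \<omega>) * exp (- \<epsilon> * (norm \<xi>)\<^sup>2 / 2) \<partial>lborel)) \<partial>lborel)"
    unfolding set_lebesgue_integral_def heat_kernel_fourier[OF \<epsilon>] fourier_const_def real_scaleR_def
    by (simp only: mult.left_commute)
  also have "\<dots> = approx \<epsilon> \<omega>"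
    unfolding approx_def * by (rule integral_mult_right_zero)
  finally show ?thesis .
qed

lemma approx_square_integrable: "\<epsilon> > 0 \<Longrightarrow> square_integrable M (approx \<epsilon>)"
  unfolding approx_def[abs_def]
  by (intro square_integrable_scale square_integrable_mixture finite_M finite_measure_weight_const
      cos_kernel_square_integrable)

lemma chaos_component_square_integrable: "square_integrable M (chaos_component n)"
  unfolding chaos_component_def[abs_def]
  by (intro square_integrable_scale square_integrable_mixture finite_M finite_measure_weight_variance
      chaos_kernel_square_integrable)

lemma chaos_component_in_chaos: "chaos_component n \<in> chaos M X n"
proof (cases "Re (\<i> ^ n) = 0")
  case True
  then have "chaos_component n = (\<lambda>\<omega>. 0)"
    by (simp add: fun_eq_iff chaos_component_def chaos_kernel_def)
  then show ?thesis by (simp add: zero_in_chaos)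
next
  case False
  let ?r = "Re (\<i> ^ n)"
  have "square_integrable (M \<Otimes>\<^sub>M weight variance_of) (\<lambda>x. (1 / ?r) * (case x of (\<omega>, z) \<Rightarrow> chaos_kernel n \<omega> z))"
    by (intro square_integrable_scale chaos_kernel_square_integrable)
  then have "square_integrable (M \<Otimes>\<^sub>M weight variance_of) (\<lambda>(\<omega>, z).
      hermite (\<integral>\<omega>. (snd z \<bullet> V (fst z) \<omega>)\<^sup>2 \<partial>M) n (snd z \<bullet> V (fst z) \<omega>))"
    using False by (simp add: chaos_kernel_def case_prod_unfold)
  from hermite_mixture_in_chaos[OF finite_measure_weight_variance V_span this, of "fourier_const * ?r"]
  moreover have "chaos_component n = (\<lambda>\<omega>. fourier_const * ?r * (\<integral>z. hermite
      (\<integral>\<omega>. (snd z \<bullet> V (fst z) \<omega>)\<^sup>2 \<partial>M) n (snd z \<bullet> V (fst z) \<omega>) \<partial>weight variance_of))"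
    unfolding chaos_component_def[abs_def] chaos_kernel_def by (simp only: integral_mult_right_zero mult.assoc)
  ultimately show ?thesis by (simp only:)
qed

lemma approx_inner:
  assumes "\<epsilon> > 0" "\<delta> > 0"
  shows "ennreal (\<integral>\<omega>. approx \<epsilon> \<omega> * approx \<delta> \<omega> \<partial>M) = ennreal (fourier_const\<^sup>2)
      * energy cosh (\<lambda>p. \<epsilon> + variance_of p) (\<lambda>p. \<delta> + variance_of p)" (is ?eq)
    and "0 \<le> (\<integral>\<omega>. approx \<epsilon> \<omega> * approx \<delta> \<omega> \<partial>M)" (is ?nonneg)
proof -
  note i = mixture_inner_nn[OF finite_M finite_measure_weight_const[OF assms(1)] finite_measure_weight_const[OF assms(2)]
      cos_kernel_square_integrable[OF assms(1)] cos_kernel_square_integrable[OF assms(2)]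
      cos_kernel_square_integrable_section cos_kernel_inner]
  let ?I = "\<integral>\<omega>. (\<integral>z. cos_kernel \<omega> z \<partial>weight (\<lambda>_. \<epsilon>)) * (\<integral>z. cos_kernel \<omega> z \<partial>weight (\<lambda>_. \<delta>)) \<partial>M"
  have eq: "(\<integral>\<omega>. approx \<epsilon> \<omega> * approx \<delta> \<omega> \<partial>M) = fourier_const\<^sup>2 * ?I"
    unfolding approx_def by (subst integral_mult_right_zero[symmetric]) (simp only: power2_eq_square mult_ac)
  have "0 \<le> ?I" by (rule i(2)) simp
  then show ?nonneg unfolding eq by simp
  have "ennreal ?I = energy cosh (\<lambda>p. \<epsilon> + variance_of p) (\<lambda>p. \<delta> + variance_of p)"
    by (subst i(1), simp) (subst nn_integral_weight_weight, auto)
  then show ?eq unfolding eq using \<open>0 \<le> ?I\<close> by (simp add: ennreal_mult)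
qed

lemma approx_chaos_component_inner:
  assumes "\<epsilon> > 0"
  shows "ennreal (\<integral>\<omega>. approx \<epsilon> \<omega> * chaos_component n \<omega> \<partial>M) = ennreal (fourier_const\<^sup>2)
      * energy (even_exp_term n) (\<lambda>p. \<epsilon> + variance_of p) variance_of" (is ?eq)
    and "0 \<le> (\<integral>\<omega>. approx \<epsilon> \<omega> * chaos_component n \<omega> \<partial>M)" (is ?nonneg)
proof -
  note i = mixture_inner_nn[OF finite_M finite_measure_weight_const[OF assms(1)] finite_measure_weight_variance
      cos_kernel_square_integrable[OF assms(1)] chaos_kernel_square_integrable
      cos_kernel_square_integrable_section cos_kernel_chaos_kernel_inner]
  let ?I = "\<integral>\<omega>. (\<integral>z. cos_kernel \<omega> z \<partial>weight (\<lambda>_. \<epsilon>)) * (\<integral>z. chaos_kernel n \<omega> z \<partial>weight variance_of) \<partial>M"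
  have eq: "(\<integral>\<omega>. approx \<epsilon> \<omega> * chaos_component n \<omega> \<partial>M) = fourier_const\<^sup>2 * ?I"
    unfolding approx_def chaos_component_def by (subst integral_mult_right_zero[symmetric]) (simp only: power2_eq_square mult_ac)
  have "0 \<le> ?I" by (rule i(2)) (simp add: even_exp_term_nonneg)
  then show ?nonneg unfolding eq by simp
  have "ennreal ?I = energy (even_exp_term n) (\<lambda>p. \<epsilon> + variance_of p) (\<lambda>p. variance_of p + 0)"
    using nn_integral_weight_weight[of "even_exp_term n" "\<lambda>_. \<epsilon>" variance_of variance_of "\<lambda>_. 0"]
    by (subst i(1)) (simp_all add: even_exp_term_nonneg)
  then show ?eq unfolding eq using \<open>0 \<le> ?I\<close> by (simp add: ennreal_mult)
qed

lemma chaos_component_norm: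
  "ennreal (\<integral>\<omega>. (chaos_component n \<omega>)\<^sup>2 \<partial>M) = ennreal (fourier_const\<^sup>2) * energy (even_exp_term n) variance_of variance_of"
proof -
  note i = mixture_inner_nn[OF finite_M finite_measure_weight_variance finite_measure_weight_variance
      chaos_kernel_square_integrable chaos_kernel_square_integrable
      chaos_kernel_square_integrable_section chaos_kernel_inner]
  let ?I = "\<integral>\<omega>. (\<integral>z. chaos_kernel n \<omega> z \<partial>weight variance_of) * (\<integral>z. chaos_kernel n \<omega> z \<partial>weight variance_of) \<partial>M"
  have eq: "(\<integral>\<omega>. (chaos_component n \<omega>)\<^sup>2 \<partial>M) = fourier_const\<^sup>2 * ?I"
    unfolding chaos_component_def by (subst integral_mult_right_zero[symmetric]) (simp only: power2_eq_square mult_ac)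
  have "0 \<le> ?I" by (rule i(2)) (simp add: even_exp_term_nonneg)
  have "ennreal ?I = energy (even_exp_term n) (\<lambda>p. variance_of p + 0) (\<lambda>p. variance_of p + 0)"
    using nn_integral_weight_weight[of "even_exp_term n" variance_of variance_of "\<lambda>_. 0" "\<lambda>_. 0"]
    by (subst i(1)) (simp_all add: even_exp_term_nonneg)
  then show ?thesis unfolding eq using \<open>0 \<le> ?I\<close> by (simp add: ennreal_mult)
qed

text \<open>
  The limits along \<open>\<epsilon> \<rightarrow> 0\<close> are taken on this sequence, where monotone convergence applies, and extended to
  all \<open>\<epsilon>\<close> by monotonicity of the energies.
\<close>

definition \<epsilon>seq :: "nat \<Rightarrow> real" where "\<epsilon>seq k = inverse (real (Suc k))"

lemma \<epsilon>seq_pos: "0 < \<epsilon>seq k" by (simp add: \<epsilon>seq_def)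

lemma \<epsilon>seq_decseq: "decseq \<epsilon>seq"
  unfolding \<epsilon>seq_def by (intro decseq_SucI le_imp_inverse_le) auto

lemma \<epsilon>seq_at_right: "filterlim \<epsilon>seq (at_right 0) sequentially"
proof -
  have "\<epsilon>seq \<longlonglongrightarrow> 0" unfolding \<epsilon>seq_def[abs_def] by (rule LIMSEQ_inverse_real_of_nat)
  moreover have "\<epsilon>seq k \<noteq> 0" for k using \<epsilon>seq_pos[of k] by simp
  ultimately show ?thesis by (simp add: filterlim_at \<epsilon>seq_pos)
qed

lemma energy_\<epsilon>seq_tendsto:
  assumes "f \<in> borel_measurable borel" "\<And>x. 0 \<le> f x"
  shows "(\<lambda>k. energy f (\<lambda>p. \<epsilon>seq k + variance_of p) (\<lambda>p. \<epsilon>seq k + variance_of p)) \<longlonglongrightarrow> energy f variance_of variance_of"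
    and "(\<lambda>k. energy f (\<lambda>p. \<epsilon>seq k + variance_of p) variance_of) \<longlonglongrightarrow> energy f variance_of variance_of"
  using energy_tendsto[OF assms(1) _ _ assms(2), of variance_of variance_of 1 1]
    energy_tendsto[OF assms(1) _ _ assms(2), of variance_of variance_of 1 0]
  by (simp_all add: \<epsilon>seq_def add.commute)

lemma cmult_top_iff: "ennreal (fourier_const\<^sup>2) * x < \<infinity> \<longleftrightarrow> x < \<infinity>"
  using fourier_const_pos by (auto simp: ennreal_mult_less_top)

text \<open>
  Norms converge along with the approximations, and their squares increase to a multiple of the energy.
\<close>

theorem approx_converges_imp_energy_finite:
  assumes "L2_tendsto M approx L (at_right 0)"
  shows "energy cosh variance_of variance_of < \<infinity>"
    and "ennreal (\<integral>\<omega>. (L \<omega>)\<^sup>2 \<partial>M) = ennreal (fourier_const\<^sup>2) * energy cosh variance_of variance_of"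
proof -
  have "(\<lambda>k. \<integral>\<omega>. (approx (\<epsilon>seq k) \<omega>)\<^sup>2 \<partial>M) \<longlonglongrightarrow> (\<integral>\<omega>. (L \<omega>)\<^sup>2 \<partial>M)"
    using filterlim_compose[OF L2_tendsto_power2[OF assms] \<epsilon>seq_at_right] .
  then have "(\<lambda>k. ennreal (\<integral>\<omega>. (approx (\<epsilon>seq k) \<omega>)\<^sup>2 \<partial>M)) \<longlonglongrightarrow> ennreal (\<integral>\<omega>. (L \<omega>)\<^sup>2 \<partial>M)"
    by (rule tendsto_ennrealI)
  moreover have "(\<lambda>k. ennreal (\<integral>\<omega>. (approx (\<epsilon>seq k) \<omega>)\<^sup>2 \<partial>M)) \<longlonglongrightarrow>
      ennreal (fourier_const\<^sup>2) * energy cosh variance_of variance_of"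
    unfolding power2_eq_square[of "approx _ _"] approx_inner(1)[OF \<epsilon>seq_pos \<epsilon>seq_pos]
    by (intro ennreal_tendsto_cmult energy_\<epsilon>seq_tendsto) auto
  ultimately show eq: "ennreal (\<integral>\<omega>. (L \<omega>)\<^sup>2 \<partial>M) = ennreal (fourier_const\<^sup>2) * energy cosh variance_of variance_of"
    by (rule LIMSEQ_unique)
  show "energy cosh variance_of variance_of < \<infinity>"
    by (rule cmult_top_iff[THEN iffD1]) (simp add: eq[symmetric])
qed

text \<open>
  All inner products of approximations lie between the squared norm at the coarser level and the limiting
  energy \<open>q\<close>; hence approximations at levels below \<open>m\<close> differ by at most \<open>2 (q - b m m)\<close> in squared norm,
  which is the Cauchy property.
\<close>

theorem energy_finite_imp_approx_converges:
  assumes fin: "energy cosh variance_of variance_of < \<infinity>"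
  shows "\<exists>L. L2_tendsto M approx L (at_right 0)"
proof -
  define b where "b \<epsilon> \<delta> = (\<integral>\<omega>. approx \<epsilon> \<omega> * approx \<delta> \<omega> \<partial>M)" for \<epsilon> \<delta>
  have "ennreal (fourier_const\<^sup>2) * energy cosh variance_of variance_of < \<infinity>"
    using fin by (rule cmult_top_iff[THEN iffD2])
  then obtain q where q: "0 \<le> q" "ennreal (fourier_const\<^sup>2) * energy cosh variance_of variance_of = ennreal q"
    by (metis ennreal_cases infinity_ennreal_def less_irrefl)
  have b_le: "b \<epsilon>' \<delta>' \<le> b \<epsilon> \<delta>" if "0 < \<epsilon>" "\<epsilon> \<le> \<epsilon>'" "0 < \<delta>" "\<delta> \<le> \<delta>'" for \<epsilon> \<epsilon>' \<delta> \<delta>'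
  proof -
    have "ennreal (b \<epsilon>' \<delta>') \<le> ennreal (b \<epsilon> \<delta>)"
      unfolding b_def using that by (simp add: approx_inner(1) energy_antimono mult_left_mono)
    moreover have "0 \<le> b \<epsilon> \<delta>" unfolding b_def using that by (intro approx_inner(2)) auto
    ultimately show ?thesis by (simp add: ennreal_le_iff)
  qed
  have b_q: "b \<epsilon> \<delta> \<le> q" if "0 < \<epsilon>" "0 < \<delta>" for \<epsilon> \<delta>
  proof -
    have "ennreal (b \<epsilon> \<delta>) \<le> ennreal q"
      unfolding b_def q(2)[symmetric] approx_inner(1)[OF that]
      using that by (intro mult_left_mono energy_antimono) auto
    then show ?thesis using q(1) by (simp add: ennreal_le_iff)
  qed
  have b_lim: "(\<lambda>k. b (\<epsilon>seq k) (\<epsilon>seq k)) \<longlonglongrightarrow> q"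
  proof -
    have "(\<lambda>k. ennreal (b (\<epsilon>seq k) (\<epsilon>seq k))) \<longlonglongrightarrow> ennreal q"
      unfolding b_def q(2)[symmetric] approx_inner(1)[OF \<epsilon>seq_pos \<epsilon>seq_pos]
      by (intro ennreal_tendsto_cmult energy_\<epsilon>seq_tendsto) auto
    then show ?thesis
      by (rule tendsto_ennrealD) (auto simp: q b_def intro!: always_eventually approx_inner(2) \<epsilon>seq_pos)
  qed
  have diff: "(\<integral>\<omega>. (approx \<epsilon> \<omega> - approx \<delta> \<omega>)\<^sup>2 \<partial>M) = b \<epsilon> \<epsilon> - 2 * b \<epsilon> \<delta> + b \<delta> \<delta>" if "0 < \<epsilon>" "0 < \<delta>" for \<epsilon> \<delta>
    using integral_power2_diff[OF approx_square_integrable[OF that(1)] approx_square_integrable[OF that(2)]]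
    by (simp add: b_def power2_eq_square)
  have diff_le: "(\<integral>\<omega>. (approx \<epsilon> \<omega> - approx \<delta> \<omega>)\<^sup>2 \<partial>M) \<le> 2 * (q - b m m)"
    if "0 < \<epsilon>" "\<epsilon> \<le> m" "0 < \<delta>" "\<delta> \<le> m" for \<epsilon> \<delta> m
  proof -
    have "b \<epsilon> \<epsilon> \<le> q" "b \<delta> \<delta> \<le> q" using that b_q by auto
    moreover have "b m m \<le> b \<epsilon> \<delta>" using that by (intro b_le)
    ultimately show ?thesis unfolding diff[OF that(1,3)] by simp
  qed
  have small: "\<exists>k. 2 * (q - b (\<epsilon>seq k) (\<epsilon>seq k)) < e" if "e > 0" for e
  proof -
    have "\<forall>\<^sub>F k in sequentially. q - e / 2 < b (\<epsilon>seq k) (\<epsilon>seq k)"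
      using b_lim that by (intro order_tendstoD) auto
    then show ?thesis by (auto simp: eventually_sequentially) (smt (verit) field_sum_of_halves order_refl)
  qed
  have "\<exists>L. L2_tendsto M (\<lambda>k. approx (\<epsilon>seq k)) L sequentially"
  proof (rule L2_complete)
    fix e :: real assume "e > 0"
    then obtain k where k: "2 * (q - b (\<epsilon>seq k) (\<epsilon>seq k)) < e" using small by blast
    have "(\<integral>\<omega>. (approx (\<epsilon>seq i) \<omega> - approx (\<epsilon>seq j) \<omega>)\<^sup>2 \<partial>M) < e" if "i \<ge> k" "j \<ge> k" for i j
      by (rule le_less_trans[OF diff_le k]) (use that \<epsilon>seq_pos decseqD[OF \<epsilon>seq_decseq] in auto)
    then show "\<exists>K. \<forall>m\<ge>K. \<forall>n\<ge>K. (\<integral>x. (approx (\<epsilon>seq m) x - approx (\<epsilon>seq n) x)\<^sup>2 \<partial>M) < e" by blast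
  qed (unfold_locales, rule approx_square_integrable[OF \<epsilon>seq_pos])
  then obtain L where L: "L2_tendsto M (\<lambda>k. approx (\<epsilon>seq k)) L sequentially" by blast
  have sqL: "square_integrable M L" using L by (simp add: L2_tendsto_def)
  have "((\<lambda>\<epsilon>. \<integral>\<omega>. (approx \<epsilon> \<omega> - L \<omega>)\<^sup>2 \<partial>M) \<longlongrightarrow> 0) (at_right 0)"
  proof (rule tendstoI)
    fix e :: real assume "e > 0"
    then obtain k where k: "2 * (q - b (\<epsilon>seq k) (\<epsilon>seq k)) < e" using small by blast
    have "(\<integral>\<omega>. (approx \<epsilon> \<omega> - L \<omega>)\<^sup>2 \<partial>M) < e" if \<epsilon>: "0 < \<epsilon>" "\<epsilon> \<le> \<epsilon>seq k" for \<epsilon>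
    proof -
      note sq = approx_square_integrable[OF \<epsilon>(1)]
      have "(\<lambda>j. (\<integral>\<omega>. (approx (\<epsilon>seq j) \<omega>)\<^sup>2 \<partial>M) - 2 * (\<integral>\<omega>. approx (\<epsilon>seq j) \<omega> * approx \<epsilon> \<omega> \<partial>M) + (\<integral>\<omega>. (approx \<epsilon> \<omega>)\<^sup>2 \<partial>M))
          \<longlonglongrightarrow> (\<integral>\<omega>. (L \<omega>)\<^sup>2 \<partial>M) - 2 * (\<integral>\<omega>. L \<omega> * approx \<epsilon> \<omega> \<partial>M) + (\<integral>\<omega>. (approx \<epsilon> \<omega>)\<^sup>2 \<partial>M)"
        by (intro tendsto_intros L2_tendsto_power2[OF L] L2_tendsto_inner[OF L] sq)
      then have lim: "(\<lambda>j. \<integral>\<omega>. (approx (\<epsilon>seq j) \<omega> - approx \<epsilon> \<omega>)\<^sup>2 \<partial>M) \<longlonglongrightarrow> (\<integral>\<omega>. (L \<omega> - approx \<epsilon> \<omega>)\<^sup>2 \<partial>M)"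
        by (simp only: integral_power2_diff[OF approx_square_integrable[OF \<epsilon>seq_pos] sq] integral_power2_diff[OF sqL sq])
      have "(\<integral>\<omega>. (L \<omega> - approx \<epsilon> \<omega>)\<^sup>2 \<partial>M) \<le> 2 * (q - b (\<epsilon>seq k) (\<epsilon>seq k))"
      proof (rule LIMSEQ_le_const2[OF lim], intro exI[of _ k] allI impI)
        fix j assume "k \<le> j"
        then show "(\<integral>\<omega>. (approx (\<epsilon>seq j) \<omega> - approx \<epsilon> \<omega>)\<^sup>2 \<partial>M) \<le> 2 * (q - b (\<epsilon>seq k) (\<epsilon>seq k))"
          using \<epsilon> \<epsilon>seq_pos decseqD[OF \<epsilon>seq_decseq] by (intro diff_le) auto
      qed
      also have "\<dots> < e" by (rule k)
      finally show ?thesis by (simp add: power2_commute)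
    qed
    moreover have "\<forall>\<^sub>F \<epsilon> in at_right 0. 0 < \<epsilon> \<and> \<epsilon> \<le> \<epsilon>seq k"
      using \<epsilon>seq_pos[of k] by (auto simp: eventually_at_right_field intro!: exI[of _ "\<epsilon>seq k"])
    ultimately show "\<forall>\<^sub>F \<epsilon> in at_right 0. dist (\<integral>\<omega>. (approx \<epsilon> \<omega> - L \<omega>)\<^sup>2 \<partial>M) 0 < e"
      by (auto elim!: eventually_mono)
  qed
  moreover have "\<forall>\<^sub>F \<epsilon> in at_right 0. square_integrable M (approx \<epsilon>)"
    by (auto simp: eventually_at_right_field intro!: exI[of _ 1] approx_square_integrable)
  ultimately show ?thesis using sqL by (auto simp: L2_tendsto_def)
qed

text \<open>
  Inner products of the approximations with a component converge to the squared norm of that component, and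
  the squared norms add up to that of the limit because \<open>cosh\<close> is the sum of its Taylor series.
\<close>

theorem approx_limit_chaos_expansion:
  assumes L: "L2_tendsto M approx L (at_right 0)"
  shows "chaos_expansion M X L chaos_component"
proof (rule chaos_expansionI[OF chaos_component_in_chaos])
  show "square_integrable M L" using L by (simp add: L2_tendsto_def)
  show inner: "(\<integral>\<omega>. L \<omega> * chaos_component n \<omega> \<partial>M) = (\<integral>\<omega>. (chaos_component n \<omega>)\<^sup>2 \<partial>M)" for n
  proof -
    have lim: "(\<lambda>k. \<integral>\<omega>. approx (\<epsilon>seq k) \<omega> * chaos_component n \<omega> \<partial>M) \<longlonglongrightarrow> (\<integral>\<omega>. L \<omega> * chaos_component n \<omega> \<partial>M)"
      using filterlim_compose[OF L2_tendsto_inner[OF L chaos_component_square_integrable] \<epsilon>seq_at_right] .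
    have "(\<lambda>k. ennreal (\<integral>\<omega>. approx (\<epsilon>seq k) \<omega> * chaos_component n \<omega> \<partial>M)) \<longlonglongrightarrow> ennreal (\<integral>\<omega>. (chaos_component n \<omega>)\<^sup>2 \<partial>M)"
      unfolding chaos_component_norm approx_chaos_component_inner(1)[OF \<epsilon>seq_pos]
      by (intro ennreal_tendsto_cmult energy_\<epsilon>seq_tendsto) (auto simp: even_exp_term_nonneg)
    then have "(\<lambda>k. \<integral>\<omega>. approx (\<epsilon>seq k) \<omega> * chaos_component n \<omega> \<partial>M) \<longlonglongrightarrow> (\<integral>\<omega>. (chaos_component n \<omega>)\<^sup>2 \<partial>M)"
      by (rule tendsto_ennrealD) (auto intro!: always_eventually approx_chaos_component_inner(2) \<epsilon>seq_pos)
    with lim show ?thesis by (rule LIMSEQ_unique)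
  qed
  have "(\<Sum>n. ennreal (\<integral>\<omega>. (chaos_component n \<omega>)\<^sup>2 \<partial>M)) = ennreal (fourier_const\<^sup>2) * energy cosh variance_of variance_of"
    unfolding chaos_component_norm ennreal_suminf_cmult
    by (subst energy_suminf[of even_exp_term _ _ cosh]) (auto simp: even_exp_term_nonneg even_exp_term_sums_cosh)
  also have "\<dots> = ennreal (\<integral>\<omega>. (L \<omega>)\<^sup>2 \<partial>M)"
    by (rule approx_converges_imp_energy_finite(2)[OF L, symmetric])
  finally have "(\<lambda>n. ennreal (\<integral>\<omega>. (chaos_component n \<omega>)\<^sup>2 \<partial>M)) sums ennreal (\<integral>\<omega>. (L \<omega>)\<^sup>2 \<partial>M)"
    using summable_sums[OF summableI, of "\<lambda>n. ennreal (\<integral>\<omega>. (chaos_component n \<omega>)\<^sup>2 \<partial>M)"] by simp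
  then show "(\<lambda>n. \<integral>\<omega>. (chaos_component n \<omega>)\<^sup>2 \<partial>M) sums (\<integral>\<omega>. (L \<omega>)\<^sup>2 \<partial>M)"
    by (subst (asm) sums_ennreal) auto
qed

text \<open>
  The weights \<open>n\<close> turn the Taylor series of \<open>cosh x\<close> into that of \<open>x sinh x\<close>.
\<close>

theorem approx_limit_in_D1_iff:
  assumes L: "L2_tendsto M approx L (at_right 0)"
  shows "L \<in> D1 M X \<longleftrightarrow> energy (\<lambda>x. x * sinh x) variance_of variance_of < \<infinity>"
proof -
  let ?a = "\<lambda>n. real n * (\<integral>\<omega>. (chaos_component n \<omega>)\<^sup>2 \<partial>M)"
  note exp = approx_limit_chaos_expansion[OF L]
  have sq: "square_integrable M L" using L by (simp add: L2_tendsto_def)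
  have "L \<in> D1 M X \<longleftrightarrow> summable ?a"
  proof
    assume "L \<in> D1 M X"
    then obtain F where F: "chaos_expansion M X L F" "summable (\<lambda>n. real n * (\<integral>\<omega>. \<bar>F n \<omega>\<bar>\<^sup>2 \<partial>M))"
      by (auto simp: D1_def)
    then show "summable ?a" using chaos_expansion_unique_norm[OF F(1) exp] by simp
  next
    assume "summable ?a"
    then show "L \<in> D1 M X" using sq exp by (auto simp: D1_def intro!: exI[of _ chaos_component])
  qed
  also have "\<dots> \<longleftrightarrow> (\<Sum>n. ennreal (?a n)) < \<infinity>"
  proof
    show "summable ?a \<Longrightarrow> (\<Sum>n. ennreal (?a n)) < \<infinity>"
      by (subst suminf_ennreal2) auto
    show "(\<Sum>n. ennreal (?a n)) < \<infinity> \<Longrightarrow> summable ?a"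
      by (rule summable_suminf_not_top) auto
  qed
  also have "(\<Sum>n. ennreal (?a n)) = ennreal (fourier_const\<^sup>2) * energy (\<lambda>x. x * sinh x) variance_of variance_of"
  proof -
    have e: "energy (\<lambda>x. real n * even_exp_term n x) variance_of variance_of
        = ennreal (real n) * energy (even_exp_term n) variance_of variance_of" for n
    proof -
      have "gauss2 TYPE('d) (\<lambda>x. real n * even_exp_term n x) A B s = ennreal (real n) * gauss2 TYPE('d) (even_exp_term n) A B s" for A B s
        by (rule gauss2_scale) (auto simp: even_exp_term_nonneg)
      then have "energy (\<lambda>x. real n * even_exp_term n x) variance_of variance_of
          = (\<integral>\<^sup>+p. indicator E p * (\<integral>\<^sup>+q. ennreal (real n) * (indicator E q * gauss2 TYPE('d) (even_exp_term n) (variance_of p) (variance_of q) (R p q)) \<partial>lborel) \<partial>lborel)"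
        unfolding energy_def by (simp only: mult.left_commute)
      also have "\<dots> = (\<integral>\<^sup>+p. ennreal (real n) * (indicator E p * (\<integral>\<^sup>+q. indicator E q * gauss2 TYPE('d) (even_exp_term n) (variance_of p) (variance_of q) (R p q) \<partial>lborel)) \<partial>lborel)"
        by (subst nn_integral_cmult, measurable) (simp only: mult.left_commute)
      also have "\<dots> = ennreal (real n) * energy (even_exp_term n) variance_of variance_of"
        unfolding energy_def by (rule nn_integral_cmult) measurable
      finally show ?thesis .
    qed
    have "(\<Sum>n. ennreal (?a n)) = (\<Sum>n. ennreal (fourier_const\<^sup>2) * energy (\<lambda>x. real n * even_exp_term n x) variance_of variance_of)"
      by (intro suminf_cong) (simp only: ennreal_mult' of_nat_0_le_iff chaos_component_norm e mult.left_commute)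
    also have "\<dots> = ennreal (fourier_const\<^sup>2) * energy (\<lambda>x. x * sinh x) variance_of variance_of"
      unfolding ennreal_suminf_cmult
      by (subst energy_suminf[of "\<lambda>n x. real n * even_exp_term n x" _ _ "\<lambda>x. x * sinh x"])
        (auto simp: even_exp_term_nonneg even_exp_term_sums_sinh)
    finally show ?thesis .
  qed
  finally show ?thesis by (simp only: cmult_top_iff)
qed

end

section \<open>Independent copies of a scalar Gaussian field\<close>

lemma gaussian_rv_affine:
  assumes "prob_space M" "gaussian_rv M Y"
  shows "\<exists>\<mu> \<sigma>. distr M borel Y = distr std_normal_distribution borel (\<lambda>x. \<mu> + \<sigma> * x)"
proof -
  interpret prob_space M by fact
  interpret N: prob_space std_normal_distribution
    by (rule prob_space_normal_density) simp
  have Y[measurable]: "Y \<in> borel_measurable M" using assms(2) by (simp add: gaussian_rv_def)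
  obtain \<mu> \<sigma> where s: "0 \<le> \<sigma>"
    and d: "if \<sigma> = 0 then AE \<omega> in M. Y \<omega> = \<mu> else distributed M lborel Y (normal_density \<mu> \<sigma>)"
    using assms(2) by (auto simp: gaussian_rv_def)
  show ?thesis
  proof (cases "\<sigma> = 0")
    case True
    then have "distr M borel Y = distr M borel (\<lambda>_. \<mu>)"
      using d by (intro distr_cong_AE) auto
    then show ?thesis by (intro exI[of _ \<mu>] exI[of _ 0]) simp
  next
    case False
    let ?Z = "\<lambda>\<omega>. (Y \<omega> - \<mu>) / \<sigma>"
    have "distributed M lborel Y (normal_density \<mu> \<sigma>)" using d False by simp
    then have "distributed M lborel ?Z std_normal_density"
      using normal_standard_normal_convert[of \<sigma> Y \<mu>] s False by simp
    then have "distr M lborel ?Z = std_normal_distribution" by (simp add: distributed_def)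
    moreover have "distr M lborel ?Z = distr M borel ?Z" by (rule distr_cong) auto
    ultimately have Z: "distr M borel ?Z = std_normal_distribution" by simp
    have "distr M borel Y = distr M borel ((\<lambda>x. \<mu> + \<sigma> * x) \<circ> ?Z)"
      using False by (intro distr_cong) auto
    also have "\<dots> = distr (distr M borel ?Z) borel (\<lambda>x. \<mu> + \<sigma> * x)"
      by (rule distr_distr[symmetric]) auto
    finally show ?thesis unfolding Z by blast
  qed
qed

lemma gaussian_rv_integrable:
  assumes "prob_space M" "gaussian_rv M Y"
  shows "integrable M Y"
proof -
  have [measurable]: "Y \<in> borel_measurable M" using assms(2) by (simp add: gaussian_rv_def)
  obtain \<mu> \<sigma> where d: "distr M borel Y = distr std_normal_distribution borel (\<lambda>x. \<mu> + \<sigma> * x)"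
    using gaussian_rv_affine[OF assms] by blast
  interpret N: prob_space std_normal_distribution
    by (rule prob_space_normal_density) simp
  have "integrable std_normal_distribution (\<lambda>x. \<mu> + \<sigma> * x)"
    using integrable_std_normal_distribution_moment[of 1] by simp
  then have "integrable (distr std_normal_distribution borel (\<lambda>x. \<mu> + \<sigma> * x)) (\<lambda>x. x)"
    by (subst integrable_distr_eq) auto
  then have "integrable (distr M borel Y) (\<lambda>x. x)" by (simp add: d)
  then show ?thesis by (subst (asm) integrable_distr_eq) auto
qed

lemma gaussian_rv_centered:
  assumes "prob_space M" "gaussian_rv M Y" "(\<integral>\<omega>. Y \<omega> \<partial>M) = 0"
  shows "\<exists>\<sigma>. distr M borel Y = distr std_normal_distribution borel (\<lambda>x. \<sigma> * x)"
proof -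
  have [measurable]: "Y \<in> borel_measurable M" using assms(2) by (simp add: gaussian_rv_def)
  interpret N: prob_space std_normal_distribution
    by (rule prob_space_normal_density) simp
  obtain \<mu> \<sigma> where d: "distr M borel Y = distr std_normal_distribution borel (\<lambda>x. \<mu> + \<sigma> * x)"
    using gaussian_rv_affine[OF assms(1,2)] by blast
  have "0 = (\<integral>x. x \<partial>distr M borel Y)" by (subst integral_distr) (auto simp: assms(3))
  also have "\<dots> = (\<integral>x. \<mu> + \<sigma> * x \<partial>std_normal_distribution)" unfolding d by (subst integral_distr) auto
  also have "\<dots> = \<mu>"
    using integrable_std_normal_distribution_moment[of 1] integral_std_normal_distribution_moment_odd[of 1] N.prob_space
    by simp
  finally show ?thesis using d by auto
qed

locale iid_gaussian_field = S: prob_space M0 + prob_space M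
  for M0 :: "'v measure" and X0 :: "'t \<Rightarrow> 'v \<Rightarrow> real"
    and M :: "'w measure" and X :: "'t \<Rightarrow> 'w \<Rightarrow> real ^ 'd::finite" +
  assumes gaussian: "gaussian_field M0 X0" and centered: "centered_field M0 X0"
    and copies: "independent_copies M0 X0 M X"
begin

text \<open>
  The span of the scalar field, as the span of a field with values in one-dimensional vectors.
\<close>

definition scalar_span :: "('v \<Rightarrow> real) set" where
  "scalar_span = linear_span (\<lambda>t \<omega>. (\<chi> i::1. X0 t \<omega>))"

lemma scalar_spanI: "finite T \<Longrightarrow> (\<lambda>\<omega>. \<Sum>t\<in>T. c t * X0 t \<omega>) \<in> scalar_span"
  unfolding scalar_span_def by (rule linear_spanI[of T _ "\<lambda>_. c"]) (simp_all add: UNIV_1)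

lemma scalar_spanE:
  assumes "Y \<in> scalar_span"
  obtains T c where "finite T" "Y = (\<lambda>\<omega>. \<Sum>t\<in>T. c t * X0 t \<omega>)"
proof -
  obtain T c where "finite T" "Y = (\<lambda>\<omega>. \<Sum>i\<in>(UNIV::1 set). \<Sum>t\<in>T. c i t * (\<chi> i::1. X0 t \<omega>) $ i)"
    using assms unfolding scalar_span_def by (rule linear_spanE)
  then show ?thesis using that[of T "c 1"] by (simp add: UNIV_1)
qed

lemma X0_in_scalar_span: "X0 t \<in> scalar_span"
  using scalar_spanI[of "{t}" "\<lambda>_. 1"] by simp

lemma gaussian_rv_combination: "finite T \<Longrightarrow> gaussian_rv M0 (\<lambda>\<omega>. \<Sum>t\<in>T. c t * X0 t \<omega>)"
  using gaussian by (auto simp: gaussian_field_def)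

lemma gaussian_rv_X0: "gaussian_rv M0 (X0 t)"
  using gaussian_rv_combination[of "{t}" "\<lambda>_. 1"] by simp

lemma X0_measurable [measurable]: "X0 t \<in> borel_measurable M0"
  using gaussian_rv_X0 by (simp add: gaussian_rv_def)

sublocale S: gaussian_space M0 scalar_span
proof
  show "Y \<in> scalar_span \<Longrightarrow> Z \<in> scalar_span \<Longrightarrow> (\<lambda>\<omega>. Y \<omega> + Z \<omega>) \<in> scalar_span" for Y Z
    unfolding scalar_span_def by (rule linear_span_add)
  show "Y \<in> scalar_span \<Longrightarrow> (\<lambda>\<omega>. c * Y \<omega>) \<in> scalar_span" for Y c
    unfolding scalar_span_def by (rule linear_span_scale)
  show "Y \<in> borel_measurable M0" if "Y \<in> scalar_span" for Y
    using that by (elim scalar_spanE) simp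
  show "\<exists>\<sigma>. distr M0 borel Y = distr std_normal_distribution borel (\<lambda>x. \<sigma> * x)" if Y: "Y \<in> scalar_span" for Y
  proof -
    obtain T c where T: "finite T" "Y = (\<lambda>\<omega>. \<Sum>t\<in>T. c t * X0 t \<omega>)"
      using Y by (rule scalar_spanE)
    have "(\<integral>\<omega>. Y \<omega> \<partial>M0) = (\<Sum>t\<in>T. c t * (\<integral>\<omega>. X0 t \<omega> \<partial>M0))"
      unfolding T(2) by (subst Bochner_Integration.integral_sum)
        (auto intro: gaussian_rv_integrable[OF S.prob_space_axioms gaussian_rv_X0])
    also have "\<dots> = 0" using centered by (simp add: centered_field_def)
    finally show ?thesis
      using gaussian_rv_centered[OF S.prob_space_axioms gaussian_rv_combination[OF T(1)]] T(2) by simp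
  qed
qed

lemma X_indep: "indep_vars (\<lambda>_. PiM UNIV (\<lambda>_. borel)) (\<lambda>i \<omega> t. X t \<omega> $ i) UNIV"
  using copies by (simp add: independent_copies_def)

lemma X_distr: "distr M (PiM UNIV (\<lambda>_. borel)) (\<lambda>\<omega> t. X t \<omega> $ i) = distr M0 (PiM UNIV (\<lambda>_. borel)) (\<lambda>\<omega> t. X0 t \<omega>)"
  using copies by (simp add: independent_copies_def)

lemma X_coordinate_process_measurable [measurable]:
  "(\<lambda>\<omega> t. X t \<omega> $ i) \<in> M \<rightarrow>\<^sub>M PiM UNIV (\<lambda>_. borel)"
  using X_indep by (simp add: indep_vars_def)

lemma X_coordinate_measurable [measurable]: "(\<lambda>\<omega>. X t \<omega> $ i) \<in> borel_measurable M"
  using measurable_compose[OF X_coordinate_process_measurable measurable_component_singleton[of t UNIV]] by simp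

lemma X0_process_measurable [measurable]: "(\<lambda>\<omega> t. X0 t \<omega>) \<in> M0 \<rightarrow>\<^sub>M PiM UNIV (\<lambda>_. borel)"
  by (rule measurable_PiM_single') auto

lemma X_measurable [measurable]: "X t \<in> borel_measurable M"
  by (subst borel_measurable_euclidean_space) (auto simp: Basis_vec_def inner_axis)

lemma expectation_coordinate:
  fixes f :: "('t \<Rightarrow> real) \<Rightarrow> 'b::{banach, second_countable_topology}"
  assumes [measurable]: "f \<in> borel_measurable (PiM UNIV (\<lambda>_. borel))"
  shows "(\<integral>\<omega>. f (\<lambda>t. X t \<omega> $ i) \<partial>M) = (\<integral>\<omega>. f (\<lambda>t. X0 t \<omega>) \<partial>M0)"
    and "integrable M (\<lambda>\<omega>. f (\<lambda>t. X t \<omega> $ i)) \<longleftrightarrow> integrable M0 (\<lambda>\<omega>. f (\<lambda>t. X0 t \<omega>))"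
proof -
  have "(\<integral>\<omega>. f (\<lambda>t. X t \<omega> $ i) \<partial>M) = integral\<^sup>L (distr M (PiM UNIV (\<lambda>_. borel)) (\<lambda>\<omega> t. X t \<omega> $ i)) f"
    by (subst integral_distr) auto
  also have "\<dots> = (\<integral>\<omega>. f (\<lambda>t. X0 t \<omega>) \<partial>M0)"
    unfolding X_distr by (subst integral_distr) auto
  finally show "(\<integral>\<omega>. f (\<lambda>t. X t \<omega> $ i) \<partial>M) = (\<integral>\<omega>. f (\<lambda>t. X0 t \<omega>) \<partial>M0)" .
  have "integrable M (\<lambda>\<omega>. f (\<lambda>t. X t \<omega> $ i)) \<longleftrightarrow> integrable (distr M (PiM UNIV (\<lambda>_. borel)) (\<lambda>\<omega> t. X t \<omega> $ i)) f"
    by (subst integrable_distr_eq) auto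
  also have "\<dots> \<longleftrightarrow> integrable M0 (\<lambda>\<omega>. f (\<lambda>t. X0 t \<omega>))"
    unfolding X_distr by (subst integrable_distr_eq) auto
  finally show "integrable M (\<lambda>\<omega>. f (\<lambda>t. X t \<omega> $ i)) \<longleftrightarrow> integrable M0 (\<lambda>\<omega>. f (\<lambda>t. X0 t \<omega>))" .
qed

text \<open>
  Independence factorises the characteristic function over the coordinates, and each factor is that of the
  scalar field.
\<close>

lemma linear_span_charfun:
  assumes T: "finite T"
  shows "(\<integral>\<omega>. exp (\<i> * of_real (\<tau> * (\<Sum>i\<in>UNIV. \<Sum>t\<in>T. c i t * X t \<omega> $ i))) \<partial>M)
    = of_real (exp (- \<tau>\<^sup>2 * (\<Sum>i\<in>UNIV. \<integral>\<omega>. (\<Sum>t\<in>T. c i t * X0 t \<omega>)\<^sup>2 \<partial>M0) / 2))"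
proof -
  let ?f = "\<lambda>i (g::'t \<Rightarrow> real). exp (\<i> * of_real (\<tau> * (\<Sum>t\<in>T. c i t * g t))) :: complex"
  have fm[measurable]: "?f i \<in> borel_measurable (PiM UNIV (\<lambda>_. borel))" for i by measurable
  have ind: "indep_vars (\<lambda>_. borel) (\<lambda>i \<omega>. ?f i (\<lambda>t. X t \<omega> $ i)) UNIV"
    by (rule indep_vars_compose2[OF X_indep]) (rule fm)
  have int: "integrable M (\<lambda>\<omega>. ?f i (\<lambda>t. X t \<omega> $ i))" for i
    by (rule integrable_const_bound[of _ 1]) auto
  have "(\<integral>\<omega>. exp (\<i> * of_real (\<tau> * (\<Sum>i\<in>UNIV. \<Sum>t\<in>T. c i t * X t \<omega> $ i))) \<partial>M)
      = (\<integral>\<omega>. (\<Prod>i\<in>UNIV. ?f i (\<lambda>t. X t \<omega> $ i)) \<partial>M)"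
    by (simp add: exp_sum[symmetric] sum_distrib_left)
  also have "\<dots> = (\<Prod>i\<in>UNIV. \<integral>\<omega>. ?f i (\<lambda>t. X t \<omega> $ i) \<partial>M)"
    by (rule indep_vars_lebesgue_integral[OF finite ind int])
  also have "\<dots> = (\<Prod>i\<in>UNIV. of_real (exp (- \<tau>\<^sup>2 * (\<integral>\<omega>. (\<Sum>t\<in>T. c i t * X0 t \<omega>)\<^sup>2 \<partial>M0) / 2)))"
  proof (intro prod.cong refl)
    fix i
    have "(\<integral>\<omega>. ?f i (\<lambda>t. X t \<omega> $ i) \<partial>M) = (\<integral>\<omega>. ?f i (\<lambda>t. X0 t \<omega>) \<partial>M0)"
      by (rule expectation_coordinate(1)) measurable
    also have "\<dots> = of_real (exp (- (\<integral>\<omega>. (\<tau> * (\<Sum>t\<in>T. c i t * X0 t \<omega>))\<^sup>2 \<partial>M0) / 2))"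
      by (rule S.charfun_G[OF S.scale[OF scalar_spanI[OF T]]])
    also have "(\<integral>\<omega>. (\<tau> * (\<Sum>t\<in>T. c i t * X0 t \<omega>))\<^sup>2 \<partial>M0) = \<tau>\<^sup>2 * (\<integral>\<omega>. (\<Sum>t\<in>T. c i t * X0 t \<omega>)\<^sup>2 \<partial>M0)"
      unfolding power_mult_distrib by (rule integral_mult_right_zero)
    finally show "(\<integral>\<omega>. ?f i (\<lambda>t. X t \<omega> $ i) \<partial>M) = of_real (exp (- \<tau>\<^sup>2 * (\<integral>\<omega>. (\<Sum>t\<in>T. c i t * X0 t \<omega>)\<^sup>2 \<partial>M0) / 2))"
      by simp
  qed
  also have "\<dots> = of_real (exp (\<Sum>i\<in>UNIV. - \<tau>\<^sup>2 * (\<integral>\<omega>. (\<Sum>t\<in>T. c i t * X0 t \<omega>)\<^sup>2 \<partial>M0) / 2))"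
    by (simp only: of_real_prod exp_sum finite)
  also have "(\<Sum>i\<in>UNIV. - \<tau>\<^sup>2 * (\<integral>\<omega>. (\<Sum>t\<in>T. c i t * X0 t \<omega>)\<^sup>2 \<partial>M0) / 2)
      = - \<tau>\<^sup>2 * (\<Sum>i\<in>UNIV. \<integral>\<omega>. (\<Sum>t\<in>T. c i t * X0 t \<omega>)\<^sup>2 \<partial>M0) / 2"
    by (simp add: sum_distrib_left sum_divide_distrib sum_negf)
  finally show ?thesis .
qed

sublocale gaussian_coordinates M X
proof
  show "(\<lambda>\<omega>. Y \<omega> + Z \<omega>) \<in> linear_span X" if "Y \<in> linear_span X" "Z \<in> linear_span X" for Y Z
    using that by (rule linear_span_add)
  show "(\<lambda>\<omega>. c * Y \<omega>) \<in> linear_span X" if "Y \<in> linear_span X" for Y c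
    using that by (rule linear_span_scale)
  show Ym: "Y \<in> borel_measurable M" if "Y \<in> linear_span X" for Y
    using that by (elim linear_spanE) simp
  show "\<exists>\<sigma>. distr M borel Y = distr std_normal_distribution borel (\<lambda>x. \<sigma> * x)" if Y: "Y \<in> linear_span X" for Y
  proof -
    obtain T c where T: "finite T" "Y = (\<lambda>\<omega>. \<Sum>i\<in>UNIV. \<Sum>t\<in>T. c i t * X t \<omega> $ i)"
      using Y by (rule linear_spanE)
    note [measurable] = Ym[OF Y]
    interpret N: prob_space std_normal_distribution
      by (rule prob_space_normal_density) simp
    define v where "v = (\<Sum>i\<in>UNIV. \<integral>\<omega>. (\<Sum>t\<in>T. c i t * X0 t \<omega>)\<^sup>2 \<partial>M0)"
    have v: "0 \<le> v" unfolding v_def by (intro sum_nonneg) simp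
    have m: "(\<lambda>x. sqrt v * x) \<in> borel_measurable std_normal_distribution" by simp
    have "distr M borel Y = distr std_normal_distribution borel (\<lambda>x. sqrt v * x)"
    proof (rule Levy_uniqueness)
      show "real_distribution (distr M borel Y)" by (intro real_distribution_distr) simp
      show "real_distribution (distr std_normal_distribution borel (\<lambda>x. sqrt v * x))"
        by (intro N.real_distribution_distr m)
      show "char (distr M borel Y) = char (distr std_normal_distribution borel (\<lambda>x. sqrt v * x))"
      proof
        fix \<tau>
        have "char (distr M borel Y) \<tau> = (\<integral>\<omega>. exp (\<i> * of_real (\<tau> * Y \<omega>)) \<partial>M)"
          unfolding char_def by (subst integral_distr) auto
        also have "\<dots> = of_real (exp (- \<tau>\<^sup>2 * v / 2))"
          unfolding T(2) v_def by (rule linear_span_charfun[OF T(1)])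
        also have "- \<tau>\<^sup>2 * v / 2 = - (\<tau> * sqrt v)\<^sup>2 / 2" using v by (simp add: power_mult_distrib)
        also have "of_real (exp (- (\<tau> * sqrt v)\<^sup>2 / 2)) = char std_normal_distribution (\<tau> * sqrt v)"
          by (simp only: char_std_normal_distribution)
        also have "\<dots> = char (distr std_normal_distribution borel (\<lambda>x. sqrt v * x)) \<tau>"
          unfolding char_def by (subst integral_distr[OF m]) (auto simp: mult.assoc)
        finally show "char (distr M borel Y) \<tau> = char (distr std_normal_distribution borel (\<lambda>x. sqrt v * x)) \<tau>" .
      qed
    qed
    then show ?thesis by blast
  qed
qed

lemma X_coordinate_square_integrable: "square_integrable M (\<lambda>\<omega>. X t \<omega> $ i)"
  by (rule G_square_integrable[OF linear_span_coordinate])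

lemma covariance_coordinates:
  "(\<integral>\<omega>. X s \<omega> $ i * X t \<omega> $ j \<partial>M) = (if i = j then (\<integral>\<omega>. X0 s \<omega> * X0 t \<omega> \<partial>M0) else 0)"
proof (cases "i = j")
  case True
  then show ?thesis using expectation_coordinate(1)[of "\<lambda>g. g s * g t" j] by simp
next
  case False
  define f where "f k (g::'t \<Rightarrow> real) = (if k = i then g s else g t)" for k :: 'd and g
  have fm: "f k \<in> borel_measurable (PiM UNIV (\<lambda>_. borel))" for k unfolding f_def by measurable
  have "indep_vars (\<lambda>_. borel) (\<lambda>k \<omega>. f k (\<lambda>t. X t \<omega> $ k)) UNIV"
    by (rule indep_vars_compose2[OF X_indep]) (rule fm)
  then have ind: "indep_vars (\<lambda>_. borel) (\<lambda>k \<omega>. f k (\<lambda>t. X t \<omega> $ k)) {i, j}"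
    by (rule indep_vars_subset) simp
  have int: "integrable M (\<lambda>\<omega>. f k (\<lambda>t. X t \<omega> $ k))" for k
    using square_integrable_integrable[OF finite_measure_axioms X_coordinate_square_integrable]
    by (cases "k = i") (simp_all add: f_def)
  have "(\<integral>\<omega>. (\<Prod>k\<in>{i, j}. f k (\<lambda>t. X t \<omega> $ k)) \<partial>M) = (\<Prod>k\<in>{i, j}. \<integral>\<omega>. f k (\<lambda>t. X t \<omega> $ k) \<partial>M)"
    by (rule indep_vars_lebesgue_integral[OF _ ind int]) simp
  moreover have "(\<integral>\<omega>. X t \<omega> $ j \<partial>M) = 0"
    using expectation_coordinate(1)[of "\<lambda>g. g t" j] centered by (simp add: centered_field_def)
  ultimately show ?thesis using False by (simp add: f_def)
qed

text \<open>
  Different coordinates are uncorrelated, so only the diagonal of the double sum over coordinates remains.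
\<close>

lemma covariance_increments:
  fixes \<xi> \<eta> :: "real ^ 'd"
  shows "(\<integral>\<omega>. (\<xi> \<bullet> (X s \<omega> - X t \<omega>)) * (\<eta> \<bullet> (X s' \<omega> - X t' \<omega>)) \<partial>M)
    = (\<xi> \<bullet> \<eta>) * (\<integral>\<omega>. (X0 s \<omega> - X0 t \<omega>) * (X0 s' \<omega> - X0 t' \<omega>) \<partial>M0)"
proof -
  let ?D = "\<lambda>s t i \<omega>. X s \<omega> $ i - X t \<omega> $ i"
  let ?R = "\<integral>\<omega>. (X0 s \<omega> - X0 t \<omega>) * (X0 s' \<omega> - X0 t' \<omega>) \<partial>M0"
  have i0: "integrable M0 (\<lambda>\<omega>. X0 u \<omega> * X0 v \<omega>)" for u v
    by (intro square_integrable_mult S.G_square_integrable X0_in_scalar_span)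
  have i: "integrable M (\<lambda>\<omega>. X u \<omega> $ i * X v \<omega> $ j)" for u v i j
    by (intro square_integrable_mult X_coordinate_square_integrable)
  have cov: "(\<integral>\<omega>. ?D s t i \<omega> * ?D s' t' j \<omega> \<partial>M) = (if i = j then ?R else 0)" for i j
    by (simp add: algebra_simps i i0 covariance_coordinates)
  have iD: "integrable M (\<lambda>\<omega>. ?D s t i \<omega> * ?D s' t' j \<omega>)" for i j
    by (simp add: algebra_simps i)
  have "(\<integral>\<omega>. (\<xi> \<bullet> (X s \<omega> - X t \<omega>)) * (\<eta> \<bullet> (X s' \<omega> - X t' \<omega>)) \<partial>M)
      = (\<integral>\<omega>. (\<Sum>i\<in>UNIV. \<Sum>j\<in>UNIV. (\<xi> $ i * \<eta> $ j) * (?D s t i \<omega> * ?D s' t' j \<omega>)) \<partial>M)"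
    unfolding inner_vec_def sum_product by (simp add: ac_simps)
  also have "\<dots> = (\<Sum>i\<in>UNIV. \<Sum>j\<in>UNIV. (\<xi> $ i * \<eta> $ j) * (\<integral>\<omega>. ?D s t i \<omega> * ?D s' t' j \<omega> \<partial>M))"
    by (simp add: iD)
  also have "\<dots> = (\<Sum>i\<in>UNIV. \<xi> $ i * \<eta> $ i * ?R)"
    unfolding cov by (simp add: mult_delta_right)
  finally show ?thesis by (simp add: inner_vec_def sum_distrib_right)
qed

lemma increment_in_linear_span: "(\<lambda>\<omega>. \<xi> \<bullet> (X s \<omega> - X t \<omega>)) \<in> linear_span X"
proof -
  have "(\<lambda>\<omega>. \<xi> \<bullet> X u \<omega>) \<in> linear_span X" for u and \<xi> :: "real ^ 'd"
    by (rule linear_spanI[of "{u}" _ "\<lambda>i t. \<xi> $ i"]) (simp_all add: inner_vec_def)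
  from linear_span_add[OF this[of \<xi> s] this[of "- \<xi>" t]]
  show ?thesis by (simp add: inner_diff_right)
qed

end

text \<open>
  Rounding the parameter to a grid of mesh \<open>1 / (k + 1)\<close> leaves countably many parameters, for which joint
  measurability is clear; continuity gives the pointwise limit.
\<close>

lemma Caratheodory_borel_measurable:
  fixes f :: "real ^ 'n::finite \<Rightarrow> 'w \<Rightarrow> 'b::{second_countable_topology, metric_space}"
  assumes f[measurable]: "\<And>t. f t \<in> borel_measurable M"
    and cont: "\<And>\<omega>. \<omega> \<in> space M \<Longrightarrow> continuous_on UNIV (\<lambda>t. f t \<omega>)"
  shows "(\<lambda>(\<omega>, t). f t \<omega>) \<in> borel_measurable (M \<Otimes>\<^sub>M borel)"
proof -
  define grid where "grid k (a :: 'n \<Rightarrow> int) = (\<chi> j. of_int (a j) / real (Suc k)) " for k and a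
  define r where "r k (t :: real ^ 'n) = (\<lambda>j. \<lfloor>real (Suc k) * t $ j\<rfloor>)" for k t
  have rm[measurable]: "r k \<in> borel \<rightarrow>\<^sub>M count_space UNIV" for k
  proof (subst measurable_count_space_eq_countable)
    show "countable (UNIV :: ('n \<Rightarrow> int) set)" by simp
    have "r k -` {a} \<inter> space borel \<in> sets borel" for a
    proof -
      have "r k -` {a} \<inter> space borel = (\<Inter>j. {t. \<lfloor>real (Suc k) * t $ j\<rfloor> = a j})"
        by (auto simp: r_def)
      also have "\<dots> \<in> sets borel" by measurable
      finally show ?thesis .
    qed
    then show "r k \<in> space borel \<rightarrow> UNIV \<and> (\<forall>a\<in>UNIV. r k -` {a} \<inter> space borel \<in> sets borel)" by auto
  qed
  have lim: "(\<lambda>k. grid k (r k t)) \<longlonglongrightarrow> t" for t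
  proof (rule vec_tendstoI)
    fix j
    show "(\<lambda>k. grid k (r k t) $ j) \<longlonglongrightarrow> t $ j"
    proof (rule LIM_zero_cancel, rule Lim_null_comparison)
      show "\<forall>\<^sub>F k in sequentially. norm (grid k (r k t) $ j - t $ j) \<le> inverse (real (Suc k))"
      proof (intro always_eventually allI)
        fix k
        let ?x = "real (Suc k) * t $ j"
        have "grid k (r k t) $ j - t $ j = (of_int \<lfloor>?x\<rfloor> - ?x) * inverse (real (Suc k))"
          by (simp add: grid_def r_def field_simps del: of_nat_Suc)
        moreover have "\<bar>of_int \<lfloor>?x\<rfloor> - ?x\<bar> \<le> 1" by linarith
        ultimately show "norm (grid k (r k t) $ j - t $ j) \<le> inverse (real (Suc k))"
          using mult_right_mono[of "\<bar>of_int \<lfloor>?x\<rfloor> - ?x\<bar>" 1 "inverse (real (Suc k))"]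
          by (simp add: abs_mult del: of_nat_Suc)
      qed
    qed (rule LIMSEQ_inverse_real_of_nat)
  qed
  show ?thesis
  proof (rule borel_measurable_LIMSEQ_metric)
    fix k
    show "(\<lambda>(\<omega>, t). f (grid k (r k t)) \<omega>) \<in> borel_measurable (M \<Otimes>\<^sub>M borel)"
      unfolding case_prod_unfold
      by (rule measurable_compose_countable'[where I = UNIV and g = "\<lambda>x. r k (snd x)" and f = "\<lambda>a x. f (grid k a) (fst x)"]) auto
  next
    fix x assume "x \<in> space (M \<Otimes>\<^sub>M (borel :: (real ^ 'n) measure))"
    then have "fst x \<in> space M" by (auto simp: space_pair_measure)
    from cont[OF this] have "isCont (\<lambda>t. f t (fst x)) (snd x)" by (simp add: continuous_on_eq_continuous_at)
    from isCont_tendsto_compose[OF this lim]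
    show "(\<lambda>k. case x of (\<omega>, t) \<Rightarrow> f (grid k (r k t)) \<omega>) \<longlonglongrightarrow> (case x of (\<omega>, t) \<Rightarrow> f t \<omega>)"
      by (simp add: case_prod_unfold)
  qed
qed

section \<open>Conditional variance and linear regression\<close>

text \<open>
  A lower bound for the conditional variance bounds the error of every linear predictor, as the
  conditional expectation is the best predictor.
\<close>

lemma cond_variance_le_regression:
  fixes Z :: "'k \<Rightarrow> 'w \<Rightarrow> real"
  assumes "prob_space M" and W: "square_integrable M W" and Z: "\<And>k. k \<in> K \<Longrightarrow> square_integrable M (Z k)"
    and m: "AE \<omega> in M. m \<le> cond_variance M (generated_algebra M Z K) W \<omega>"
  shows "m \<le> (\<integral>\<omega>. (W \<omega> - (\<Sum>k\<in>K. l k * Z k \<omega>))\<^sup>2 \<partial>M)"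
proof -
  interpret prob_space M by fact
  define F where "F = generated_algebra M Z K"
  have Zm: "Z k \<in> borel_measurable M" if "k \<in> K" for k using Z[OF that] by (simp add: square_integrable_def)
  have Wm[measurable]: "W \<in> borel_measurable M" using W by (simp add: square_integrable_def)
  have map: "(\<lambda>\<omega>. \<lambda>k\<in>K. Z k \<omega>) \<in> M \<rightarrow>\<^sub>M PiM K (\<lambda>_. borel)"
    by (rule measurable_restrict) (rule Zm)
  have sub: "subalgebra M F"
    using map unfolding subalgebra_def F_def generated_algebra_def measurable_iff_sets by auto
  interpret F: finite_measure_subalgebra M F by unfold_locales (rule sub)
  have ZF: "Z k \<in> borel_measurable F" if "k \<in> K" for k
  proof -
    have "(\<lambda>\<omega>. \<lambda>k\<in>K. Z k \<omega>) \<in> F \<rightarrow>\<^sub>M PiM K (\<lambda>_. borel)"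
      unfolding F_def generated_algebra_def by (rule measurable_vimage_algebra1) (auto simp: space_PiM)
    from measurable_compose[OF this measurable_component_singleton[OF that]]
    show ?thesis using that by simp
  qed
  define A where "A = real_cond_exp M F W"
  define L where "L \<omega> = (\<Sum>k\<in>K. l k * Z k \<omega>)" for \<omega>
  have AF[measurable]: "A \<in> borel_measurable F" unfolding A_def by simp
  have Am[measurable]: "A \<in> borel_measurable M" using measurable_from_subalg[OF sub AF] .
  have LF[measurable]: "L \<in> borel_measurable F" unfolding L_def using ZF by simp
  have sqL: "square_integrable M L"
    unfolding L_def by (intro square_integrable_sum square_integrable_scale Z)
  have intW: "integrable M W" by (rule square_integrable_integrable[OF finite_measure_axioms W])
  have intW2: "integrable M (\<lambda>\<omega>. (W \<omega>)\<^sup>2)" using W by (simp add: square_integrable_def)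
  have "convex_on UNIV (\<lambda>x::real. x\<^sup>2)" by (rule convex_power2)
  then have jensen: "AE \<omega> in M. (A \<omega>)\<^sup>2 \<le> real_cond_exp M F (\<lambda>\<omega>. (W \<omega>)\<^sup>2) \<omega>"
    unfolding A_def by (intro F.real_cond_exp_jensens_inequality(2)[of W UNIV]) (auto simp: intW intW2)
  have "integrable M (\<lambda>\<omega>. (A \<omega>)\<^sup>2)"
  proof (rule Bochner_Integration.integrable_bound)
    show "integrable M (real_cond_exp M F (\<lambda>\<omega>. (W \<omega>)\<^sup>2))" by (rule F.real_cond_exp_int(1)[OF intW2])
    show "AE \<omega> in M. norm ((A \<omega>)\<^sup>2) \<le> norm (real_cond_exp M F (\<lambda>\<omega>. (W \<omega>)\<^sup>2) \<omega>)"
      using jensen by eventually_elim (simp add: order_trans[OF _ abs_ge_self])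
  qed simp
  then have sqA: "square_integrable M A" by (simp add: square_integrable_def)
  have sqWA: "square_integrable M (\<lambda>\<omega>. W \<omega> - A \<omega>)" by (rule square_integrable_diff[OF W sqA])
  have sqAL: "square_integrable M (\<lambda>\<omega>. A \<omega> - L \<omega>)" by (rule square_integrable_diff[OF sqA sqL])
  have cross: "(\<integral>\<omega>. (A \<omega> - L \<omega>) * A \<omega> \<partial>M) = (\<integral>\<omega>. (A \<omega> - L \<omega>) * W \<omega> \<partial>M)"
    unfolding A_def
    by (rule F.real_cond_exp_intg(2)) (use square_integrable_mult[OF sqAL W] AF LF in \<open>auto simp: A_def\<close>)
  have "(\<integral>\<omega>. (W \<omega> - A \<omega>) * (A \<omega> - L \<omega>) \<partial>M) = (\<integral>\<omega>. (A \<omega> - L \<omega>) * W \<omega> - (A \<omega> - L \<omega>) * A \<omega> \<partial>M)"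
    by (simp add: algebra_simps)
  also have "\<dots> = 0"
    using square_integrable_mult[OF sqAL W] square_integrable_mult[OF sqAL sqA] cross by simp
  finally have orth: "(\<integral>\<omega>. (W \<omega> - A \<omega>) * (A \<omega> - L \<omega>) \<partial>M) = 0" .
  have intD: "integrable M (\<lambda>\<omega>. (W \<omega> - A \<omega>)\<^sup>2)" using sqWA by (simp add: square_integrable_def)
  have "m = (\<integral>\<omega>. m \<partial>M)" by (simp add: prob_space)
  also have "\<dots> \<le> (\<integral>\<omega>. real_cond_exp M F (\<lambda>\<omega>. (W \<omega> - A \<omega>)\<^sup>2) \<omega> \<partial>M)"
    using m unfolding cond_variance_def F_def[symmetric] A_def[symmetric]
    by (intro integral_mono_AE F.real_cond_exp_int(1)[OF intD]) auto
  also have "\<dots> = (\<integral>\<omega>. (W \<omega> - A \<omega>)\<^sup>2 \<partial>M)" by (rule F.real_cond_exp_int(2)[OF intD])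
  also have "\<dots> \<le> (\<integral>\<omega>. (W \<omega> - A \<omega>)\<^sup>2 \<partial>M) + (\<integral>\<omega>. (A \<omega> - L \<omega>)\<^sup>2 \<partial>M)" by simp
  also have "\<dots> = (\<integral>\<omega>. ((W \<omega> - A \<omega>) + (A \<omega> - L \<omega>))\<^sup>2 \<partial>M)"
    unfolding integral_power2_sum[OF sqWA sqAL] orth by simp
  finally show ?thesis by (simp add: L_def)
qed

text \<open>
  The points \<open>a, b, c\<close> come from the conditioning; the distance to \<open>0\<close> is the extra term of the condition.
\<close>

definition min_dist :: "real \<Rightarrow> real \<Rightarrow> real \<Rightarrow> real \<Rightarrow> real" where
  "min_dist x a b c = min \<bar>x\<bar> (min \<bar>x - a\<bar> (min \<bar>x - b\<bar> \<bar>x - c\<bar>))"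

definition gap :: "real ^ 'n::finite \<Rightarrow> real ^ 'n \<Rightarrow> real ^ 'n \<Rightarrow> real ^ 'n \<Rightarrow> real ^ 'n \<Rightarrow> real" where
  "gap H u a b c = (\<Sum>j\<in>UNIV. min_dist (u $ j) (a $ j) (b $ j) (c $ j) powr (2 * H $ j))"

lemma min_dist_nonneg: "0 \<le> min_dist x a b c"
  by (simp add: min_dist_def)

lemma gap_nonneg: "0 \<le> gap H u a b c"
  unfolding gap_def by (intro sum_nonneg) simp

lemma condition_C3_regression:
  fixes Y :: "real ^ 'n::finite \<Rightarrow> 'v \<Rightarrow> real"
  assumes "prob_space M" and sq: "\<And>t. square_integrable M (Y t)" and C3: "condition_C3 M Y H"
    and H: "\<And>j. 0 < H $ j"
  obtains c where "c > 0" "\<And>u t1 t2 t3 l1 l2 l3. u \<in> cbox 0 1 \<Longrightarrow> t1 \<in> cbox 0 1 \<Longrightarrow> t2 \<in> cbox 0 1 \<Longrightarrow> t3 \<in> cbox 0 1 \<Longrightarrow>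
     c * gap H u t1 t2 t3 \<le> (\<integral>\<omega>. (Y u \<omega> - (l1 * Y t1 \<omega> + l2 * Y t2 \<omega> + l3 * Y t3 \<omega>))\<^sup>2 \<partial>M)"
proof -
  have set3: "{1..3} = {1, 2, 3::nat}" "{0..3} = {0, 1, 2, 3::nat}" by auto
  obtain c where c: "c > 0" and C: "\<And>u t. u \<in> cbox 0 1 \<Longrightarrow> (\<forall>k\<in>{1..3::nat}. t k \<in> cbox 0 1) \<Longrightarrow>
        (AE \<omega> in M.
           c * (\<Sum>j\<in>UNIV. MIN k\<in>{0..3}. \<bar>u $ j - (t(0 := 0)) k $ j\<bar> powr (2 * H $ j))
           \<le> cond_variance M (generated_algebra M (\<lambda>k. Y (t k)) {1..3}) (Y u) \<omega>)"
    using C3 unfolding condition_C3_def by blast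
  show ?thesis
  proof (rule that[OF c])
    fix u t1 t2 t3 :: "real ^ 'n" and l1 l2 l3 :: real
    assume u: "u \<in> cbox 0 1" and t: "t1 \<in> cbox 0 1" "t2 \<in> cbox 0 1" "t3 \<in> cbox 0 1"
    define t where "t k = (if k = 1 then t1 else if k = 2 then t2 else t3)" for k :: nat
    define l where "l k = (if k = 1 then l1 else if k = 2 then l2 else l3)" for k :: nat
    have min_powr: "min (x powr a) (y powr a) = min x y powr a" if "0 \<le> x" "0 \<le> y" "0 < a" for x y a :: real
    proof (cases "x \<le> y")
      case True
      then show ?thesis using powr_mono2[of a x y] that by (simp add: min_absorb1)
    next
      case False
      then show ?thesis using powr_mono2[of a y x] that by (simp add: min_absorb2)
    qed
    have eq: "(\<Sum>j\<in>UNIV. MIN k\<in>{0..3}. \<bar>u $ j - (t(0 := 0)) k $ j\<bar> powr (2 * H $ j)) = gap H u t1 t2 t3"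
      unfolding gap_def set3 by (intro sum.cong refl) (simp add: t_def min_dist_def min_powr H)
    have "c * gap H u t1 t2 t3 \<le> (\<integral>\<omega>. (Y u \<omega> - (\<Sum>k\<in>{1..3}. l k * Y (t k) \<omega>))\<^sup>2 \<partial>M)"
      using C[OF u, of t] t unfolding eq
      by (intro cond_variance_le_regression[OF assms(1) sq sq]) (auto simp: t_def)
    also have "(\<lambda>\<omega>. (Y u \<omega> - (\<Sum>k\<in>{1..3}. l k * Y (t k) \<omega>))\<^sup>2)
       = (\<lambda>\<omega>. (Y u \<omega> - (l1 * Y t1 \<omega> + l2 * Y t2 \<omega> + l3 * Y t3 \<omega>))\<^sup>2)"
      unfolding set3 by (simp add: l_def t_def add.assoc)
    finally show "c * gap H u t1 t2 t3 \<le> (\<integral>\<omega>. (Y u \<omega> - (l1 * Y t1 \<omega> + l2 * Y t2 \<omega> + l3 * Y t3 \<omega>))\<^sup>2 \<partial>M)" .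
  qed
qed

section \<open>Singular integrals over boxes\<close>

text \<open>
  \<open>\<bar>x\<bar> powr - g\<close> with its correct value at the singularity; \<open>0 powr - g = 0\<close> would break the upper bounds.
\<close>

definition sing :: "real \<Rightarrow> real \<Rightarrow> ennreal" where
  "sing g x = (if x = 0 then \<top> else ennreal (\<bar>x\<bar> powr - g))"

lemma sing_measurable [measurable]:
  assumes [measurable]: "f \<in> borel_measurable M"
  shows "(\<lambda>x. sing g (f x)) \<in> borel_measurable M"
  unfolding sing_def by measurable

lemma sing_nonzero: "sing g x \<noteq> 0"
  by (simp add: sing_def)

lemma sing_abs: "sing g \<bar>x\<bar> = sing g x"
  by (simp add: sing_def)

lemma nn_integral_sing_half:
  assumes "g < 1"
  shows "(\<integral>\<^sup>+x. indicator {0..1} x * sing g x \<partial>lborel) = ennreal (1 / (1 - g))"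
proof -
  have "((\<lambda>x. x powr - g) has_integral (1 powr (- g + 1) / (- g + 1))) {0..1}"
    by (rule has_integral_powr_from_0) (use assms in auto)
  then have "(\<integral>\<^sup>+x. ennreal (x powr - g) * indicator {0..1} x \<partial>lborel) = ennreal (1 powr (- g + 1) / (- g + 1))"
    by (intro nn_integral_has_integral_lebesgue') auto
  moreover have "(\<integral>\<^sup>+x. indicator {0..1} x * sing g x \<partial>lborel) = (\<integral>\<^sup>+x. ennreal (x powr - g) * indicator {0..1} x \<partial>lborel)"
    using AE_lborel_singleton[of "0::real"]
    by (intro nn_integral_cong_AE) (auto simp: sing_def split: split_indicator elim!: eventually_mono)
  ultimately show ?thesis by simp
qed

lemma nn_integral_sing_shift:
  assumes "g < 1" "a \<in> {0..1}"
  shows "(\<integral>\<^sup>+x. indicator {0..1} x * sing g (x - a) \<partial>lborel) \<le> ennreal (2 / (1 - g))"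
proof -
  have "(\<integral>\<^sup>+x. indicator {0..1} x * sing g (x - a) \<partial>lborel)
      = (\<integral>\<^sup>+x. indicator {0..1} (a + 1 * x) * sing g ((a + 1 * x) - a) \<partial>lborel)"
    by (subst nn_integral_real_affine[where c = 1 and t = a]) auto
  also have "\<dots> \<le> (\<integral>\<^sup>+x. indicator {0..1} x * sing g x + indicator {0..1} (0 + (-1) * x) * sing g (0 + (-1) * x) \<partial>lborel)"
    using assms by (intro nn_integral_mono) (auto simp: sing_def split: split_indicator)
  also have "\<dots> = (\<integral>\<^sup>+x. indicator {0..1} x * sing g x \<partial>lborel)
      + (\<integral>\<^sup>+x. indicator {0..1} (0 + (-1) * x) * sing g (0 + (-1) * x) \<partial>lborel)"
    by (rule nn_integral_add) auto
  also have "(\<integral>\<^sup>+x. indicator {0..1} (0 + (-1) * x) * sing g (0 + (-1) * x) \<partial>lborel) = (\<integral>\<^sup>+x. indicator {0..1} x * sing g x \<partial>lborel)"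
    by (subst (2) nn_integral_real_affine[where c = "-1" and t = 0]) auto
  finally show ?thesis
    using assms by (simp add: nn_integral_sing_half ennreal_plus[symmetric] del: ennreal_plus)
qed

lemma sing_min_dist_le: "sing g (min_dist x a b c) \<le> sing g x + sing g (x - a) + sing g (x - b) + sing g (x - c)"
proof -
  have "min_dist x a b c \<in> {\<bar>x\<bar>, \<bar>x - a\<bar>, \<bar>x - b\<bar>, \<bar>x - c\<bar>}"
    unfolding min_dist_def by (auto simp: min_def)
  then have "sing g (min_dist x a b c) \<in> {sing g x, sing g (x - a), sing g (x - b), sing g (x - c)}"
    using sing_abs by auto
  then show ?thesis by (auto simp: add_increasing add_increasing2)
qed

lemma indicator_unit_cube: "indicator (cbox 0 1) (x :: real ^ 'n::finite) = (\<Prod>j\<in>UNIV. indicator {0..1} (x $ j) :: ennreal)"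
proof (cases "x \<in> cbox 0 1")
  case False
  then obtain j where "x $ j \<notin> {0..1}" by (auto simp: mem_box_cart)
  then have "\<exists>j\<in>UNIV. indicator {0..1} (x $ j) = (0 :: ennreal)" by (intro bexI[of _ j]) auto
  then show ?thesis using False by (simp add: prod_zero)
qed (auto simp: mem_box_cart)

lemma nn_integral_unit_cube_prod:
  fixes f :: "'n::finite \<Rightarrow> real \<Rightarrow> ennreal"
  assumes [measurable]: "\<And>j. f j \<in> borel_measurable borel"
  shows "(\<integral>\<^sup>+(x::real^'n). indicator (cbox 0 1) x * (\<Prod>j\<in>UNIV. f j (x $ j)) \<partial>lborel)
     = (\<Prod>j\<in>UNIV. \<integral>\<^sup>+x. indicator {0..1} x * f j x \<partial>lborel)"
  unfolding indicator_unit_cube prod.distrib[symmetric]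
  by (rule nn_integral_vec_prod) measurable

lemma vec_nth_measurable [measurable]:
  fixes f :: "'a \<Rightarrow> real ^ 'n::finite"
  assumes [measurable]: "f \<in> borel_measurable M"
  shows "(\<lambda>x. f x $ j) \<in> borel_measurable M"
  unfolding cart_eq_inner_axis by measurable

lemma gap_measurable [measurable]:
  fixes u a b c :: "'a \<Rightarrow> real ^ 'n::finite"
  assumes [measurable]: "u \<in> borel_measurable M" "a \<in> borel_measurable M" "b \<in> borel_measurable M" "c \<in> borel_measurable M"
  shows "(\<lambda>x. gap H (u x) (a x) (b x) (c x)) \<in> borel_measurable M"
  unfolding gap_def min_dist_def by measurable

lemma prod_eq_top_ennreal:
  fixes f :: "'a \<Rightarrow> ennreal"
  assumes "finite A" "a \<in> A" "f a = \<top>" "\<And>x. x \<in> A \<Longrightarrow> f x \<noteq> 0"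
  shows "prod f A = \<top>"
proof -
  have "prod f A = f a * prod f (A - {a})" using assms by (simp add: prod.remove)
  moreover have "prod f (A - {a}) \<noteq> 0" using assms by (auto simp: prod_zero_iff)
  ultimately show ?thesis using assms by (simp add: ennreal_top_mult)
qed

text \<open>
  A sum dominates each of its terms, hence any weighted geometric mean of them.  The weights are
  proportional to \<open>1 / H $ j\<close>, with each \<open>j \<in> S\<close> counted twice, which gives all factors the same exponent
  \<open>g\<close>.
\<close>

lemma sing_gap_le_prod:
  fixes H :: "real ^ 'n::finite" and S :: "'n set"
  assumes H: "\<And>j. 0 < H $ j" and g: "0 \<le> g"
    and \<kappa>: "\<kappa> = g / 2 * (2 * (\<Sum>j\<in>S. 1 / H $ j) + (\<Sum>j\<in>- S. 1 / H $ j))"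
  shows "sing \<kappa> (gap H u a b c + gap H u' a' b' c')
    \<le> (\<Prod>j\<in>UNIV. sing g (min_dist (u $ j) (a $ j) (b $ j) (c $ j)))
      * (\<Prod>j\<in>S. sing g (min_dist (u' $ j) (a' $ j) (b' $ j) (c' $ j)))" (is "sing \<kappa> ?\<rho> \<le> ?P * ?Q")
proof -
  define x where "x j = min_dist (u $ j) (a $ j) (b $ j) (c $ j)" for j
  define y where "y j = min_dist (u' $ j) (a' $ j) (b' $ j) (c' $ j)" for j
  have x0: "0 \<le> x j" and y0: "0 \<le> y j" for j by (simp_all add: x_def y_def min_dist_nonneg)
  have nz: "?P \<noteq> 0" "?Q \<noteq> 0" by (auto simp: prod_zero_iff sing_nonzero)
  show ?thesis
  proof (cases "(\<exists>j. x j = 0) \<or> (\<exists>j\<in>S. y j = 0)")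
    case True
    then have "?P = \<top> \<or> ?Q = \<top>"
    proof (elim disjE exE bexE)
      fix j assume "x j = 0"
      then have "?P = \<top>" by (intro prod_eq_top_ennreal[of _ j]) (auto simp: sing_nonzero x_def sing_def)
      then show ?thesis ..
    next
      fix j assume "y j = 0" "j \<in> S"
      then have "?Q = \<top>" by (intro prod_eq_top_ennreal[of _ j]) (auto simp: sing_nonzero y_def sing_def)
      then show ?thesis ..
    qed
    then have "?P * ?Q = \<top>" using nz by (auto simp: ennreal_top_mult ennreal_mult_top)
    then show ?thesis by simp
  next
    case False
    then have xp: "0 < x j" and yp: "j \<in> S \<Longrightarrow> 0 < y j" for j using x0[of j] y0[of j] by (auto simp: less_le)
    have \<rho>x: "x j powr (2 * H $ j) \<le> ?\<rho>" for j
    proof -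
      have "x j powr (2 * H $ j) \<le> gap H u a b c"
        unfolding gap_def x_def by (rule member_le_sum) auto
      then show ?thesis using gap_nonneg[of H u' a' b' c'] by simp
    qed
    have \<rho>y: "y j powr (2 * H $ j) \<le> ?\<rho>" for j
    proof -
      have "y j powr (2 * H $ j) \<le> gap H u' a' b' c'"
        unfolding gap_def y_def by (rule member_le_sum) auto
      then show ?thesis using gap_nonneg[of H u a b c] by simp
    qed
    have "0 < x undefined powr (2 * H $ undefined)" using xp[of undefined] by simp
    then have \<rho>: "0 < ?\<rho>" using \<rho>x[of undefined] by linarith
    define e where "e j = - (g / (2 * H $ j))" for j
    have e: "e j \<le> 0" "2 * H $ j * e j = - g" for j using g H[of j] by (auto simp: e_def)
    have "- \<kappa> = (\<Sum>j\<in>UNIV. e j) + (\<Sum>j\<in>S. e j)"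
    proof -
      define A B where "A = (\<Sum>j\<in>S. 1 / H $ j)" and "B = (\<Sum>j\<in>- S. 1 / H $ j)"
      have sum: "sum e T = - (g / 2) * (\<Sum>j\<in>T. 1 / H $ j)" for T
        by (simp add: e_def sum_distrib_left sum_negf)
      have "sum e S = - (g / 2) * A" unfolding sum A_def ..
      moreover have "sum e UNIV = - (g / 2) * (A + B)"
        unfolding sum A_def B_def
        by (metis (no_types) Compl_partition Compl_disjoint finite sum.union_disjoint)
      moreover have "\<kappa> = g / 2 * (2 * A + B)" unfolding \<kappa> A_def B_def ..
      ultimately show ?thesis by (simp add: algebra_simps add_divide_distrib diff_divide_distrib)
    qed
    then have "?\<rho> powr - \<kappa> = (\<Prod>j\<in>UNIV. ?\<rho> powr e j) * (\<Prod>j\<in>S. ?\<rho> powr e j)"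
      using \<rho> by (simp add: powr_add powr_sum)
    also have "\<dots> \<le> (\<Prod>j\<in>UNIV. x j powr - g) * (\<Prod>j\<in>S. y j powr - g)"
    proof (intro mult_mono prod_mono conjI prod_nonneg)
      fix j
      have "?\<rho> powr e j \<le> (x j powr (2 * H $ j)) powr e j"
        using \<rho>x[of j] xp[of j] e(1)[of j] by (intro powr_mono2') auto
      then show "?\<rho> powr e j \<le> x j powr - g" by (simp add: powr_powr e(2))
    next
      fix j assume "j \<in> S"
      then have "?\<rho> powr e j \<le> (y j powr (2 * H $ j)) powr e j"
        using \<rho>y[of j] yp[of j] e(1)[of j] by (intro powr_mono2') auto
      then show "?\<rho> powr e j \<le> y j powr - g" by (simp add: powr_powr e(2))
    qed auto
    finally have "ennreal (?\<rho> powr - \<kappa>) \<le> ennreal ((\<Prod>j\<in>UNIV. x j powr - g) * (\<Prod>j\<in>S. y j powr - g))"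
      by (rule ennreal_leI)
    also have "\<dots> = (\<Prod>j\<in>UNIV. ennreal (x j powr - g)) * (\<Prod>j\<in>S. ennreal (y j powr - g))"
      by (simp add: ennreal_mult prod_nonneg prod_ennreal)
    also have "\<dots> = ?P * ?Q"
    proof -
      have "ennreal (x j powr - g) = sing g (x j)" for j using xp[of j] by (simp add: sing_def)
      moreover have "ennreal (y j powr - g) = sing g (y j)" if "j \<in> S" for j using yp[OF that] by (simp add: sing_def)
      ultimately show ?thesis by (simp add: x_def y_def cong: prod.cong)
    qed
    finally show ?thesis using \<rho> by (simp add: sing_def)
  qed
qed

lemma nn_integral_prod_lborel:
  fixes f :: "'a::euclidean_space \<times> 'b::euclidean_space \<Rightarrow> ennreal"
  assumes "f \<in> borel_measurable borel"
  shows "(\<integral>\<^sup>+q. f q \<partial>lborel) = (\<integral>\<^sup>+t. \<integral>\<^sup>+s. f (s, t) \<partial>lborel \<partial>lborel)"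
proof -
  have "f \<in> borel_measurable (lborel \<Otimes>\<^sub>M lborel)" using assms by (simp add: lborel_prod)
  from lborel_pair.nn_integral_snd[OF this] show ?thesis by (simp add: lborel_prod)
qed

text \<open>
  After the product bound the integral over \<open>s'\<close> factorises for fixed \<open>t'\<close>.  The factors in the separated
  coordinates of \<open>t'\<close> involve \<open>s'\<close> only through \<open>\<bar>t' $ j - s' $ j\<bar> \<ge> \<delta>\<close>, which is replaced by a
  constant, so that the remaining integral over \<open>t'\<close> factorises as well.
\<close>

lemma sing_gap_integral_finite:
  fixes H :: "real ^ 'n::finite" and S :: "'n set" and I J :: "(real ^ 'n) set"
  assumes H: "\<And>j. 0 < H $ j" and g: "0 \<le> g" "g < 1"
    and \<kappa>: "\<kappa> = g / 2 * (2 * (\<Sum>j\<in>S. 1 / H $ j) + (\<Sum>j\<in>- S. 1 / H $ j))"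
    and IJ: "I \<subseteq> cbox 0 1" "J \<subseteq> cbox 0 1" and [measurable]: "I \<in> sets borel" "J \<in> sets borel"
    and \<delta>: "0 < \<delta>" "\<And>s t j. s \<in> I \<Longrightarrow> t \<in> J \<Longrightarrow> j \<in> S \<Longrightarrow> \<delta> \<le> \<bar>t $ j - s $ j\<bar>"
  shows "\<exists>C<\<top>. \<forall>s\<in>I. \<forall>t\<in>J. (\<integral>\<^sup>+q. indicator (I \<times> J) q *
      sing \<kappa> (gap H (fst q) (snd q) s t + gap H (snd q) (fst q) s t) \<partial>lborel) \<le> C"
proof -
  define K where "K = ennreal (2 / (1 - g))"
  define B where "B = ennreal (\<delta> powr - g)"
  have K4: "K + K + K + K = 4 * K" and K3: "K + K + K = 3 * K"
  proof -
    have "(4 :: ennreal) = 1 + 1 + 1 + 1" "(3 :: ennreal) = 1 + 1 + 1" by simp_all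
    then show "K + K + K + K = 4 * K" "K + K + K = 3 * K" by (simp_all only: distrib_right mult_1_left)
  qed
  define C where "C = (4 * K) ^ CARD('n) * (\<Prod>j\<in>UNIV. if j \<in> S then B + 3 * K else 1)"
  have fin: "4 * K < \<top>" "B + 3 * K < \<top>"
    unfolding K_def B_def by (auto simp: ennreal_mult_less_top)
  have "(\<Prod>j\<in>A. if j \<in> S then B + 3 * K else 1) < \<top>" for A :: "'n set"
    using fin by (induction A rule: infinite_finite_induct) (auto simp: ennreal_mult_less_top)
  moreover have "(4 * K) ^ CARD('n) < \<top>" using fin(1) by (simp only: power_less_top_ennreal simp_thms)
  ultimately have "C < \<top>" unfolding C_def by (simp only: ennreal_mult_less_top simp_thms)
  moreover have "(\<integral>\<^sup>+q. indicator (I \<times> J) q *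
      sing \<kappa> (gap H (fst q) (snd q) s t + gap H (snd q) (fst q) s t) \<partial>lborel) \<le> C" if st: "s \<in> I" "t \<in> J" for s t
  proof -
    \<comment> \<open>one-dimensional majorants of the factors belonging to \<open>s'\<close> and to \<open>t'\<close>\<close>
    define \<phi> where "\<phi> t' j x = sing g x + sing g (x - t' $ j) + sing g (x - s $ j) + sing g (x - t $ j)" for t' :: "real ^ 'n" and j x
    define \<psi> where "\<psi> j x = (if j \<in> S then B + (sing g x + sing g (x - s $ j) + sing g (x - t $ j)) else 1)" for j x
    have [measurable]: "\<phi> t' j \<in> borel_measurable borel" "\<psi> j \<in> borel_measurable borel" for t' j
      unfolding \<phi>_def \<psi>_def by measurable
    have unit: "u $ j \<in> {0..1}" if "u \<in> I \<or> u \<in> J" for u j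
      using that IJ by (auto simp: mem_box_cart)
    have K1: "(\<integral>\<^sup>+x. indicator {0..1} x * sing g (x - a) \<partial>lborel) \<le> K" if "a \<in> {0..1}" for a
      unfolding K_def by (rule nn_integral_sing_shift[OF g(2) that])
    have K0: "(\<integral>\<^sup>+x. indicator {0..1} x * sing g x \<partial>lborel) \<le> K"
      using K1[of 0] by simp
    have int\<phi>: "(\<integral>\<^sup>+x. indicator {0..1} x * \<phi> t' j x \<partial>lborel) \<le> 4 * K" if "t' \<in> J" for t' j
    proof -
      have "(\<integral>\<^sup>+x. indicator {0..1} x * \<phi> t' j x \<partial>lborel) = (\<integral>\<^sup>+x. indicator {0..1} x * sing g x \<partial>lborel)
        + (\<integral>\<^sup>+x. indicator {0..1} x * sing g (x - t' $ j) \<partial>lborel) + (\<integral>\<^sup>+x. indicator {0..1} x * sing g (x - s $ j) \<partial>lborel)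
        + (\<integral>\<^sup>+x. indicator {0..1} x * sing g (x - t $ j) \<partial>lborel)"
        unfolding \<phi>_def distrib_left by (simp add: nn_integral_add)
      also have "\<dots> \<le> K + K + K + K"
        by (intro add_mono K0 K1 unit) (use st that in auto)
      also have "\<dots> = 4 * K" by (rule K4)
      finally show ?thesis .
    qed
    have int\<psi>: "(\<integral>\<^sup>+x. indicator {0..1} x * \<psi> j x \<partial>lborel) \<le> (if j \<in> S then B + 3 * K else 1)" for j
    proof (cases "j \<in> S")
      case True
      have "(\<integral>\<^sup>+x. indicator {0..1} x * \<psi> j x \<partial>lborel) = (\<integral>\<^sup>+(x::real). indicator {0..1} x * B \<partial>lborel)
        + ((\<integral>\<^sup>+x. indicator {0..1} x * sing g x \<partial>lborel) + (\<integral>\<^sup>+x. indicator {0..1} x * sing g (x - s $ j) \<partial>lborel)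
        + (\<integral>\<^sup>+x. indicator {0..1} x * sing g (x - t $ j) \<partial>lborel))"
        using True unfolding \<psi>_def distrib_left by (simp add: nn_integral_add distrib_left)
      also have "(\<integral>\<^sup>+(x::real). indicator {0..1} x * B \<partial>lborel) = B"
        by (subst mult.commute) (simp add: nn_integral_cmult_indicator)
      also have "B + ((\<integral>\<^sup>+x. indicator {0..1} x * sing g x \<partial>lborel) + (\<integral>\<^sup>+x. indicator {0..1} x * sing g (x - s $ j) \<partial>lborel)
        + (\<integral>\<^sup>+x. indicator {0..1} x * sing g (x - t $ j) \<partial>lborel)) \<le> B + (K + K + K)"
        by (intro add_mono K0 K1 unit order_refl) (use st in auto)
      also have "\<dots> = B + 3 * K" by (simp only: K3)
      finally show ?thesis using True by simp
    qed (simp add: \<psi>_def)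
    have pw: "indicator (I \<times> J) (s', t') * sing \<kappa> (gap H s' t' s t + gap H t' s' s t)
       \<le> (indicator J t' * indicator (cbox 0 1) t' * (\<Prod>j\<in>UNIV. \<psi> j (t' $ j))) * (indicator (cbox 0 1) s' * (\<Prod>j\<in>UNIV. \<phi> t' j (s' $ j)))"
      for s' t'
    proof (cases "s' \<in> I \<and> t' \<in> J")
      case True
      have "sing \<kappa> (gap H s' t' s t + gap H t' s' s t) \<le> (\<Prod>j\<in>UNIV. sing g (min_dist (s' $ j) (t' $ j) (s $ j) (t $ j)))
        * (\<Prod>j\<in>S. sing g (min_dist (t' $ j) (s' $ j) (s $ j) (t $ j)))"
        by (rule sing_gap_le_prod[OF H g(1) \<kappa>])
      also have "\<dots> \<le> (\<Prod>j\<in>UNIV. \<phi> t' j (s' $ j)) * (\<Prod>j\<in>S. \<psi> j (t' $ j))"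
      proof (intro mult_mono prod_mono_ennreal)
        fix j assume j: "j \<in> S"
        have "\<delta> \<le> \<bar>t' $ j - s' $ j\<bar>" using \<delta>(2)[of s' t' j] True j by simp
        then have "sing g (t' $ j - s' $ j) \<le> B"
          using \<delta>(1) g by (auto simp: sing_def B_def intro!: ennreal_leI powr_mono2')
        then have "sing g (t' $ j) + sing g (t' $ j - s' $ j) + sing g (t' $ j - s $ j) + sing g (t' $ j - t $ j)
          \<le> sing g (t' $ j) + B + sing g (t' $ j - s $ j) + sing g (t' $ j - t $ j)"
          by (intro add_mono order_refl)
        with sing_min_dist_le[of g "t' $ j" "s' $ j" "s $ j" "t $ j"]
        show "sing g (min_dist (t' $ j) (s' $ j) (s $ j) (t $ j)) \<le> \<psi> j (t' $ j)"
          using j unfolding \<psi>_def by (auto simp: ac_simps intro: order_trans)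
      qed (auto simp: \<phi>_def sing_min_dist_le)
      also have "(\<Prod>j\<in>S. \<psi> j (t' $ j)) = (\<Prod>j\<in>UNIV. \<psi> j (t' $ j))"
        by (rule prod.mono_neutral_left) (auto simp: \<psi>_def)
      finally have "sing \<kappa> (gap H s' t' s t + gap H t' s' s t)
          \<le> (\<Prod>j\<in>UNIV. \<phi> t' j (s' $ j)) * (\<Prod>j\<in>UNIV. \<psi> j (t' $ j))" .
      moreover have "s' \<in> cbox 0 1" "t' \<in> cbox 0 1" using True IJ by auto
      ultimately show ?thesis using True by (simp add: mult.commute)
    qed (auto simp: indicator_def)
    have "(\<integral>\<^sup>+q. indicator (I \<times> J) q * sing \<kappa> (gap H (fst q) (snd q) s t + gap H (snd q) (fst q) s t) \<partial>lborel)
      = (\<integral>\<^sup>+t'. \<integral>\<^sup>+s'. indicator (I \<times> J) (s', t') * sing \<kappa> (gap H s' t' s t + gap H t' s' s t) \<partial>lborel \<partial>lborel)"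
      by (subst nn_integral_prod_lborel) (auto simp: borel_prod[symmetric])
    also have "\<dots> \<le> (\<integral>\<^sup>+t'. \<integral>\<^sup>+s'. (indicator J t' * indicator (cbox 0 1) t' * (\<Prod>j\<in>UNIV. \<psi> j (t' $ j)))
        * (indicator (cbox 0 1) s' * (\<Prod>j\<in>UNIV. \<phi> t' j (s' $ j))) \<partial>lborel \<partial>lborel)"
      by (intro nn_integral_mono pw)
    also have "\<dots> \<le> (\<integral>\<^sup>+t'. (4 * K) ^ CARD('n) * (indicator (cbox 0 1) t' * (\<Prod>j\<in>UNIV. \<psi> j (t' $ j))) \<partial>lborel)"
    proof (intro nn_integral_mono)
      fix t' :: "real ^ 'n"
      have "(\<integral>\<^sup>+s'. indicator (cbox 0 1) s' * (\<Prod>j\<in>UNIV. \<phi> t' j (s' $ j)) \<partial>lborel) \<le> (4 * K) ^ CARD('n)" if "t' \<in> J"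
      proof -
        have "(\<integral>\<^sup>+s'. indicator (cbox 0 1) s' * (\<Prod>j\<in>UNIV. \<phi> t' j (s' $ j)) \<partial>lborel) \<le> (\<Prod>j\<in>(UNIV::'n set). 4 * K)"
          unfolding nn_integral_unit_cube_prod[of "\<phi> t'", simplified] by (intro prod_mono_ennreal int\<phi> that)
        then show ?thesis by simp
      qed
      then have "(\<integral>\<^sup>+s'. indicator (cbox 0 1) s' * (\<Prod>j\<in>UNIV. \<phi> t' j (s' $ j)) \<partial>lborel) * indicator J t' \<le> (4 * K) ^ CARD('n)"
        by (auto split: split_indicator)
      from mult_right_mono[OF this, of "indicator (cbox 0 1) t' * (\<Prod>j\<in>UNIV. \<psi> j (t' $ j))"]
      show "(\<integral>\<^sup>+s'. (indicator J t' * indicator (cbox 0 1) t' * (\<Prod>j\<in>UNIV. \<psi> j (t' $ j)))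
        * (indicator (cbox 0 1) s' * (\<Prod>j\<in>UNIV. \<phi> t' j (s' $ j))) \<partial>lborel) \<le> (4 * K) ^ CARD('n) * (indicator (cbox 0 1) t' * (\<Prod>j\<in>UNIV. \<psi> j (t' $ j)))"
        by (subst nn_integral_cmult) (auto simp: ac_simps)
    qed
    also have "\<dots> = (4 * K) ^ CARD('n) * (\<Prod>j\<in>UNIV. \<integral>\<^sup>+x. indicator {0..1} x * \<psi> j x \<partial>lborel)"
      by (subst nn_integral_cmult) (auto simp: nn_integral_unit_cube_prod)
    also have "\<dots> \<le> C"
      unfolding C_def by (intro mult_left_mono prod_mono_ennreal int\<psi>) auto
    finally show ?thesis .
  qed
  ultimately show ?thesis by blast
qed

definition holder :: "real ^ 'n::finite \<Rightarrow> real ^ 'n \<Rightarrow> real ^ 'n \<Rightarrow> real" where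
  "holder H s t = (\<Sum>j\<in>UNIV. \<bar>s $ j - t $ j\<bar> powr (2 * H $ j))"

lemma holder_nonneg: "0 \<le> holder H s t"
  unfolding holder_def by (intro sum_nonneg) simp

lemma suminf_const_eq_top:
  assumes "0 < c" shows "(\<Sum>k::nat. ennreal c) = \<top>"
proof (rule ccontr)
  assume "(\<Sum>k::nat. ennreal c) \<noteq> \<top>"
  then have "summable (\<lambda>k::nat. c)"
    using assms by (intro summable_suminf_not_top) auto
  then show False using assms by (simp add: summable_const_iff)
qed

lemma emeasure_box_prod:
  fixes l u :: "real ^ 'n::finite" and l' u' :: "real ^ 'n"
  assumes "\<And>j. l $ j \<le> u $ j" "\<And>j. l' $ j \<le> u' $ j"
  shows "emeasure lborel (box l u \<times> box l' u') = ennreal ((\<Prod>j\<in>UNIV. u $ j - l $ j) * (\<Prod>j\<in>UNIV. u' $ j - l' $ j))"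
proof -
  have 1: "emeasure lborel (box l u) = ennreal (\<Prod>j\<in>UNIV. u $ j - l $ j)" if "\<And>j. l $ j \<le> u $ j" for l u :: "real ^ 'n"
  proof -
    have "emeasure lborel (box l u) = (\<Prod>b\<in>Basis. (u - l) \<bullet> b)"
      using that by (intro emeasure_lborel_box) (auto simp: Basis_vec_def inner_axis)
    then show ?thesis
      by (simp add: Basis_vec_eq_range prod.reindex[OF inj_axis_one] inner_axis)
  qed
  have "emeasure lborel (box l u \<times> box l' u') = emeasure (lborel \<Otimes>\<^sub>M lborel) (box l u \<times> box l' u')"
    by (simp add: lborel_prod)
  also have "\<dots> = emeasure lborel (box l u) * emeasure lborel (box l' u')"
    by (rule lborel.emeasure_pair_measure_Times) auto
  finally show ?thesis
    using assms by (simp add: 1 ennreal_mult prod_nonneg)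
qed

text \<open>
  The dyadic shell number \<open>k\<close> contains the box \<open>B k\<close> with side lengths \<open>r k powr (1 / (2 * H $ j))\<close> in both
  halves of the coordinates, shortened in one coordinate to make the boxes disjoint.  Its volume is a
  constant times \<open>r k powr \<Sum>j. 1 / H $ j\<close>, the integrand is at least a constant times \<open>r k powr - \<kappa>\<close>,
  and the product is bounded below.
\<close>

lemma holder_integral_infinite:
  fixes H a b :: "real ^ 'n::finite" and h r0 \<kappa> :: real
  assumes H: "\<And>j. 0 < H $ j" and \<kappa>: "(\<Sum>j\<in>UNIV. 1 / H $ j) \<le> \<kappa>" and h: "0 < h" and r0: "0 < r0"
    and s: "\<And>j. a $ j \<le> s $ j" "\<And>j. s $ j \<le> a $ j + h / 2"
    and t: "\<And>j. b $ j \<le> t $ j" "\<And>j. t $ j \<le> b $ j + h / 2"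
    and G: "\<And>s' t'. s' \<in> cbox a (\<chi> j. a $ j + h) \<Longrightarrow> t' \<in> cbox b (\<chi> j. b $ j + h) \<Longrightarrow>
      0 < holder H s s' + holder H t t' \<Longrightarrow> holder H s s' + holder H t t' \<le> r0 \<Longrightarrow>
      ennreal (c * (holder H s s' + holder H t t') powr - \<kappa>) \<le> G (s', t')"
    and c: "0 < c"
  shows "(\<integral>\<^sup>+q. indicator (cbox a (\<chi> j. a $ j + h) \<times> cbox b (\<chi> j. b $ j + h)) q * G q \<partial>lborel) = \<top>"
proof -
  let ?N = "real CARD('n)"
  let ?E = "cbox a (\<chi> j. a $ j + h) \<times> cbox b (\<chi> j. b $ j + h)"
  define j0 :: 'n where "j0 = undefined"
  \<comment> \<open>small enough for all boxes to stay inside the domain and below the level \<open>r0\<close>\<close>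
  define rr where "rr = Min (insert 1 (insert (r0 / (2 * ?N)) (range (\<lambda>j. (h / 2) powr (2 * H $ j)))))"
  have rr: "0 < rr" unfolding rr_def using h r0 by (subst Min_gr_iff) auto
  have rr1: "rr \<le> 1" unfolding rr_def by (intro Min_le) auto
  have rrr: "rr \<le> r0 / (2 * ?N)" unfolding rr_def by (intro Min_le) auto
  have rrh: "rr \<le> (h / 2) powr (2 * H $ j)" for j unfolding rr_def by (intro Min_le) auto
  define r where "r k = rr * (1/2) ^ k" for k :: nat
  have r: "0 < r k" "r k \<le> rr" for k
    using rr by (auto simp: r_def mult_le_cancel_left1 power_le_one)
  have r1: "r k \<le> 1" for k using r(2)[of k] rr1 by linarith
  define l where "l k j = r k powr (1 / (2 * H $ j))" for k j
  have lp: "0 < l k j" for k j using r(1)[of k] by (simp add: l_def)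
  have lH: "l k j powr (2 * H $ j) = r k" for k j
    using r(1)[of k] H[of j] by (simp add: l_def powr_powr)
  have lh: "l k j \<le> h / 2" for k j
  proof -
    have "l k j \<le> ((h / 2) powr (2 * H $ j)) powr (1 / (2 * H $ j))"
      unfolding l_def using r[of k] rrh[of j] H[of j] by (intro powr_mono2) auto
    also have "\<dots> = h / 2" using h H[of j] by (simp add: powr_powr)
    finally show ?thesis .
  qed
  define \<theta> where "\<theta> = (1/2) powr (1 / (2 * H $ j0))"
  have \<theta>: "0 < \<theta>" "\<theta> < 1"
    using H[of j0] powr_less_mono2[of "1 / (2 * H $ j0)" "1/2" 1] by (auto simp: \<theta>_def)
  have lS: "l (Suc k) j0 = \<theta> * l k j0" for k
  proof -
    have "r (Suc k) = 1/2 * r k" by (simp add: r_def)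
    then show ?thesis unfolding l_def \<theta>_def using r(1)[of k] by (simp only:) (subst powr_mult, auto)
  qed
  have l_mono: "l k' j0 \<le> l (Suc k) j0" if "k < k'" for k k'
  proof -
    have "r k' \<le> r (Suc k)" unfolding r_def using that rr by (intro mult_left_mono power_decreasing) auto
    then show ?thesis unfolding l_def using r(1)[of k'] H[of j0] by (intro powr_mono2) auto
  qed
  define u where "u k = (\<chi> j. s $ j + (if j = j0 then l (Suc k) j0 else 0))" for k
  define v where "v k = (\<chi> j. s $ j + l k j)" for k
  define w where "w k = (\<chi> j. t $ j + l k j)" for k
  define B where "B k = box (u k) (v k) \<times> box t (w k)" for k
  have inB: "(s', t') \<in> B k \<longleftrightarrow> (\<forall>j. u k $ j < s' $ j \<and> s' $ j < v k $ j) \<and> (\<forall>j. t $ j < t' $ j \<and> t' $ j < w k $ j)" for s' t' k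
    by (auto simp: B_def mem_box_cart)
  have Bs: "s $ j < s' $ j" "s' $ j < s $ j + l k j" "t $ j < t' $ j" "t' $ j < t $ j + l k j" if "(s', t') \<in> B k" for s' t' k j
  proof -
    have "s $ j \<le> u k $ j" using lp[of "Suc k" j0] by (simp add: u_def)
    moreover have "u k $ j < s' $ j" using that by (simp add: inB)
    ultimately show "s $ j < s' $ j" by linarith
    show "s' $ j < s $ j + l k j" "t $ j < t' $ j" "t' $ j < t $ j + l k j" using that by (auto simp: inB v_def w_def)
  qed
  have disj: "disjoint_family B"
  proof -
    have no: False if "q \<in> B k" "q \<in> B k'" "k < k'" for q k k'
    proof -
      obtain s' t' where q: "q = (s', t')" by (cases q)
      have "s $ j0 + l (Suc k) j0 = u k $ j0" by (simp add: u_def)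
      also have "\<dots> < s' $ j0" using that(1) by (simp add: q inB)
      also have "\<dots> < s $ j0 + l k' j0" using Bs(2)[of s' t' k' j0] that(2) by (simp add: q)
      also have "\<dots> \<le> s $ j0 + l (Suc k) j0" using l_mono[OF that(3)] by simp
      finally show False by simp
    qed
    show ?thesis
      unfolding disjoint_family_on_def
    proof (intro ballI impI)
      fix k k' :: nat assume "k \<noteq> k'"
      then show "B k \<inter> B k' = {}" using no[of _ k k'] no[of _ k' k] by (cases "k < k'") auto
    qed
  qed
  have BE: "B k \<subseteq> ?E" for k
  proof
    fix q assume q: "q \<in> B k"
    obtain s' t' where [simp]: "q = (s', t')" by (cases q)
    have "a $ j \<le> s' $ j" "s' $ j \<le> a $ j + h" "b $ j \<le> t' $ j" "t' $ j \<le> b $ j + h" for j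
      using Bs[of s' t' k j] q s[of j] t[of j] lh[of k j] by auto
    then show "q \<in> ?E" by (auto simp: mem_box_cart)
  qed
  define m where "m k = c * (2 * ?N * r k) powr - \<kappa>" for k
  have N: "0 < ?N" by simp
  have \<kappa>0: "0 \<le> \<kappa>" using \<kappa> sum_nonneg[of UNIV "\<lambda>j. 1 / H $ j"] H by (meson less_imp_le order_trans zero_le_divide_1_iff)
  have Gm: "ennreal (m k) \<le> G q" if q: "q \<in> B k" for k q
  proof -
    obtain s' t' where q': "q = (s', t')" by (cases q)
    have ls: "\<bar>s $ j - s' $ j\<bar> powr (2 * H $ j) \<le> r k" for j
      unfolding lH[symmetric, of k j] using Bs[of s' t' k j] q H[of j] by (intro powr_mono2) (auto simp: q')
    have lt: "\<bar>t $ j - t' $ j\<bar> powr (2 * H $ j) \<le> r k" for j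
      unfolding lH[symmetric, of k j] using Bs[of s' t' k j] q H[of j] by (intro powr_mono2) (auto simp: q')
    have "holder H s s' \<le> (\<Sum>j\<in>(UNIV::'n set). r k)" "holder H t t' \<le> (\<Sum>j\<in>(UNIV::'n set). r k)"
      unfolding holder_def by (intro sum_mono ls lt)+
    then have le: "holder H s s' + holder H t t' \<le> 2 * ?N * r k" by simp
    have "0 < \<bar>s $ j0 - s' $ j0\<bar> powr (2 * H $ j0)" using Bs(1)[of s' t' k j0] q by (simp add: q')
    also have "\<dots> \<le> holder H s s'" unfolding holder_def by (rule member_le_sum) auto
    finally have pos: "0 < holder H s s' + holder H t t'" using holder_nonneg[of H t t'] by linarith
    have "2 * ?N * r k \<le> 2 * ?N * (r0 / (2 * ?N))" using r(2)[of k] rrr by (intro mult_left_mono) auto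
    then have small: "holder H s s' + holder H t t' \<le> r0" using le N by simp
    have "m k \<le> c * (holder H s s' + holder H t t') powr - \<kappa>"
      unfolding m_def using pos le \<kappa>0 c by (intro mult_left_mono powr_mono2') auto
    then have "ennreal (m k) \<le> ennreal (c * (holder H s s' + holder H t t') powr - \<kappa>)" by (rule ennreal_leI)
    also have "\<dots> \<le> G (s', t')" using BE[of k] q q' by (intro G pos small) auto
    finally show ?thesis by (simp add: q')
  qed
  define C where "C = c * (2 * ?N) powr - \<kappa> * (1 - \<theta>)"
  have C: "0 < C" unfolding C_def using c \<theta> N by simp
  have mB: "ennreal C \<le> ennreal (m k) * emeasure lborel (B k)" for k
  proof -
    have "u k $ j \<le> v k $ j" for j
      using lp[of k j] lp[of k j0] \<theta> by (auto simp: u_def v_def lS mult_le_cancel_right1 mult_left_le_one_le)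
    moreover have "t $ j \<le> w k $ j" for j using lp[of k j] by (simp add: w_def)
    ultimately have "emeasure lborel (B k) = ennreal ((\<Prod>j\<in>UNIV. v k $ j - u k $ j) * (\<Prod>j\<in>UNIV. w k $ j - t $ j))"
      unfolding B_def by (rule emeasure_box_prod)
    also have "(\<Prod>j\<in>UNIV. w k $ j - t $ j) = (\<Prod>j\<in>UNIV. l k j)" by (simp add: w_def)
    also have "(\<Prod>j\<in>UNIV. v k $ j - u k $ j) = (1 - \<theta>) * (\<Prod>j\<in>UNIV. l k j)"
    proof -
      have "(\<Prod>j\<in>UNIV. v k $ j - u k $ j) = (\<Prod>j\<in>UNIV. (if j = j0 then 1 - \<theta> else 1) * l k j)"
        by (intro prod.cong refl) (auto simp: u_def v_def lS algebra_simps)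
      then show ?thesis by (simp add: prod.distrib)
    qed
    also have "(1 - \<theta>) * (\<Prod>j\<in>UNIV. l k j) * (\<Prod>j\<in>UNIV. l k j) = (1 - \<theta>) * r k powr (\<Sum>j\<in>UNIV. 1 / H $ j)"
    proof -
      have "(\<Prod>j\<in>UNIV. l k j) * (\<Prod>j\<in>UNIV. l k j) = (\<Prod>j\<in>UNIV. l k j * l k j)" by (simp add: prod.distrib)
      also have "\<dots> = (\<Prod>j\<in>UNIV. r k powr (1 / H $ j))"
        by (intro prod.cong refl) (simp add: l_def powr_add[symmetric])
      also have "\<dots> = r k powr (\<Sum>j\<in>UNIV. 1 / H $ j)" using r(1)[of k] by (simp add: powr_sum)
      finally show ?thesis by (simp add: mult.assoc)
    qed
    finally have em: "emeasure lborel (B k) = ennreal ((1 - \<theta>) * r k powr (\<Sum>j\<in>UNIV. 1 / H $ j))" .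
    have "C * 1 \<le> C * (r k powr - \<kappa> * r k powr (\<Sum>j\<in>UNIV. 1 / H $ j))"
    proof (rule mult_left_mono)
      have "1 \<le> r k powr (- \<kappa> + (\<Sum>j\<in>UNIV. 1 / H $ j))"
        using r(1)[of k] r1[of k] \<kappa> powr_mono'[of "- \<kappa> + (\<Sum>j\<in>UNIV. 1 / H $ j)" 0 "r k"] by simp
      then show "1 \<le> r k powr - \<kappa> * r k powr (\<Sum>j\<in>UNIV. 1 / H $ j)" by (simp only: powr_add)
    qed (use C in simp)
    also have "\<dots> = m k * ((1 - \<theta>) * r k powr (\<Sum>j\<in>UNIV. 1 / H $ j))"
    proof -
      have "(2 * ?N * r k) powr - \<kappa> = (2 * ?N) powr - \<kappa> * r k powr - \<kappa>"
        by (rule powr_mult)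
      then show ?thesis by (simp add: C_def m_def mult_ac)
    qed
    finally show ?thesis unfolding em using \<theta> c by (simp add: ennreal_mult[symmetric] m_def ennreal_leI)
  qed
  have Bsets: "B k \<in> sets borel" for k
    unfolding B_def by (intro borel_open open_Times open_box)
  have "\<top> = (\<Sum>k::nat. ennreal C)" using suminf_const_eq_top[OF C] by simp
  also have "\<dots> \<le> (\<Sum>k. ennreal (m k) * emeasure lborel (B k))"
    by (intro suminf_le mB) auto
  also have "\<dots> = (\<Sum>k. \<integral>\<^sup>+q. ennreal (m k) * indicator (B k) q \<partial>lborel)"
    using Bsets by (intro suminf_cong) (simp add: nn_integral_cmult_indicator)
  also have "\<dots> = (\<integral>\<^sup>+q. (\<Sum>k. ennreal (m k) * indicator (B k) q) \<partial>lborel)"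
    using Bsets by (intro nn_integral_suminf[symmetric]) simp
  also have "\<dots> \<le> (\<integral>\<^sup>+q. indicator ?E q * G q \<partial>lborel)"
  proof (intro nn_integral_mono)
    fix q
    show "(\<Sum>k. ennreal (m k) * indicator (B k) q) \<le> indicator ?E q * G q"
    proof (cases "\<exists>k. q \<in> B k")
      case True
      then obtain k where k: "q \<in> B k" by blast
      have "(\<Sum>k. ennreal (m k) * indicator (B k) q) = ennreal (m k)"
        by (rule suminf_cmult_indicator[OF disj k])
      also have "\<dots> \<le> indicator ?E q * G q" using Gm[OF k] BE[of k] k by (auto simp: indicator_def)
      finally show ?thesis .
    next
      case False
      then have "(\<lambda>k. ennreal (m k) * indicator (B k) q) = (\<lambda>_. 0)" by (auto simp: fun_eq_iff)
      then show ?thesis by (simp only:) simp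
    qed
  qed
  finally show ?thesis by (simp add: top_unique)
qed

section \<open>Increments of the field over separated boxes\<close>

lemma L2_tendsto_cong:
  assumes "\<forall>\<^sub>F e in F. \<forall>\<omega>\<in>space M. f e \<omega> = g e \<omega>"
  shows "L2_tendsto M f l F \<longleftrightarrow> L2_tendsto M g l F"
proof -
  have *: "L2_tendsto M g l F" if "L2_tendsto M f l F" "\<forall>\<^sub>F e in F. \<forall>\<omega>\<in>space M. f e \<omega> = g e \<omega>" for f g
    unfolding L2_tendsto_def
  proof (intro conjI)
    show "\<forall>\<^sub>F e in F. square_integrable M (g e)"
    proof -
      have "\<forall>\<^sub>F e in F. square_integrable M (f e)" using that(1) by (simp add: L2_tendsto_def)
      then show ?thesis using that(2)
      proof eventually_elim
        case (elim e)
        then have "f e \<in> borel_measurable M \<longleftrightarrow> g e \<in> borel_measurable M" by (intro measurable_cong) auto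
        moreover have "integrable M (\<lambda>\<omega>. (f e \<omega>)\<^sup>2) \<longleftrightarrow> integrable M (\<lambda>\<omega>. (g e \<omega>)\<^sup>2)"
          using elim by (intro Bochner_Integration.integrable_cong refl) auto
        ultimately show ?case using elim by (simp add: square_integrable_def)
      qed
    qed
    show "square_integrable M l" using that(1) by (simp add: L2_tendsto_def)
    have lim: "((\<lambda>e. \<integral>\<omega>. (f e \<omega> - l \<omega>)\<^sup>2 \<partial>M) \<longlongrightarrow> 0) F" using that(1) by (simp add: L2_tendsto_def)
    have "\<forall>\<^sub>F e in F. (\<integral>\<omega>. (f e \<omega> - l \<omega>)\<^sup>2 \<partial>M) = (\<integral>\<omega>. (g e \<omega> - l \<omega>)\<^sup>2 \<partial>M)"
      using that(2) by eventually_elim (intro Bochner_Integration.integral_cong refl, auto)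
    with lim show "((\<lambda>e. \<integral>\<omega>. (g e \<omega> - l \<omega>)\<^sup>2 \<partial>M) \<longlongrightarrow> 0) F"
      by (rule Lim_transform_eventually)
  qed
  have "\<forall>\<^sub>F e in F. \<forall>\<omega>\<in>space M. g e \<omega> = f e \<omega>" using assms by eventually_elim auto
  then show ?thesis using *[of f g] *[of g f] assms by blast
qed

text \<open>
  Parameters are clamped to the unit cube below, so that the field is continuous and its increments are
  defined for all parameters; inside the boxes clamping has no effect.
\<close>

locale separated_boxes = iid_gaussian_field M0 X0 M X
  for M0 :: "'v measure" and X0 :: "real ^ 'n::finite \<Rightarrow> 'v \<Rightarrow> real"
    and M :: "'w measure" and X :: "real ^ 'n \<Rightarrow> 'w \<Rightarrow> real ^ 'd::finite" +
  fixes H a b :: "real ^ 'n" and h :: real and I J :: "(real ^ 'n) set" and S :: "'n set"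
  assumes continuous_covariance_X0: "continuous_covariance M0 X0"
    and continuous_paths: "\<And>\<omega>. \<omega> \<in> space M \<Longrightarrow> continuous_on (cbox 0 1) (\<lambda>t. X t \<omega>)"
    and H_pos: "\<And>j. 0 < H $ j"
    and C1: "condition_C1 M0 X0 H" and C3: "condition_C3 M0 X0 H"
    and h_pos: "0 < h"
    and I_def: "I = cbox a (\<chi> j. a $ j + h)" and J_def: "J = cbox b (\<chi> j. b $ j + h)"
    and I_unit: "I \<subseteq> cbox 0 1" and J_unit: "J \<subseteq> cbox 0 1"
    and S_nonempty: "S \<noteq> {}" and S_separated: "\<And>j. j \<in> S \<Longrightarrow> a $ j + h < b $ j"
begin

abbreviation cl :: "real ^ 'n \<Rightarrow> real ^ 'n" where "cl \<equiv> clamp 0 1"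

definition V :: "(real ^ 'n) \<times> (real ^ 'n) \<Rightarrow> 'w \<Rightarrow> real ^ 'd" where
  "V p \<omega> = X (cl (fst p)) \<omega> - X (cl (snd p)) \<omega>"

definition V0 :: "(real ^ 'n) \<times> (real ^ 'n) \<Rightarrow> 'v \<Rightarrow> real" where
  "V0 p \<omega> = X0 (cl (fst p)) \<omega> - X0 (cl (snd p)) \<omega>"

definition R :: "(real ^ 'n) \<times> (real ^ 'n) \<Rightarrow> (real ^ 'n) \<times> (real ^ 'n) \<Rightarrow> real" where
  "R p q = (\<integral>\<omega>. V0 p \<omega> * V0 q \<omega> \<partial>M0)"

lemma X0_square_integrable: "square_integrable M0 (X0 t)"
  by (rule S.G_square_integrable[OF X0_in_scalar_span])

lemma V0_square_integrable: "square_integrable M0 (V0 p)"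
  unfolding V0_def[abs_def] by (intro square_integrable_diff X0_square_integrable)

lemma cl_eq: "t \<in> I \<Longrightarrow> cl t = t" "t \<in> J \<Longrightarrow> cl t = t"
  using I_unit J_unit by auto

lemma cl_continuous: "continuous_on UNIV cl"
  using clamp_continuous_on[of 0 1 "\<lambda>x. x" UNIV] by (simp add: continuous_on_id)

lemma V_measurable: "(\<lambda>(\<omega>, p). V p \<omega>) \<in> borel_measurable (M \<Otimes>\<^sub>M borel)"
proof -
  have m: "(\<lambda>(\<omega>, t). X (cl t) \<omega>) \<in> borel_measurable (M \<Otimes>\<^sub>M borel)"
    by (rule Caratheodory_borel_measurable) (auto intro: clamp_continuous_on continuous_paths)
  have g: "(fst :: (real ^ 'n) \<times> (real ^ 'n) \<Rightarrow> _) \<in> borel_measurable borel"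
    "(snd :: (real ^ 'n) \<times> (real ^ 'n) \<Rightarrow> _) \<in> borel_measurable borel"
    by (auto intro!: borel_measurable_continuous_onI continuous_intros)
  have f: "(\<lambda>x. (fst x, fst (snd x))) \<in> M \<Otimes>\<^sub>M (borel :: ((real ^ 'n) \<times> (real ^ 'n)) measure) \<rightarrow>\<^sub>M M \<Otimes>\<^sub>M (borel :: (real ^ 'n) measure)"
    by (rule measurable_Pair[OF measurable_fst measurable_compose[OF measurable_snd g(1)]])
  have f': "(\<lambda>x. (fst x, snd (snd x))) \<in> M \<Otimes>\<^sub>M (borel :: ((real ^ 'n) \<times> (real ^ 'n)) measure) \<rightarrow>\<^sub>M M \<Otimes>\<^sub>M (borel :: (real ^ 'n) measure)"
    by (rule measurable_Pair[OF measurable_fst measurable_compose[OF measurable_snd g(2)]])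
  show ?thesis
    using borel_measurable_diff[OF measurable_compose[OF f m] measurable_compose[OF f' m]]
    by (simp add: V_def case_prod_unfold)
qed

lemma R_continuous: "continuous_on UNIV (\<lambda>x. R (fst x) (snd x))"
proof -
  define K where "K = (\<lambda>(s, t). \<integral>\<omega>. X0 s \<omega> * X0 t \<omega> \<partial>M0)"
  have K: "continuous_on UNIV K"
    using continuous_covariance_X0 centered by (simp add: continuous_covariance_def centered_field_def K_def)
  have K': "continuous_on UNIV (\<lambda>x. K (cl (f x), cl (g x)))"
    if "continuous_on UNIV f" "continuous_on UNIV g" for f g :: "'z::topological_space \<Rightarrow> real ^ 'n"
    by (rule continuous_on_compose2[OF K])
      (auto intro!: continuous_on_Pair continuous_on_compose2[OF cl_continuous] that)
  have i: "integrable M0 (\<lambda>\<omega>. X0 s \<omega> * X0 t \<omega>)" for s t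
    by (intro square_integrable_mult X0_square_integrable)
  have "R p q = K (cl (fst p), cl (fst q)) - K (cl (fst p), cl (snd q)) - K (cl (snd p), cl (fst q)) + K (cl (snd p), cl (snd q))" for p q
    by (simp add: R_def V0_def K_def algebra_simps i)
  then show ?thesis by (simp only:) (intro continuous_intros K')
qed

lemma R_measurable: "(\<lambda>(p, q). R p q) \<in> borel_measurable (borel \<Otimes>\<^sub>M borel)"
  using borel_measurable_continuous_onI[OF R_continuous] by (simp add: borel_prod case_prod_unfold)

lemma R_eq_variance: "R p p = (\<integral>\<omega>. (V0 p \<omega>)\<^sup>2 \<partial>M0)"
  by (simp add: R_def power2_eq_square)

lemma increment_variance: "(\<integral>\<omega>. (V0 q \<omega> - l * V0 p \<omega>)\<^sup>2 \<partial>M0) = R q q - 2 * l * R p q + l\<^sup>2 * R p p"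
proof -
  have "(\<integral>\<omega>. (V0 q \<omega> - l * V0 p \<omega>)\<^sup>2 \<partial>M0) = (\<integral>\<omega>. (V0 q \<omega>)\<^sup>2 \<partial>M0) - 2 * (\<integral>\<omega>. V0 q \<omega> * (l * V0 p \<omega>) \<partial>M0) + (\<integral>\<omega>. (l * V0 p \<omega>)\<^sup>2 \<partial>M0)"
    by (intro integral_power2_diff square_integrable_scale V0_square_integrable)
  also have "(\<integral>\<omega>. V0 q \<omega> * (l * V0 p \<omega>) \<partial>M0) = l * R p q"
    unfolding R_def integral_mult_right_zero[symmetric] by (simp only: mult_ac)
  also have "(\<integral>\<omega>. (l * V0 p \<omega>)\<^sup>2 \<partial>M0) = l\<^sup>2 * R p p"
    unfolding R_eq_variance integral_mult_right_zero[symmetric] power_mult_distrib ..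
  finally show ?thesis by (simp add: R_eq_variance[of q])
qed

text \<open>
  The entry \<open>h\<close> bounds the separated coordinates of points of \<open>J\<close> away from \<open>0\<close>: they exceed \<open>a $ j + h\<close>
  with \<open>a $ j \<ge> 0\<close>.
\<close>

definition separation :: real where
  "separation = Min (insert h ((\<lambda>j. b $ j - (a $ j + h)) ` S))"

lemma separation_pos: "0 < separation"
  unfolding separation_def using h_pos S_separated by (subst Min_gr_iff) auto

lemma separation_le: "s \<in> I \<Longrightarrow> t \<in> J \<Longrightarrow> j \<in> S \<Longrightarrow> separation \<le> \<bar>t $ j - s $ j\<bar>"
proof -
  assume st: "s \<in> I" "t \<in> J" and j: "j \<in> S"
  have "separation \<le> b $ j - (a $ j + h)" unfolding separation_def using j by (intro Min_le) auto
  moreover have "s $ j \<le> a $ j + h" "b $ j \<le> t $ j" using st by (auto simp: I_def J_def mem_box_cart)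
  ultimately show ?thesis by linarith
qed

lemma separation_le_abs: "t \<in> J \<Longrightarrow> j \<in> S \<Longrightarrow> separation \<le> \<bar>t $ j\<bar>"
proof -
  assume t: "t \<in> J" and j: "j \<in> S"
  have "a \<in> I" using h_pos by (auto simp: I_def mem_box_cart)
  then have "0 \<le> a $ j" using I_unit by (auto simp: mem_box_cart)
  moreover have "separation \<le> h" unfolding separation_def by (intro Min_le) auto
  moreover have "b $ j \<le> t $ j" using t by (auto simp: J_def mem_box_cart)
  ultimately show ?thesis using S_separated[OF j] by linarith
qed

text \<open>
  The variance of an increment is at least the prediction error of \<open>X\<close> at \<open>t\<close> from \<open>s\<close>, and a separated
  coordinate keeps that error away from \<open>0\<close>.  The determinant is \<open>R p p\<close> times the error of the best
  linear predictor of \<open>V0 q\<close> from \<open>V0 p\<close>; this error is also one for predicting \<open>X0\<close> at either end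
  point of \<open>q\<close> from the three other points, and the average of the two resulting bounds is used.
\<close>

lemma variance_bounds_exist:
  obtains c1 \<sigma>0 c3 where "0 < c1" "0 < \<sigma>0" "0 < c3"
    "\<And>s t. s \<in> cbox 0 1 \<Longrightarrow> t \<in> cbox 0 1 \<Longrightarrow> (\<integral>\<omega>. (X0 s \<omega> - X0 t \<omega>)\<^sup>2 \<partial>M0) \<le> c1 * holder H s t"
    "\<And>p. p \<in> I \<times> J \<Longrightarrow> \<sigma>0 \<le> R p p"
    "\<And>p q. p \<in> I \<times> J \<Longrightarrow> q \<in> I \<times> J \<Longrightarrow>
      c3 * (gap H (fst q) (snd q) (fst p) (snd p) + gap H (snd q) (fst q) (fst p) (snd p)) \<le> R p p * R q q - (R p q)\<^sup>2"
proof -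
  obtain c1 where c1: "0 < c1" "\<And>s t. s \<in> cbox 0 1 \<Longrightarrow> t \<in> cbox 0 1 \<Longrightarrow>
        (\<integral>\<omega>. (X0 s \<omega> - X0 t \<omega>)\<^sup>2 \<partial>M0) \<le> c1 * holder H s t"
    using C1 unfolding condition_C1_def holder_def by blast
  obtain c where c: "0 < c" and reg: "\<And>u t1 t2 t3 l1 l2 l3. u \<in> cbox 0 1 \<Longrightarrow> t1 \<in> cbox 0 1 \<Longrightarrow> t2 \<in> cbox 0 1 \<Longrightarrow> t3 \<in> cbox 0 1 \<Longrightarrow>
     c * gap H u t1 t2 t3 \<le> (\<integral>\<omega>. (X0 u \<omega> - (l1 * X0 t1 \<omega> + l2 * X0 t2 \<omega> + l3 * X0 t3 \<omega>))\<^sup>2 \<partial>M0)"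
    using condition_C3_regression[OF S.prob_space_axioms X0_square_integrable C3 H_pos] by blast
  obtain j0 where j0: "j0 \<in> S" using S_nonempty by blast
  define \<sigma>0 where "\<sigma>0 = c * separation powr (2 * H $ j0)"
  have \<sigma>0: "0 < \<sigma>0" unfolding \<sigma>0_def using c separation_pos by simp
  have unit: "s \<in> cbox 0 1" "t \<in> cbox 0 1" if "s \<in> I" "t \<in> J" for s t using that I_unit J_unit by auto
  have lower: "\<sigma>0 \<le> R p p" if p: "p \<in> I \<times> J" for p
  proof -
    obtain s t where st: "p = (s, t)" "s \<in> I" "t \<in> J" using p by auto
    have "separation \<le> min_dist (t $ j0) (s $ j0) (s $ j0) (s $ j0)"
      using separation_le[OF st(2,3) j0] separation_le_abs[OF st(3) j0] by (simp add: min_dist_def)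
    then have "separation powr (2 * H $ j0) \<le> min_dist (t $ j0) (s $ j0) (s $ j0) (s $ j0) powr (2 * H $ j0)"
      using separation_pos H_pos[of j0] by (intro powr_mono2) auto
    also have "\<dots> \<le> gap H t s s s" unfolding gap_def by (rule member_le_sum) auto
    finally have "\<sigma>0 \<le> c * gap H t s s s" unfolding \<sigma>0_def using c by simp
    also have "\<dots> \<le> (\<integral>\<omega>. (X0 t \<omega> - (1 * X0 s \<omega> + 0 * X0 s \<omega> + 0 * X0 s \<omega>))\<^sup>2 \<partial>M0)"
      by (rule reg) (use st unit in auto)
    also have "\<dots> = R p p"
      unfolding R_eq_variance using st by (simp add: V0_def cl_eq power2_commute)
    finally show ?thesis .
  qed
  have det: "\<sigma>0 * c / 2 * (gap H (fst q) (snd q) (fst p) (snd p) + gap H (snd q) (fst q) (fst p) (snd p)) \<le> R p p * R q q - (R p q)\<^sup>2"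
    if p: "p \<in> I \<times> J" and q: "q \<in> I \<times> J" for p q
  proof -
    obtain s t where st: "p = (s, t)" "s \<in> I" "t \<in> J" using p by auto
    obtain s' t' where st': "q = (s', t')" "s' \<in> I" "t' \<in> J" using q by auto
    note u = unit[OF st(2,3)] unit[OF st'(2,3)]
    define l where "l = R p q / R p p"
    have Rp: "0 < R p p" using lower[OF p] \<sigma>0 by linarith
    let ?W = "\<integral>\<omega>. (V0 q \<omega> - l * V0 p \<omega>)\<^sup>2 \<partial>M0"
    have "c * gap H s' t' s t \<le> (\<integral>\<omega>. (X0 s' \<omega> - (1 * X0 t' \<omega> + l * X0 s \<omega> + (- l) * X0 t \<omega>))\<^sup>2 \<partial>M0)"
      by (rule reg) (use u in auto)
    also have "\<dots> = ?W"
      using st st' by (intro Bochner_Integration.integral_cong refl arg_cong[of _ _ "\<lambda>x. x\<^sup>2"]) (simp add: V0_def cl_eq algebra_simps)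
    finally have 1: "c * gap H s' t' s t \<le> ?W" .
    have "c * gap H t' s' s t \<le> (\<integral>\<omega>. (X0 t' \<omega> - (1 * X0 s' \<omega> + (- l) * X0 s \<omega> + l * X0 t \<omega>))\<^sup>2 \<partial>M0)"
      by (rule reg) (use u in auto)
    also have "\<dots> = (\<integral>\<omega>. (- (V0 q \<omega> - l * V0 p \<omega>))\<^sup>2 \<partial>M0)"
      using st st' by (intro Bochner_Integration.integral_cong refl arg_cong[of _ _ "\<lambda>x. x\<^sup>2"]) (simp add: V0_def cl_eq algebra_simps)
    also have "\<dots> = ?W" by (simp only: power2_minus)
    finally have 2: "c * gap H t' s' s t \<le> ?W" .
    have "c / 2 * (gap H s' t' s t + gap H t' s' s t) \<le> ?W" using 1 2 by (simp add: algebra_simps)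
    moreover have "0 \<le> c / 2 * (gap H s' t' s t + gap H t' s' s t)"
      using c gap_nonneg[of H s' t' s t] gap_nonneg[of H t' s' s t] by simp
    ultimately have "\<sigma>0 * (c / 2 * (gap H s' t' s t + gap H t' s' s t)) \<le> R p p * ?W"
      using lower[OF p] \<sigma>0 Rp by (intro mult_mono) auto
    also have "R p p * ?W = R p p * R q q - (R p q)\<^sup>2"
      unfolding increment_variance l_def using Rp by (simp add: field_simps power2_eq_square)
    finally show ?thesis using st st' by (simp add: mult.assoc)
  qed
  have c3: "0 < \<sigma>0 * c / 2" using \<sigma>0 c by simp
  show ?thesis by (rule that[OF c1(1) \<sigma>0 c3 c1(2) lower det])
qed

lemma IJ_sets: "I \<times> J \<in> sets borel" "I \<in> sets borel" "J \<in> sets borel"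
  unfolding I_def J_def by (auto intro!: borel_closed closed_Times)

lemma IJ_finite: "emeasure lborel (I \<times> J) < \<infinity>"
  unfolding I_def J_def by (intro emeasure_compact_finite compact_Times) auto

lemma gaussian_local_timeI:
  assumes "0 < \<sigma>0" "\<And>p. p \<in> I \<times> J \<Longrightarrow> \<sigma>0 \<le> R p p"
  shows "gaussian_local_time M X V (I \<times> J) R \<sigma>0"
proof unfold_locales
  show "(\<lambda>(\<omega>, p). V p \<omega>) \<in> borel_measurable (M \<Otimes>\<^sub>M borel)" by (rule V_measurable)
  show "(\<lambda>\<omega>. \<xi> \<bullet> V p \<omega>) \<in> linear_span X" for \<xi> p
    unfolding V_def by (rule increment_in_linear_span)
  show "(\<integral>\<omega>. (\<xi> \<bullet> V p \<omega>) * (\<eta> \<bullet> V q \<omega>) \<partial>M) = (\<xi> \<bullet> \<eta>) * R p q" for \<xi> \<eta> p q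
    unfolding V_def R_def V0_def by (rule covariance_increments)
  show "(\<lambda>(p, q). R p q) \<in> borel_measurable (borel \<Otimes>\<^sub>M borel)" by (rule R_measurable)
  show "I \<times> J \<in> sets borel" by (rule IJ_sets)
  show "emeasure lborel (I \<times> J) < \<infinity>" by (rule IJ_finite)
qed (use assms in auto)

lemma local_time_iff_approx:
  assumes "gaussian_local_time M X V (I \<times> J) R \<sigma>0"
  shows "self_intersection_local_time M X I J L \<longleftrightarrow> L2_tendsto M (gaussian_local_time.approx V (I \<times> J)) L (at_right 0)"
proof -
  interpret G: gaussian_local_time M X V "I \<times> J" R \<sigma>0 by fact
  have eq: "approx_self_intersection_local_time X I J \<epsilon> \<omega> = G.approx \<epsilon> \<omega>" if "0 < \<epsilon>" "\<omega> \<in> space M" for \<epsilon> \<omega>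
  proof -
    have "approx_self_intersection_local_time X I J \<epsilon> \<omega> = (LINT p:I \<times> J|lborel. heat_kernel \<epsilon> (V p \<omega>))"
      unfolding approx_self_intersection_local_time_def set_lebesgue_integral_def
      by (intro Bochner_Integration.integral_cong refl) (auto simp: V_def cl_eq split: split_indicator)
    then show ?thesis using G.approx_eq_heat_kernel[OF that] by simp
  qed
  show ?thesis
    unfolding self_intersection_local_time_def
    by (intro L2_tendsto_cong) (auto simp: eventually_at_right_field eq intro!: exI[of _ 1])
qed

text \<open>
  The exponent \<open>g = 2 \<kappa> / Q\<close> of the one-dimensional integrals is below \<open>1\<close> exactly if \<open>2 \<kappa> < Q\<close>.
\<close>

lemma energy_finite:
  assumes G: "gaussian_local_time M X V (I \<times> J) R \<sigma>0"
    and \<kappa>: "0 \<le> \<kappa>" "2 * \<kappa> < 2 * (\<Sum>j\<in>S. 1 / H $ j) + (\<Sum>j\<in>- S. 1 / H $ j)"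
    and f: "f \<in> borel_measurable borel"
    and le: "\<And>p q. p \<in> I \<times> J \<Longrightarrow> q \<in> I \<times> J \<Longrightarrow>
      0 < gap H (fst q) (snd q) (fst p) (snd p) + gap H (snd q) (fst q) (fst p) (snd p) \<Longrightarrow>
      gauss2 TYPE('d) f (R p p) (R q q) (R p q)
        \<le> ennreal (C * (gap H (fst q) (snd q) (fst p) (snd p) + gap H (snd q) (fst q) (fst p) (snd p)) powr - \<kappa>)"
    and C: "0 < C"
  shows "gaussian_local_time.energy TYPE('d) (I \<times> J) R f (\<lambda>p. R p p) (\<lambda>p. R p p) < \<infinity>"
proof -
  interpret G: gaussian_local_time M X V "I \<times> J" R \<sigma>0 by fact
  let ?\<rho> = "\<lambda>p q. gap H (fst q) (snd q) (fst p) (snd p) + gap H (snd q) (fst q) (fst p) (snd p)"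
  define Q where "Q = 2 * (\<Sum>j\<in>S. 1 / H $ j) + (\<Sum>j\<in>- S. 1 / H $ j)"
  define g where "g = 2 * \<kappa> / Q"
  have Q: "0 < Q" using \<kappa> by (simp add: Q_def)
  have g: "0 \<le> g" "g < 1" "\<kappa> = g / 2 * Q" using \<kappa> Q by (auto simp: g_def Q_def[symmetric])
  obtain C' where C': "C' < \<top>" "\<And>s t. s \<in> I \<Longrightarrow> t \<in> J \<Longrightarrow> (\<integral>\<^sup>+q. indicator (I \<times> J) q *
      sing \<kappa> (gap H (fst q) (snd q) s t + gap H (snd q) (fst q) s t) \<partial>lborel) \<le> C'"
    using sing_gap_integral_finite[OF H_pos g(1,2) g(3)[unfolded Q_def] I_unit J_unit IJ_sets(2,3) separation_pos separation_le]
    by blast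
  have le': "gauss2 TYPE('d) f (R p p) (R q q) (R p q) \<le> ennreal C * sing \<kappa> (?\<rho> p q)"
    if "p \<in> I \<times> J" "q \<in> I \<times> J" for p q
  proof (cases "?\<rho> p q = 0")
    case True
    then show ?thesis using C by (simp add: sing_def ennreal_mult_top)
  next
    case False
    then have pos: "0 < ?\<rho> p q"
      using gap_nonneg[of H "fst q" "snd q" "fst p" "snd p"] gap_nonneg[of H "snd q" "fst q" "fst p" "snd p"] by linarith
    then show ?thesis using le[OF that pos] C by (simp add: sing_def ennreal_mult)
  qed
  have "G.energy f (\<lambda>p. R p p) (\<lambda>p. R p p) \<le> (\<integral>\<^sup>+p. (ennreal C * C') * indicator (I \<times> J) p \<partial>lborel)"
    unfolding G.energy_def
  proof (intro nn_integral_mono)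
    fix p :: "(real ^ 'n) \<times> (real ^ 'n)"
    show "indicator (I \<times> J) p * (\<integral>\<^sup>+q. indicator (I \<times> J) q * gauss2 TYPE('d) f (R p p) (R q q) (R p q) \<partial>lborel)
        \<le> (ennreal C * C') * indicator (I \<times> J) p"
    proof (cases "p \<in> I \<times> J")
      case True
      have [measurable]: "(\<lambda>q. sing \<kappa> (?\<rho> p q)) \<in> borel_measurable borel"
        unfolding borel_prod[symmetric] by measurable
      have "(\<integral>\<^sup>+q. indicator (I \<times> J) q * gauss2 TYPE('d) f (R p p) (R q q) (R p q) \<partial>lborel)
          \<le> (\<integral>\<^sup>+q. ennreal C * (indicator (I \<times> J) q * sing \<kappa> (?\<rho> p q)) \<partial>lborel)"
        by (intro nn_integral_mono) (auto split: split_indicator intro!: le' True simp del: fst_conv snd_conv)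
      also have "\<dots> = ennreal C * (\<integral>\<^sup>+q. indicator (I \<times> J) q * sing \<kappa> (?\<rho> p q) \<partial>lborel)"
        using IJ_sets by (intro nn_integral_cmult) measurable
      also have "\<dots> \<le> ennreal C * C'"
        using True by (intro mult_left_mono C'(2)) auto
      finally show ?thesis using True by simp
    qed simp
  qed
  also have "\<dots> = (ennreal C * C') * emeasure lborel (I \<times> J)"
    using IJ_sets by (intro nn_integral_cmult_indicator) simp
  also have "\<dots> < \<infinity>" using C' IJ_finite by (simp add: ennreal_mult_less_top)
  finally show ?thesis .
qed

text \<open>
  Starting points are restricted to the lower halves of the boxes to leave room for the shells.
\<close>

lemma energy_infinite:
  assumes G: "gaussian_local_time M X V (I \<times> J) R \<sigma>0"
    and \<kappa>: "(\<Sum>j\<in>UNIV. 1 / H $ j) \<le> \<kappa>" and r0: "0 < r0" and c: "0 < c"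
    and ge: "\<And>s t s' t'. s \<in> I \<Longrightarrow> t \<in> J \<Longrightarrow> s' \<in> I \<Longrightarrow> t' \<in> J \<Longrightarrow>
      0 < holder H s s' + holder H t t' \<Longrightarrow> holder H s s' + holder H t t' \<le> r0 \<Longrightarrow>
      ennreal (c * (holder H s s' + holder H t t') powr - \<kappa>)
        \<le> gauss2 TYPE('d) f (R (s, t) (s, t)) (R (s', t') (s', t')) (R (s, t) (s', t'))"
  shows "gaussian_local_time.energy TYPE('d) (I \<times> J) R f (\<lambda>p. R p p) (\<lambda>p. R p p) = \<infinity>"
proof -
  interpret G: gaussian_local_time M X V "I \<times> J" R \<sigma>0 by fact
  define B where "B = box a (\<chi> j. a $ j + h / 2) \<times> box b (\<chi> j. b $ j + h / 2)"
  have BE: "B \<subseteq> I \<times> J"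
  proof -
    have "box c (\<chi> j. c $ j + h / 2) \<subseteq> cbox c (\<chi> j. c $ j + h)" for c :: "real ^ 'n"
    proof
      fix x assume x: "x \<in> box c (\<chi> j. c $ j + h / 2)"
      have "c $ j \<le> x $ j \<and> x $ j \<le> c $ j + h" for j
      proof -
        have "c $ j < x $ j" "x $ j < c $ j + h / 2" using x by (auto simp: mem_box_cart)
        then show ?thesis using h_pos by simp
      qed
      then show "x \<in> cbox c (\<chi> j. c $ j + h)" by (simp add: mem_box_cart)
    qed
    then show ?thesis unfolding B_def I_def J_def by (intro Sigma_mono)
  qed
  have B: "B \<in> sets borel" unfolding B_def by (intro borel_open open_Times open_box)
  have "emeasure lborel B = ennreal ((\<Prod>j\<in>(UNIV::'n set). h / 2) * (\<Prod>j\<in>(UNIV::'n set). h / 2))"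
    unfolding B_def using h_pos by (subst emeasure_box_prod) auto
  then have pos: "emeasure lborel B \<noteq> 0" using h_pos by (simp add: ennreal_eq_0_iff not_le)
  have "\<infinity> = \<top> * emeasure lborel B" using pos by (simp add: ennreal_top_mult)
  also have "\<dots> = (\<integral>\<^sup>+p. \<top> * indicator B p \<partial>lborel)"
    using B by (simp add: nn_integral_cmult_indicator)
  also have "\<dots> \<le> G.energy f (\<lambda>p. R p p) (\<lambda>p. R p p)"
    unfolding G.energy_def
  proof (intro nn_integral_mono)
    fix p :: "(real ^ 'n) \<times> (real ^ 'n)"
    show "\<top> * indicator B p \<le> indicator (I \<times> J) p * (\<integral>\<^sup>+q. indicator (I \<times> J) q * gauss2 TYPE('d) f (R p p) (R q q) (R p q) \<partial>lborel)"
    proof (cases "p \<in> B")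
      case True
      obtain s t where p: "p = (s, t)" by (cases p)
      have pIJ: "p \<in> I \<times> J" using True BE by auto
      have st: "a $ j \<le> s $ j" "s $ j \<le> a $ j + h / 2" "b $ j \<le> t $ j" "t $ j \<le> b $ j + h / 2" for j
        using True by (auto simp: p B_def mem_box_cart less_imp_le)
      have "(\<integral>\<^sup>+q. indicator (I \<times> J) q * gauss2 TYPE('d) f (R p p) (R q q) (R p q) \<partial>lborel) = \<top>"
        unfolding I_def J_def
      proof (rule holder_integral_infinite[OF H_pos \<kappa> h_pos r0 st _ c])
        fix s' t' assume "s' \<in> cbox a (\<chi> j. a $ j + h)" "t' \<in> cbox b (\<chi> j. b $ j + h)"
          "0 < holder H s s' + holder H t t'" "holder H s s' + holder H t t' \<le> r0"
        then show "ennreal (c * (holder H s s' + holder H t t') powr - \<kappa>)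
            \<le> gauss2 TYPE('d) f (R p p) (R (s', t') (s', t')) (R p (s', t'))"
          using pIJ unfolding p by (intro ge) (auto simp: I_def J_def)
      qed
      then show ?thesis using True pIJ by simp
    qed simp
  qed
  finally show ?thesis by (simp add: top_unique)
qed

text \<open>
  The four cases differ only in the function (\<open>cosh\<close> or \<open>x sinh x\<close>), in the exponent (\<open>d / 2\<close> or
  \<open>(d + 2) / 2\<close>) and in the direction of the bound.
\<close>

theorem existence_and_smoothness:
  "(2 * (\<Sum>j\<in>S. 1 / H $ j) + (\<Sum>j\<in>- S. 1 / H $ j) > real CARD('d) \<longrightarrow>
      (\<exists>L. self_intersection_local_time M X I J L)) \<and>
   (2 * (\<Sum>j\<in>UNIV. 1 / H $ j) \<le> real CARD('d) \<longrightarrow>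
      \<not> (\<exists>L. self_intersection_local_time M X I J L)) \<and>
   (2 * (\<Sum>j\<in>S. 1 / H $ j) + (\<Sum>j\<in>- S. 1 / H $ j) > real CARD('d) + 2 \<longrightarrow>
      (\<exists>L. self_intersection_local_time M X I J L \<and> L \<in> D1 M X)) \<and>
   (2 * (\<Sum>j\<in>UNIV. 1 / H $ j) \<le> real CARD('d) + 2 \<longrightarrow>
      \<not> (\<exists>L. self_intersection_local_time M X I J L \<and> L \<in> D1 M X))"
proof -
  let ?d = "real CARD('d)"
  let ?\<rho> = "\<lambda>p q. gap H (fst q) (snd q) (fst p) (snd p) + gap H (snd q) (fst q) (fst p) (snd p)"
  obtain c1 \<sigma>0 c3 where c1: "0 < c1" and \<sigma>0: "0 < \<sigma>0" and c3: "0 < c3"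
    and upper: "\<And>s t. s \<in> cbox 0 1 \<Longrightarrow> t \<in> cbox 0 1 \<Longrightarrow> (\<integral>\<omega>. (X0 s \<omega> - X0 t \<omega>)\<^sup>2 \<partial>M0) \<le> c1 * holder H s t"
    and lower: "\<And>p. p \<in> I \<times> J \<Longrightarrow> \<sigma>0 \<le> R p p"
    and det: "\<And>p q. p \<in> I \<times> J \<Longrightarrow> q \<in> I \<times> J \<Longrightarrow> c3 * ?\<rho> p q \<le> R p p * R q q - (R p q)\<^sup>2"
    by (rule variance_bounds_exist) blast
  have G: "gaussian_local_time M X V (I \<times> J) R \<sigma>0" by (rule gaussian_local_timeI[OF \<sigma>0 lower])
  interpret G: gaussian_local_time M X V "I \<times> J" R \<sigma>0 by (rule G)
  note L_iff = local_time_iff_approx[OF G]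
  define m where "m = c1 * real CARD('n)"
  have m: "0 < m" using c1 by (simp add: m_def)
  have Rpos: "0 < R p p" if "p \<in> I \<times> J" for p using lower[OF that] \<sigma>0 by linarith
  have Rle: "R p p \<le> m" if "p \<in> I \<times> J" for p
  proof -
    obtain s t where st: "p = (s, t)" "s \<in> I" "t \<in> J" using \<open>p \<in> I \<times> J\<close> by auto
    have unit: "s \<in> cbox 0 1" "t \<in> cbox 0 1" using st I_unit J_unit by auto
    have "R p p \<le> c1 * holder H s t"
      unfolding R_eq_variance using upper[OF unit] st by (simp add: V0_def cl_eq)
    also have "holder H s t \<le> (\<Sum>j\<in>(UNIV::'n set). 1)"
      unfolding holder_def
    proof (intro sum_mono)
      fix j
      have "\<bar>s $ j - t $ j\<bar> \<le> 1" using unit by (auto simp: mem_box_cart abs_le_iff) (smt (verit))+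
      then show "\<bar>s $ j - t $ j\<bar> powr (2 * H $ j) \<le> 1"
        using H_pos[of j] powr_mono2[of "2 * H $ j" "\<bar>s $ j - t $ j\<bar>" 1] by simp
    qed
    finally show ?thesis using c1 by (simp add: m_def)
  qed
  \<comment> \<open>upper bounds for the energies\<close>
  have cosh_le: "gauss2 TYPE('d) cosh (R p p) (R q q) (R p q)
      \<le> ennreal ((2 * pi) powr ?d * c3 powr (- ?d / 2) * ?\<rho> p q powr - (?d / 2))"
    if "p \<in> I \<times> J" "q \<in> I \<times> J" "0 < ?\<rho> p q" for p q
  proof -
    have "gauss2 TYPE('d) cosh (R p p) (R q q) (R p q) \<le> ennreal ((2 * pi) powr ?d * (c3 * ?\<rho> p q) powr (- ?d / 2))"
      by (rule gauss2_cosh_le) (use that Rpos det c3 in auto)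
    also have "(c3 * ?\<rho> p q) powr (- ?d / 2) = c3 powr (- ?d / 2) * ?\<rho> p q powr (- ?d / 2)"
      by (rule powr_mult)
    finally show ?thesis by (simp add: mult.assoc)
  qed
  have sinh_le: "gauss2 TYPE('d) (\<lambda>x. x * sinh x) (R p p) (R q q) (R p q)
      \<le> ennreal (6 * (m * m) * 2 powr (?d / 2) * (2 * pi) powr ?d * c3 powr (- (?d + 2) / 2) * ?\<rho> p q powr - ((?d + 2) / 2))"
    if "p \<in> I \<times> J" "q \<in> I \<times> J" "0 < ?\<rho> p q" for p q
  proof -
    have "gauss2 TYPE('d) (\<lambda>x. x * sinh x) (R p p) (R q q) (R p q)
      \<le> ennreal (6 * (m * m) * 2 powr (?d / 2) * (2 * pi) powr ?d * (c3 * ?\<rho> p q) powr (- (?d + 2) / 2))"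
    proof (rule gauss2_sinh_le)
      show "R p p * R q q \<le> m * m"
        using Rle[OF that(1)] Rle[OF that(2)] Rpos[OF that(2)] m by (intro mult_mono) auto
    qed (use that Rpos det c3 in auto)
    also have "(c3 * ?\<rho> p q) powr (- (?d + 2) / 2) = c3 powr (- (?d + 2) / 2) * ?\<rho> p q powr (- (?d + 2) / 2)"
      by (rule powr_mult)
    finally show ?thesis by (simp only: mult.assoc minus_divide_left)
  qed
  \<comment> \<open>lower bounds near the diagonal\<close>
  have diff: "R p p + R q q - 2 * R p q \<le> 2 * c1 * (holder H s s' + holder H t t')"
    if "p = (s, t)" "q = (s', t')" "s \<in> I" "t \<in> J" "s' \<in> I" "t' \<in> J" for p q s t s' t'
  proof -
    have unit: "s \<in> cbox 0 1" "t \<in> cbox 0 1" "s' \<in> cbox 0 1" "t' \<in> cbox 0 1" using that I_unit J_unit by auto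
    have sq: "square_integrable M0 (\<lambda>\<omega>. X0 u \<omega> - X0 v \<omega>)" for u v
      by (intro square_integrable_diff X0_square_integrable)
    have sq2: "(x - y)\<^sup>2 \<le> 2 * x\<^sup>2 + 2 * y\<^sup>2" for x y :: real
      using zero_le_power2[of "x + y"] by (simp add: power2_sum power2_diff)
    have "R p p + R q q - 2 * R p q = (\<integral>\<omega>. (V0 q \<omega> - 1 * V0 p \<omega>)\<^sup>2 \<partial>M0)"
      unfolding increment_variance by simp
    also have "\<dots> = (\<integral>\<omega>. ((X0 s \<omega> - X0 s' \<omega>) - (X0 t \<omega> - X0 t' \<omega>))\<^sup>2 \<partial>M0)"
    proof (intro Bochner_Integration.integral_cong refl)
      fix \<omega>
      have "V0 q \<omega> - 1 * V0 p \<omega> = - ((X0 s \<omega> - X0 s' \<omega>) - (X0 t \<omega> - X0 t' \<omega>))"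
        using that by (simp add: V0_def cl_eq)
      then show "(V0 q \<omega> - 1 * V0 p \<omega>)\<^sup>2 = ((X0 s \<omega> - X0 s' \<omega>) - (X0 t \<omega> - X0 t' \<omega>))\<^sup>2"
        by (simp only: power2_minus)
    qed
    also have "\<dots> \<le> (\<integral>\<omega>. 2 * (X0 s \<omega> - X0 s' \<omega>)\<^sup>2 + 2 * (X0 t \<omega> - X0 t' \<omega>)\<^sup>2 \<partial>M0)"
    proof (rule integral_mono)
      fix \<omega>
      show "((X0 s \<omega> - X0 s' \<omega>) - (X0 t \<omega> - X0 t' \<omega>))\<^sup>2 \<le> 2 * (X0 s \<omega> - X0 s' \<omega>)\<^sup>2 + 2 * (X0 t \<omega> - X0 t' \<omega>)\<^sup>2"
        by (rule sq2)
    qed (use sq square_integrable_diff[OF sq sq] in \<open>auto simp: square_integrable_def\<close>)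
    also have "\<dots> = 2 * (\<integral>\<omega>. (X0 s \<omega> - X0 s' \<omega>)\<^sup>2 \<partial>M0) + 2 * (\<integral>\<omega>. (X0 t \<omega> - X0 t' \<omega>)\<^sup>2 \<partial>M0)"
      using sq by (simp add: square_integrable_def)
    also have "\<dots> \<le> 2 * (c1 * holder H s s') + 2 * (c1 * holder H t t')"
      using upper[OF unit(1,3)] upper[OF unit(2,4)] by simp
    finally show ?thesis by (simp add: algebra_simps)
  qed
  have det_le: "R p p * R q q - (R p q)\<^sup>2 \<le> 2 * c1 * m * (holder H s s' + holder H t t')"
    if "p = (s, t)" "q = (s', t')" "s \<in> I" "t \<in> J" "s' \<in> I" "t' \<in> J" for p q s t s' t'
  proof -
    have pq: "p \<in> I \<times> J" "q \<in> I \<times> J" using that by auto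
    have "R p p * R q q - (R p q)\<^sup>2 = R p p * (R p p + R q q - 2 * R p q) - (R p p - R p q)\<^sup>2"
      by (simp add: power2_eq_square algebra_simps)
    also have "\<dots> \<le> R p p * (R p p + R q q - 2 * R p q)" by simp
    also have "\<dots> \<le> R p p * (2 * c1 * (holder H s s' + holder H t t'))"
      using diff[OF that] Rpos[OF pq(1)] by (intro mult_left_mono) auto
    also have "\<dots> \<le> m * (2 * c1 * (holder H s s' + holder H t t'))"
      using Rle[OF pq(1)] c1 holder_nonneg[of H s s'] holder_nonneg[of H t t'] by (intro mult_right_mono) auto
    finally show ?thesis by (simp add: mult_ac)
  qed
  define c4 where "c4 = 2 * c1 * m"
  have c4: "0 < c4" using c1 m by (simp add: c4_def)
  have cosh_ge: "ennreal ((2 * pi) powr ?d * c4 powr (- ?d / 2) * (holder H s s' + holder H t t') powr - (?d / 2))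
      \<le> gauss2 TYPE('d) cosh (R (s, t) (s, t)) (R (s', t') (s', t')) (R (s, t) (s', t'))"
    if "s \<in> I" "t \<in> J" "s' \<in> I" "t' \<in> J" "0 < holder H s s' + holder H t t'" for s t s' t'
  proof -
    have "ennreal ((2 * pi) powr ?d * (c4 * (holder H s s' + holder H t t')) powr (- ?d / 2))
       \<le> gauss2 TYPE('d) cosh (R (s, t) (s, t)) (R (s', t') (s', t')) (R (s, t) (s', t'))"
      using that Rpos det_le[OF refl refl that(1-4)] c4 by (intro gauss2_cosh_ge) (auto simp: c4_def)
    also have "(c4 * (holder H s s' + holder H t t')) powr (- ?d / 2) = c4 powr (- ?d / 2) * (holder H s s' + holder H t t') powr (- ?d / 2)"
      by (rule powr_mult)
    finally show ?thesis by (simp add: mult.assoc)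
  qed
  \<comment> \<open>within this distance the covariance is at least half of \<open>\<sigma>0\<close>, and its square exceeds the bound for the determinant\<close>
  define r0 where "r0 = min (\<sigma>0 / (2 * c1)) (\<sigma>0\<^sup>2 / (4 * c4))"
  have r0: "0 < r0" using \<sigma>0 c1 c4 by (simp add: r0_def)
  define c5 where "c5 = (\<sigma>0 / 2)\<^sup>2 * (1 - 2 powr (- ?d / 2)) * (2 * pi) powr ?d * c4 powr (- (?d + 2) / 2)"
  have two: "2 powr (- ?d / 2) < 1"
    using powr_less_cancel_iff[of 2 "- ?d / 2" 0] by simp
  have c5: "0 < c5" unfolding c5_def using two \<sigma>0 c4 by simp
  have sinh_ge: "ennreal (c5 * (holder H s s' + holder H t t') powr - ((?d + 2) / 2))
      \<le> gauss2 TYPE('d) (\<lambda>x. x * sinh x) (R (s, t) (s, t)) (R (s', t') (s', t')) (R (s, t) (s', t'))"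
    if st: "s \<in> I" "t \<in> J" "s' \<in> I" "t' \<in> J" and pos: "0 < holder H s s' + holder H t t'"
      and small: "holder H s s' + holder H t t' \<le> r0" for s t s' t'
  proof -
    let ?r = "holder H s s' + holder H t t'" and ?R = "R (s, t) (s', t')"
    have IJ: "(s, t) \<in> I \<times> J" "(s', t') \<in> I \<times> J" using st by auto
    have "2 * c1 * ?r \<le> 2 * c1 * (\<sigma>0 / (2 * c1))" using small c1 by (intro mult_left_mono) (auto simp: r0_def)
    then have "2 * c1 * ?r \<le> \<sigma>0" using c1 by simp
    then have Rge: "\<sigma>0 / 2 \<le> ?R"
      using diff[OF refl refl st] lower[OF IJ(1)] lower[OF IJ(2)] by linarith
    then have sq: "(\<sigma>0 / 2)\<^sup>2 \<le> ?R\<^sup>2" using \<sigma>0 by (intro power_mono) auto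
    have "c4 * ?r \<le> c4 * (\<sigma>0\<^sup>2 / (4 * c4))" using small c4 by (intro mult_left_mono) (auto simp: r0_def)
    also have "\<dots> = (\<sigma>0 / 2)\<^sup>2" using c4 by (simp add: power2_eq_square)
    finally have D: "c4 * ?r \<le> ?R\<^sup>2" using sq by simp
    have "c5 * ?r powr (- (?d + 2) / 2) = (\<sigma>0 / 2)\<^sup>2 * ((1 - 2 powr (- ?d / 2)) * (2 * pi) powr ?d * (c4 * ?r) powr (- (?d + 2) / 2))"
      unfolding c5_def powr_mult by (simp only: mult_ac)
    also have "\<dots> \<le> ?R\<^sup>2 * ((1 - 2 powr (- ?d / 2)) * (2 * pi) powr ?d * (c4 * ?r) powr (- (?d + 2) / 2))"
      using two by (intro mult_right_mono[OF sq]) auto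
    finally have "ennreal (c5 * ?r powr (- (?d + 2) / 2))
        \<le> ennreal (?R\<^sup>2 * (1 - 2 powr (- ?d / 2)) * (2 * pi) powr ?d * (c4 * ?r) powr (- (?d + 2) / 2))"
      by (intro ennreal_leI) (simp only: mult.assoc)
    also have "\<dots> \<le> gauss2 TYPE('d) (\<lambda>x. x * sinh x) (R (s, t) (s, t)) (R (s', t') (s', t')) ?R"
      using Rpos[OF IJ(1)] Rpos[OF IJ(2)] det_le[OF refl refl st] c4 pos D by (intro gauss2_sinh_ge) (auto simp: c4_def)
    finally show ?thesis by (simp only: minus_divide_left)
  qed
  have exists: "\<exists>L. L2_tendsto M G.approx L (at_right 0)"
    if "2 * (\<Sum>j\<in>S. 1 / H $ j) + (\<Sum>j\<in>- S. 1 / H $ j) > ?d"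
    by (rule G.energy_finite_imp_approx_converges, rule energy_finite[OF G _ _ _ cosh_le]) (use that c3 in auto)
  have D1: "L \<in> D1 M X" if "L2_tendsto M G.approx L (at_right 0)"
    "2 * (\<Sum>j\<in>S. 1 / H $ j) + (\<Sum>j\<in>- S. 1 / H $ j) > ?d + 2" for L
    unfolding G.approx_limit_in_D1_iff[OF that(1)]
    by (rule energy_finite[OF G _ _ _ sinh_le]) (use that(2) c3 m in auto)
  have not_exists: "\<not> L2_tendsto M G.approx L (at_right 0)" if "2 * (\<Sum>j\<in>UNIV. 1 / H $ j) \<le> ?d" for L
  proof
    assume "L2_tendsto M G.approx L (at_right 0)"
    from G.approx_converges_imp_energy_finite(1)[OF this]
    have "G.energy cosh (\<lambda>p. R p p) (\<lambda>p. R p p) < \<infinity>" .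
    moreover have "G.energy cosh (\<lambda>p. R p p) (\<lambda>p. R p p) = \<infinity>"
      by (rule energy_infinite[OF G _ r0 _ cosh_ge]) (use that c4 in auto)
    ultimately show False by simp
  qed
  have not_D1: "L \<notin> D1 M X" if "L2_tendsto M G.approx L (at_right 0)" "2 * (\<Sum>j\<in>UNIV. 1 / H $ j) \<le> ?d + 2" for L
  proof -
    have "G.energy (\<lambda>x. x * sinh x) (\<lambda>p. R p p) (\<lambda>p. R p p) = \<infinity>"
      by (rule energy_infinite[OF G _ r0 c5 sinh_ge]) (use that in auto)
    then show ?thesis unfolding G.approx_limit_in_D1_iff[OF that(1)] by simp
  qed
  show ?thesis
    unfolding L_iff
  proof (intro conjI impI)
    assume "2 * (\<Sum>j\<in>S. 1 / H $ j) + (\<Sum>j\<in>- S. 1 / H $ j) > ?d"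
    then show "\<exists>L. L2_tendsto M G.approx L (at_right 0)" by (rule exists)
  next
    assume "2 * (\<Sum>j\<in>UNIV. 1 / H $ j) \<le> ?d"
    then show "\<not> (\<exists>L. L2_tendsto M G.approx L (at_right 0))" using not_exists by blast
  next
    assume *: "2 * (\<Sum>j\<in>S. 1 / H $ j) + (\<Sum>j\<in>- S. 1 / H $ j) > ?d + 2"
    then obtain L where "L2_tendsto M G.approx L (at_right 0)" using exists by auto
    then show "\<exists>L. L2_tendsto M G.approx L (at_right 0) \<and> L \<in> D1 M X" using D1 * by blast
  next
    assume "2 * (\<Sum>j\<in>UNIV. 1 / H $ j) \<le> ?d + 2"
    then show "\<not> (\<exists>L. L2_tendsto M G.approx L (at_right 0) \<and> L \<in> D1 M X)" using not_D1 by blast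
  qed
qed

end

theorem theorem3p2:
  fixes M0 :: "'v measure" and X0 :: "real ^ 'n::finite \<Rightarrow> 'v \<Rightarrow> real"
    and M :: "'w measure" and X :: "real ^ 'n \<Rightarrow> 'w \<Rightarrow> real ^ 'd::finite"
    and H a b :: "real ^ 'n" and h :: real
    and I J :: "(real ^ 'n) set" and S :: "'n set"
  assumes "prob_space M0" and "prob_space M"
    and "gaussian_field M0 X0" and "centered_field M0 X0" and "continuous_covariance M0 X0"
    and "independent_copies M0 X0 M X"
    and "\<forall>\<omega>\<in>space M. continuous_on (cbox 0 1) (\<lambda>t. X t \<omega>)"
    and "\<forall>j. 0 < H $ j \<and> H $ j < 1"
    and "condition_C1 M0 X0 H" and "condition_C3 M0 X0 H"
    and "h > 0"
    and "I = cbox a (\<chi> j. a $ j + h)" and "J = cbox b (\<chi> j. b $ j + h)"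
    and "I \<subseteq> cbox 0 1" and "J \<subseteq> cbox 0 1"
    and "partially_separated I J" and "S = separated_coords I J"
    and "\<forall>j\<in>S. b $ j > a $ j + h" and "\<forall>j\<in>- S. a $ j = b $ j"
  shows
    "(2 * (\<Sum>j\<in>S. 1 / H $ j) + (\<Sum>j\<in>- S. 1 / H $ j) > real CARD('d) \<longrightarrow>
        (\<exists>L. self_intersection_local_time M X I J L)) \<and>
     (2 * (\<Sum>j\<in>UNIV. 1 / H $ j) \<le> real CARD('d) \<longrightarrow>
        \<not> (\<exists>L. self_intersection_local_time M X I J L)) \<and>
     (2 * (\<Sum>j\<in>S. 1 / H $ j) + (\<Sum>j\<in>- S. 1 / H $ j) > real CARD('d) + 2 \<longrightarrow>
        (\<exists>L. self_intersection_local_time M X I J L \<and> L \<in> D1 M X)) \<and>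
     (2 * (\<Sum>j\<in>UNIV. 1 / H $ j) \<le> real CARD('d) + 2 \<longrightarrow>
        \<not> (\<exists>L. self_intersection_local_time M X I J L \<and> L \<in> D1 M X))"
proof -
  have "separated_boxes M0 X0 M X H a b h I J S"
  proof (intro separated_boxes.intro iid_gaussian_field.intro iid_gaussian_field_axioms.intro separated_boxes_axioms.intro)
    show "S \<noteq> {}" using \<open>partially_separated I J\<close> \<open>S = separated_coords I J\<close>
      by (simp add: partially_separated_def)
  qed (use assms in auto)
  then show ?thesis by (rule separated_boxes.existence_and_smoothness)
qed

end
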